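(* Let $a,b>-1/2$ and $c>0$. For each $N$ put $\beta=2c/N$ and let $L_{N,\beta}$ be the empirical distribution of the beta Jacobi ensemble of size $N$ with parameters $(\beta,a,b)$. Let $\nu_c$, $Z_c^*$ and $\tilde P_n$ ($n\ge 0$) be as defined in the context, where $\tilde P_n$ is a primitive of the polynomial $\tilde p_n$. Then the following hold. (i) For every $n\ge 0$, as $N\to\infty$ with $\beta=2c/N$, $$\sqrt N\left(\langle L_{N,\beta},\tilde P_n\rangle-\langle \nu_c,\tilde P_n\rangle\right)\xrightarrow{d}\mathcal N(0,\sigma_{\tilde P_n}^2),\qquad \sigma_{\tilde P_n}^2=\frac{Z_c^*}{(n+1)(n+2c+a+b+2)},$$ where $$Z_c^*=\langle\nu_c,x(1-x)\rangle=\frac{(c+a+1)(c+b+1)(c+a+b+2)}{(2c+a+b+2)^2(2c+a+b+3)}.$$ (ii) For every $M\in\mathbb N$, the random variables $\big\{\sqrt N\big(\langle L_{N,\beta},\tilde P_n\rangle-\langle\nu_c,\tilde P_n\rangle\big)\big\}_{n=0}^M$ jointly converge in distribution, as $N\to\infty$ with $\beta=2c/N$, to independent Gaussian random variables.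
   Context: Notation: $\langle\mu,f\rangle=\int f\,d\mu$; $\xrightarrow{d}$ is convergence in distribution; $\mathcal N(m,\sigma^2)$ is the Gaussian distribution with mean $m$ and variance $\sigma^2$; $\mathrm{Beta}(p,q)$ is the beta distribution on $[0,1]$ with parameters $p,q>0$. Beta Jacobi ensemble of size $N$ with parameters $\beta>0$, $a,b>-1$: the random vector $(\lambda_1,\dots,\lambda_N)$ with joint density $\frac1Z\prod_{i<j}|\lambda_j-\lambda_i|^\beta\prod_{l=1}^N\lambda_l^a(1-\lambda_l)^b$ on $0\le\lambda_1\le\cdots\le\lambda_N\le1$ ($Z$ a normalizing constant). Its empirical distribution is $L_{N,\beta}=\frac1N\sum_{i=1}^N\delta_{\lambda_i}$. Limiting measure $\nu_c$: let $\{p_n^{(\infty)}\}_{n\ge1}$ be i.i.d. with law $\mathrm{Beta}(c+a+1,c+b+1)$ and $\{q_n^{(\infty)}\}_{n\ge1}$ be i.i.d. with law $\mathrm{Beta}(c,c+a+b+2)$, the two sequences being independent, and $q_0^{(\infty)}=0$. Put $s_n=p_n^{(\infty)}(1-q_{n-1}^{(\infty)})$, $t_n=q_n^{(\infty)}(1-p_n^{(\infty)})$. Let $B$ be the semi-infinite lower bidiagonal matrix with $B(n,n)=\sqrt{s_n}$, $B(n+1,n)=\sqrt{t_n}$ and other entries $0$, and $J_c^{(\infty)}=BB^{\top}$. Then $\nu_c$ is the unique probability measure on $[0,1]$ with $\langle\nu_c,x^k\rangle=\mathbb E[(J_c^{(\infty)})^k(1,1)]$ for $k=0,1,2,\dots$.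 It is the limit of $L_{N,\beta}$ as $N\to\infty$, $\beta N\to 2c$. Set $Z_c^*=\langle\nu_c,x(1-x)\rangle$ and let $\nu_c^*$ be the probability measure $\nu_c^*(dx)=(Z_c^* )^{-1}x(1-x)\,\nu_c(dx)$. Polynomials: for $n\ge0$ set $$\lambda_n^*=\frac{n+c+a+1}{2n+2c+a+b+2}\cdot\frac{n+c+a+b+2}{2n+2c+a+b+3},\qquad \mu_n^*=\frac{n+c+1}{2n+2c+a+b+3}\cdot\frac{n+c+b+2}{2n+2c+a+b+4},$$ and for $n\ge1$ set $a_n^*=\lambda_{n-1}^*+\mu_{n-1}^*$, $b_n^*=\sqrt{\mu_{n-1}^*\lambda_n^*}$. The polynomials $\tilde p_n$ are defined by $\tilde p_0=1$, $b_1^*\tilde p_1(x)=x-a_1^*$, and $b_{n+1}^*\tilde p_{n+1}(x)=x\tilde p_n(x)-a_{n+1}^*\tilde p_n(x)-b_n^*\tilde p_{n-1}(x)$ for $n\ge1$; they are the orthonormal polynomials with respect to $\nu_c^*$. $\tilde P_n$ denotes a primitive of $\tilde p_n$, i.e. a polynomial with $\tilde P_n'=\tilde p_n$. *)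

theory Defs
  imports "HOL-Probability.Probability" "HOL-Computational_Algebra.Polynomial"
begin

definition gaussian :: "real \<Rightarrow> real \<Rightarrow> real measure" where
  "gaussian m v = density lborel (\<lambda>x. ennreal (normal_density m (sqrt v) x))"

definition beta_distr :: "real \<Rightarrow> real \<Rightarrow> real measure" where
  "beta_distr p q = density lborel
     (\<lambda>x. ennreal (indicator {0..1} x * x powr (p - 1) * (1 - x) powr (q - 1) / Beta p q))"


subsection \<open>Beta Jacobi ensemble\<close>

definition jacobi_weight :: "real \<Rightarrow> real \<Rightarrow> real \<Rightarrow> nat \<Rightarrow> (nat \<Rightarrow> real) \<Rightarrow> real" where
  "jacobi_weight \<beta> a b N x =
     (if (\<forall>i\<in>{1..N}. 0 \<le> x i \<and> x i \<le> 1) \<and> mono_on {1..N} x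
      then (\<Prod>j\<in>{1..N}. \<Prod>i\<in>{1..<j}. \<bar>x j - x i\<bar> powr \<beta>) *
           (\<Prod>l\<in>{1..N}. x l powr a * (1 - x l) powr b)
      else 0)"

definition jacobi_ensemble :: "real \<Rightarrow> real \<Rightarrow> real \<Rightarrow> nat \<Rightarrow> (nat \<Rightarrow> real) measure" where
  "jacobi_ensemble \<beta> a b N =
     (let \<Lambda> = PiM {1..N} (\<lambda>_. lborel);
          Z = (\<integral>x. jacobi_weight \<beta> a b N x \<partial>\<Lambda>)
      in density \<Lambda> (\<lambda>x. ennreal (jacobi_weight \<beta> a b N x / Z)))"

text \<open>The push-forward of the uniform distribution on the indices is
  \<open>(1/N) \<Sum>\<^sub>i \<delta>\<^bsub>x i\<^esub>\<close>, with multiplicities.\<close>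

definition empirical_distr :: "nat \<Rightarrow> (nat \<Rightarrow> real) \<Rightarrow> real measure" where
  "empirical_distr N x = distr (uniform_count_measure {1..N}) borel x"


subsection \<open>The limiting measure\<close>

text \<open>Semi-infinite matrices have rows and columns indexed by \<open>1, 2, \<dots>\<close>; the spurious
  row and column \<open>0\<close> of the matrix \<open>B\<close> below are zero. All matrices multiplied
  here are banded, so the series in the product has only finitely many nonzero terms.\<close>

type_synonym imat = "nat \<Rightarrow> nat \<Rightarrow> real"

definition imat_mult :: "imat \<Rightarrow> imat \<Rightarrow> imat" where
  "imat_mult A B = (\<lambda>i j. \<Sum>l. A i l * B l j)"

definition imat_transpose :: "imat \<Rightarrow> imat" where
  "imat_transpose A = (\<lambda>i j. A j i)"

primrec imat_power :: "imat \<Rightarrow> nat \<Rightarrow> imat" where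
  "imat_power A 0 = (\<lambda>i j. if i = j then 1 else 0)"
| "imat_power A (Suc k) = imat_mult A (imat_power A k)"

definition coeff_s :: "(nat \<Rightarrow> real) \<Rightarrow> (nat \<Rightarrow> real) \<Rightarrow> nat \<Rightarrow> real" where
  "coeff_s p q n = p n * (1 - (if n = 1 then 0 else q (n - 1)))"

definition coeff_t :: "(nat \<Rightarrow> real) \<Rightarrow> (nat \<Rightarrow> real) \<Rightarrow> nat \<Rightarrow> real" where
  "coeff_t p q n = q n * (1 - p n)"

definition bidiag :: "(nat \<Rightarrow> real) \<Rightarrow> (nat \<Rightarrow> real) \<Rightarrow> imat" where
  "bidiag p q = (\<lambda>i j.
     if 1 \<le> j \<and> i = j then sqrt (coeff_s p q j)
     else if 1 \<le> j \<and> i = j + 1 then sqrt (coeff_t p q j)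
     else 0)"

definition jacobi_matrix :: "(nat \<Rightarrow> real) \<Rightarrow> (nat \<Rightarrow> real) \<Rightarrow> imat" where
  "jacobi_matrix p q = imat_mult (bidiag p q) (imat_transpose (bidiag p q))"

definition pq_law :: "real \<Rightarrow> real \<Rightarrow> real \<Rightarrow> ((nat \<Rightarrow> real) \<times> (nat \<Rightarrow> real)) measure" where
  "pq_law a b c =
     PiM {1..} (\<lambda>_. beta_distr (c + a + 1) (c + b + 1)) \<Otimes>\<^sub>M
     PiM {1..} (\<lambda>_. beta_distr c (c + a + b + 2))"

definition nu :: "real \<Rightarrow> real \<Rightarrow> real \<Rightarrow> real measure" where
  "nu a b c = (THE \<mu>. sets \<mu> = sets borel \<and> prob_space \<mu> \<and> measure \<mu> {0..1} = 1 \<and>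
     (\<forall>k. (\<integral>x. x ^ k \<partial>\<mu>) =
          (\<integral>(p, q). imat_power (jacobi_matrix p q) k 1 1 \<partial>pq_law a b c)))"

definition Z_star :: "real \<Rightarrow> real \<Rightarrow> real \<Rightarrow> real" where
  "Z_star a b c = (\<integral>x. x * (1 - x) \<partial>nu a b c)"


subsection \<open>The orthogonal polynomials\<close>

definition lambda_star :: "real \<Rightarrow> real \<Rightarrow> real \<Rightarrow> nat \<Rightarrow> real" where
  "lambda_star a b c n =
     (n + c + a + 1) / (2 * n + 2 * c + a + b + 2) *
     ((n + c + a + b + 2) / (2 * n + 2 * c + a + b + 3))"

definition mu_star :: "real \<Rightarrow> real \<Rightarrow> real \<Rightarrow> nat \<Rightarrow> real" where
  "mu_star a b c n =
     (n + c + 1) / (2 * n + 2 * c + a + b + 3) *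
     ((n + c + b + 2) / (2 * n + 2 * c + a + b + 4))"

text \<open>The next two are used for \<open>n \<ge> 1\<close> only.\<close>

definition a_star :: "real \<Rightarrow> real \<Rightarrow> real \<Rightarrow> nat \<Rightarrow> real" where
  "a_star a b c n = lambda_star a b c (n - 1) + mu_star a b c (n - 1)"

definition b_star :: "real \<Rightarrow> real \<Rightarrow> real \<Rightarrow> nat \<Rightarrow> real" where
  "b_star a b c n = sqrt (mu_star a b c (n - 1) * lambda_star a b c n)"

fun p_tilde :: "real \<Rightarrow> real \<Rightarrow> real \<Rightarrow> nat \<Rightarrow> real poly" where
  "p_tilde a b c 0 = 1"
| "p_tilde a b c (Suc 0) = smult (1 / b_star a b c 1) [:- a_star a b c 1, 1:]"
| "p_tilde a b c (Suc (Suc n)) = smult (1 / b_star a b c (n + 2))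
     ([:- a_star a b c (n + 2), 1:] * p_tilde a b c (Suc n)
      - smult (b_star a b c (n + 1)) (p_tilde a b c n))"


subsection \<open>Fluctuations and convergence in distribution\<close>

definition fluctuation ::
  "real \<Rightarrow> real \<Rightarrow> real \<Rightarrow> nat \<Rightarrow> (real \<Rightarrow> real) \<Rightarrow> (nat \<Rightarrow> real) \<Rightarrow> real" where
  "fluctuation a b c N f x =
     sqrt (real N) * ((\<integral>u. f u \<partial>empirical_distr N x) - (\<integral>u. f u \<partial>nu a b c))"

text \<open>Convergence in distribution of random vectors indexed by a finite set \<open>I\<close>, that is,
  weak convergence of Borel measures on \<open>\<real>\<^sup>I\<close> (realised as extensional functions, with the
  product topology), tested against bounded continuous functions. For real random variables
  \<^const>\<open>weak_conv_m\<close> from the library is used.\<close>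

definition weak_conv_PiM ::
  "'i set \<Rightarrow> (nat \<Rightarrow> ('i \<Rightarrow> real) measure) \<Rightarrow> ('i \<Rightarrow> real) measure \<Rightarrow> bool" where
  "weak_conv_PiM I M L \<longleftrightarrow>
     (\<forall>f. continuous_map (powertop_real I) euclideanreal f \<and>
          bounded (f ` topspace (powertop_real I)) \<longrightarrow>
          (\<lambda>N. \<integral>x. f x \<partial>M N) \<longlonglongrightarrow> (\<integral>x. f x \<partial>L))"

end

theory Submission
  imports Defs
begin

text \<open>Moving all particles along \<open>x \<mapsto> x + t x\<^bsup>k+1\<^esup>(1 - x)\<close> and differentiating at \<open>t = 0\<close> gives
  loop equations. They force the fourth moments of \<open>\<langle>L\<^sub>N, x\<^sup>k\<rangle> - m\<^sub>k\<close> to be \<open>O(N\<^bsup>-2\<^esup>)\<close>, where \<open>m\<^sub>k\<close>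
  solves the limiting equations. For \<open>X\<^sub>f = \<surd>N (\<langle>L\<^sub>N, f\<rangle> - \<langle>\<nu>\<^sub>c, f\<rangle>)\<close> they then become
  \<open>E[\<phi>(X\<^sub>f) X\<^bsub>Tp\<^esub>] = - \<langle>\<nu>\<^sub>c, f' x(1 - x) p\<rangle> E[\<phi>'(X\<^sub>f)] + O(N\<^bsup>-1/2\<^esup>)\<close> with a linear operator \<open>T\<close> on
  polynomials. Since covariances are symmetric, \<open>p \<mapsto> (Tp)'\<close> is symmetric in \<open>L\<^sup>2(\<nu>\<^sub>c\<^sup>*)\<close>; being triangular in the
  degree, it is diagonalised by orthogonal polynomials, and comparing the three leading coefficients
  shows that these are the \<open>p\<^sub>n\<close>, with eigenvalue \<open>-(n + 1)(n + 2c + a + b + 2)\<close>. So \<open>T p\<^sub>n\<close> is a multiple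
  of \<open>P\<^sub>n\<close> up to a constant, and \<open>\<phi> = sin, cos\<close> turns the loop equation into the differential equation of a
  Gaussian characteristic function for every linear combination of the \<open>X\<^bsub>P n\<^esub>\<close>.

  That the \<open>m\<^sub>k\<close> are the moments of \<open>\<nu>\<^sub>c\<close> is seen from their generating function, a ratio of two
  hypergeometric series: the resolvent of the random matrix is a continued fraction in the beta
  variables, and a beta integral exhibits the stationary law of one step of it.\<close>

section \<open>Substitution and differentiation under the expectation\<close>

text \<open>With \<open>\<beta> = 2c/N\<close> the pair interaction, the weights and the Jacobian of
  the transport all contribute at order \<open>N\<close>, so the Jacobian survives in the limit. It
  is the source of the summands \<open>k\<close> in the loop equations, hence of the quadratic
  growth of the eigenvalues. The equations are quadratic in the moments. The covariance limit meets
  a deviation times the quadratic remainder, a product of three deviations that must be of smaller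
  order than \<open>1/N\<close>; bounded fourth moments give exactly this. No formula for the
  limiting covariance is available in advance; its symmetry is read off by evaluating one limit
  twice. Nor is the orthogonality of the polynomials taken from a measure: it is proved together
  with the eigenvalue equation. \<open>nu\<close> is a definite description through the random
  matrix, so three facts have to meet: a measure with moments \<open>jmom\<close> exists (by
  tightness of the mean empirical laws), it is unique, and the expected matrix powers are the same
  numbers.\<close>

text \<open>Fubini reduces the diagonal change of variables to the one-dimensional rule, one
  coordinate at a time. The indicators of the cube stay in the formula because \<open>h\<close> is
  known to be monotone only on the unit interval; nonnegative integrals spare every integrability
  condition.\<close>

lemma nn_integral_cube_substitution:
  fixes h h' :: "real \<Rightarrow> real" and I :: "'i set"
  assumes fin: "finite I"
    and der: "\<And>x. x \<in> {0..1} \<Longrightarrow> (h has_real_derivative h' x) (at x)"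
    and cont: "continuous_on {0..1} h'" and nonneg: "\<And>x. x \<in> {0..1} \<Longrightarrow> 0 \<le> h' x"
    and h01: "h 0 = 0" "h 1 = 1"
    and [measurable]: "h \<in> borel_measurable borel" "h' \<in> borel_measurable borel"
    and f: "f \<in> borel_measurable (PiM I (\<lambda>_. lborel))"
  shows "(\<integral>\<^sup>+x. f x * (\<Prod>i\<in>I. indicator {0..1} (x i)) \<partial>PiM I (\<lambda>_. lborel)) =
         (\<integral>\<^sup>+x. f (\<lambda>i\<in>I. h (x i)) * (\<Prod>i\<in>I. ennreal (h' (x i)) * indicator {0..1} (x i)) \<partial>PiM I (\<lambda>_. lborel))"
  using fin f
proof (induction I arbitrary: f)
  case empty
  then show ?case
    by (simp add: PiM_empty nn_integral_count_space_finite)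
next
  case (insert i I f)
  interpret product_sigma_finite "\<lambda>_::'i. lborel :: real measure" ..
  have fm[measurable]: "f \<in> borel_measurable (PiM (insert i I) (\<lambda>_. lborel))" by fact
  have f2: "(\<lambda>(x, y). f (x(i := y))) \<in> borel_measurable (PiM I (\<lambda>_. lborel) \<Otimes>\<^sub>M (lborel :: real measure))"
    by measurable
  have P1: "(\<Prod>j\<in>insert i I. w ((x(i:=y)) j)) = w y * (\<Prod>j\<in>I. w (x j))"
    for x y and w :: "real \<Rightarrow> ennreal"
  proof -
    have "(\<Prod>j\<in>I. w ((x(i:=y)) j)) = (\<Prod>j\<in>I. w (x j))"
      using insert.hyps by (intro prod.cong) auto
    then show ?thesis using insert.hyps by simp
  qed
  \<comment> \<open>The new coordinate is substituted and integrated out, so that the induction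
    hypothesis can be applied to \<open>F\<close> in the remaining ones.\<close>
  define F where "F = (\<lambda>x. \<integral>\<^sup>+y. f (x(i := h y)) * (ennreal (h' y) * indicator {0..1} y) \<partial>lborel)"
  have h2: "(\<lambda>(x, y). f (x(i := h y))) \<in> borel_measurable (PiM I (\<lambda>_. lborel) \<Otimes>\<^sub>M (lborel :: real measure))"
    by measurable
  have [measurable]: "F \<in> borel_measurable (PiM I (\<lambda>_. lborel))"
    unfolding F_def by measurable
  have "(\<integral>\<^sup>+x. f x * (\<Prod>i\<in>insert i I. indicator {0..1} (x i)) \<partial>PiM (insert i I) (\<lambda>_. lborel))
     = (\<integral>\<^sup>+x. (\<integral>\<^sup>+y. f (x(i:=y)) * (indicator {0..1} y * (\<Prod>j\<in>I. indicator {0..1} (x j))) \<partial>lborel) \<partial>PiM I (\<lambda>_. lborel))"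
  proof (subst product_nn_integral_insert)
    show "(\<lambda>x. f x * (\<Prod>i\<in>insert i I. indicator {0..1} (x i))) \<in> borel_measurable (PiM (insert i I) (\<lambda>_. lborel))"
      by measurable
  qed (use insert.hyps in \<open>simp_all only: P1 not_False_eq_True\<close>)
  also have "\<dots> = (\<integral>\<^sup>+x. F x * (\<Prod>j\<in>I. indicator {0..1} (x j)) \<partial>PiM I (\<lambda>_. lborel))"
  proof (intro nn_integral_cong)
    fix x :: "'i \<Rightarrow> real" assume x: "x \<in> space (PiM I (\<lambda>_. lborel))"
    have m: "(\<lambda>y. f (x(i:=y))) \<in> borel_measurable borel"
      using measurable_compose[OF measurable_Pair1'[OF x, of lborel] f2] by simp
    have "(\<integral>\<^sup>+y. f (x(i:=y)) * (indicator {0..1} y * (\<Prod>j\<in>I. indicator {0..1} (x j))) \<partial>lborel)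
       = (\<integral>\<^sup>+y. f (x(i:=y)) * indicator {0..1} y * (\<Prod>j\<in>I. indicator {0..1} (x j)) \<partial>lborel)"
      by (simp add: mult.assoc)
    also have "\<dots> = (\<integral>\<^sup>+y. f (x(i:=y)) * indicator {0..1} y \<partial>lborel) * (\<Prod>j\<in>I. indicator {0..1} (x j))"
      using m by (intro nn_integral_multc) auto
    also have "(\<integral>\<^sup>+y. f (x(i:=y)) * indicator {0..1} y \<partial>lborel) = F x"
      using nn_integral_substitution_aux[of "\<lambda>y. f (x(i:=y))" 0 1 h h'] m der cont nonneg h01
      by (simp add: F_def mult.assoc)
    finally show "(\<integral>\<^sup>+y. f (x(i:=y)) * (indicator {0..1} y * (\<Prod>j\<in>I. indicator {0..1} (x j))) \<partial>lborel)
       = F x * (\<Prod>j\<in>I. indicator {0..1} (x j))" .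
  qed
  also have "\<dots> = (\<integral>\<^sup>+x. F (\<lambda>i\<in>I. h (x i)) * (\<Prod>i\<in>I. ennreal (h' (x i)) * indicator {0..1} (x i)) \<partial>PiM I (\<lambda>_. lborel))"
    by (rule insert.IH) simp
  also have "\<dots> = (\<integral>\<^sup>+x. (\<integral>\<^sup>+y. f (\<lambda>j\<in>insert i I. h ((x(i:=y)) j)) *
       (\<Prod>j\<in>insert i I. ennreal (h' ((x(i:=y)) j)) * indicator {0..1} ((x(i:=y)) j)) \<partial>lborel) \<partial>PiM I (\<lambda>_. lborel))"
  proof (intro nn_integral_cong)
    fix x :: "'i \<Rightarrow> real" assume x: "x \<in> space (PiM I (\<lambda>_. lborel))"
    have eq: "(\<lambda>j\<in>I. h (x j))(i := h y) = (\<lambda>j\<in>insert i I. h ((x(i:=y)) j))" for y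
      using insert.hyps by (auto simp: fun_eq_iff)
    have x': "(\<lambda>j\<in>I. h (x j)) \<in> space (PiM I (\<lambda>_. lborel))" by (simp add: space_PiM)
    have m: "(\<lambda>y. f ((\<lambda>j\<in>I. h (x j))(i:=h y))) \<in> borel_measurable lborel"
      using measurable_compose[OF measurable_Pair1'[OF x', of lborel] h2] by simp
    have "F (\<lambda>j\<in>I. h (x j)) * (\<Prod>j\<in>I. ennreal (h' (x j)) * indicator {0..1} (x j)) =
       (\<integral>\<^sup>+y. f ((\<lambda>j\<in>I. h (x j))(i := h y)) * (ennreal (h' y) * indicator {0..1} y) * (\<Prod>j\<in>I. ennreal (h' (x j)) * indicator {0..1} (x j)) \<partial>lborel)"
      unfolding F_def using m by (intro nn_integral_multc[symmetric]) auto
    then show "F (\<lambda>j\<in>I. h (x j)) * (\<Prod>j\<in>I. ennreal (h' (x j)) * indicator {0..1} (x j)) =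
       (\<integral>\<^sup>+y. f (\<lambda>j\<in>insert i I. h ((x(i:=y)) j)) *
       (\<Prod>j\<in>insert i I. ennreal (h' ((x(i:=y)) j)) * indicator {0..1} ((x(i:=y)) j)) \<partial>lborel)"
      by (simp add: P1[of "\<lambda>u. ennreal (h' u) * indicator {0..1} u"] eq mult.assoc del: fun_upd_apply)
  qed
  also have "\<dots> = (\<integral>\<^sup>+x. f (\<lambda>i\<in>insert i I. h (x i)) * (\<Prod>i\<in>insert i I. ennreal (h' (x i)) * indicator {0..1} (x i)) \<partial>PiM (insert i I) (\<lambda>_. lborel))"
    by (subst product_nn_integral_insert) (use insert.hyps in \<open>auto\<close>)
  finally show ?case .
qed

section \<open>Families differentiable in a parameter, uniformly over a set of states\<close>

text \<open>What dominated convergence needs for differentiating under an expectation. Bounding the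
  value as well as the derivative makes the class closed under products and compositions.\<close>

definition unif_diff :: "'x set \<Rightarrow> real \<Rightarrow> (real \<Rightarrow> 'x \<Rightarrow> real) \<Rightarrow> (real \<Rightarrow> 'x \<Rightarrow> real) \<Rightarrow> bool" where
  "unif_diff S e u u' \<longleftrightarrow> (\<exists>K. \<forall>x\<in>S. \<forall>t\<in>{-e..e}. \<bar>u t x\<bar> \<le> K \<and> \<bar>u' t x\<bar> \<le> K \<and>
     ((\<lambda>t. u t x) has_real_derivative u' t x) (at t))"

lemma unif_diffI:
  assumes "\<And>x t. x \<in> S \<Longrightarrow> \<bar>t\<bar> \<le> e \<Longrightarrow> \<bar>u t x\<bar> \<le> K"
    and "\<And>x t. x \<in> S \<Longrightarrow> \<bar>t\<bar> \<le> e \<Longrightarrow> \<bar>u' t x\<bar> \<le> L"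
    and "\<And>x t. x \<in> S \<Longrightarrow> \<bar>t\<bar> \<le> e \<Longrightarrow> ((\<lambda>t. u t x) has_real_derivative u' t x) (at t)"
  shows "unif_diff S e u u'"
  unfolding unif_diff_def
proof (intro exI[of _ "max K L"] ballI conjI)
  fix x t assume "x \<in> S" "t \<in> {-e..e}"
  then have x: "x \<in> S" "\<bar>t\<bar> \<le> e" by auto
  show "\<bar>u t x\<bar> \<le> max K L" using assms(1)[OF x] by simp
  show "\<bar>u' t x\<bar> \<le> max K L" using assms(2)[OF x] by simp
  show "((\<lambda>t. u t x) has_real_derivative u' t x) (at t)" using assms(3)[OF x] .
qed

lemma unif_diffE:
  assumes "unif_diff S e u u'"
  obtains K where "K \<ge> 0" "\<And>x t. x \<in> S \<Longrightarrow> \<bar>t\<bar> \<le> e \<Longrightarrow> \<bar>u t x\<bar> \<le> K"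
    "\<And>x t. x \<in> S \<Longrightarrow> \<bar>t\<bar> \<le> e \<Longrightarrow> \<bar>u' t x\<bar> \<le> K"
    "\<And>x t. x \<in> S \<Longrightarrow> \<bar>t\<bar> \<le> e \<Longrightarrow> ((\<lambda>t. u t x) has_real_derivative u' t x) (at t)"
proof -
  obtain K where K: "\<forall>x\<in>S. \<forall>t\<in>{-e..e}. \<bar>u t x\<bar> \<le> K \<and> \<bar>u' t x\<bar> \<le> K \<and>
     ((\<lambda>t. u t x) has_real_derivative u' t x) (at t)"
    using assms unfolding unif_diff_def by blast
  have *: "\<bar>t\<bar> \<le> e \<Longrightarrow> t \<in> {-e..e}" for t by auto
  show ?thesis
    by (rule that[of "max K 0"]) (use K * in \<open>force simp: le_max_iff_disj\<close>)+
qed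

lemma unif_diff_add:
  assumes "unif_diff S e u u'" "unif_diff S e v v'"
  shows "unif_diff S e (\<lambda>t x. u t x + v t x) (\<lambda>t x. u' t x + v' t x)"
proof -
  from assms(1) obtain K where K: "K \<ge> 0" "\<And>x t. x \<in> S \<Longrightarrow> \<bar>t\<bar> \<le> e \<Longrightarrow> \<bar>u t x\<bar> \<le> K"
    "\<And>x t. x \<in> S \<Longrightarrow> \<bar>t\<bar> \<le> e \<Longrightarrow> \<bar>u' t x\<bar> \<le> K"
    "\<And>x t. x \<in> S \<Longrightarrow> \<bar>t\<bar> \<le> e \<Longrightarrow> ((\<lambda>t. u t x) has_real_derivative u' t x) (at t)"
    by (elim unif_diffE) blast
  from assms(2) obtain L where L: "L \<ge> 0" "\<And>x t. x \<in> S \<Longrightarrow> \<bar>t\<bar> \<le> e \<Longrightarrow> \<bar>v t x\<bar> \<le> L"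
    "\<And>x t. x \<in> S \<Longrightarrow> \<bar>t\<bar> \<le> e \<Longrightarrow> \<bar>v' t x\<bar> \<le> L"
    "\<And>x t. x \<in> S \<Longrightarrow> \<bar>t\<bar> \<le> e \<Longrightarrow> ((\<lambda>t. v t x) has_real_derivative v' t x) (at t)"
    by (elim unif_diffE) blast
  show ?thesis
  proof (rule unif_diffI[where K = "K + L" and L = "K + L"])
    fix x t assume x: "x \<in> S" "\<bar>t\<bar> \<le> e"
    show "\<bar>u t x + v t x\<bar> \<le> K + L" "\<bar>u' t x + v' t x\<bar> \<le> K + L"
      using K(2,3)[OF x] L(2,3)[OF x] by linarith+
    show "((\<lambda>t. u t x + v t x) has_real_derivative u' t x + v' t x) (at t)"
      using K(4)[OF x] L(4)[OF x] by (rule DERIV_add)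
  qed
qed

lemma unif_diff_mult:
  assumes "unif_diff S e u u'" "unif_diff S e v v'"
  shows "unif_diff S e (\<lambda>t x. u t x * v t x) (\<lambda>t x. u' t x * v t x + u t x * v' t x)"
proof -
  from assms(1) obtain K where K: "K \<ge> 0" "\<And>x t. x \<in> S \<Longrightarrow> \<bar>t\<bar> \<le> e \<Longrightarrow> \<bar>u t x\<bar> \<le> K"
    "\<And>x t. x \<in> S \<Longrightarrow> \<bar>t\<bar> \<le> e \<Longrightarrow> \<bar>u' t x\<bar> \<le> K"
    "\<And>x t. x \<in> S \<Longrightarrow> \<bar>t\<bar> \<le> e \<Longrightarrow> ((\<lambda>t. u t x) has_real_derivative u' t x) (at t)"
    by (elim unif_diffE) blast
  from assms(2) obtain L where L: "L \<ge> 0" "\<And>x t. x \<in> S \<Longrightarrow> \<bar>t\<bar> \<le> e \<Longrightarrow> \<bar>v t x\<bar> \<le> L"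
    "\<And>x t. x \<in> S \<Longrightarrow> \<bar>t\<bar> \<le> e \<Longrightarrow> \<bar>v' t x\<bar> \<le> L"
    "\<And>x t. x \<in> S \<Longrightarrow> \<bar>t\<bar> \<le> e \<Longrightarrow> ((\<lambda>t. v t x) has_real_derivative v' t x) (at t)"
    by (elim unif_diffE) blast
  show ?thesis
  proof (rule unif_diffI[where K = "K * L" and L = "K * L + K * L"])
    fix x t assume x: "x \<in> S" "\<bar>t\<bar> \<le> e"
    show "\<bar>u t x * v t x\<bar> \<le> K * L"
      unfolding abs_mult using K(1) K(2,3)[OF x] L(2,3)[OF x] by (intro mult_mono) auto
    have "\<bar>u' t x * v t x\<bar> \<le> K * L" "\<bar>u t x * v' t x\<bar> \<le> K * L"
      unfolding abs_mult using K(1) K(2,3)[OF x] L(2,3)[OF x] by (intro mult_mono; simp)+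
    then show "\<bar>u' t x * v t x + u t x * v' t x\<bar> \<le> K * L + K * L" by linarith
    show "((\<lambda>t. u t x * v t x) has_real_derivative u' t x * v t x + u t x * v' t x) (at t)"
      using DERIV_mult[OF K(4)[OF x] L(4)[OF x]] by (simp add: mult.commute)
  qed
qed

lemma unif_diff_const: "unif_diff S e (\<lambda>t x. k) (\<lambda>t x. 0)"
  by (rule unif_diffI[where K = "\<bar>k\<bar>" and L = 0]) auto

lemma unif_diff_cmult:
  assumes "unif_diff S e u u'"
  shows "unif_diff S e (\<lambda>t x. k * u t x) (\<lambda>t x. k * u' t x)"
  using unif_diff_mult[OF unif_diff_const[of S e k] assms] by simp

lemma unif_diff_sum:
  assumes "finite I" "\<And>i. i \<in> I \<Longrightarrow> unif_diff S e (u i) (u' i)"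
  shows "unif_diff S e (\<lambda>t x. \<Sum>i\<in>I. u i t x) (\<lambda>t x. \<Sum>i\<in>I. u' i t x)"
  using assms
  by (induction I) (auto simp: unif_diff_const intro!: unif_diff_add)

text \<open>The inner function stays in the compact interval \<open>{-K..K}\<close>, on which
  \<open>F\<close> and \<open>F'\<close> are bounded by continuity.\<close>

lemma unif_diff_compose:
  assumes "unif_diff S e u u'" and F: "\<And>y. (F has_real_derivative F' y) (at y)"
    and F': "continuous_on UNIV F'"
  shows "unif_diff S e (\<lambda>t x. F (u t x)) (\<lambda>t x. F' (u t x) * u' t x)"
proof -
  from assms(1) obtain K where K: "K \<ge> 0" "\<And>x t. x \<in> S \<Longrightarrow> \<bar>t\<bar> \<le> e \<Longrightarrow> \<bar>u t x\<bar> \<le> K"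
    "\<And>x t. x \<in> S \<Longrightarrow> \<bar>t\<bar> \<le> e \<Longrightarrow> \<bar>u' t x\<bar> \<le> K"
    "\<And>x t. x \<in> S \<Longrightarrow> \<bar>t\<bar> \<le> e \<Longrightarrow> ((\<lambda>t. u t x) has_real_derivative u' t x) (at t)"
    by (elim unif_diffE) blast
  have bd: "\<exists>B. \<forall>y. \<bar>y\<bar> \<le> K \<longrightarrow> \<bar>G y\<bar> \<le> B" if "continuous_on {-K..K} G" for G :: "real \<Rightarrow> real"
  proof -
    have "bounded (G ` {-K..K})" using that by (intro compact_imp_bounded compact_continuous_image) auto
    then obtain B where "\<forall>y\<in>{-K..K}. \<bar>G y\<bar> \<le> B" by (auto simp: bounded_iff)
    moreover have "y \<in> {-K..K}" if "\<bar>y\<bar> \<le> K" for y using that by auto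
    ultimately show ?thesis by blast
  qed
  have "continuous_on {-K..K} F" using F by (meson DERIV_isCont continuous_at_imp_continuous_on)
  then obtain B1 where B1: "\<And>y. \<bar>y\<bar> \<le> K \<Longrightarrow> \<bar>F y\<bar> \<le> B1"
    using bd[of F] by blast
  have "continuous_on {-K..K} F'" using F' continuous_on_subset by blast
  then obtain B2 where B2: "\<And>y. \<bar>y\<bar> \<le> K \<Longrightarrow> \<bar>F' y\<bar> \<le> B2"
    using bd[of F'] by blast
  have "0 \<le> B2" using B2[of 0] K(1) by simp
  show ?thesis
  proof (rule unif_diffI[where K = B1 and L = "B2 * K"])
    fix x t assume x: "x \<in> S" "\<bar>t\<bar> \<le> e"
    show "\<bar>F (u t x)\<bar> \<le> B1" using B1 K(2)[OF x] .
    show "\<bar>F' (u t x) * u' t x\<bar> \<le> B2 * K"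
      unfolding abs_mult using B2[OF K(2)[OF x]] K(3)[OF x] \<open>0 \<le> B2\<close> by (intro mult_mono) auto
    show "((\<lambda>t. F (u t x)) has_real_derivative F' (u t x) * u' t x) (at t)"
      using DERIV_chain2[OF F K(4)[OF x]] by simp
  qed
qed

text \<open>The condition on \<open>e\<close> keeps the argument of the logarithm between 1/2 and
  3/2, away from its singularity.\<close>

lemma unif_diff_ln:
  assumes d: "\<And>x. x \<in> S \<Longrightarrow> \<bar>d x\<bar> \<le> D" and e: "e * D \<le> 1 / 2" and "e \<ge> 0"
  shows "unif_diff S e (\<lambda>t x. ln (1 + t * d x)) (\<lambda>t x. d x / (1 + t * d x))"
proof (rule unif_diffI[where K = 1 and L = "2 * D"])
  fix x t assume x: "x \<in> S" "\<bar>t\<bar> \<le> e"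
  have "\<bar>t * d x\<bar> \<le> e * D" unfolding abs_mult using d x assms(3) by (intro mult_mono) auto
  then have td: "\<bar>t * d x\<bar> \<le> 1/2" using e by linarith
  then have pos: "1 + t * d x \<ge> 1/2" "1 + t * d x \<le> 3/2" by linarith+
  have "ln (1/2) \<le> ln (1 + t * d x)" using pos by (subst ln_le_cancel_iff) auto
  moreover have "ln (1/2::real) \<ge> -1" using ln_diff_le[of 1 "1/2::real"] ln_one by simp
  moreover have "ln (1 + t * d x) \<le> t * d x" using pos by (intro ln_add_one_self_le_self2) auto
  ultimately show "\<bar>ln (1 + t * d x)\<bar> \<le> 1" using td by linarith
  have "\<bar>d x\<bar> / (1 + t * d x) \<le> \<bar>d x\<bar> / (1/2)" using pos by (intro divide_left_mono) auto
  then show "\<bar>d x / (1 + t * d x)\<bar> \<le> 2 * D" using d[OF x(1)] pos by (simp add: abs_divide)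
  show "((\<lambda>t. ln (1 + t * d x)) has_real_derivative d x / (1 + t * d x)) (at t)"
    using pos by (auto intro!: derivative_eq_intros)
qed

text \<open>Difference quotients along \<open>e / (n + 1)\<close> all have expectation zero,
  converge pointwise to \<open>q' 0\<close>, and are bounded by the mean value theorem.\<close>

lemma expectation_derivative_zero:
  assumes "finite_measure M" and AE: "AE x in M. x \<in> S" and U: "unif_diff S e q q'" and e: "e > 0"
    and [measurable]: "\<And>t. q t \<in> borel_measurable M" "q' 0 \<in> borel_measurable M"
    and eq: "\<And>t. \<bar>t\<bar> \<le> e \<Longrightarrow> (\<integral>x. q t x \<partial>M) = (\<integral>x. q 0 x \<partial>M)"
  shows "(\<integral>x. q' 0 x \<partial>M) = 0"
proof -
  interpret finite_measure M by fact
  obtain K where K: "K \<ge> 0" "\<And>x t. x \<in> S \<Longrightarrow> \<bar>t\<bar> \<le> e \<Longrightarrow> \<bar>q t x\<bar> \<le> K"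
    "\<And>x t. x \<in> S \<Longrightarrow> \<bar>t\<bar> \<le> e \<Longrightarrow> \<bar>q' t x\<bar> \<le> K"
    "\<And>x t. x \<in> S \<Longrightarrow> \<bar>t\<bar> \<le> e \<Longrightarrow> ((\<lambda>t. q t x) has_real_derivative q' t x) (at t)"
    using U by (elim unif_diffE) blast
  define s where "s = (\<lambda>n. e / real (Suc n))"
  have s: "s n > 0" "s n \<le> e" for n using e by (auto simp: s_def field_simps)
  have s0: "s \<longlonglongrightarrow> 0" unfolding s_def using LIMSEQ_Suc[OF lim_const_over_n[of e]] by simp
  have int: "integrable M (q t)" if "\<bar>t\<bar> \<le> e" for t
    by (rule integrable_const_bound[where B = K]) (use AE K(2) that in \<open>auto elim!: eventually_mono\<close>)
  have "(\<lambda>n. \<integral>x. (q (s n) x - q 0 x) / s n \<partial>M) \<longlonglongrightarrow> (\<integral>x. q' 0 x \<partial>M)"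
  proof (rule integral_dominated_convergence[where w = "\<lambda>_. K"])
    show "AE x in M. (\<lambda>n. (q (s n) x - q 0 x) / s n) \<longlonglongrightarrow> q' 0 x"
      using AE
    proof eventually_elim
      fix x assume x: "x \<in> S"
      have "((\<lambda>t. q t x) has_real_derivative q' 0 x) (at 0)" using K(4)[OF x, of 0] e by simp
      then have "((\<lambda>h. (q h x - q 0 x) / h) \<longlongrightarrow> q' 0 x) (at 0)" by (simp add: DERIV_def)
      moreover have "filterlim s (at 0) sequentially"
        using s0 s(1) by (auto simp: filterlim_at intro!: always_eventually) (metis less_irrefl)
      ultimately show "(\<lambda>n. (q (s n) x - q 0 x) / s n) \<longlonglongrightarrow> q' 0 x"
        by (rule filterlim_compose)
    qed
    show "AE x in M. norm ((q (s n) x - q 0 x) / s n) \<le> K" for n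
      using AE
    proof eventually_elim
      fix x assume x: "x \<in> S"
      have "\<exists>z>0. z < s n \<and> q (s n) x - q 0 x = (s n - 0) * q' z x"
        using s[of n] by (intro MVT2[of 0 "s n" "\<lambda>t. q t x" "\<lambda>t. q' t x"] K(4)[OF x]) auto
      then obtain z where z: "z > 0" "z < s n" "q (s n) x - q 0 x = s n * q' z x" by auto
      then have "(q (s n) x - q 0 x) / s n = q' z x" using s(1)[of n] by simp
      then show "norm ((q (s n) x - q 0 x) / s n) \<le> K" using K(3)[OF x, of z] z s(2)[of n] by simp
    qed
  qed auto
  moreover have "(\<lambda>n. \<integral>x. (q (s n) x - q 0 x) / s n \<partial>M) = (\<lambda>n. 0)"
  proof
    fix n
    show "(\<integral>x. (q (s n) x - q 0 x) / s n \<partial>M) = 0"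
      using s[of n] e eq[of "s n"] int[of "s n"] int[of 0] by simp
  qed
  ultimately have "(\<lambda>n. 0) \<longlonglongrightarrow> (\<integral>x. q' 0 x \<partial>M)" by (simp only:)
  then show ?thesis by (simp add: LIMSEQ_const_iff)
qed

section \<open>The Jacobi ensemble and its loop equations\<close>

declare One_nat_def [simp del]

lemma integrable_beta_kernel:
  fixes a b :: real
  assumes "a > -1" "b > -1"
  shows "integrable lborel (\<lambda>x. indicator {0..1} x * (x powr a * (1 - x) powr b))"
  using integrable_Beta[of "a + 1" "b + 1"] assms by (simp add: set_integrable_def)

lemma jacobi_weight_nonneg: "jacobi_weight \<beta> a b N x \<ge> 0"
  unfolding jacobi_weight_def by (auto intro!: mult_nonneg_nonneg prod_nonneg)

lemma measurable_jacobi_weight [measurable]: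
  "jacobi_weight \<beta> a b N \<in> borel_measurable (PiM {1..N} (\<lambda>_. lborel))"
proof -
  have *: "mono_on {1..N} x \<longleftrightarrow> (\<forall>i\<in>{1..N}. \<forall>j\<in>{1..N}. i \<le> j \<longrightarrow> x i \<le> x j)" for x :: "nat \<Rightarrow> real"
    by (auto simp: mono_on_def)
  have comp: "(\<lambda>x. x i) \<in> borel_measurable (PiM {1..N} (\<lambda>_. lborel))" if "i \<in> {1..N}" for i :: nat
    using measurable_component_singleton[OF that, of "\<lambda>_. lborel"] by simp
  note [measurable] = comp
  have [measurable]: "(\<lambda>x. x i) \<in> borel_measurable (PiM {1..N} (\<lambda>_. lborel))" if "i \<in> {1..<j}" "j \<in> {1..N}" for i j :: nat
    using comp[of i] that by simp
  have le [measurable]: "Measurable.pred (PiM {1..N} (\<lambda>_. lborel)) (\<lambda>x. x i \<le> (x j :: real))"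
    if "i \<in> {1..N}" "j \<in> {1..N}" for i j
    unfolding pred_def by (rule borel_measurable_le[OF comp[OF that(1)] comp[OF that(2)]])
  have 1: "Measurable.pred (PiM {1..N} (\<lambda>_. lborel)) (\<lambda>x. (\<forall>i\<in>{1..N}. 0 \<le> x i \<and> x i \<le> (1::real)) \<and> mono_on {1..N} x)"
    unfolding * by measurable
  have 2: "(\<lambda>x. (\<Prod>j\<in>{1..N}. \<Prod>i\<in>{1..<j}. \<bar>x j - x i\<bar> powr \<beta>) *
           (\<Prod>l\<in>{1..N}. x l powr a * (1 - x l) powr b)) \<in> borel_measurable (PiM {1..N} (\<lambda>_. lborel))"
    by (intro borel_measurable_times borel_measurable_prod powr_real_measurable borel_measurable_abs borel_measurable_diff) auto
  show ?thesis
    unfolding jacobi_weight_def by (rule measurable_If[OF 2 _ 1[unfolded pred_def]]) simp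
qed

text \<open>For particles in the unit interval every interaction factor is at most 1, which leaves a
  product of integrable one-particle weights as a majorant.\<close>

lemma jacobi_weight_le:
  assumes "\<beta> \<ge> 0"
  shows "jacobi_weight \<beta> a b N x \<le> (\<Prod>l\<in>{1..N}. indicator {0..1} (x l) * (x l powr a * (1 - x l) powr b))"
proof (cases "(\<forall>i\<in>{1..N}. 0 \<le> x i \<and> x i \<le> 1) \<and> mono_on {1..N} x")
  case True
  have "(\<Prod>j\<in>{1..N}. \<Prod>i\<in>{1..<j}. \<bar>x j - x i\<bar> powr \<beta>) \<le> 1"
  proof (intro prod_le_1 conjI prod_nonneg ballI)
    fix j i assume "j \<in> {1..N}" "i \<in> {1..<j}"
    then have "0 \<le> x i" "x i \<le> 1" "0 \<le> x j" "x j \<le> 1" using True by auto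
    then have "\<bar>x j - x i\<bar> \<le> 1" by linarith
    then show "\<bar>x j - x i\<bar> powr \<beta> \<le> 1" using powr_mono2[OF assms, of "\<bar>x j - x i\<bar>" 1] by simp
  qed auto
  then have "(\<Prod>j\<in>{1..N}. \<Prod>i\<in>{1..<j}. \<bar>x j - x i\<bar> powr \<beta>) * (\<Prod>l\<in>{1..N}. x l powr a * (1 - x l) powr b)
    \<le> 1 * (\<Prod>l\<in>{1..N}. x l powr a * (1 - x l) powr b)"
    by (intro mult_right_mono prod_nonneg) auto
  moreover have "(\<Prod>l\<in>{1..N}. indicator {0..1} (x l) * (x l powr a * (1 - x l) powr b)) = (\<Prod>l\<in>{1..N}. x l powr a * (1 - x l) powr b)"
    using True by (intro prod.cong) auto
  ultimately show ?thesis using True by (simp add: jacobi_weight_def)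
next
  case False
  then show ?thesis by (auto simp: jacobi_weight_def intro!: prod_nonneg)
qed

lemma integrable_jacobi_weight:
  assumes "\<beta> \<ge> 0" "a > -1" "b > -1"
  shows "integrable (PiM {1..N} (\<lambda>_. lborel)) (jacobi_weight \<beta> a b N)"
proof (rule Bochner_Integration.integrable_bound)
  interpret product_sigma_finite "\<lambda>_::nat. lborel :: real measure" ..
  show "integrable (PiM {1..N} (\<lambda>_. lborel)) (\<lambda>x. \<Prod>l\<in>{1..N}. indicator {0..1} (x l) * (x l powr a * (1 - x l) powr b))"
    using integrable_beta_kernel[OF assms(2,3)] by (intro product_integrable_prod) auto
  show "AE x in PiM {1..N} (\<lambda>_. lborel). norm (jacobi_weight \<beta> a b N x) \<le>
     norm (\<Prod>l\<in>{1..N}. indicator {0..1} (x l) * (x l powr a * (1 - x l) powr b))"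
  proof (rule AE_I2)
    fix x :: "nat \<Rightarrow> real"
    have "(\<Prod>l\<in>{1..N}. indicator {0..1} (x l) * (x l powr a * (1 - x l) powr b)) \<ge> 0"
      by (intro prod_nonneg) auto
    then show "norm (jacobi_weight \<beta> a b N x) \<le>
     norm (\<Prod>l\<in>{1..N}. indicator {0..1} (x l) * (x l powr a * (1 - x l) powr b))"
      using jacobi_weight_le[OF assms(1), of a b N x] jacobi_weight_nonneg[of \<beta> a b N x] by simp
  qed
qed measurable

definition jacobi_const :: "real \<Rightarrow> real \<Rightarrow> real \<Rightarrow> nat \<Rightarrow> real" where
  "jacobi_const \<beta> a b N = (\<integral>x. jacobi_weight \<beta> a b N x \<partial>PiM {1..N} (\<lambda>_. lborel))"

lemma jacobi_ensemble_eq: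
  "jacobi_ensemble \<beta> a b N = density (PiM {1..N} (\<lambda>_. lborel)) (\<lambda>x. ennreal (jacobi_weight \<beta> a b N x / jacobi_const \<beta> a b N))"
  by (simp add: jacobi_ensemble_def jacobi_const_def Let_def)

text \<open>Disjoint increasing intervals give a box of positive volume on which the weight is positive.\<close>

lemma jacobi_const_pos:
  assumes "\<beta> \<ge> 0" "a > -1" "b > -1"
  shows "jacobi_const \<beta> a b N > 0"
proof -
  let ?L = "PiM {1..N} (\<lambda>_. lborel :: real measure)"
  interpret product_sigma_finite "\<lambda>_::nat. lborel :: real measure" ..
  \<comment> \<open>Left ends are even and right ends odd multiples of \<open>1 / (2N + 2)\<close>,
    which leaves gaps between neighbours; starting at index 1 and stopping at \<open>N\<close> keeps
    the box away from 0 and 1.\<close>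
  define lo where "lo = (\<lambda>i::nat. (2 * real i) / (2 * real N + 2))"
  define hi where "hi = (\<lambda>i::nat. (2 * real i + 1) / (2 * real N + 2))"
  define A where "A = PiE {1..N} (\<lambda>i. {lo i..hi i})"
  have lohi: "lo i < hi i" for i by (simp add: lo_def hi_def divide_strict_right_mono)
  have hilo: "hi i < lo j" if "i < j" for i j
    using that by (simp add: lo_def hi_def divide_strict_right_mono)
  have lo0: "lo i > 0" if "i \<ge> 1" for i using that by (simp add: lo_def)
  have hi1: "hi i < 1" if "i \<le> N" for i using that by (simp add: hi_def)
  have "jacobi_const \<beta> a b N \<ge> 0" unfolding jacobi_const_def
    by (intro integral_nonneg_AE AE_I2 jacobi_weight_nonneg)
  moreover have "jacobi_const \<beta> a b N \<noteq> 0"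
  proof
    assume "jacobi_const \<beta> a b N = 0"
    then have "AE x in ?L. jacobi_weight \<beta> a b N x = 0"
      unfolding jacobi_const_def
      by (subst (asm) integral_nonneg_eq_0_iff_AE[OF integrable_jacobi_weight[OF assms]])
         (auto simp: jacobi_weight_nonneg)
    moreover have "jacobi_weight \<beta> a b N x > 0" if x: "x \<in> A" for x
    proof -
      have b: "lo i \<le> x i" "x i \<le> hi i" if "i \<in> {1..N}" for i
        using x that by (auto simp: A_def PiE_def)
      have b': "0 < x i" "x i < 1" if "i \<in> {1..N}" for i
        using b[OF that] lo0[of i] hi1[of i] that by auto
      have less: "x i < x j" if "i \<in> {1..N}" "j \<in> {1..N}" "i < j" for i j
        using b[OF that(1)] b[OF that(2)] hilo[OF that(3)] by linarith
      have "mono_on {1..N} x"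
        by (intro mono_onI) (metis less less_eq_real_def le_neq_implies_less)
      moreover have "(\<Prod>j\<in>{1..N}. \<Prod>i\<in>{1..<j}. \<bar>x j - x i\<bar> powr \<beta>) > 0"
      proof (intro prod_pos ballI)
        fix j i assume "j \<in> {1..N}" "i \<in> {1..<j}"
        then have "x i < x j" using less[of i j] by auto
        then show "0 < \<bar>x j - x i\<bar> powr \<beta>" by simp
      qed
      moreover have "(\<Prod>l\<in>{1..N}. x l powr a * (1 - x l) powr b) > 0"
      proof (intro prod_pos ballI)
        fix l assume "l \<in> {1..N}"
        then show "0 < x l powr a * (1 - x l) powr b" using b'[of l] by simp
      qed
      ultimately show ?thesis using b' by (auto simp: jacobi_weight_def less_imp_le)
    qed
    ultimately have "AE x in ?L. x \<notin> A" by (auto elim!: eventually_mono) (metis less_irrefl)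
    moreover have As: "A \<in> sets ?L" unfolding A_def by (intro sets_PiM_I_finite) auto
    ultimately have "emeasure ?L A = 0"
      by (subst (asm) AE_iff_measurable[OF As]) (auto simp: A_def space_PiM PiE_def)
    moreover have "emeasure ?L A = (\<Prod>i\<in>{1..N}. ennreal (hi i - lo i))"
      unfolding A_def using lohi by (subst emeasure_PiM) (auto simp: less_imp_le)
    ultimately have "(\<Prod>i\<in>{1..N}. ennreal (hi i - lo i)) = 0" by simp
    then obtain i where "ennreal (hi i - lo i) = 0" by (auto simp: prod_zero_iff)
    then show False using lohi[of i] by (simp add: ennreal_eq_0_iff)
  qed
  ultimately show ?thesis by simp
qed

lemma prob_space_jacobi_ensemble:
  assumes "\<beta> \<ge> 0" "a > -1" "b > -1"
  shows "prob_space (jacobi_ensemble \<beta> a b N)"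
proof
  let ?L = "PiM {1..N} (\<lambda>_. lborel :: real measure)"
  note Z = jacobi_const_pos[OF assms, of N]
  have "emeasure (jacobi_ensemble \<beta> a b N) (space (jacobi_ensemble \<beta> a b N)) =
     (\<integral>\<^sup>+x. ennreal (jacobi_weight \<beta> a b N x / jacobi_const \<beta> a b N) \<partial>?L)"
    by (simp add: jacobi_ensemble_eq emeasure_density cong: nn_integral_cong_simp)
  also have "\<dots> = ennreal (\<integral>x. jacobi_weight \<beta> a b N x / jacobi_const \<beta> a b N \<partial>?L)"
    using Z integrable_jacobi_weight[OF assms]
    by (intro nn_integral_eq_integral) (auto simp: jacobi_weight_nonneg)
  also have "(\<integral>x. jacobi_weight \<beta> a b N x / jacobi_const \<beta> a b N \<partial>?L) = 1"
    using Z by (simp add: jacobi_const_def)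
  finally show "emeasure (jacobi_ensemble \<beta> a b N) (space (jacobi_ensemble \<beta> a b N)) = 1" by simp
qed

lemma sets_jacobi_ensemble [measurable_cong]: "sets (jacobi_ensemble \<beta> a b N) = sets (PiM {1..N} (\<lambda>_. borel))"
proof -
  have "sets (PiM {1..N} (\<lambda>_. lborel)) = sets (PiM {1..N} (\<lambda>_. borel :: real measure))"
    by (intro sets_PiM_cong) auto
  then show ?thesis by (simp add: jacobi_ensemble_eq)
qed

definition unit_cube :: "nat \<Rightarrow> (nat \<Rightarrow> real) set" where
  "unit_cube N = {x. \<forall>i\<in>{1..N}. 0 \<le> x i \<and> x i \<le> 1}"

lemma AE_jacobi_ensemble_cube: "AE x in jacobi_ensemble \<beta> a b N. x \<in> unit_cube N"
proof -
  have "AE x in PiM {1..N} (\<lambda>_. lborel). 0 < ennreal (jacobi_weight \<beta> a b N x / jacobi_const \<beta> a b N) \<longrightarrow> x \<in> unit_cube N"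
  proof (rule AE_I2, rule impI)
    fix x assume "0 < ennreal (jacobi_weight \<beta> a b N x / jacobi_const \<beta> a b N)"
    then have "jacobi_weight \<beta> a b N x \<noteq> 0" by auto
    then show "x \<in> unit_cube N" by (auto simp: jacobi_weight_def unit_cube_def split: if_splits)
  qed
  then show ?thesis unfolding jacobi_ensemble_eq by (subst AE_density) auto
qed

lemma measurable_jacobi_component [measurable]:
  "i \<in> {1..N} \<Longrightarrow> (\<lambda>x. x i) \<in> borel_measurable (jacobi_ensemble \<beta> a b N)"
  using measurable_component_singleton[of i "{1..N}" "\<lambda>_. borel :: real measure"]
  by (simp add: measurable_cong_sets[OF sets_jacobi_ensemble refl])

section \<open>The flow of the particles and the change of the weight along it\<close>

text \<open>The divided difference of \<open>flow_field\<close>, written as a polynomial so that it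
  makes sense for coinciding particles too, where it is the derivative.\<close>

definition flow_dd :: "nat \<Rightarrow> real \<Rightarrow> real \<Rightarrow> real" where
  "flow_dd k x y = (\<Sum>p<Suc k. x ^ p * y ^ (k - p)) - (\<Sum>p<Suc (Suc k). x ^ p * y ^ (Suc k - p))"

definition flow_field :: "nat \<Rightarrow> real \<Rightarrow> real" where
  "flow_field k x = x ^ Suc k * (1 - x)"

definition flow_field' :: "nat \<Rightarrow> real \<Rightarrow> real" where
  "flow_field' k x = real (Suc k) * x ^ k - real (Suc (Suc k)) * x ^ Suc k"

definition flow :: "nat \<Rightarrow> real \<Rightarrow> real \<Rightarrow> real" where
  "flow k t x = x + t * flow_field k x"

lemma flow_dd_mult: "(x - y) * flow_dd k x y = flow_field k x - flow_field k y"
proof -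
  have "(x - y) * flow_dd k x y = (x ^ Suc k - y ^ Suc k) - (x ^ Suc (Suc k) - y ^ Suc (Suc k))"
    unfolding diff_power_eq_sum flow_dd_def by (simp only: right_diff_distrib)
  then show ?thesis by (simp add: flow_field_def algebra_simps)
qed

lemma flow_dd_diag: "flow_dd k x x = flow_field' k x"
proof -
  have *: "(\<Sum>p<Suc n. x ^ p * x ^ (n - p)) = real (Suc n) * x ^ n" for n
  proof -
    have "(\<Sum>p<Suc n. x ^ p * x ^ (n - p)) = (\<Sum>p<Suc n. x ^ n)"
      by (intro sum.cong) (auto simp flip: power_add)
    then show ?thesis by simp
  qed
  show ?thesis unfolding flow_dd_def flow_field'_def * ..
qed

lemma flow_dd_commute: "flow_dd k x y = flow_dd k y x"
proof -
  have *: "(\<Sum>p<Suc n. x ^ p * y ^ (n - p)) = (\<Sum>p<Suc n. y ^ p * x ^ (n - p))" for n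
    by (rule sum.reindex_bij_witness[of _ "\<lambda>p. n - p" "\<lambda>p. n - p"]) auto
  show ?thesis unfolding flow_dd_def by (simp only: *)
qed

text \<open>Both sums are nonnegative, so their difference is bounded by the larger number of terms
  rather than by the sum of the two.\<close>

lemma flow_dd_bound:
  assumes "0 \<le> x" "x \<le> 1" "0 \<le> y" "y \<le> 1"
  shows "\<bar>flow_dd k x y\<bar> \<le> real (k + 2)"
proof -
  have *: "0 \<le> (\<Sum>p<Suc n. x ^ p * y ^ (n - p))" "(\<Sum>p<Suc n. x ^ p * y ^ (n - p)) \<le> real (Suc n)" for n
  proof -
    show "0 \<le> (\<Sum>p<Suc n. x ^ p * y ^ (n - p))" using assms by (intro sum_nonneg) auto
    have "(\<Sum>p<Suc n. x ^ p * y ^ (n - p)) \<le> (\<Sum>p<Suc n. 1)"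
      using assms by (intro sum_mono mult_le_one power_le_one) auto
    then show "(\<Sum>p<Suc n. x ^ p * y ^ (n - p)) \<le> real (Suc n)" by simp
  qed
  show ?thesis using *[of k] *[of "Suc k"] unfolding flow_dd_def by linarith
qed

lemma flow_field'_bound:
  assumes "0 \<le> x" "x \<le> 1" shows "\<bar>flow_field' k x\<bar> \<le> real (k + 2)"
  using flow_dd_bound[OF assms assms, of k] by (simp add: flow_dd_diag)

lemma flow_field_bound:
  assumes "0 \<le> x" "x \<le> 1" shows "0 \<le> flow_field k x" "flow_field k x \<le> 1"
  using assms by (auto simp: flow_field_def intro!: mult_le_one power_le_one simp del: power_Suc)

lemma DERIV_flow_field: "(flow_field k has_real_derivative flow_field' k x) (at x)"
  unfolding flow_field_def flow_field'_def
  by (auto intro!: derivative_eq_intros simp del: power_Suc of_nat_Suc) (simp add: algebra_simps)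

lemma flow_diff: "flow k t x - flow k t y = (x - y) * (1 + t * flow_dd k x y)"
proof -
  have "flow k t x - flow k t y = (x - y) + t * (flow_field k x - flow_field k y)"
    by (simp add: flow_def algebra_simps)
  also have "\<dots> = (x - y) * (1 + t * flow_dd k x y)"
    unfolding flow_dd_mult[symmetric] by (simp add: algebra_simps)
  finally show ?thesis .
qed

text \<open>The distances to the endpoints 0 and 1 are multiplied by factors near 1. In this form
  the possibly singular weights change only by powers of bounded positive numbers.\<close>

lemma flow_factor: "flow k t x = x * (1 + t * (x ^ k * (1 - x)))"
  "1 - flow k t x = (1 - x) * (1 + t * (- (x ^ Suc k)))"
  by (simp_all add: flow_def flow_field_def algebra_simps)

text \<open>A single range of \<open>t\<close> serves all factors: divided differences, endpoint
  factors and the derivative of the field are all bounded by \<open>k + 2\<close>.\<close>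

lemma one_plus_ge_half:
  assumes "\<bar>t\<bar> \<le> 1 / (2 * real (k + 2))" "\<bar>d\<bar> \<le> real (k + 2)"
  shows "1 + t * d \<ge> 1 / 2"
proof -
  have "\<bar>t * d\<bar> \<le> 1 / (2 * real (k + 2)) * real (k + 2)"
    unfolding abs_mult using assms by (intro mult_mono) auto
  also have "\<dots> = 1 / 2" by simp
  finally show ?thesis by linarith
qed

text \<open>The logarithm of the ratio between the pulled-back and the original weight, Jacobian
  included. The singular parts of the weight and the normalizing constant cancel in this ratio, so
  it is smooth in \<open>t\<close>.\<close>

definition log_transport :: "nat \<Rightarrow> real \<Rightarrow> real \<Rightarrow> real \<Rightarrow> nat \<Rightarrow> real \<Rightarrow> (nat \<Rightarrow> real) \<Rightarrow> real" where
  "log_transport k \<beta> a b N t x =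
     \<beta> * (\<Sum>j\<in>{1..N}. \<Sum>i\<in>{1..<j}. ln (1 + t * flow_dd k (x j) (x i))) +
     (\<Sum>l\<in>{1..N}. a * ln (1 + t * (x l ^ k * (1 - x l))) + b * ln (1 + t * (- (x l ^ Suc k))) +
        ln (1 + t * flow_field' k (x l)))"

lemma cube_power_bounds:
  fixes x :: real
  assumes "0 \<le> x" "x \<le> 1"
  shows "\<bar>x ^ k * (1 - x)\<bar> \<le> real (k + 2)" "\<bar>- (x ^ Suc k)\<bar> \<le> real (k + 2)"
proof -
  have "0 \<le> x ^ k * (1 - x)" "x ^ k * (1 - x) \<le> 1" "0 \<le> x ^ Suc k" "x ^ Suc k \<le> 1"
    using assms by (auto intro!: mult_le_one power_le_one simp del: power_Suc)
  then show "\<bar>x ^ k * (1 - x)\<bar> \<le> real (k + 2)" "\<bar>- (x ^ Suc k)\<bar> \<le> real (k + 2)" by simp_all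
qed

text \<open>Differences of particles are multiplied by positive numbers, so order and membership in
  the cube are preserved in both directions, and each factor of the weight picks up an explicit
  positive factor. For unordered particles both sides vanish.\<close>

lemma jacobi_weight_transport:
  assumes x: "x \<in> unit_cube N" and t: "\<bar>t\<bar> \<le> 1 / (2 * real (k + 2))"
  shows "jacobi_weight \<beta> a b N (\<lambda>i\<in>{1..N}. flow k t (x i)) * (\<Prod>i\<in>{1..N}. 1 + t * flow_field' k (x i)) =
    jacobi_weight \<beta> a b N x * exp (log_transport k \<beta> a b N t x)"
proof -
  let ?y = "\<lambda>i\<in>{1..N}. flow k t (x i)"
  have x01: "0 \<le> x i" "x i \<le> 1" if "i \<in> {1..N}" for i using x that by (auto simp: unit_cube_def)
  note half = one_plus_ge_half[OF t]
  have d: "1 + t * flow_dd k (x i) (x j) \<ge> 1/2" if "i \<in> {1..N}" "j \<in> {1..N}" for i j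
    using half[OF flow_dd_bound] x01 that by simp
  have d': "1 + t * flow_field' k (x i) \<ge> 1/2" if "i \<in> {1..N}" for i
    using half[OF flow_field'_bound] x01 that by simp
  have e1: "1 + t * (x i ^ k * (1 - x i)) \<ge> 1/2" if "i \<in> {1..N}" for i
    using half[OF cube_power_bounds(1)] x01 that by simp
  have e2: "1 + t * (- (x i ^ Suc k)) \<ge> 1/2" if "i \<in> {1..N}" for i
    using half[OF cube_power_bounds(2)] x01[OF that] by blast
  have y01: "0 \<le> ?y i" "?y i \<le> 1" if "i \<in> {1..N}" for i
  proof -
    have "0 \<le> flow k t (x i)" unfolding flow_factor using x01[OF that] e1[OF that] by (intro mult_nonneg_nonneg) auto
    moreover have "0 \<le> 1 - flow k t (x i)" unfolding flow_factor(2) using x01[OF that] e2[OF that] by (intro mult_nonneg_nonneg) auto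
    ultimately show "0 \<le> ?y i" "?y i \<le> 1" using that by simp_all
  qed
  have le: "?y i \<le> ?y j \<longleftrightarrow> x i \<le> x j" if "i \<in> {1..N}" "j \<in> {1..N}" for i j
  proof -
    have "?y j - ?y i = (x j - x i) * (1 + t * flow_dd k (x j) (x i))"
      using that by (simp add: flow_diff)
    moreover have "1 + t * flow_dd k (x j) (x i) > 0" using d[OF that(2,1)] by linarith
    ultimately show ?thesis by (metis diff_ge_0_iff_ge zero_le_mult_iff less_le_not_le)
  qed
  have mono: "mono_on {1..N} ?y \<longleftrightarrow> mono_on {1..N} x"
    unfolding mono_on_def using le by blast
  have P1: "(\<Prod>j\<in>{1..N}. \<Prod>i\<in>{1..<j}. \<bar>?y j - ?y i\<bar> powr \<beta>) =
     (\<Prod>j\<in>{1..N}. \<Prod>i\<in>{1..<j}. \<bar>x j - x i\<bar> powr \<beta>) *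
       exp (\<beta> * (\<Sum>j\<in>{1..N}. \<Sum>i\<in>{1..<j}. ln (1 + t * flow_dd k (x j) (x i))))"
  proof -
    have "(\<Prod>j\<in>{1..N}. \<Prod>i\<in>{1..<j}. \<bar>?y j - ?y i\<bar> powr \<beta>) =
      (\<Prod>j\<in>{1..N}. \<Prod>i\<in>{1..<j}. \<bar>x j - x i\<bar> powr \<beta> * exp (\<beta> * ln (1 + t * flow_dd k (x j) (x i))))"
    proof (intro prod.cong refl)
      fix j i assume ji: "j \<in> {1..N}" "i \<in> {1..<j}"
      then have i: "i \<in> {1..N}" by auto
      have pos: "1 + t * flow_dd k (x j) (x i) > 0" using d[OF ji(1) i] by linarith
      have "\<bar>?y j - ?y i\<bar> = \<bar>x j - x i\<bar> * (1 + t * flow_dd k (x j) (x i))"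
        using ji(1) i pos by (simp add: flow_diff abs_mult)
      then show "\<bar>?y j - ?y i\<bar> powr \<beta> = \<bar>x j - x i\<bar> powr \<beta> * exp (\<beta> * ln (1 + t * flow_dd k (x j) (x i)))"
        using pos by (simp only: powr_mult) (simp add: powr_def)
    qed
    also have "\<dots> = (\<Prod>j\<in>{1..N}. \<Prod>i\<in>{1..<j}. \<bar>x j - x i\<bar> powr \<beta>) *
       exp (\<beta> * (\<Sum>j\<in>{1..N}. \<Sum>i\<in>{1..<j}. ln (1 + t * flow_dd k (x j) (x i))))"
      by (simp add: prod.distrib exp_sum sum_distrib_left)
    finally show ?thesis .
  qed
  have P2: "(\<Prod>l\<in>{1..N}. ?y l powr a * (1 - ?y l) powr b) * (\<Prod>i\<in>{1..N}. 1 + t * flow_field' k (x i)) =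
     (\<Prod>l\<in>{1..N}. x l powr a * (1 - x l) powr b) *
     exp (\<Sum>l\<in>{1..N}. a * ln (1 + t * (x l ^ k * (1 - x l))) + b * ln (1 + t * (- (x l ^ Suc k))) +
        ln (1 + t * flow_field' k (x l)))"
    unfolding prod.distrib[symmetric] exp_sum[OF finite_atLeastAtMost]
  proof (intro prod.cong refl)
    fix l assume l: "l \<in> {1..N}"
    have "?y l powr a = x l powr a * exp (a * ln (1 + t * (x l ^ k * (1 - x l))))"
      using e1[OF l] x01[OF l] l flow_factor(1)[of k t "x l"]
      by (simp only: restrict_apply powr_mult if_True) (simp add: powr_def)
    moreover have "(1 - ?y l) powr b = (1 - x l) powr b * exp (b * ln (1 + t * (- (x l ^ Suc k))))"
      using e2[OF l] x01[OF l] l flow_factor(2)[of k t "x l"]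
      by (simp only: restrict_apply powr_mult if_True) (simp add: powr_def)
    moreover have "1 + t * flow_field' k (x l) = exp (ln (1 + t * flow_field' k (x l)))"
      using d'[OF l] by simp
    ultimately show "?y l powr a * (1 - ?y l) powr b * (1 + t * flow_field' k (x l)) =
       x l powr a * (1 - x l) powr b * exp (a * ln (1 + t * (x l ^ k * (1 - x l))) + b * ln (1 + t * (- (x l ^ Suc k))) +
        ln (1 + t * flow_field' k (x l)))"
      by (simp only: exp_add) (simp only: mult_ac)
  qed
  show ?thesis
  proof (cases "mono_on {1..N} x")
    case True
    then have "jacobi_weight \<beta> a b N ?y = (\<Prod>j\<in>{1..N}. \<Prod>i\<in>{1..<j}. \<bar>?y j - ?y i\<bar> powr \<beta>) *
      (\<Prod>l\<in>{1..N}. ?y l powr a * (1 - ?y l) powr b)"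
      unfolding jacobi_weight_def mono using y01 by (intro if_P) auto
    moreover have "jacobi_weight \<beta> a b N x = (\<Prod>j\<in>{1..N}. \<Prod>i\<in>{1..<j}. \<bar>x j - x i\<bar> powr \<beta>) *
      (\<Prod>l\<in>{1..N}. x l powr a * (1 - x l) powr b)"
      unfolding jacobi_weight_def using x01 True by (intro if_P) auto
    ultimately show ?thesis
      by (simp only: P1 log_transport_def exp_add mult.assoc P2) (simp only: mult_ac)
  next
    case False
    then have "jacobi_weight \<beta> a b N ?y = 0" "jacobi_weight \<beta> a b N x = 0"
      using mono by (simp_all add: jacobi_weight_def)
    then show ?thesis by simp
  qed
qed

lemma measurable_flow [measurable]: "flow k t \<in> borel_measurable borel"
  "flow_field k \<in> borel_measurable borel" "flow_field' k \<in> borel_measurable borel"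
  "(\<lambda>(x, y). flow_dd k x y) \<in> borel_measurable (borel \<Otimes>\<^sub>M borel)"
proof -
  have fd: "flow k t = (\<lambda>x. x + t * (x ^ Suc k * (1 - x)))" by (simp add: flow_def flow_field_def fun_eq_iff)
  show "flow k t \<in> borel_measurable borel" unfolding fd by measurable
  have fd: "flow_field k = (\<lambda>x. (x ^ Suc k * (1 - x)))" by (simp add: flow_field_def fun_eq_iff)
  show "flow_field k \<in> borel_measurable borel" unfolding fd by measurable
  have fd: "flow_field' k = (\<lambda>x. real (Suc k) * x ^ k - real (Suc (Suc k)) * x ^ Suc k)" by (simp add: flow_field'_def fun_eq_iff)
  show "flow_field' k \<in> borel_measurable borel" unfolding fd by measurable
  show "(\<lambda>(x, y). flow_dd k x y) \<in> borel_measurable (borel \<Otimes>\<^sub>M borel)"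
    unfolding flow_dd_def by measurable
qed

lemma measurable_PiM_lborel_component:
  "i \<in> {1..N} \<Longrightarrow> (\<lambda>x. x i) \<in> borel_measurable (PiM {1..N} (\<lambda>_. lborel :: real measure))" for i :: nat
  using measurable_component_singleton[of i "{1..N}" "\<lambda>_. lborel :: real measure"] by simp

lemma measurable_log_transport:
  "log_transport k \<beta> a b N t \<in> borel_measurable (PiM {1..N} (\<lambda>_. lborel))"
proof -
  have [measurable]: "(\<lambda>x. x i) \<in> borel_measurable (PiM {1..N} (\<lambda>_. lborel :: real measure))"
    if "i \<in> {1..N}" for i :: nat by (rule measurable_PiM_lborel_component[OF that])
  have [measurable]: "(\<lambda>x. x i) \<in> borel_measurable (PiM {1..N} (\<lambda>_. lborel :: real measure))"
    if "i \<in> {1..<j}" "j \<in> {1..N}" for i j :: nat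
    using that by (intro measurable_PiM_lborel_component) auto
  have [measurable]: "(\<lambda>x. flow_dd k (x j) (x i)) \<in> borel_measurable (PiM {1..N} (\<lambda>_. lborel :: real measure))"
    if "i \<in> {1..<j}" "j \<in> {1..N}" for i j :: nat
    using measurable_compose[OF measurable_Pair measurable_flow(4)] that by simp
  show ?thesis unfolding log_transport_def by measurable
qed

lemma sets_PiM_lborel: "sets (PiM I (\<lambda>_. lborel)) = sets (PiM I (\<lambda>_. borel :: real measure))"
  by (intro sets_PiM_cong) auto

lemma measurable_log_transport' [measurable]:
  "log_transport k \<beta> a b N t \<in> borel_measurable (jacobi_ensemble \<beta> a b N)"
  using measurable_log_transport[of k \<beta> a b N t]
  by (simp add: measurable_cong_sets[OF sets_jacobi_ensemble refl] measurable_cong_sets[OF sets_PiM_lborel refl])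

lemma measurable_flow_map:
  "(\<lambda>x. \<lambda>i\<in>{1..N::nat}. flow k t (x i)) \<in> measurable (PiM {1..N} (\<lambda>_. lborel)) (PiM {1..N} (\<lambda>_. borel))"
proof (rule measurable_restrict)
  fix i assume i: "i \<in> {1..N}"
  show "(\<lambda>x. flow k t (x i)) \<in> borel_measurable (PiM {1..N} (\<lambda>_. lborel))"
    by (rule measurable_compose[OF measurable_PiM_lborel_component[OF i] measurable_flow(1)])
qed

lemma nn_integral_jacobi_ensemble:
  assumes "f \<in> borel_measurable (PiM {1..N} (\<lambda>_. lborel))"
  shows "(\<integral>\<^sup>+x. f x \<partial>jacobi_ensemble \<beta> a b N) =
    (\<integral>\<^sup>+x. ennreal (jacobi_weight \<beta> a b N x / jacobi_const \<beta> a b N) * f x \<partial>PiM {1..N} (\<lambda>_. lborel))"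
  unfolding jacobi_ensemble_eq using assms measurable_jacobi_weight[of \<beta> a b N]
  by (intro nn_integral_density) auto

text \<open>The change of variables on the cube, which carries the whole mass of the ensemble; the
  Jacobian and the ratio of the weights merge into the exponential.\<close>

lemma nn_integral_transport:
  assumes ab: "\<beta> \<ge> 0" "a > -1" "b > -1" and t: "\<bar>t\<bar> \<le> 1 / (2 * real (k + 2))"
    and f: "f \<in> borel_measurable (PiM {1..N} (\<lambda>_. borel))"
  shows "(\<integral>\<^sup>+x. f x \<partial>jacobi_ensemble \<beta> a b N) =
    (\<integral>\<^sup>+x. ennreal (exp (log_transport k \<beta> a b N t x)) * f (\<lambda>i\<in>{1..N}. flow k t (x i)) \<partial>jacobi_ensemble \<beta> a b N)"
proof -
  let ?L = "PiM {1..N} (\<lambda>_. lborel :: real measure)"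
  let ?Z = "jacobi_const \<beta> a b N"
  let ?W = "jacobi_weight \<beta> a b N"
  let ?T = "\<lambda>x. \<lambda>i\<in>{1..N}. flow k t (x i)"
  note Z = jacobi_const_pos[OF ab, of N]
  have fL[measurable]: "f \<in> borel_measurable ?L"
    using f by (simp add: measurable_cong_sets[OF sets_PiM_lborel refl])
  have [measurable]: "?W \<in> borel_measurable ?L" by measurable
  have ind: "(\<Prod>i\<in>{1..N}. indicator {0..1} (x i)) = (indicator (unit_cube N) x :: ennreal)" for x
    by (cases "x \<in> unit_cube N") (auto simp: unit_cube_def indicator_def prod_zero_iff)
  have pos: "1 + t * flow_field' k u \<ge> 0" if "u \<in> {0..1}" for u
    using one_plus_ge_half[OF t flow_field'_bound, of u] that by simp
  have "(\<integral>\<^sup>+x. f x \<partial>jacobi_ensemble \<beta> a b N) = (\<integral>\<^sup>+x. ennreal (?W x / ?Z) * f x * (\<Prod>i\<in>{1..N}. indicator {0..1} (x i)) \<partial>?L)"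
    unfolding nn_integral_jacobi_ensemble[OF fL] ind
    by (intro nn_integral_cong) (auto simp: indicator_def jacobi_weight_def unit_cube_def)
  also have "\<dots> = (\<integral>\<^sup>+x. ennreal (?W (?T x) / ?Z) * f (?T x) * (\<Prod>i\<in>{1..N}. ennreal (1 + t * flow_field' k (x i)) * indicator {0..1} (x i)) \<partial>?L)"
  proof (intro nn_integral_cube_substitution)
    show "(flow k t has_real_derivative 1 + t * flow_field' k u) (at u)" for u
      unfolding flow_def[abs_def] by (auto intro!: derivative_eq_intros DERIV_flow_field)
    show "continuous_on {0..1} (\<lambda>u. 1 + t * flow_field' k u)"
      unfolding flow_field'_def by (intro continuous_intros)
  qed (use pos in \<open>auto simp: flow_def flow_field_def\<close>)
  also have "\<dots> = (\<integral>\<^sup>+x. ennreal (?W x / ?Z) * (ennreal (exp (log_transport k \<beta> a b N t x)) * f (?T x)) \<partial>?L)"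
  proof (intro nn_integral_cong)
    fix x
    show "ennreal (?W (?T x) / ?Z) * f (?T x) * (\<Prod>i\<in>{1..N}. ennreal (1 + t * flow_field' k (x i)) * indicator {0..1} (x i))
      = ennreal (?W x / ?Z) * (ennreal (exp (log_transport k \<beta> a b N t x)) * f (?T x))"
    proof (cases "x \<in> unit_cube N")
      case True
      then have x01: "x i \<in> {0..1}" if "i \<in> {1..N}" for i using that by (auto simp: unit_cube_def)
      have "(\<Prod>i\<in>{1..N}. ennreal (1 + t * flow_field' k (x i)) * indicator {0..1} (x i)) =
         (\<Prod>i\<in>{1..N}. ennreal (1 + t * flow_field' k (x i)))"
        using x01 by (intro prod.cong) auto
      also have "\<dots> = ennreal (\<Prod>i\<in>{1..N}. 1 + t * flow_field' k (x i))"
        using x01 pos by (intro prod_ennreal) auto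
      finally have 1: "(\<Prod>i\<in>{1..N}. ennreal (1 + t * flow_field' k (x i)) * indicator {0..1} (x i)) =
         ennreal (\<Prod>i\<in>{1..N}. 1 + t * flow_field' k (x i))" .
      have 2: "ennreal (?W (?T x) / ?Z) * ennreal (\<Prod>i\<in>{1..N}. 1 + t * flow_field' k (x i)) =
         ennreal (?W x / ?Z) * ennreal (exp (log_transport k \<beta> a b N t x))"
      proof -
        have "ennreal (?W (?T x) / ?Z) * ennreal (\<Prod>i\<in>{1..N}. 1 + t * flow_field' k (x i)) =
          ennreal ((?W (?T x) * (\<Prod>i\<in>{1..N}. 1 + t * flow_field' k (x i))) / ?Z)"
          using Z x01 pos by (subst ennreal_mult'[symmetric]) (auto intro!: prod_nonneg simp: jacobi_weight_nonneg)
        also have "\<dots> = ennreal (?W x / ?Z) * ennreal (exp (log_transport k \<beta> a b N t x))"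
          unfolding jacobi_weight_transport[OF True t] using Z jacobi_weight_nonneg[of \<beta> a b N x]
          by (subst ennreal_mult'[symmetric]) auto
        finally show ?thesis .
      qed
      show ?thesis unfolding 1 using 2 by (simp add: mult_ac)
    next
      case False
      then have "?W x = 0" by (auto simp: jacobi_weight_def unit_cube_def)
      moreover have "(\<Prod>i\<in>{1..N}. ennreal (1 + t * flow_field' k (x i)) * indicator {0..1} (x i)) = 0"
        using False by (auto simp: unit_cube_def prod_zero_iff indicator_def)
      ultimately show ?thesis by simp
    qed
  qed
  also have "\<dots> = (\<integral>\<^sup>+x. ennreal (exp (log_transport k \<beta> a b N t x)) * f (?T x) \<partial>jacobi_ensemble \<beta> a b N)"
  proof (rule nn_integral_jacobi_ensemble[symmetric])
    have "(\<lambda>x. f (?T x)) \<in> borel_measurable ?L"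
      by (rule measurable_compose[OF measurable_flow_map f])
    then show "(\<lambda>x. ennreal (exp (log_transport k \<beta> a b N t x)) * f (?T x)) \<in> borel_measurable ?L"
      using measurable_log_transport[of k \<beta> a b N t] by measurable
  qed
  finally show ?thesis .
qed

text \<open>On indicators, the nonnegative version says that the ensemble tilted by the exponential
  and moved by the flow is the ensemble again; from this equality of measures the formula passes to
  signed functions.\<close>

lemma expectation_transport:
  fixes f :: "(nat \<Rightarrow> real) \<Rightarrow> real"
  assumes ab: "\<beta> \<ge> 0" "a > -1" "b > -1" and t: "\<bar>t\<bar> \<le> 1 / (2 * real (k + 2))"
    and f: "f \<in> borel_measurable (PiM {1..N} (\<lambda>_. borel))"
  shows "(\<integral>x. f (\<lambda>i\<in>{1..N}. flow k t (x i)) * exp (log_transport k \<beta> a b N t x) \<partial>jacobi_ensemble \<beta> a b N) =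
    (\<integral>x. f x \<partial>jacobi_ensemble \<beta> a b N)"
proof -
  let ?J = "jacobi_ensemble \<beta> a b N"
  let ?T = "\<lambda>x. \<lambda>i\<in>{1..N}. flow k t (x i)"
  let ?E = "\<lambda>x. exp (log_transport k \<beta> a b N t x)"
  have T: "?T \<in> measurable ?J (PiM {1..N} (\<lambda>_. borel))"
    using measurable_flow_map[where N = N and k = k and t = t]
    by (simp add: measurable_cong_sets[OF sets_jacobi_ensemble refl] measurable_cong_sets[OF sets_PiM_lborel refl])
  have T': "?T \<in> measurable (density ?J (\<lambda>x. ennreal (?E x))) (PiM {1..N} (\<lambda>_. borel))"
    using T by simp
  have eq: "distr (density ?J (\<lambda>x. ennreal (?E x))) (PiM {1..N} (\<lambda>_. borel)) ?T = ?J"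
  proof (rule measure_eqI)
    fix A assume "A \<in> sets (distr (density ?J (\<lambda>x. ennreal (?E x))) (PiM {1..N} (\<lambda>_. borel)) ?T)"
    then have A: "A \<in> sets (PiM {1..N} (\<lambda>_. borel))" by simp
    have "emeasure (distr (density ?J (\<lambda>x. ennreal (?E x))) (PiM {1..N} (\<lambda>_. borel)) ?T) A =
       (\<integral>\<^sup>+x. indicator A x \<partial>distr (density ?J (\<lambda>x. ennreal (?E x))) (PiM {1..N} (\<lambda>_. borel)) ?T)"
      using A by simp
    also have "\<dots> = (\<integral>\<^sup>+x. indicator A (?T x) \<partial>density ?J (\<lambda>x. ennreal (?E x)))"
      using A by (intro nn_integral_distr[OF T']) auto
    also have "\<dots> = (\<integral>\<^sup>+x. ennreal (?E x) * indicator A (?T x) \<partial>?J)"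
    proof (rule nn_integral_density)
      show "(\<lambda>x. indicator A (?T x) :: ennreal) \<in> borel_measurable ?J"
        using A by (intro measurable_compose[OF T]) auto
    qed auto
    also have "\<dots> = (\<integral>\<^sup>+x. indicator A x \<partial>?J)"
      using A by (intro nn_integral_transport[OF ab t, symmetric]) auto
    also have "\<dots> = emeasure ?J A" using A by (simp add: sets_jacobi_ensemble)
    finally show "emeasure (distr (density ?J (\<lambda>x. ennreal (?E x))) (PiM {1..N} (\<lambda>_. borel)) ?T) A = emeasure ?J A" .
  qed (simp add: sets_jacobi_ensemble)
  have "(\<integral>x. f x \<partial>?J) = (\<integral>x. f x \<partial>distr (density ?J (\<lambda>x. ennreal (?E x))) (PiM {1..N} (\<lambda>_. borel)) ?T)"
    by (simp only: eq)
  also have "\<dots> = (\<integral>x. f (?T x) \<partial>density ?J (\<lambda>x. ennreal (?E x)))"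
    by (rule integral_distr[OF T' f])
  also have "\<dots> = (\<integral>x. ?E x *\<^sub>R f (?T x) \<partial>?J)"
    by (intro integral_density measurable_compose[OF T f]) auto
  finally show ?thesis by (simp add: mult.commute)
qed

lemma unif_diff_log_transport:
  "unif_diff (unit_cube N) (1 / (2 * real (k + 2))) (log_transport k \<beta> a b N)
     (\<lambda>t x. \<beta> * (\<Sum>j\<in>{1..N}. \<Sum>i\<in>{1..<j}. flow_dd k (x j) (x i) / (1 + t * flow_dd k (x j) (x i))) +
       (\<Sum>l\<in>{1..N}. a * ((x l ^ k * (1 - x l)) / (1 + t * (x l ^ k * (1 - x l)))) +
          b * ((- (x l ^ Suc k)) / (1 + t * (- (x l ^ Suc k)))) +
          flow_field' k (x l) / (1 + t * flow_field' k (x l))))"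
proof -
  have x01: "0 \<le> x i" "x i \<le> 1" if "i \<in> {1..N}" "x \<in> unit_cube N" for i x
    using that by (auto simp: unit_cube_def)
  show ?thesis
    unfolding log_transport_def
  proof (intro unif_diff_add unif_diff_cmult unif_diff_sum unif_diff_ln[where D = "real (k + 2)"] finite_atLeastAtMost finite_atLeastLessThan)
    fix i j x assume "j \<in> {1..N}" "i \<in> {1..<j}" "x \<in> unit_cube N"
    then show "\<bar>flow_dd k (x j) (x i)\<bar> \<le> real (k + 2)" by (intro flow_dd_bound x01) auto
  next
    fix l x assume "l \<in> {1..N}" "x \<in> unit_cube N"
    note 1 = x01[OF this]
    show "\<bar>x l ^ k * (1 - x l)\<bar> \<le> real (k + 2)" "\<bar>- (x l ^ Suc k)\<bar> \<le> real (k + 2)"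
      using cube_power_bounds[OF 1] by blast+
    show "\<bar>flow_field' k (x l)\<bar> \<le> real (k + 2)" by (rule flow_field'_bound[OF 1])
  qed (simp_all)
qed

section \<open>Linear statistics and the loop equation\<close>

definition linstat :: "nat \<Rightarrow> real poly \<Rightarrow> (nat \<Rightarrow> real) \<Rightarrow> real" where
  "linstat N f x = (\<Sum>l\<in>{1..N}. poly f (x l))"

lemma borel_measurable_poly [measurable]: "poly (f :: real poly) \<in> borel_measurable borel"
  by (intro borel_measurable_continuous_onI continuous_intros)

lemma measurable_linstat [measurable]:
  "linstat N f \<in> borel_measurable (PiM {1..N} (\<lambda>_. borel))" "linstat N f \<in> borel_measurable (jacobi_ensemble \<beta> a b N)"
proof -
  show "linstat N f \<in> borel_measurable (PiM {1..N} (\<lambda>_. borel))"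
    unfolding linstat_def by measurable
  then show "linstat N f \<in> borel_measurable (jacobi_ensemble \<beta> a b N)"
    by (simp add: measurable_cong_sets[OF sets_jacobi_ensemble refl])
qed

lemma unif_diff_linstat:
  assumes "e \<le> 1"
  shows "unif_diff (unit_cube N) e (\<lambda>t x. linstat N f (\<lambda>i\<in>{1..N}. flow k t (x i)))
    (\<lambda>t x. \<Sum>l\<in>{1..N}. poly (pderiv f) (flow k t (x l)) * flow_field k (x l))"
proof -
  have "unif_diff (unit_cube N) e (\<lambda>t x. \<Sum>l\<in>{1..N}. poly f (flow k t (x l)))
    (\<lambda>t x. \<Sum>l\<in>{1..N}. poly (pderiv f) (flow k t (x l)) * flow_field k (x l))"
  proof (intro unif_diff_sum unif_diff_compose poly_DERIV finite_atLeastAtMost)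
    fix l assume l: "l \<in> {1..N}"
    show "unif_diff (unit_cube N) e (\<lambda>t x. flow k t (x l)) (\<lambda>t x. flow_field k (x l))"
    proof (rule unif_diffI[where K = 2 and L = 1])
      fix x t assume x: "x \<in> unit_cube N" "\<bar>t\<bar> \<le> e"
      then have 1: "0 \<le> x l" "x l \<le> 1" using l by (auto simp: unit_cube_def)
      note g = flow_field_bound[OF 1, of k]
      show "\<bar>flow_field k (x l)\<bar> \<le> 1" using g by simp
      have "\<bar>t * flow_field k (x l)\<bar> \<le> 1" using g x assms unfolding abs_mult by (intro mult_le_one) auto
      then show "\<bar>flow k t (x l)\<bar> \<le> 2" using 1 unfolding flow_def by linarith
      show "((\<lambda>t. flow k t (x l)) has_real_derivative flow_field k (x l)) (at t)"
        unfolding flow_def by (auto intro!: derivative_eq_intros)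
    qed
    show "continuous_on UNIV (poly (pderiv f))" by (intro continuous_intros)
  qed
  then show ?thesis by (simp add: linstat_def)
qed

text \<open>The derivative of \<open>log_transport\<close> in \<open>t\<close> at 0.\<close>

definition loop_drift :: "nat \<Rightarrow> real \<Rightarrow> real \<Rightarrow> real \<Rightarrow> nat \<Rightarrow> (nat \<Rightarrow> real) \<Rightarrow> real" where
  "loop_drift k \<beta> a b N x = \<beta> * (\<Sum>j\<in>{1..N}. \<Sum>i\<in>{1..<j}. flow_dd k (x j) (x i)) +
     (\<Sum>l\<in>{1..N}. a * (x l ^ k * (1 - x l)) + b * (- (x l ^ Suc k)) + flow_field' k (x l))"

lemma measurable_loop_drift [measurable]:
  "loop_drift k \<beta> a b N \<in> borel_measurable (jacobi_ensemble \<beta>' a' b' N)"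
proof -
  have [measurable]: "(\<lambda>x. x i) \<in> borel_measurable (jacobi_ensemble \<beta>' a' b' N)"
    if "i \<in> {1..<j}" "j \<in> {1..N}" for i j :: nat
    using that by (intro measurable_jacobi_component) auto
  have [measurable]: "(\<lambda>x. flow_dd k (x j) (x i)) \<in> borel_measurable (jacobi_ensemble \<beta>' a' b' N)"
    if "i \<in> {1..<j}" "j \<in> {1..N}" for i j :: nat
    using measurable_compose[OF measurable_Pair measurable_flow(4)] that by simp
  show ?thesis unfolding loop_drift_def by measurable
qed

text \<open>All particles are moved by the same flow \<open>x \<mapsto> x + t x\<^bsup>k+1\<^esup>(1 - x)\<close>, which keeps the ordered
  simplex invariant; differentiating the transported expectation at \<open>t = 0\<close> gives the loop
  equation without any boundary or singular terms.\<close>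

theorem loop_equation:
  assumes ab: "\<beta> \<ge> 0" "a > -1" "b > -1"
    and \<phi>: "\<And>y. (\<phi> has_real_derivative \<phi>' y) (at y)" and \<phi>': "continuous_on UNIV \<phi>'"
  shows "(\<integral>x. \<phi>' (linstat N f x) * (\<Sum>l\<in>{1..N}. poly (pderiv f) (x l) * flow_field k (x l))
      + \<phi> (linstat N f x) * loop_drift k \<beta> a b N x \<partial>jacobi_ensemble \<beta> a b N) = 0"
proof -
  let ?J = "jacobi_ensemble \<beta> a b N"
  let ?e = "1 / (2 * real (k + 2))"
  define L' where "L' = (\<lambda>t x. \<beta> * (\<Sum>j\<in>{1..N}. \<Sum>i\<in>{1..<j}. flow_dd k (x j) (x i) / (1 + t * flow_dd k (x j) (x i))) +
       (\<Sum>l\<in>{1..N}. a * ((x l ^ k * (1 - x l)) / (1 + t * (x l ^ k * (1 - x l)))) +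
          b * ((- (x l ^ Suc k)) / (1 + t * (- (x l ^ Suc k)))) +
          flow_field' k (x l) / (1 + t * flow_field' k (x l :: real))))"
  define q where "q = (\<lambda>t x. \<phi> (linstat N f (\<lambda>i\<in>{1..N}. flow k t (x i))) * exp (log_transport k \<beta> a b N t x))"
  define q' where "q' = (\<lambda>t x. \<phi>' (linstat N f (\<lambda>i\<in>{1..N}. flow k t (x i))) *
       (\<Sum>l\<in>{1..N}. poly (pderiv f) (flow k t (x l)) * flow_field k (x l)) * exp (log_transport k \<beta> a b N t x)
     + \<phi> (linstat N f (\<lambda>i\<in>{1..N}. flow k t (x i))) * (exp (log_transport k \<beta> a b N t x) * L' t x))"
  have \<phi>m[measurable]: "\<phi> \<in> borel_measurable borel" "\<phi>' \<in> borel_measurable borel"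
    using \<phi> \<phi>' by (auto intro!: borel_measurable_continuous_onI continuous_at_imp_continuous_on DERIV_isCont)
  interpret prob_space ?J by (rule prob_space_jacobi_ensemble[OF ab])
  have flow0: "flow k 0 u = u" for u by (simp add: flow_def)
  have lin0: "linstat N f (\<lambda>i\<in>{1..N}. x i) = linstat N f x" for x by (simp add: linstat_def)
  have log0: "log_transport k \<beta> a b N 0 x = 0" for x by (simp add: log_transport_def)
  have q'0: "q' 0 = (\<lambda>x. \<phi>' (linstat N f x) * (\<Sum>l\<in>{1..N}. poly (pderiv f) (x l) * flow_field k (x l))
      + \<phi> (linstat N f x) * loop_drift k \<beta> a b N x)"
    by (simp add: q'_def flow0 lin0 log0 L'_def loop_drift_def)
  have "(\<integral>x. q' 0 x \<partial>?J) = 0"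
  proof (rule expectation_derivative_zero)
    show "finite_measure ?J" by (rule finite_measure_axioms)
    show "AE x in ?J. x \<in> unit_cube N" by (rule AE_jacobi_ensemble_cube)
    show "?e > 0" by simp
    show "unif_diff (unit_cube N) ?e q q'"
      unfolding q_def q'_def L'_def
      by (intro unif_diff_mult unif_diff_compose[OF unif_diff_linstat \<phi> \<phi>']
           unif_diff_compose[OF unif_diff_log_transport DERIV_exp]) (auto intro!: continuous_intros simp: field_simps)
    show "q' 0 \<in> borel_measurable ?J" unfolding q'0 by measurable
    show "q t \<in> borel_measurable ?J" for t
    proof -
      have T: "(\<lambda>x. \<lambda>i\<in>{1..N}. flow k t (x i)) \<in> measurable ?J (PiM {1..N} (\<lambda>_. borel))"
        using measurable_flow_map[where N = N and k = k and t = t]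
        by (simp add: measurable_cong_sets[OF sets_jacobi_ensemble refl] measurable_cong_sets[OF sets_PiM_lborel refl])
      have [measurable]: "(\<lambda>x. linstat N f (\<lambda>i\<in>{1..N}. flow k t (x i))) \<in> borel_measurable ?J"
        by (rule measurable_compose[OF T measurable_linstat(1)])
      show ?thesis unfolding q_def by measurable
    qed
    \<comment> \<open>By transport the expectation of \<open>q t\<close> does not depend on
      \<open>t\<close>, so its derivative at 0 is zero.\<close>
    have E: "(\<integral>x. q t x \<partial>?J) = (\<integral>x. \<phi> (linstat N f x) \<partial>?J)" if "\<bar>t\<bar> \<le> ?e" for t
      unfolding q_def by (rule expectation_transport[OF ab that]) measurable
    show "(\<integral>x. q t x \<partial>?J) = (\<integral>x. q 0 x \<partial>?J)" if "\<bar>t\<bar> \<le> ?e" for t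
      using E[OF that] E[of 0] by simp
  qed
  then show ?thesis by (simp only: q'0)
qed

section \<open>Fourth moments of the moment deviations\<close>

text \<open>Summed over all pairs of particles, the divided difference of \<open>x ^ (k + 1)\<close>
  becomes such a convolution of power sums; this makes the interaction quadratic in the
  moments.\<close>

definition conv_sum :: "nat \<Rightarrow> (nat \<Rightarrow> real) \<Rightarrow> (nat \<Rightarrow> real) \<Rightarrow> real" where
  "conv_sum k u v = (\<Sum>p<Suc k. u p * v (k - p))"

lemma conv_sum_commute: "conv_sum k u v = conv_sum k v u"
  unfolding conv_sum_def by (rule sum.reindex_bij_witness[of _ "\<lambda>p. k - p" "\<lambda>p. k - p"]) auto

lemma conv_sum_add: "conv_sum k (\<lambda>i. u i + v i) (\<lambda>i. u i + v i) = conv_sum k u u + 2 * conv_sum k u v + conv_sum k v v"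
proof -
  have "conv_sum k (\<lambda>i. u i + v i) (\<lambda>i. u i + v i) = conv_sum k u u + conv_sum k u v + (conv_sum k v u + conv_sum k v v)"
    unfolding conv_sum_def by (simp add: sum.distrib[symmetric] algebra_simps)
  then show ?thesis by (simp add: conv_sum_commute[of k v u])
qed

text \<open>The highest index occurs in the two end terms only, each time next to index 0. As the
  moment of order 0 is 1, the loop equation is linear in the highest moment.\<close>

lemma conv_sum_Suc: "conv_sum (Suc k) u v = u 0 * v (Suc k) + (\<Sum>p\<in>{1..k}. u p * v (Suc k - p)) + u (Suc k) * v 0"
proof -
  have "{..<Suc (Suc k)} = insert 0 (insert (Suc k) {1..k})" by (auto simp: One_nat_def)
  then show ?thesis unfolding conv_sum_def by (simp add: One_nat_def)
qed

text \<open>The limiting loop equations, solved for the highest moment.\<close>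

fun jmom :: "real \<Rightarrow> real \<Rightarrow> real \<Rightarrow> nat \<Rightarrow> real" where
  "jmom a b c 0 = 1"
| "jmom a b c (Suc k) = ((k + 1 + a) * jmom a b c k + c * ((\<Sum>p\<in>{..<Suc k}. jmom a b c p * jmom a b c (k - p)) -
     (\<Sum>p\<in>{1..k}. jmom a b c p * jmom a b c (Suc k - p)))) / (k + 2 + a + b + 2 * c)"

declare jmom.simps(2) [simp del]

lemma sum_strict_lower_triangle:
  fixes d :: "nat \<Rightarrow> nat \<Rightarrow> real"
  assumes "\<And>i j. d i j = d j i"
  shows "2 * (\<Sum>j\<in>{1..N}. \<Sum>i\<in>{1..<j}. d j i) = (\<Sum>j\<in>{1..N}. \<Sum>i\<in>{1..N}. d j i) - (\<Sum>j\<in>{1..N}. d j j)"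
proof (induction N)
  case (Suc N)
  have 1: "{1..Suc N} = insert (Suc N) {1..N}" by auto
  have 2: "{1..<Suc N} = {1..N}" by auto
  have "(\<Sum>j\<in>{1..Suc N}. \<Sum>i\<in>{1..Suc N}. d j i) = (\<Sum>j\<in>{1..N}. \<Sum>i\<in>{1..N}. d j i) + 2 * (\<Sum>i\<in>{1..N}. d (Suc N) i) + d (Suc N) (Suc N)"
  proof -
    have "(\<Sum>j\<in>{1..N}. d j (Suc N)) = (\<Sum>j\<in>{1..N}. d (Suc N) j)"
      by (intro sum.cong refl assms)
    then show ?thesis unfolding 1 by (simp add: sum.distrib)
  qed
  then show ?case using Suc.IH by (simp add: 1 2)
qed auto

section \<open>The regime in which the product of \<open>\<beta>\<close> and \<open>N\<close> is the
  constant \<open>2c\<close>\<close>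

locale jacobi_hot =
  fixes a b c :: real
  assumes a: "a > -1" and b: "b > -1" and c: "c > 0"
begin

abbreviation mom :: "nat \<Rightarrow> real" where "mom \<equiv> jmom a b c"

abbreviation J :: "nat \<Rightarrow> (nat \<Rightarrow> real) measure" where "J N \<equiv> jacobi_ensemble (2 * c / real N) a b N"

text \<open>The coefficient of the highest moment in the loop equation: \<open>k + 2 + a + b\<close>
  from the weight and the Jacobian, \<open>2 * c\<close> from the two end terms of the convolution.
  Its positivity is the stability on which the moment estimates rest.\<close>

definition rate :: "nat \<Rightarrow> real" where "rate k = real k + 2 + a + b + 2 * c"

lemma rate_pos: "rate k > 0" using a b c by (simp add: rate_def)

lemma mom_equation:
  "(real k + 1 + a) * mom k - (real k + 2 + a + b) * mom (Suc k) + c * (conv_sum k mom mom - conv_sum (Suc k) mom mom) = 0"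
proof -
  have "mom (Suc k) = ((real k + 1 + a) * mom k + c * (conv_sum k mom mom - (\<Sum>p\<in>{1..k}. mom p * mom (Suc k - p)))) / rate k"
    by (simp only: jmom.simps(2) rate_def conv_sum_def)
  then have "rate k * mom (Suc k) = (real k + 1 + a) * mom k + c * (conv_sum k mom mom - (\<Sum>p\<in>{1..k}. mom p * mom (Suc k - p)))"
    using rate_pos[of k] by simp
  then show ?thesis unfolding conv_sum_Suc by (simp add: rate_def algebra_simps)
qed

lemma prob_space_J: "prob_space (J N)"
  using a b c by (intro prob_space_jacobi_ensemble) auto

sublocale J: prob_space "J N" for N by (rule prob_space_J)

definition emom :: "nat \<Rightarrow> nat \<Rightarrow> (nat \<Rightarrow> real) \<Rightarrow> real" where
  "emom N k x = (\<Sum>l\<in>{1..N}. x l ^ k) / real N"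

text \<open>The sum over pairs is half of the full double sum minus its diagonal. On the diagonal
  the divided difference is the derivative of the field, which yields the correction with factor
  \<open>c / real N\<close>.\<close>

lemma loop_drift_eq:
  assumes "N \<ge> 1"
  shows "loop_drift k (2 * c / real N) a b N x / real N =
    (real k + 1 + a) * emom N k x - (real k + 2 + a + b) * emom N (Suc k) x
     + c * (conv_sum k (\<lambda>i. emom N i x) (\<lambda>i. emom N i x) - conv_sum (Suc k) (\<lambda>i. emom N i x) (\<lambda>i. emom N i x))
     - c / real N * ((real k + 1) * emom N k x - (real k + 2) * emom N (Suc k) x)"
proof -
  have N: "real N > 0" using assms by simp
  have dd: "(\<Sum>j\<in>{1..N}. \<Sum>i\<in>{1..N}. (\<Sum>p<Suc n. x j ^ p * x i ^ (n - p))) = real N ^ 2 * conv_sum n (\<lambda>i. emom N i x) (\<lambda>i. emom N i x)" for n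
  proof -
    have "(\<Sum>j\<in>{1..N}. \<Sum>i\<in>{1..N}. (\<Sum>p<Suc n. x j ^ p * x i ^ (n - p))) = (\<Sum>j\<in>{1..N}. \<Sum>p<Suc n. \<Sum>i\<in>{1..N}. x j ^ p * x i ^ (n - p))"
      by (intro sum.cong refl sum.swap)
    also have "\<dots> = (\<Sum>p<Suc n. \<Sum>j\<in>{1..N}. \<Sum>i\<in>{1..N}. x j ^ p * x i ^ (n - p))"
      by (rule sum.swap)
    also have "\<dots> = (\<Sum>p<Suc n. (\<Sum>j\<in>{1..N}. x j ^ p) * (\<Sum>i\<in>{1..N}. x i ^ (n - p)))"
      by (simp only: sum_product)
    also have "\<dots> = (\<Sum>p<Suc n. real N ^ 2 * (emom N p x * emom N (n - p) x))"
      using N by (intro sum.cong) (auto simp: emom_def power2_eq_square)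
    finally show ?thesis unfolding conv_sum_def sum_distrib_left .
  qed
  have S: "(\<Sum>l\<in>{1..N}. x l ^ n) = real N * emom N n x" for n using N by (simp add: emom_def)
  have D: "(\<Sum>l\<in>{1..N}. flow_field' k (x l)) = real N * ((real k + 1) * emom N k x - (real k + 2) * emom N (Suc k) x)"
    unfolding flow_field'_def sum_subtractf sum_distrib_left[symmetric] S by (simp add: algebra_simps)
  have "2 * (\<Sum>j\<in>{1..N}. \<Sum>i\<in>{1..<j}. flow_dd k (x j) (x i)) =
     (\<Sum>j\<in>{1..N}. \<Sum>i\<in>{1..N}. flow_dd k (x j) (x i)) - (\<Sum>l\<in>{1..N}. flow_field' k (x l))"
    by (subst sum_strict_lower_triangle) (auto intro: flow_dd_commute simp: flow_dd_diag)
  also have "(\<Sum>j\<in>{1..N}. \<Sum>i\<in>{1..N}. flow_dd k (x j) (x i)) =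
     real N ^ 2 * (conv_sum k (\<lambda>i. emom N i x) (\<lambda>i. emom N i x) - conv_sum (Suc k) (\<lambda>i. emom N i x) (\<lambda>i. emom N i x))"
    unfolding flow_dd_def sum_subtractf dd by (simp add: right_diff_distrib)
  finally have 1: "(\<Sum>j\<in>{1..N}. \<Sum>i\<in>{1..<j}. flow_dd k (x j) (x i)) =
     (real N ^ 2 * (conv_sum k (\<lambda>i. emom N i x) (\<lambda>i. emom N i x) - conv_sum (Suc k) (\<lambda>i. emom N i x) (\<lambda>i. emom N i x)) -
      real N * ((real k + 1) * emom N k x - (real k + 2) * emom N (Suc k) x)) / 2" unfolding D by simp
  have 2: "(\<Sum>l\<in>{1..N}. a * (x l ^ k * (1 - x l)) + b * (- (x l ^ Suc k)) + flow_field' k (x l)) =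
     real N * (a * (emom N k x - emom N (Suc k) x) - b * emom N (Suc k) x + ((real k + 1) * emom N k x - (real k + 2) * emom N (Suc k) x))"
  proof -
    have "(\<Sum>l\<in>{1..N}. a * (x l ^ k * (1 - x l)) + b * (- (x l ^ Suc k)) + flow_field' k (x l)) =
      (\<Sum>l\<in>{1..N}. a * x l ^ k - (a + b) * x l ^ Suc k + flow_field' k (x l))"
      by (intro sum.cong) (auto simp: algebra_simps)
    also have "\<dots> = a * (real N * emom N k x) - (a + b) * (real N * emom N (Suc k) x) + real N * ((real k + 1) * emom N k x - (real k + 2) * emom N (Suc k) x)"
      unfolding sum.distrib sum_subtractf sum_distrib_left[symmetric] S D ..
    finally show ?thesis by (simp add: algebra_simps)
  qed
  show ?thesis unfolding loop_drift_def 1 2 using N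
    by (simp add: field_simps power2_eq_square)
qed

section \<open>Uniformly bounded and small functions of the particles\<close>

text \<open>The bound is asked on the unit cube only, where the ensemble lives, and for
  \<open>N \<ge> 1\<close>, where division by \<open>N\<close> is meaningful. Measurability is
  included, so that integrability comes for free.\<close>

definition ubd :: "(nat \<Rightarrow> (nat \<Rightarrow> real) \<Rightarrow> real) \<Rightarrow> bool" where
  "ubd r \<longleftrightarrow> (\<forall>N. r N \<in> borel_measurable (J N)) \<and> (\<exists>K. \<forall>N\<ge>1. \<forall>x\<in>unit_cube N. \<bar>r N x\<bar> \<le> K)"

text \<open>Fluctuations of order \<open>N\<^bsup>-1/2\<^esup>\<close>, measured in \<open>L\<^sup>4\<close>.\<close>

definition small :: "(nat \<Rightarrow> (nat \<Rightarrow> real) \<Rightarrow> real) \<Rightarrow> bool" where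
  "small r \<longleftrightarrow> ubd r \<and> (\<exists>C. \<forall>N\<ge>1. (\<integral>x. r N x ^ 4 \<partial>J N) \<le> C / real N ^ 2)"

lemma ubd_measurable: "ubd r \<Longrightarrow> r N \<in> borel_measurable (J N)" by (simp add: ubd_def)

lemma small_ubd: "small r \<Longrightarrow> ubd r" by (simp add: small_def)

lemma ubdI:
  assumes "\<And>N. r N \<in> borel_measurable (J N)" "\<And>N x. N \<ge> 1 \<Longrightarrow> x \<in> unit_cube N \<Longrightarrow> \<bar>r N x\<bar> \<le> K"
  shows "ubd r" using assms by (auto simp: ubd_def)

lemma ubdE:
  assumes "ubd r" obtains K where "K \<ge> 0" "\<And>N x. N \<ge> 1 \<Longrightarrow> x \<in> unit_cube N \<Longrightarrow> \<bar>r N x\<bar> \<le> K"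
proof -
  obtain K where "\<forall>N\<ge>1. \<forall>x\<in>unit_cube N. \<bar>r N x\<bar> \<le> K" using assms by (auto simp: ubd_def)
  then show ?thesis by (intro that[of "max K 0"]) (auto simp: le_max_iff_disj)
qed

lemma ubd_integrable:
  assumes "ubd r" "N \<ge> 1" shows "integrable (J N) (r N)"
proof -
  from assms(1) obtain K where "\<And>N x. N \<ge> 1 \<Longrightarrow> x \<in> unit_cube N \<Longrightarrow> \<bar>r N x\<bar> \<le> K" by (elim ubdE) blast
  then show ?thesis
    using assms eventually_mono[OF AE_jacobi_ensemble_cube, of N "\<lambda>x. norm (r N x) \<le> K"]
    by (intro J.integrable_const_bound[where B = K]) (auto simp: ubd_measurable)
qed

lemma ubd_expectation_bound:
  assumes "ubd r" shows "\<exists>K. \<forall>N\<ge>1. \<bar>\<integral>x. r N x \<partial>J N\<bar> \<le> K"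
proof -
  from assms(1) obtain K where K: "\<And>N x. N \<ge> 1 \<Longrightarrow> x \<in> unit_cube N \<Longrightarrow> \<bar>r N x\<bar> \<le> K" by (elim ubdE) blast
  have "\<bar>\<integral>x. r N x \<partial>J N\<bar> \<le> K" if "N \<ge> 1" for N
  proof -
    have AE: "AE x in J N. \<bar>r N x\<bar> \<le> K"
      using AE_jacobi_ensemble_cube by (rule eventually_mono) (use K that in auto)
    have "(\<integral>x. r N x \<partial>J N) \<le> K"
      by (intro J.integral_le_const ubd_integrable assms that) (use AE in \<open>auto elim!: eventually_mono\<close>)
    moreover have "- K \<le> (\<integral>x. r N x \<partial>J N)"
      by (intro J.integral_ge_const ubd_integrable assms that) (use AE in \<open>auto elim!: eventually_mono\<close>)
    ultimately show ?thesis by linarith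
  qed
  then show ?thesis by blast
qed

lemma ubd_const: "ubd (\<lambda>N x. k)" by (auto simp: ubd_def)

lemma ubd_add: assumes "ubd r" "ubd s" shows "ubd (\<lambda>N x. r N x + s N x)"
proof -
  obtain K where K: "\<And>N x. N \<ge> 1 \<Longrightarrow> x \<in> unit_cube N \<Longrightarrow> \<bar>r N x\<bar> \<le> K" using assms(1) by (elim ubdE) blast
  obtain L where L: "\<And>N x. N \<ge> 1 \<Longrightarrow> x \<in> unit_cube N \<Longrightarrow> \<bar>s N x\<bar> \<le> L" using assms(2) by (elim ubdE) blast
  have "\<bar>r N x + s N x\<bar> \<le> K + L" if "N \<ge> 1" "x \<in> unit_cube N" for N x
    using K[OF that] L[OF that] by linarith
  then show ?thesis
    using assms[THEN ubd_measurable] by (intro ubdI[where K = "K + L"] borel_measurable_add)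
qed

lemma ubd_mult: assumes "ubd r" "ubd s" shows "ubd (\<lambda>N x. r N x * s N x)"
proof -
  obtain K where K: "K \<ge> 0" "\<And>N x. N \<ge> 1 \<Longrightarrow> x \<in> unit_cube N \<Longrightarrow> \<bar>r N x\<bar> \<le> K" using assms(1) by (elim ubdE) blast
  obtain L where L: "\<And>N x. N \<ge> 1 \<Longrightarrow> x \<in> unit_cube N \<Longrightarrow> \<bar>s N x\<bar> \<le> L" using assms(2) by (elim ubdE) blast
  have "\<bar>r N x * s N x\<bar> \<le> K * L" if "N \<ge> 1" "x \<in> unit_cube N" for N x
    unfolding abs_mult using K(1) K(2)[OF that] L[OF that] by (intro mult_mono) auto
  then show ?thesis
    using assms[THEN ubd_measurable] by (intro ubdI[where K = "K * L"] borel_measurable_times)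
qed

lemma ubd_cmult: "ubd r \<Longrightarrow> ubd (\<lambda>N x. k * r N x)" using ubd_mult[OF ubd_const] .

lemma ubd_diff: "ubd r \<Longrightarrow> ubd s \<Longrightarrow> ubd (\<lambda>N x. r N x - s N x)"
  using ubd_add[of r "\<lambda>N x. (-1) * s N x"] ubd_cmult[of s "-1"] by simp

lemma ubd_power: "ubd r \<Longrightarrow> ubd (\<lambda>N x. r N x ^ n)"
  by (induction n) (auto simp: ubd_const intro!: ubd_mult)

lemma ubd_abs: "ubd r \<Longrightarrow> ubd (\<lambda>N x. \<bar>r N x\<bar>)"
  by (auto simp: ubd_def intro!: borel_measurable_abs)

lemma ubd_over_N: "ubd (\<lambda>N x. 1 / real N)"
  by (auto simp: ubd_def intro!: exI[of _ 1] simp: field_simps)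

lemma smallI:
  assumes "ubd r" "\<And>N. N \<ge> 1 \<Longrightarrow> (\<integral>x. r N x ^ 4 \<partial>J N) \<le> C / real N ^ 2"
  shows "small r" using assms by (auto simp: small_def)

lemma smallE:
  assumes "small r"
  obtains C where "C \<ge> 0" "\<And>N. N \<ge> 1 \<Longrightarrow> (\<integral>x. r N x ^ 4 \<partial>J N) \<le> C / real N ^ 2"
proof -
  obtain C where C: "\<forall>N\<ge>1. (\<integral>x. r N x ^ 4 \<partial>J N) \<le> C / real N ^ 2" using assms by (auto simp: small_def)
  show ?thesis
  proof (rule that[of "max C 0"])
    fix N :: nat assume N: "N \<ge> 1"
    have "C / real N ^ 2 \<le> max C 0 / real N ^ 2" by (intro divide_right_mono) auto
    then show "(\<integral>x. r N x ^ 4 \<partial>J N) \<le> max C 0 / real N ^ 2" using C N by force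
  qed simp
qed

lemma pow4_add_le: "(x + y) ^ 4 \<le> 8 * (x ^ 4 + y ^ 4)" for x y :: real
proof -
  have "(x + y)\<^sup>2 \<le> 2 * (x\<^sup>2 + y\<^sup>2)" using sum_squares_bound[of x y] by (simp add: power2_sum)
  then have "((x + y)\<^sup>2)\<^sup>2 \<le> (2 * (x\<^sup>2 + y\<^sup>2))\<^sup>2" by (intro power_mono) auto
  also have "\<dots> \<le> 8 * ((x\<^sup>2)\<^sup>2 + (y\<^sup>2)\<^sup>2)" using sum_squares_bound[of "x\<^sup>2" "y\<^sup>2"] by (simp add: power2_sum power_mult_distrib)
  finally show ?thesis by simp
qed

lemma small_add: assumes "small r" "small s" shows "small (\<lambda>N x. r N x + s N x)"
proof -
  obtain C where C: "\<And>N. N \<ge> 1 \<Longrightarrow> (\<integral>x. r N x ^ 4 \<partial>J N) \<le> C / real N ^ 2" using assms(1) by (elim smallE) blast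
  obtain D where D: "\<And>N. N \<ge> 1 \<Longrightarrow> (\<integral>x. s N x ^ 4 \<partial>J N) \<le> D / real N ^ 2" using assms(2) by (elim smallE) blast
  note u = assms[THEN small_ubd]
  show ?thesis
  proof (rule smallI[where C = "8 * (C + D)"])
    fix N :: nat assume N: "N \<ge> 1"
    have "(\<integral>x. (r N x + s N x) ^ 4 \<partial>J N) \<le> (\<integral>x. 8 * (r N x ^ 4 + s N x ^ 4) \<partial>J N)"
      by (intro integral_mono pow4_add_le ubd_integrable[OF _ N] ubd_power ubd_add ubd_cmult u)
    also have "\<dots> = 8 * ((\<integral>x. r N x ^ 4 \<partial>J N) + (\<integral>x. s N x ^ 4 \<partial>J N))"
      by (simp add: Bochner_Integration.integral_add ubd_integrable[OF ubd_power[OF u(1)] N] ubd_integrable[OF ubd_power[OF u(2)] N])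
    also have "\<dots> \<le> 8 * (C / real N ^ 2 + D / real N ^ 2)" using C[OF N] D[OF N] by simp
    finally show "(\<integral>x. (r N x + s N x) ^ 4 \<partial>J N) \<le> 8 * (C + D) / real N ^ 2" by (simp add: add_divide_distrib)
  qed (intro ubd_add u)
qed

text \<open>One bounded factor is enough. Products of two deviations are estimated by treating one
  of them as merely bounded, and this lets the induction on the order of the moment close.\<close>

lemma small_mult: assumes "ubd r" "small s" shows "small (\<lambda>N x. r N x * s N x)"
proof -
  obtain K where K: "K \<ge> 0" "\<And>N x. N \<ge> 1 \<Longrightarrow> x \<in> unit_cube N \<Longrightarrow> \<bar>r N x\<bar> \<le> K" using assms(1) by (elim ubdE) blast
  obtain D where D: "\<And>N. N \<ge> 1 \<Longrightarrow> (\<integral>x. s N x ^ 4 \<partial>J N) \<le> D / real N ^ 2" using assms(2) by (elim smallE) blast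
  note u = assms(1) assms(2)[THEN small_ubd]
  show ?thesis
  proof (rule smallI[where C = "K ^ 4 * D"])
    fix N :: nat assume N: "N \<ge> 1"
    have "(\<integral>x. (r N x * s N x) ^ 4 \<partial>J N) \<le> (\<integral>x. K ^ 4 * s N x ^ 4 \<partial>J N)"
    proof (rule integral_mono_AE)
      show "AE x in J N. (r N x * s N x) ^ 4 \<le> K ^ 4 * s N x ^ 4"
        using AE_jacobi_ensemble_cube
      proof eventually_elim
        fix x assume "x \<in> unit_cube N"
        then have "\<bar>r N x\<bar> ^ 4 \<le> K ^ 4" using K N by (intro power_mono) auto
        then show "(r N x * s N x) ^ 4 \<le> K ^ 4 * s N x ^ 4"
          by (simp add: power_mult_distrib mult_right_mono power_even_abs)
      qed
    qed (intro ubd_integrable[OF _ N] ubd_power ubd_mult ubd_cmult u)+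
    also have "\<dots> = K ^ 4 * (\<integral>x. s N x ^ 4 \<partial>J N)" by simp
    also have "\<dots> \<le> K ^ 4 * (D / real N ^ 2)" using D[OF N] K(1) by (intro mult_left_mono) auto
    finally show "(\<integral>x. (r N x * s N x) ^ 4 \<partial>J N) \<le> K ^ 4 * D / real N ^ 2" by simp
  qed (intro ubd_mult u)
qed

lemma small_cmult: "small s \<Longrightarrow> small (\<lambda>N x. k * s N x)" using small_mult[OF ubd_const] .

lemma small_diff: "small r \<Longrightarrow> small s \<Longrightarrow> small (\<lambda>N x. r N x - s N x)"
  using small_add[of r "\<lambda>N x. (-1) * s N x"] small_cmult[of s "-1"] by simp

lemma small_zero: "small (\<lambda>N x. 0)"
  by (rule smallI[where C = 0]) (auto simp: ubd_const)

lemma small_sum: "finite I \<Longrightarrow> (\<And>i. i \<in> I \<Longrightarrow> small (r i)) \<Longrightarrow> small (\<lambda>N x. \<Sum>i\<in>I. r i N x)"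
  by (induction I rule: finite_induct) (auto simp: small_zero intro!: small_add)

lemma small_over_N: "small (\<lambda>N x. 1 / real N)"
proof (rule smallI[where C = 1])
  fix N :: nat assume "N \<ge> 1"
  then have "real N ^ 2 \<le> real N ^ 4" by (intro power_increasing) auto
  then show "(\<integral>x. (1 / real N) ^ 4 \<partial>J N) \<le> 1 / real N ^ 2"
    using \<open>N \<ge> 1\<close> by (simp add: J.prob_space power_one_over frac_le)
qed (rule ubd_over_N)

text \<open>Agreement is asked for \<open>N \<ge> 1\<close> only, because \<open>N = 0\<close> is
  degenerate: \<open>dmom 0\<close>, for instance, vanishes for all other \<open>N\<close>.\<close>

lemma small_cong:
  assumes "small r" "\<And>N. s N \<in> borel_measurable (J N)" "\<And>N x. N \<ge> 1 \<Longrightarrow> s N x = r N x"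
  shows "small s"
proof -
  have "ubd s" using assms(1)[THEN small_ubd] assms(2,3) by (auto simp: ubd_def)
  then show ?thesis using assms(1,3) by (auto simp: small_def)
qed

section \<open>Empirical moments and their deviations from the limiting ones\<close>

lemma measurable_emom [measurable]: "emom N k \<in> borel_measurable (J N)"
  unfolding emom_def by measurable

lemma emom_bounds:
  assumes "N \<ge> 1" "x \<in> unit_cube N" shows "0 \<le> emom N k x" "emom N k x \<le> 1"
proof -
  show "0 \<le> emom N k x" using assms by (auto simp: emom_def unit_cube_def intro!: divide_nonneg_nonneg sum_nonneg)
  have "(\<Sum>l\<in>{1..N}. x l ^ k) \<le> (\<Sum>l\<in>{1..N}. 1)"
    using assms by (intro sum_mono power_le_one) (auto simp: unit_cube_def)
  then show "emom N k x \<le> 1" using assms by (simp add: emom_def)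
qed

lemma ubd_emom: "ubd (\<lambda>N. emom N k)"
  unfolding ubd_def using emom_bounds by (auto intro!: exI[of _ 1])

definition dmom :: "nat \<Rightarrow> nat \<Rightarrow> (nat \<Rightarrow> real) \<Rightarrow> real" where
  "dmom k N x = emom N k x - mom k"

lemma ubd_dmom: "ubd (dmom k)"
  unfolding dmom_def[abs_def] by (intro ubd_diff ubd_emom ubd_const)

lemma dmom_0: "N \<ge> 1 \<Longrightarrow> dmom 0 N x = 0" by (simp add: dmom_def emom_def)

lemma loop_drift_dmom:
  assumes N: "N \<ge> 1"
  shows "loop_drift k (2 * c / real N) a b N x / real N =
    (real k + 1 + a) * dmom k N x - (real k + 2 + a + b) * dmom (Suc k) N x
     + 2 * c * (conv_sum k mom (\<lambda>i. dmom i N x) - conv_sum (Suc k) mom (\<lambda>i. dmom i N x))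
     + c * (conv_sum k (\<lambda>i. dmom i N x) (\<lambda>i. dmom i N x) - conv_sum (Suc k) (\<lambda>i. dmom i N x) (\<lambda>i. dmom i N x))
     - c / real N * ((real k + 1) * emom N k x - (real k + 2) * emom N (Suc k) x)"
proof -
  have e: "emom N i x = mom i + dmom i N x" for i by (simp add: dmom_def)
  have "conv_sum n (\<lambda>i. emom N i x) (\<lambda>i. emom N i x) = conv_sum n mom mom + 2 * conv_sum n mom (\<lambda>i. dmom i N x) +
     conv_sum n (\<lambda>i. dmom i N x) (\<lambda>i. dmom i N x)" for n
    unfolding e by (rule conv_sum_add)
  then show ?thesis using mom_equation[of k] unfolding loop_drift_eq[OF N]
    by (simp add: e[of k] e[of "Suc k"] algebra_simps)
qed

text \<open>The highest deviation occurs linearly, with the negative coefficient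
  \<open>- rate k\<close>. The quadratic part involves lower deviations only, since its end terms
  carry the factor \<open>dmom 0\<close>, which is zero.\<close>

lemma loop_drift_split:
  assumes N: "N \<ge> 1"
  shows "loop_drift k (2 * c / real N) a b N x / real N = - rate k * dmom (Suc k) N x +
    ((real k + 1 + a) * dmom k N x
     + 2 * c * ((\<Sum>p\<in>{..<Suc k}. mom p * dmom (k - p) N x) - (\<Sum>p\<in>{1..k}. mom p * dmom (Suc k - p) N x))
     + c * ((\<Sum>p\<in>{..<Suc k}. dmom p N x * dmom (k - p) N x) - (\<Sum>p\<in>{1..k}. dmom p N x * dmom (Suc k - p) N x))
     - (c * ((real k + 1) * emom N k x - (real k + 2) * emom N (Suc k) x)) * (1 / real N))"
  unfolding loop_drift_dmom[OF N] conv_sum_Suc unfolding conv_sum_def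
  by (simp add: dmom_0[OF N] rate_def algebra_simps del: sum.lessThan_Suc)

text \<open>Either \<open>r\<close> is small compared with \<open>\<kappa> / 4 * d\<close>, and then
  the first summand suffices, or \<open>d\<close> is bounded by a multiple of \<open>r\<close>. The
  factor 1/4 leaves room to absorb a second error term as well.\<close>

lemma young_cube:
  fixes d r \<kappa> :: real assumes "\<kappa> > 0"
  shows "d ^ 3 * r \<le> \<kappa> / 4 * d ^ 4 + (4 / \<kappa>) ^ 3 * r ^ 4"
proof -
  have le: "d ^ 3 * r \<le> \<bar>d\<bar> ^ 3 * \<bar>r\<bar>" by (metis abs_ge_self abs_mult power_abs)
  have p4: "\<bar>u\<bar> ^ 3 * \<bar>u\<bar> = u ^ 4" for u :: real
  proof -
    have "\<bar>u\<bar> ^ 3 * \<bar>u\<bar> = \<bar>u\<bar> ^ 4" by (simp add: power3_eq_cube power4_eq_xxxx)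
    then show ?thesis by (simp only: power_even_abs even_numeral)
  qed
  have nn: "0 \<le> \<kappa> / 4 * d ^ 4" "0 \<le> (4 / \<kappa>) ^ 3 * r ^ 4" using assms by auto
  show ?thesis
  proof (cases "\<bar>r\<bar> \<le> \<kappa> / 4 * \<bar>d\<bar>")
    case True
    then have "\<bar>d\<bar> ^ 3 * \<bar>r\<bar> \<le> \<bar>d\<bar> ^ 3 * (\<kappa> / 4 * \<bar>d\<bar>)" by (intro mult_left_mono) auto
    also have "\<dots> = \<kappa> / 4 * d ^ 4" by (simp only: p4[symmetric] mult_ac)
    finally show ?thesis using le nn by linarith
  next
    case False
    then have "\<bar>d\<bar> \<le> 4 / \<kappa> * \<bar>r\<bar>" using assms by (simp add: field_simps)
    then have "\<bar>d\<bar> ^ 3 * \<bar>r\<bar> \<le> (4 / \<kappa> * \<bar>r\<bar>) ^ 3 * \<bar>r\<bar>" by (intro mult_right_mono power_mono) auto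
    also have "\<dots> = (4 / \<kappa>) ^ 3 * r ^ 4" by (simp only: p4[symmetric] power_mult_distrib mult_ac)
    finally show ?thesis using le nn by linarith
  qed
qed

text \<open>The second absorption, by completing a square. With \<open>young_cube\<close> it uses up
  half of \<open>\<kappa> * d ^ 4\<close> and leaves the other half.\<close>

lemma young_square:
  fixes d r \<kappa> n :: real assumes "\<kappa> > 0" "n > 0"
  shows "3 * (d ^ 2 * r) * (1 / n) \<le> \<kappa> / 4 * d ^ 4 + 9 / (\<kappa> * n ^ 2) * r ^ 2"
proof -
  define u where "u = r / n"
  have "0 \<le> (\<kappa> * d ^ 2 - 6 * u) ^ 2 / (4 * \<kappa>)" using assms by simp
  also have "\<dots> = \<kappa> / 4 * d ^ 4 - 3 * d ^ 2 * u + 9 / \<kappa> * u ^ 2"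
    using assms(1) by (simp add: power2_diff power_mult_distrib field_simps power2_eq_square power4_eq_xxxx)
  finally show ?thesis using assms by (simp add: u_def power_divide)
qed

lemma measurable_dmom [measurable]: "dmom k N \<in> borel_measurable (J N)"
  using ubd_dmom by (rule ubd_measurable)

text \<open>The loop equation is tested with the cube of the deviation. The leading drift then gives
  \<open>rate k\<close> times the fourth moment with a definite sign; against it stand the cube
  times a remainder \<open>R\<close> that is small by induction, and a term of order
  \<open>1/N\<close> from the derivative of the cube.\<close>

lemma small_dmom: "small (dmom k)"
proof (induction k rule: less_induct)
  case (less n)
  show ?case
  proof (cases n)
    case 0
    show ?thesis unfolding 0 by (rule small_cong[OF small_zero]) (simp_all add: dmom_0)
  next
    case (Suc k)
    have IH: "small (dmom j)" if "j \<le> k" for j using less.IH[of j] that Suc by simp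
    define R where "R = (\<lambda>N x. (real k + 1 + a) * dmom k N x
     + 2 * c * ((\<Sum>p\<in>{..<Suc k}. mom p * dmom (k - p) N x) - (\<Sum>p\<in>{1..k}. mom p * dmom (Suc k - p) N x))
     + c * ((\<Sum>p\<in>{..<Suc k}. dmom p N x * dmom (k - p) N x) - (\<Sum>p\<in>{1..k}. dmom p N x * dmom (Suc k - p) N x))
     - (c * ((real k + 1) * emom N k x - (real k + 2) * emom N (Suc k) x)) * (1 / real N))"
    \<comment> \<open>The empirical mean of \<open>(k + 1) * x ^ k\<close> times the flow field,
      that is, the derivative of the tested moment along the flow.\<close>
    define B where "B = (\<lambda>N x. real (Suc k) * (emom N (2 * k + 1) x - emom N (2 * k + 2) x))"
    have smallR: "small R" unfolding R_def
      by (intro small_diff small_add small_cmult small_sum small_mult[OF _ small_over_N] small_mult[OF ubd_dmom] IH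
           ubd_cmult ubd_diff ubd_emom) auto
    have uR: "ubd R" by (rule small_ubd[OF smallR])
    have uB: "ubd B" unfolding B_def by (intro ubd_cmult ubd_diff ubd_emom)
    note ud = ubd_dmom[of "Suc k"]
    let ?\<kappa> = "rate k"
    note \<kappa> = rate_pos[of k]
    obtain C where C: "C \<ge> 0" "\<And>N. N \<ge> 1 \<Longrightarrow> (\<integral>x. R N x ^ 4 \<partial>J N) \<le> C / real N ^ 2"
      using smallR by (elim smallE) blast
    obtain K where K: "\<And>N. N \<ge> 1 \<Longrightarrow> \<bar>\<integral>x. B N x ^ 2 \<partial>J N\<bar> \<le> K"
      using ubd_expectation_bound[OF ubd_power[OF uB, of 2]] by blast
    \<comment> \<open>The bracket collects what the two absorptions leave over;
      \<open>2 / rate k\<close> inverts the half of the leading coefficient that remains.\<close>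
    have "(\<integral>x. dmom (Suc k) N x ^ 4 \<partial>J N) \<le> (2 / ?\<kappa> * ((4 / ?\<kappa>) ^ 3 * C + 9 / ?\<kappa> * K)) / real N ^ 2" if N: "N \<ge> 1" for N
    proof -
      have N0: "real N > 0" using N by simp
      let ?d = "dmom (Suc k) N"
      have lin: "linstat N (monom 1 (Suc k)) x / real N - mom (Suc k) = ?d x" for x
        by (simp add: linstat_def poly_monom dmom_def emom_def)
      have Bsum: "(\<Sum>l\<in>{1..N}. poly (pderiv (monom 1 (Suc k))) (x l) * flow_field k (x l)) = real N * B N x" for x
      proof -
        have "poly (pderiv (monom 1 (Suc k))) u * flow_field k u = real (Suc k) * (u ^ (2 * k + 1) - u ^ (2 * k + 2))" for u :: real
        proof -
          have "u ^ (2 * k + 1) = u ^ k * u ^ Suc k" "u ^ (2 * k + 2) = u ^ k * u ^ Suc k * u"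
            by (simp_all add: mult_2 power_add power2_eq_square)
          then show ?thesis
            by (simp only: pderiv_monom poly_monom flow_field_def diff_Suc_1) (simp only: algebra_simps)
        qed
        then have "(\<Sum>l\<in>{1..N}. poly (pderiv (monom 1 (Suc k))) (x l) * flow_field k (x l)) =
           (\<Sum>l\<in>{1..N}. real (Suc k) * (x l ^ (2 * k + 1) - x l ^ (2 * k + 2)))"
          by (intro sum.cong refl)
        also have "\<dots> = real N * B N x"
          unfolding sum_distrib_left[symmetric] sum_subtractf using N0 by (simp add: B_def emom_def field_simps)
        finally show ?thesis .
      qed
      have "(\<integral>x. 3 * (linstat N (monom 1 (Suc k)) x / real N - mom (Suc k)) ^ 2 / real N * (\<Sum>l\<in>{1..N}. poly (pderiv (monom 1 (Suc k))) (x l) * flow_field k (x l))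
        + (linstat N (monom 1 (Suc k)) x / real N - mom (Suc k)) ^ 3 * loop_drift k (2 * c / real N) a b N x \<partial>J N) = 0"
        using a b c N0
        by (intro loop_equation[where \<phi> = "\<lambda>y. (y / real N - mom (Suc k)) ^ 3"])
           (auto intro!: derivative_eq_intros continuous_intros)
      then have "(\<integral>x. 3 * ?d x ^ 2 / real N * (real N * B N x) + ?d x ^ 3 * loop_drift k (2 * c / real N) a b N x \<partial>J N) = 0"
        unfolding lin Bsum .
      moreover have "3 * ?d x ^ 2 / real N * (real N * B N x) + ?d x ^ 3 * loop_drift k (2 * c / real N) a b N x =
         - real N * (?\<kappa> * ?d x ^ 4 - ?d x ^ 3 * R N x - 3 * (?d x ^ 2 * B N x) * (1 / real N))" for x
      proof -
        have E: "loop_drift k (2 * c / real N) a b N x = real N * (- ?\<kappa> * ?d x + R N x)"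
        proof -
          have "loop_drift k (2 * c / real N) a b N x / real N = - ?\<kappa> * ?d x + R N x"
            using loop_drift_split[OF N, of k x] by (simp only: R_def)
          then show ?thesis using N0 by (simp add: field_simps)
        qed
        show ?thesis unfolding E using N0 by (simp add: field_simps power2_eq_square power3_eq_cube power4_eq_xxxx)
      qed
      ultimately have 0: "(\<integral>x. ?\<kappa> * ?d x ^ 4 - ?d x ^ 3 * R N x - 3 * (?d x ^ 2 * B N x) * (1 / real N) \<partial>J N) = 0"
        using N0 by simp
      have "(\<integral>x. ?\<kappa> / 2 * ?d x ^ 4 - (4 / ?\<kappa>) ^ 3 * R N x ^ 4 - 9 / (?\<kappa> * real N ^ 2) * B N x ^ 2 \<partial>J N) \<le>
        (\<integral>x. ?\<kappa> * ?d x ^ 4 - ?d x ^ 3 * R N x - 3 * (?d x ^ 2 * B N x) * (1 / real N) \<partial>J N)"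
      proof (rule integral_mono)
        fix x
        have 1: "?d x ^ 3 * R N x \<le> ?\<kappa> / 4 * ?d x ^ 4 + (4 / ?\<kappa>) ^ 3 * R N x ^ 4" by (rule young_cube[OF \<kappa>])
        have 2: "3 * (?d x ^ 2 * B N x) * (1 / real N) \<le> ?\<kappa> / 4 * ?d x ^ 4 + 9 / (?\<kappa> * real N ^ 2) * B N x ^ 2"
          by (rule young_square[OF \<kappa> N0])
        show "?\<kappa> / 2 * ?d x ^ 4 - (4 / ?\<kappa>) ^ 3 * R N x ^ 4 - 9 / (?\<kappa> * real N ^ 2) * B N x ^ 2 \<le>
          ?\<kappa> * ?d x ^ 4 - ?d x ^ 3 * R N x - 3 * (?d x ^ 2 * B N x) * (1 / real N)" using 1 2 by linarith
      qed (rule ubd_integrable[OF _ N], intro ubd_diff ubd_cmult ubd_mult ubd_power ud uR uB ubd_over_N)+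
      also note 0
      finally have "(\<integral>x. ?\<kappa> / 2 * ?d x ^ 4 - (4 / ?\<kappa>) ^ 3 * R N x ^ 4 - 9 / (?\<kappa> * real N ^ 2) * B N x ^ 2 \<partial>J N) \<le> 0" .
      then have "?\<kappa> / 2 * (\<integral>x. ?d x ^ 4 \<partial>J N) \<le> (4 / ?\<kappa>) ^ 3 * (\<integral>x. R N x ^ 4 \<partial>J N) + 9 / (?\<kappa> * real N ^ 2) * (\<integral>x. B N x ^ 2 \<partial>J N)"
        using ubd_integrable[OF ubd_power[OF ud] N, of 4] ubd_integrable[OF ubd_power[OF uR] N, of 4] ubd_integrable[OF ubd_power[OF uB] N, of 2]
        by simp
      also have "\<dots> \<le> (4 / ?\<kappa>) ^ 3 * (C / real N ^ 2) + 9 / (?\<kappa> * real N ^ 2) * K"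
        using C(2)[OF N] K[OF N] \<kappa> by (intro add_mono mult_left_mono) auto
      finally show ?thesis using \<kappa> N0 by (simp add: field_simps)
    qed
    then show ?thesis unfolding Suc by (intro smallI[OF ud])
  qed
qed

text \<open>With \<open>M\<close> the largest of the three absolute values, the product is at most
  \<open>M ^ 3\<close>, hence at most \<open>1 + M ^ 4\<close>. This stands in for Hoelder's
  inequality.\<close>

lemma abs_prod3_le: "\<bar>x * y * z\<bar> \<le> 1 + x ^ 4 + y ^ 4 + z ^ 4" for x y z :: real
proof -
  define M where "M = max \<bar>x\<bar> (max \<bar>y\<bar> \<bar>z\<bar>)"
  have M: "\<bar>x\<bar> \<le> M" "\<bar>y\<bar> \<le> M" "\<bar>z\<bar> \<le> M" "M \<ge> 0" by (auto simp: M_def)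
  have "\<bar>x * y * z\<bar> \<le> M * M * M" unfolding abs_mult using M by (intro mult_mono) auto
  also have "\<dots> \<le> 1 + M ^ 4"
  proof (cases "M \<le> 1")
    case True
    then have "M * M * M \<le> 1" using M(4) by (intro mult_le_one) auto
    then show ?thesis using zero_le_power[OF M(4), of 4] by linarith
  next
    case False
    then have "M ^ 3 \<le> M ^ 4" by (intro power_increasing) auto
    then show ?thesis by (simp add: power3_eq_cube)
  qed
  also have "M ^ 4 \<le> x ^ 4 + y ^ 4 + z ^ 4"
  proof -
    have "M = \<bar>x\<bar> \<or> M = \<bar>y\<bar> \<or> M = \<bar>z\<bar>" unfolding M_def by linarith
    then have "M ^ 4 = x ^ 4 \<or> M ^ 4 = y ^ 4 \<or> M ^ 4 = z ^ 4"
      by (metis power_even_abs even_numeral)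
    moreover have "0 \<le> x ^ 4" "0 \<le> y ^ 4" "0 \<le> z ^ 4" by auto
    ultimately show ?thesis by linarith
  qed
  finally show ?thesis by simp
qed

lemma sqrt_power4: "sqrt (real N) ^ 4 = real N ^ 2"
proof -
  have "sqrt (real N) ^ 4 = (sqrt (real N) * sqrt (real N)) * (sqrt (real N) * sqrt (real N))"
    by (simp only: power4_eq_xxxx mult.assoc)
  then show ?thesis by (simp add: power2_eq_square)
qed

text \<open>Multiplying each factor by the square root of \<open>N\<close> makes its fourth moment
  bounded, and then the expected absolute product of the three is bounded.\<close>

lemma small_prod3:
  assumes "small r" "small s" "small t"
  shows "\<exists>C. \<forall>N\<ge>1. (\<integral>x. \<bar>r N x * s N x * t N x\<bar> \<partial>J N) \<le> C / (real N * sqrt (real N))"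
proof -
  obtain C where C: "\<And>N. N \<ge> 1 \<Longrightarrow> (\<integral>x. r N x ^ 4 \<partial>J N) \<le> C / real N ^ 2" using assms(1) by (elim smallE) blast
  obtain D where D: "\<And>N. N \<ge> 1 \<Longrightarrow> (\<integral>x. s N x ^ 4 \<partial>J N) \<le> D / real N ^ 2" using assms(2) by (elim smallE) blast
  obtain E where E: "\<And>N. N \<ge> 1 \<Longrightarrow> (\<integral>x. t N x ^ 4 \<partial>J N) \<le> E / real N ^ 2" using assms(3) by (elim smallE) blast
  note u = assms[THEN small_ubd]
  have "(\<integral>x. \<bar>r N x * s N x * t N x\<bar> \<partial>J N) \<le> (1 + C + D + E) / (real N * sqrt (real N))" if N: "N \<ge> 1" for N
  proof -
    have N0: "real N > 0" using N by simp
    have pw: "(sqrt (real N) * y) ^ 4 = real N ^ 2 * y ^ 4" for y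
      by (simp add: power_mult_distrib sqrt_power4)
    have "(real N * sqrt (real N)) * (\<integral>x. \<bar>r N x * s N x * t N x\<bar> \<partial>J N) = (\<integral>x. (real N * sqrt (real N)) * \<bar>r N x * s N x * t N x\<bar> \<partial>J N)"
      by simp
    also have "\<dots> \<le> (\<integral>x. 1 + real N ^ 2 * r N x ^ 4 + real N ^ 2 * s N x ^ 4 + real N ^ 2 * t N x ^ 4 \<partial>J N)"
    proof (rule integral_mono)
      fix x
      have "(real N * sqrt (real N)) * \<bar>r N x * s N x * t N x\<bar> = \<bar>(sqrt (real N) * r N x) * (sqrt (real N) * s N x) * (sqrt (real N) * t N x)\<bar>"
      proof -
        have "real N * sqrt (real N) = sqrt (real N) * sqrt (real N) * sqrt (real N)" by simp
        then show ?thesis by (simp only: abs_mult abs_of_nonneg real_sqrt_ge_zero of_nat_0_le_iff mult_ac)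
      qed
      also have "\<dots> \<le> 1 + (sqrt (real N) * r N x) ^ 4 + (sqrt (real N) * s N x) ^ 4 + (sqrt (real N) * t N x) ^ 4"
        by (rule abs_prod3_le)
      finally show "(real N * sqrt (real N)) * \<bar>r N x * s N x * t N x\<bar> \<le> 1 + real N ^ 2 * r N x ^ 4 + real N ^ 2 * s N x ^ 4 + real N ^ 2 * t N x ^ 4"
        unfolding pw .
    next
      have i: "integrable (J N) (\<lambda>x. \<bar>r N x * s N x * t N x\<bar>)"
        by (rule ubd_integrable[OF _ N], intro ubd_abs ubd_mult u)
      then show "integrable (J N) (\<lambda>x. (real N * sqrt (real N)) * \<bar>r N x * s N x * t N x\<bar>)" by simp
      show "integrable (J N) (\<lambda>x. 1 + real N ^ 2 * r N x ^ 4 + real N ^ 2 * s N x ^ 4 + real N ^ 2 * t N x ^ 4)"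
        using ubd_integrable[OF ubd_power[OF u(1), of 4] N] ubd_integrable[OF ubd_power[OF u(2), of 4] N] ubd_integrable[OF ubd_power[OF u(3), of 4] N] by simp
    qed
    also have "\<dots> = 1 + real N ^ 2 * (\<integral>x. r N x ^ 4 \<partial>J N) + real N ^ 2 * (\<integral>x. s N x ^ 4 \<partial>J N) + real N ^ 2 * (\<integral>x. t N x ^ 4 \<partial>J N)"
      using ubd_integrable[OF ubd_power[OF u(1), of 4] N] ubd_integrable[OF ubd_power[OF u(2), of 4] N] ubd_integrable[OF ubd_power[OF u(3), of 4] N]
      by (simp add: J.prob_space)
    also have "\<dots> \<le> 1 + C + D + E"
      using C[OF N] D[OF N] E[OF N] N0 by (simp add: field_simps)
    finally show ?thesis using N0 by (simp add: field_simps)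
  qed
  then show ?thesis by blast
qed

text \<open>A deterministic quantity of the size of a fluctuation. Padding a product with it yields
  the estimates for two factors and for one from the estimate for three.\<close>

lemma small_inv_sqrt: "small (\<lambda>N x. 1 / sqrt (real N))"
proof (rule smallI[where C = 1])
  show "ubd (\<lambda>N x. 1 / sqrt (real N))" by (rule ubdI[where K = 1]) (auto simp: field_simps)
  fix N :: nat assume "N \<ge> 1"
  show "(\<integral>x. (1 / sqrt (real N)) ^ 4 \<partial>J N) \<le> 1 / real N ^ 2"
    by (simp add: J.prob_space power_one_over sqrt_power4)
qed

lemma small_prod2:
  assumes "small r" "small s"
  shows "\<exists>C. \<forall>N\<ge>1. (\<integral>x. \<bar>r N x * s N x\<bar> \<partial>J N) \<le> C / real N"
proof -
  obtain C where C: "\<forall>N\<ge>1. (\<integral>x. \<bar>r N x * s N x * (1 / sqrt (real N))\<bar> \<partial>J N) \<le> C / (real N * sqrt (real N))"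
    using small_prod3[OF assms small_inv_sqrt] by blast
  have "(\<integral>x. \<bar>r N x * s N x\<bar> \<partial>J N) \<le> C / real N" if N: "N \<ge> 1" for N
  proof -
    have "(\<integral>x. \<bar>r N x * s N x * (1 / sqrt (real N))\<bar> \<partial>J N) = (\<integral>x. \<bar>r N x * s N x\<bar> \<partial>J N) / sqrt (real N)"
      by (simp add: abs_mult)
    then show ?thesis using C[rule_format, OF N] N by (simp add: field_simps)
  qed
  then show ?thesis by blast
qed

lemma small_prod1:
  assumes "small r"
  shows "\<exists>C. \<forall>N\<ge>1. (\<integral>x. \<bar>r N x\<bar> \<partial>J N) \<le> C / sqrt (real N)"
proof -
  obtain C where C: "\<forall>N\<ge>1. (\<integral>x. \<bar>r N x * (1 / sqrt (real N))\<bar> \<partial>J N) \<le> C / real N"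
    using small_prod2[OF assms small_inv_sqrt] by blast
  have "(\<integral>x. \<bar>r N x\<bar> \<partial>J N) \<le> C / sqrt (real N)" if N: "N \<ge> 1" for N
  proof -
    have "(\<integral>x. \<bar>r N x * (1 / sqrt (real N))\<bar> \<partial>J N) = (\<integral>x. \<bar>r N x\<bar> \<partial>J N) / sqrt (real N)"
      by (simp add: abs_mult)
    then have "(\<integral>x. \<bar>r N x\<bar> \<partial>J N) / sqrt (real N) \<le> (C / sqrt (real N)) / sqrt (real N)" using C[rule_format, OF N] N by simp
    then show ?thesis using N by (simp only: divide_le_cancel) auto
  qed
  then show ?thesis by blast
qed

section \<open>Linear statistics of polynomials and the linearised drift\<close>

text \<open>The linear functional with moments \<open>mom\<close>, used algebraically long before it
  is identified with integration against \<open>nu\<close>.\<close>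

definition mfun :: "real poly \<Rightarrow> real" where
  "mfun f = (\<Sum>i\<le>degree f. coeff f i * mom i)"

lemma mfun_eq: "degree f \<le> n \<Longrightarrow> mfun f = (\<Sum>i\<le>n. coeff f i * mom i)"
  unfolding mfun_def by (intro sum.mono_neutral_left) (auto simp: coeff_eq_0)

lemma mfun_add: "mfun (f + g) = mfun f + mfun g"
proof -
  let ?n = "max (degree f) (degree g)"
  have "degree (f + g) \<le> ?n" by (rule degree_add_le_max)
  then show ?thesis
    by (simp add: mfun_eq[of "f + g" ?n] mfun_eq[of f ?n] mfun_eq[of g ?n] distrib_right sum.distrib)
qed

lemma mfun_smult: "mfun (smult k f) = k * mfun f"
  by (simp add: mfun_eq[of "smult k f" "degree f"] mfun_def degree_smult_le sum_distrib_left mult.assoc)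

lemma mfun_0 [simp]: "mfun 0 = 0" by (simp add: mfun_def)

lemma mfun_minus: "mfun (- f) = - mfun f"
  using mfun_smult[of "-1" f] by simp

lemma mfun_diff: "mfun (f - g) = mfun f - mfun g"
  using mfun_add[of f "- g"] by (simp add: mfun_minus)

lemma mfun_sum: "mfun (\<Sum>i\<in>I. f i) = (\<Sum>i\<in>I. mfun (f i))"
  by (induction I rule: infinite_finite_induct) (auto simp: mfun_add)

lemma mfun_monom: "mfun (monom k n) = k * mom n"
proof -
  have "mfun (monom k n) = (\<Sum>i\<le>n. coeff (monom k n) i * mom i)" by (rule mfun_eq) (rule degree_monom_le)
  also have "\<dots> = (\<Sum>i\<in>{n}. k * mom n)" by (intro sum.mono_neutral_cong_right) auto
  finally show ?thesis by simp
qed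

definition ep :: "nat \<Rightarrow> real poly \<Rightarrow> (nat \<Rightarrow> real) \<Rightarrow> real" where
  "ep N f x = linstat N f x / real N"

definition dev :: "real poly \<Rightarrow> nat \<Rightarrow> (nat \<Rightarrow> real) \<Rightarrow> real" where
  "dev f N x = ep N f x - mfun f"

lemma ep_add: "ep N (f + g) x = ep N f x + ep N g x"
  by (simp add: ep_def linstat_def sum.distrib add_divide_distrib)

lemma ep_smult: "ep N (smult k f) x = k * ep N f x"
  by (simp add: ep_def linstat_def sum_distrib_left)

lemma ep_sum: "ep N (\<Sum>i\<in>I. f i) x = (\<Sum>i\<in>I. ep N (f i) x)"
  by (induction I rule: infinite_finite_induct) (auto simp: ep_add, simp_all add: ep_def linstat_def)

lemma dev_add: "dev (f + g) N x = dev f N x + dev g N x"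
  by (simp add: dev_def ep_add mfun_add)

lemma dev_smult: "dev (smult k f) N x = k * dev f N x"
  by (simp add: dev_def ep_smult mfun_smult algebra_simps)

lemma dev_minus: "dev (- f) N x = - dev f N x"
  using dev_smult[of "-1" f] by simp

lemma dev_diff: "dev (f - g) N x = dev f N x - dev g N x"
  using dev_add[of f "- g"] by (simp add: dev_minus)

lemma dev_sum: "dev (\<Sum>i\<in>I. f i) N x = (\<Sum>i\<in>I. dev (f i) N x)"
  by (simp add: dev_def ep_sum mfun_sum sum_subtractf)

lemma dev_monom: "dev (monom k n) N x = k * dmom n N x"
  by (simp add: dev_def ep_def linstat_def poly_monom mfun_monom dmom_def emom_def sum_distrib_left[symmetric] algebra_simps)

lemma dev_const: "N \<ge> 1 \<Longrightarrow> dev [:k:] N x = 0"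
  using dev_monom[of k 0 N x] by (simp add: dmom_0 monom_0)

lemma dev_expand: "dev f N x = (\<Sum>i\<le>degree f. coeff f i * dmom i N x)"
  using dev_sum[of "\<lambda>i. monom (coeff f i) i" "{..degree f}" N x]
  by (simp add: poly_as_sum_of_monoms dev_monom)

lemma small_dev: "small (dev f)"
proof -
  have "small (\<lambda>N x. \<Sum>i\<le>degree f. coeff f i * dmom i N x)"
    by (intro small_sum small_cmult small_dmom) auto
  then show ?thesis by (simp add: dev_expand[abs_def])
qed

lemma ubd_ep: "ubd (\<lambda>N. ep N f)"
proof -
  have "ubd (\<lambda>N x. dev f N x + mfun f)" by (intro ubd_add ubd_const small_ubd small_dev)
  then show ?thesis by (simp add: dev_def)
qed

text \<open>The part of the drift that is linear in the deviations, encoded as the polynomial whose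
  deviation it is. Linearised loop equations thereby become statements about an operator on
  polynomials.\<close>

definition lin_drift :: "nat \<Rightarrow> real poly" where
  "lin_drift k = monom (real k + 1 + a) k - monom (real k + 2 + a + b) (Suc k) +
     smult (2 * c) ((\<Sum>p\<in>{..<Suc k}. monom (mom p) (k - p)) - (\<Sum>p\<in>{..<Suc (Suc k)}. monom (mom p) (Suc k - p)))"

definition drift_rem :: "nat \<Rightarrow> nat \<Rightarrow> (nat \<Rightarrow> real) \<Rightarrow> real" where
  "drift_rem k N x = c * (conv_sum k (\<lambda>i. dmom i N x) (\<lambda>i. dmom i N x) - conv_sum (Suc k) (\<lambda>i. dmom i N x) (\<lambda>i. dmom i N x))
     - c / real N * ((real k + 1) * emom N k x - (real k + 2) * emom N (Suc k) x)"

lemma loop_drift_lin: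
  assumes N: "N \<ge> 1"
  shows "loop_drift k (2 * c / real N) a b N x / real N = dev (lin_drift k) N x + drift_rem k N x"
  unfolding loop_drift_dmom[OF N] lin_drift_def drift_rem_def dev_add dev_diff dev_smult dev_sum dev_monom
  unfolding conv_sum_def by (simp add: algebra_simps del: sum.lessThan_Suc)

lemma pderiv_linstat:
  "(\<Sum>l\<in>{1..N}. poly (pderiv f) (x l) * flow_field k (x l)) = linstat N (pderiv f * ([:0, 1, -1:] * monom 1 k)) x"
  unfolding linstat_def by (intro sum.cong) (auto simp: flow_field_def poly_monom algebra_simps)

section \<open>Approximate loop equations and covariances\<close>

text \<open>Decay of the first absolute moment. The rate is a parameter because the remainder of the
  drift is needed both by itself, at order \<open>1/N\<close>, and multiplied by a deviation, at
  order \<open>N^(-3/2)\<close>.\<close>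

definition dec :: "(nat \<Rightarrow> real) \<Rightarrow> (nat \<Rightarrow> (nat \<Rightarrow> real) \<Rightarrow> real) \<Rightarrow> bool" where
  "dec q r \<longleftrightarrow> ubd r \<and> (\<exists>C. \<forall>N\<ge>1. (\<integral>x. \<bar>r N x\<bar> \<partial>J N) \<le> C * q N)"

lemma decI: "ubd r \<Longrightarrow> \<exists>C. \<forall>N\<ge>1. (\<integral>x. \<bar>r N x\<bar> \<partial>J N) \<le> C * q N \<Longrightarrow> dec q r"
  by (simp add: dec_def)

lemma dec_ubd: "dec q r \<Longrightarrow> ubd r" by (simp add: dec_def)

lemma dec_add: assumes "dec q r" "dec q s" shows "dec q (\<lambda>N x. r N x + s N x)"
proof -
  note u = assms[THEN dec_ubd]
  obtain C D where C: "\<forall>N\<ge>1. (\<integral>x. \<bar>r N x\<bar> \<partial>J N) \<le> C * q N" and D: "\<forall>N\<ge>1. (\<integral>x. \<bar>s N x\<bar> \<partial>J N) \<le> D * q N"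
    using assms unfolding dec_def by blast
  have "(\<integral>x. \<bar>r N x + s N x\<bar> \<partial>J N) \<le> (C + D) * q N" if N: "N \<ge> 1" for N
  proof -
    have "(\<integral>x. \<bar>r N x + s N x\<bar> \<partial>J N) \<le> (\<integral>x. \<bar>r N x\<bar> + \<bar>s N x\<bar> \<partial>J N)"
      by (intro integral_mono ubd_integrable[OF _ N] ubd_abs ubd_add u) auto
    also have "\<dots> = (\<integral>x. \<bar>r N x\<bar> \<partial>J N) + (\<integral>x. \<bar>s N x\<bar> \<partial>J N)"
      by (intro Bochner_Integration.integral_add ubd_integrable[OF _ N] ubd_abs u)
    also have "\<dots> \<le> (C + D) * q N" using C D N by (simp add: distrib_right add_mono)
    finally show ?thesis .
  qed
  then show ?thesis by (intro decI ubd_add u) blast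
qed

lemma dec_cmult: assumes "dec q r" shows "dec q (\<lambda>N x. k * r N x)"
proof -
  obtain C where C: "\<forall>N\<ge>1. (\<integral>x. \<bar>r N x\<bar> \<partial>J N) \<le> C * q N"
    using assms unfolding dec_def by blast
  have "(\<integral>x. \<bar>k * r N x\<bar> \<partial>J N) \<le> (\<bar>k\<bar> * C) * q N" if N: "N \<ge> 1" for N
  proof -
    have "(\<integral>x. \<bar>k * r N x\<bar> \<partial>J N) = \<bar>k\<bar> * (\<integral>x. \<bar>r N x\<bar> \<partial>J N)" by (simp add: abs_mult)
    also have "\<dots> \<le> \<bar>k\<bar> * (C * q N)" using C N by (intro mult_left_mono) auto
    finally show ?thesis by (simp add: mult.assoc)
  qed
  then show ?thesis by (intro decI ubd_cmult[OF dec_ubd[OF assms]]) blast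
qed

lemma dec_diff: "dec q r \<Longrightarrow> dec q s \<Longrightarrow> dec q (\<lambda>N x. r N x - s N x)"
  using dec_add[of q r "\<lambda>N x. (-1) * s N x"] dec_cmult[of q s "-1"] by simp

lemma dec_zero: "dec q (\<lambda>N x. 0)"
  by (auto intro!: decI ubd_const exI[of _ 0])

lemma dec_sum: "finite I \<Longrightarrow> (\<And>i. i \<in> I \<Longrightarrow> dec q (r i)) \<Longrightarrow> dec q (\<lambda>N x. \<Sum>i\<in>I. r i N x)"
  by (induction I rule: finite_induct) (auto simp: dec_zero intro!: dec_add)

lemma dec_small2: "small r \<Longrightarrow> small s \<Longrightarrow> dec (\<lambda>N. 1 / real N) (\<lambda>N x. 1 * (r N x * s N x))"
  using small_prod2[of r s] by (simp add: dec_def ubd_mult small_ubd)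

lemma dec_small3: "small t \<Longrightarrow> small r \<Longrightarrow> small s \<Longrightarrow> dec (\<lambda>N. 1 / (real N * sqrt (real N))) (\<lambda>N x. t N x * (r N x * s N x))"
  using small_prod3[of t r s] by (intro decI ubd_mult small_ubd) (auto simp: mult.assoc)

lemma dec_small1: "small r \<Longrightarrow> dec (\<lambda>N. 1 / sqrt (real N)) r"
  using small_prod1[of r] by (intro decI small_ubd) auto

text \<open>The remainder is a combination of products of two small functions: the convolutions
  visibly so, and the correction once its \<open>1/N\<close> is split into two factors
  \<open>1 / sqrt N\<close>. The weight \<open>w\<close> is later 1 or a deviation.\<close>

lemma dec_drift_rem:
  assumes "\<And>r s. small r \<Longrightarrow> small s \<Longrightarrow> dec q (\<lambda>N x. w N x * (r N x * s N x))"
  shows "dec q (\<lambda>N x. w N x * drift_rem k N x)"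
proof -
  have conv: "dec q (\<lambda>N x. w N x * conv_sum n (\<lambda>i. dmom i N x) (\<lambda>i. dmom i N x))" for n
    unfolding conv_sum_def sum_distrib_left by (intro dec_sum assms small_dmom) auto
  define r where "r = (\<lambda>N x. (c * ((real k + 1) * emom N k x - (real k + 2) * emom N (Suc k) x)) * (1 / sqrt (real N)))"
  have r: "small r" unfolding r_def
    by (intro small_mult small_inv_sqrt ubd_cmult ubd_diff ubd_emom)
  have "dec q (\<lambda>N x. c * (w N x * conv_sum k (\<lambda>i. dmom i N x) (\<lambda>i. dmom i N x)
      - w N x * conv_sum (Suc k) (\<lambda>i. dmom i N x) (\<lambda>i. dmom i N x)) - w N x * (r N x * (1 / sqrt (real N))))"
    by (intro dec_diff dec_cmult conv assms r small_inv_sqrt)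
  moreover have "(\<lambda>N x. c * (w N x * conv_sum k (\<lambda>i. dmom i N x) (\<lambda>i. dmom i N x)
      - w N x * conv_sum (Suc k) (\<lambda>i. dmom i N x) (\<lambda>i. dmom i N x)) - w N x * (r N x * (1 / sqrt (real N)))) =
      (\<lambda>N x. w N x * drift_rem k N x)"
  proof (intro ext)
    fix N x
    have "r N x * (1 / sqrt (real N)) = c / real N * ((real k + 1) * emom N k x - (real k + 2) * emom N (Suc k) x)"
      by (simp add: r_def)
    then show "c * (w N x * conv_sum k (\<lambda>i. dmom i N x) (\<lambda>i. dmom i N x)
      - w N x * conv_sum (Suc k) (\<lambda>i. dmom i N x) (\<lambda>i. dmom i N x)) - w N x * (r N x * (1 / sqrt (real N))) =
      w N x * drift_rem k N x" unfolding drift_rem_def by (simp only: right_diff_distrib mult_ac)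
  qed
  ultimately show ?thesis by simp
qed

text \<open>The operator \<open>T\<close> of the overview, extended linearly from the
  monomials.\<close>

definition drift_op :: "real poly \<Rightarrow> real poly" where
  "drift_op p = (\<Sum>k\<le>degree p. smult (coeff p k) (lin_drift k))"

definition drift_err :: "real poly \<Rightarrow> nat \<Rightarrow> (nat \<Rightarrow> real) \<Rightarrow> real" where
  "drift_err p N x = (\<Sum>k\<le>degree p. coeff p k * drift_rem k N x)"

lemma dec_drift_err:
  assumes "\<And>r s. small r \<Longrightarrow> small s \<Longrightarrow> dec q (\<lambda>N x. w N x * (r N x * s N x))"
  shows "dec q (\<lambda>N x. w N x * drift_err p N x)"
proof -
  have "dec q (\<lambda>N x. \<Sum>k\<le>degree p. coeff p k * (w N x * drift_rem k N x))"
    by (intro dec_sum dec_cmult dec_drift_rem assms) auto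
  then show ?thesis by (simp add: drift_err_def sum_distrib_left mult.left_commute)
qed

lemma dec_drift_err1: "dec (\<lambda>N. 1 / real N) (drift_err p)"
proof -
  have "dec (\<lambda>N. 1 / real N) (\<lambda>N x. 1 * drift_err p N x)"
    by (rule dec_drift_err) (rule dec_small2)
  then show ?thesis by simp
qed

lemma ubd_drift_err: "ubd (drift_err p)"
  using dec_ubd[OF dec_drift_err1] .

lemma integrable_comp_ubd:
  assumes r: "ubd r" and s: "ubd s" and \<phi>: "continuous_on UNIV (\<phi> :: real \<Rightarrow> real)" and N: "N \<ge> 1"
  shows "integrable (J N) (\<lambda>x. \<phi> (k * r N x) * s N x)"
proof -
  obtain K where K: "\<And>N x. N \<ge> 1 \<Longrightarrow> x \<in> unit_cube N \<Longrightarrow> \<bar>r N x\<bar> \<le> K" using r by (elim ubdE) blast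
  obtain L where L: "L \<ge> 0" "\<And>N x. N \<ge> 1 \<Longrightarrow> x \<in> unit_cube N \<Longrightarrow> \<bar>s N x\<bar> \<le> L" using s by (elim ubdE) blast
  let ?I = "{- (\<bar>k\<bar> * K)..\<bar>k\<bar> * K}"
  have "bounded (\<phi> ` ?I)" using \<phi> by (intro compact_imp_bounded compact_continuous_image) (auto intro: continuous_on_subset)
  then obtain B where B: "\<forall>y\<in>?I. \<bar>\<phi> y\<bar> \<le> B" by (auto simp: bounded_iff)
  have [measurable]: "\<phi> \<in> borel_measurable borel" using \<phi> by (rule borel_measurable_continuous_onI)
  have [measurable]: "r N \<in> borel_measurable (J N)" "s N \<in> borel_measurable (J N)" using r s by (simp_all add: ubd_measurable)
  show ?thesis
  proof (rule J.integrable_const_bound[where B = "B * L"])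
    show "AE x in J N. norm (\<phi> (k * r N x) * s N x) \<le> B * L"
      using AE_jacobi_ensemble_cube
    proof eventually_elim
      fix x assume x: "x \<in> unit_cube N"
      have "\<bar>k * r N x\<bar> \<le> \<bar>k\<bar> * K" unfolding abs_mult using K[OF N x] by (intro mult_left_mono) auto
      then have "k * r N x \<in> ?I" by auto
      then have "\<bar>\<phi> (k * r N x)\<bar> \<le> B" using B by blast
      then show "norm (\<phi> (k * r N x) * s N x) \<le> B * L"
        unfolding real_norm_def abs_mult using L(1) L(2)[OF N x] by (intro mult_mono) auto
    qed
  qed measurable
qed

abbreviation wt :: "real poly" where "wt \<equiv> [:0, 1, -1:]"

text \<open>The loop equation is linear in the vector field, so the fields
  \<open>x (1 - x) p(x)\<close> follow from those with \<open>p\<close> a monomial. The test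
  function is rescaled to the size of the fluctuations.\<close>

lemma loop_poly:
  assumes \<phi>: "\<And>y. (\<phi> has_real_derivative \<phi>' y) (at y)" and \<phi>': "continuous_on UNIV \<phi>'" and N: "N \<ge> 1"
  shows "(\<integral>x. \<phi>' (sqrt (real N) * dev f N x) * ep N (pderiv f * (wt * p)) x +
     \<phi> (sqrt (real N) * dev f N x) * (sqrt (real N) * (dev (drift_op p) N x + drift_err p N x)) \<partial>J N) = 0"
proof -
  let ?q = "sqrt (real N)"
  have N0: "real N > 0" using N by simp
  have qq: "?q * ?q = real N" by simp
  have c\<phi>: "continuous_on UNIV \<phi>" using \<phi> by (meson DERIV_isCont continuous_at_imp_continuous_on)
  define t where "t = (\<lambda>k x. \<phi>' (?q * dev f N x) * ep N (pderiv f * (wt * monom 1 k)) x +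
     \<phi> (?q * dev f N x) * (?q * (dev (lin_drift k) N x + drift_rem k N x)))"
  have ud: "ubd (drift_rem k)" for k
  proof -
    have "dec (\<lambda>N. 1 / real N) (\<lambda>N x. 1 * drift_rem k N x)"
      by (rule dec_drift_rem) (rule dec_small2)
    from dec_ubd[OF this] show ?thesis by simp
  qed
  have int: "integrable (J N) (t k)" for k
  proof -
    have "integrable (J N) (\<lambda>x. \<phi> (?q * dev f N x) * (?q * (dev (lin_drift k) N x + drift_rem k N x)))"
      using integrable_comp_ubd[OF small_ubd[OF small_dev] ubd_add[OF small_ubd[OF small_dev] ud] c\<phi> N, of ?q f "lin_drift k" k]
      by (simp add: mult.left_commute[of _ ?q])
    then show ?thesis unfolding t_def
      by (intro Bochner_Integration.integrable_add integrable_comp_ubd[OF small_ubd[OF small_dev] ubd_ep \<phi>' N])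
  qed
  have zero: "(\<integral>x. t k x \<partial>J N) = 0" for k
  proof -
    have "(\<integral>x. (\<phi>' (?q * (linstat N f x / real N - mfun f)) * (?q / real N)) * (\<Sum>l\<in>{1..N}. poly (pderiv f) (x l) * flow_field k (x l)) +
        \<phi> (?q * (linstat N f x / real N - mfun f)) * loop_drift k (2 * c / real N) a b N x \<partial>J N) = 0"
      using a b c N0
      by (intro loop_equation[where \<phi> = "\<lambda>y. \<phi> (?q * (y / real N - mfun f))"] DERIV_chain2[OF \<phi>]
           continuous_intros continuous_on_compose2[OF \<phi>']) (auto intro!: derivative_eq_intros)
    also have "(\<lambda>x. (\<phi>' (?q * (linstat N f x / real N - mfun f)) * (?q / real N)) * (\<Sum>l\<in>{1..N}. poly (pderiv f) (x l) * flow_field k (x l)) +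
        \<phi> (?q * (linstat N f x / real N - mfun f)) * loop_drift k (2 * c / real N) a b N x) = (\<lambda>x. ?q * t k x)"
    proof
      fix x
      have alg: "(u * (s / real N)) * (real N * e) + v * (s * s * z) = s * (u * e + v * (s * z))" for u s e v z
        using N0 by (simp add: field_simps)
      have d: "linstat N f x / real N - mfun f = dev f N x" by (simp add: dev_def ep_def)
      have l: "loop_drift k (2 * c / real N) a b N x = ?q * ?q * (dev (lin_drift k) N x + drift_rem k N x)"
        using loop_drift_lin[OF N, of k x] N0 unfolding qq by (simp add: field_simps)
      have e: "linstat N (pderiv f * (wt * monom 1 k)) x = real N * ep N (pderiv f * (wt * monom 1 k)) x"
        using N0 by (simp add: ep_def)
      show "(\<phi>' (?q * (linstat N f x / real N - mfun f)) * (?q / real N)) * (\<Sum>l\<in>{1..N}. poly (pderiv f) (x l) * flow_field k (x l)) +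
        \<phi> (?q * (linstat N f x / real N - mfun f)) * loop_drift k (2 * c / real N) a b N x = ?q * t k x"
        unfolding d l pderiv_linstat e t_def by (rule alg)
    qed
    finally show ?thesis using N0 by simp
  qed
  have "(\<lambda>x. \<phi>' (?q * dev f N x) * ep N (pderiv f * (wt * p)) x +
     \<phi> (?q * dev f N x) * (?q * (dev (drift_op p) N x + drift_err p N x))) = (\<lambda>x. \<Sum>k\<le>degree p. coeff p k * t k x)"
  proof
    fix x
    have p: "(\<Sum>k\<le>degree p. smult (coeff p k) (monom 1 k)) = p"
      by (simp add: smult_monom poly_as_sum_of_monoms)
    have "pderiv f * (wt * (\<Sum>k\<le>degree p. smult (coeff p k) (monom 1 k))) =
       (\<Sum>k\<le>degree p. smult (coeff p k) (pderiv f * (wt * monom 1 k)))"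
      by (simp only: sum_distrib_left mult_smult_right)
    then have "pderiv f * (wt * p) = (\<Sum>k\<le>degree p. smult (coeff p k) (pderiv f * (wt * monom 1 k)))"
      unfolding p .
    then have "ep N (pderiv f * (wt * p)) x = (\<Sum>k\<le>degree p. coeff p k * ep N (pderiv f * (wt * monom 1 k)) x)"
      by (simp only: ep_sum ep_smult)
    then show "\<phi>' (?q * dev f N x) * ep N (pderiv f * (wt * p)) x +
     \<phi> (?q * dev f N x) * (?q * (dev (drift_op p) N x + drift_err p N x)) = (\<Sum>k\<le>degree p. coeff p k * t k x)"
      unfolding drift_op_def dev_sum dev_smult drift_err_def sum.distrib[symmetric] t_def
      by (simp add: sum_distrib_left sum.distrib[symmetric] algebra_simps)
  qed
  then show ?thesis
    using zero int by simp
qed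

lemma sqrt_over: "N \<ge> 1 \<Longrightarrow> sqrt (real N) / real N = 1 / sqrt (real N)"
  by (simp add: real_div_sqrt field_simps)

text \<open>The empirical average of \<open>g\<close> is replaced by its limit inside the
  expectation; the cost is the first absolute moment of the deviation of \<open>g\<close>, whatever
  the bounded factor.\<close>

lemma expectation_ep:
  "\<exists>C. \<forall>N\<ge>1. \<forall>\<phi>. \<phi> \<in> borel_measurable borel \<longrightarrow> (\<forall>y. \<bar>\<phi> y\<bar> \<le> 1) \<longrightarrow>
     \<bar>(\<integral>x. \<phi> (sqrt (real N) * dev f N x) * ep N g x \<partial>J N) - mfun g * (\<integral>x. \<phi> (sqrt (real N) * dev f N x) \<partial>J N)\<bar> \<le> C / sqrt (real N)"
proof -
  obtain C where C: "\<forall>N\<ge>1. (\<integral>x. \<bar>dev g N x\<bar> \<partial>J N) \<le> C * (1 / sqrt (real N))"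
    using dec_small1[OF small_dev, of g] unfolding dec_def by blast
  have "\<bar>(\<integral>x. \<phi> (sqrt (real N) * dev f N x) * ep N g x \<partial>J N) - mfun g * (\<integral>x. \<phi> (sqrt (real N) * dev f N x) \<partial>J N)\<bar> \<le> C / sqrt (real N)"
    if N: "N \<ge> 1" and [measurable]: "\<phi> \<in> borel_measurable borel" and \<phi>: "\<forall>y. \<bar>\<phi> y\<bar> \<le> 1" for N and \<phi> :: "real \<Rightarrow> real"
  proof -
    let ?p = "\<lambda>x. \<phi> (sqrt (real N) * dev f N x)"
    have [measurable]: "dev h N \<in> borel_measurable (J N)" for h by (intro ubd_measurable small_ubd small_dev)
    have i1: "integrable (J N) ?p" using \<phi> by (intro J.integrable_const_bound[where B = 1]) auto
    have i2: "integrable (J N) (\<lambda>x. ?p x * dev g N x)"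
    proof (rule Bochner_Integration.integrable_bound)
      show "integrable (J N) (dev g N)" by (intro ubd_integrable[OF _ N] small_ubd small_dev)
      show "AE x in J N. norm (?p x * dev g N x) \<le> norm (dev g N x)"
        using \<phi> by (intro AE_I2) (simp add: abs_mult mult_left_le_one_le)
    qed measurable
    have "(\<integral>x. ?p x * ep N g x \<partial>J N) = (\<integral>x. ?p x * dev g N x + mfun g * ?p x \<partial>J N)"
      by (intro Bochner_Integration.integral_cong) (auto simp: dev_def algebra_simps)
    then have "(\<integral>x. ?p x * ep N g x \<partial>J N) - mfun g * (\<integral>x. ?p x \<partial>J N) = (\<integral>x. ?p x * dev g N x \<partial>J N)"
      using i1 i2 by simp
    also have "\<bar>\<dots>\<bar> \<le> (\<integral>x. \<bar>?p x * dev g N x\<bar> \<partial>J N)" using integral_norm_bound[of "J N" "\<lambda>x. ?p x * dev g N x"] by simp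
    also have "\<dots> \<le> (\<integral>x. \<bar>dev g N x\<bar> \<partial>J N)"
    proof (rule integral_mono)
      show "integrable (J N) (\<lambda>x. \<bar>?p x * dev g N x\<bar>)" using i2 by simp
      show "integrable (J N) (\<lambda>x. \<bar>dev g N x\<bar>)" by (intro ubd_integrable[OF _ N] ubd_abs small_ubd small_dev)
    qed (use \<phi> in \<open>simp add: abs_mult mult_left_le_one_le\<close>)
    finally show ?thesis using C N by force
  qed
  then show ?thesis by blast
qed

text \<open>The constant is chosen before the test function. Later a whole family of sines and
  cosines is inserted, and a differential inequality in its parameter needs one bound for all
  members.\<close>

lemma approx_loop:
  "\<exists>C. \<forall>N\<ge>1. \<forall>\<phi> \<phi>'. (\<forall>y. (\<phi> has_real_derivative \<phi>' y) (at y)) \<longrightarrow> continuous_on UNIV \<phi>' \<longrightarrow>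
     (\<forall>y. \<bar>\<phi> y\<bar> \<le> 1) \<longrightarrow> (\<forall>y. \<bar>\<phi>' y\<bar> \<le> 1) \<longrightarrow>
     \<bar>mfun (pderiv f * (wt * p)) * (\<integral>x. \<phi>' (sqrt (real N) * dev f N x) \<partial>J N) +
      (\<integral>x. \<phi> (sqrt (real N) * dev f N x) * (sqrt (real N) * dev (drift_op p) N x) \<partial>J N)\<bar> \<le> C / sqrt (real N)"
proof -
  let ?g = "pderiv f * (wt * p)"
  obtain C where C: "\<And>N \<phi>. N \<ge> 1 \<Longrightarrow> \<phi> \<in> borel_measurable borel \<Longrightarrow> (\<forall>y. \<bar>\<phi> y\<bar> \<le> 1) \<Longrightarrow>
     \<bar>(\<integral>x. \<phi> (sqrt (real N) * dev f N x) * ep N ?g x \<partial>J N) - mfun ?g * (\<integral>x. \<phi> (sqrt (real N) * dev f N x) \<partial>J N)\<bar> \<le> C / sqrt (real N)"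
    using expectation_ep[of f ?g] by blast
  obtain D where D: "\<forall>N\<ge>1. (\<integral>x. \<bar>drift_err p N x\<bar> \<partial>J N) \<le> D * (1 / real N)"
    using dec_drift_err1[of p] unfolding dec_def by blast
  have "\<bar>mfun ?g * (\<integral>x. \<phi>' (sqrt (real N) * dev f N x) \<partial>J N) +
      (\<integral>x. \<phi> (sqrt (real N) * dev f N x) * (sqrt (real N) * dev (drift_op p) N x) \<partial>J N)\<bar> \<le> (C + D) / sqrt (real N)"
    if N: "N \<ge> 1" and der: "\<forall>y. (\<phi> has_real_derivative \<phi>' y) (at y)" and cont: "continuous_on UNIV \<phi>'"
      and bd: "\<forall>y. \<bar>\<phi> y\<bar> \<le> 1" "\<forall>y. \<bar>\<phi>' y\<bar> \<le> 1" for N \<phi> \<phi>'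
  proof -
    let ?q = "sqrt (real N)"
    let ?P = "\<lambda>x. \<phi> (?q * dev f N x)"
    have c\<phi>: "continuous_on UNIV \<phi>" using der by (meson DERIV_isCont continuous_at_imp_continuous_on)
    have m\<phi>': "\<phi>' \<in> borel_measurable borel" using cont by (rule borel_measurable_continuous_onI)
    note ud = small_ubd[OF small_dev]
    have i1: "integrable (J N) (\<lambda>x. \<phi>' (?q * dev f N x) * ep N ?g x)"
      by (rule integrable_comp_ubd[OF ud ubd_ep cont N])
    have i2: "integrable (J N) (\<lambda>x. ?P x * (?q * dev (drift_op p) N x))"
      using integrable_comp_ubd[OF ud ud c\<phi> N, of ?q f "drift_op p"] by (simp add: mult.left_commute[of _ ?q])
    have i3': "integrable (J N) (\<lambda>x. ?P x * drift_err p N x)"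
      by (rule integrable_comp_ubd[OF ud ubd_drift_err c\<phi> N])
    then have i3: "integrable (J N) (\<lambda>x. ?P x * (?q * drift_err p N x))" by (simp add: mult.left_commute[of _ ?q])
    have "(\<integral>x. \<phi>' (?q * dev f N x) * ep N ?g x + ?P x * (?q * (dev (drift_op p) N x + drift_err p N x)) \<partial>J N) = 0"
      using der by (intro loop_poly cont N) blast
    also have "(\<lambda>x. \<phi>' (?q * dev f N x) * ep N ?g x + ?P x * (?q * (dev (drift_op p) N x + drift_err p N x))) =
      (\<lambda>x. \<phi>' (?q * dev f N x) * ep N ?g x + ?P x * (?q * dev (drift_op p) N x) + ?P x * (?q * drift_err p N x))"
      by (intro ext) (simp add: algebra_simps)
    finally have eq: "(\<integral>x. \<phi>' (?q * dev f N x) * ep N ?g x \<partial>J N) + (\<integral>x. ?P x * (?q * dev (drift_op p) N x) \<partial>J N)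
        + (\<integral>x. ?P x * (?q * drift_err p N x) \<partial>J N) = 0"
      using i1 i2 i3 by simp
    have "\<bar>\<integral>x. ?P x * drift_err p N x \<partial>J N\<bar> \<le> (\<integral>x. \<bar>?P x * drift_err p N x\<bar> \<partial>J N)"
      using integral_norm_bound[of "J N" "\<lambda>x. ?P x * drift_err p N x"] by simp
    also have "\<dots> \<le> (\<integral>x. \<bar>drift_err p N x\<bar> \<partial>J N)"
    proof (rule integral_mono)
      show "integrable (J N) (\<lambda>x. \<bar>?P x * drift_err p N x\<bar>)" using i3' by simp
      show "integrable (J N) (\<lambda>x. \<bar>drift_err p N x\<bar>)" by (intro ubd_integrable[OF _ N] ubd_abs ubd_drift_err)
    qed (use bd in \<open>simp add: abs_mult mult_left_le_one_le\<close>)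
    also have "\<dots> \<le> D * (1 / real N)" using D N by blast
    finally have "?q * \<bar>\<integral>x. ?P x * drift_err p N x \<partial>J N\<bar> \<le> ?q * (D * (1 / real N))" by (intro mult_left_mono) auto
    moreover have "(\<integral>x. ?P x * (?q * drift_err p N x) \<partial>J N) = ?q * (\<integral>x. ?P x * drift_err p N x \<partial>J N)"
      by (simp add: mult.left_commute[of _ ?q])
    moreover have "?q * (D * (1 / real N)) = D / ?q"
    proof -
      have "?q * (D * (1 / real N)) = D * (?q / real N)" by simp
      then show ?thesis unfolding sqrt_over[OF N] by simp
    qed
    ultimately have "\<bar>\<integral>x. ?P x * (?q * drift_err p N x) \<partial>J N\<bar> \<le> D / ?q" by (simp add: abs_mult)
    then show ?thesis using eq C[OF N m\<phi>' bd(2)] by (simp add: add_divide_distrib)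
  qed
  then show ?thesis by blast
qed

lemma const_over_sqrt_tendsto: "(\<lambda>N. C / sqrt (real N)) \<longlonglongrightarrow> 0"
  by (intro tendsto_divide_0[OF tendsto_const] filterlim_at_top_imp_at_infinity filterlim_compose[OF sqrt_at_top filterlim_real_sequentially])

text \<open>The test function is the identity, which is unbounded, so the bounded version does not
  apply. The error is \<open>N\<close> times the expected product of a deviation and the quadratic
  remainder, of order \<open>N * N^(-3/2)\<close>.\<close>

lemma cov_limit:
  "(\<lambda>N. \<integral>x. real N * (dev f N x * dev (drift_op p) N x) \<partial>J N) \<longlonglongrightarrow> - mfun (pderiv f * (wt * p))"
proof -
  let ?g = "pderiv f * (wt * p)"
  note ud = small_ubd[OF small_dev]
  obtain C where C: "\<forall>N\<ge>1. (\<integral>x. \<bar>dev ?g N x\<bar> \<partial>J N) \<le> C * (1 / sqrt (real N))"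
    using dec_small1[OF small_dev, of ?g] unfolding dec_def by blast
  obtain D where D: "\<forall>N\<ge>1. (\<integral>x. \<bar>dev f N x * drift_err p N x\<bar> \<partial>J N) \<le> D * (1 / (real N * sqrt (real N)))"
  proof -
    have "dec (\<lambda>N. 1 / (real N * sqrt (real N))) (\<lambda>N x. dev f N x * drift_err p N x)"
      by (rule dec_drift_err) (rule dec_small3[OF small_dev])
    then show thesis using that unfolding dec_def by blast
  qed
  have bound: "\<bar>(\<integral>x. real N * (dev f N x * dev (drift_op p) N x) \<partial>J N) + mfun ?g\<bar> \<le> (C + D) / sqrt (real N)" if N: "N \<ge> 1" for N
  proof -
    let ?q = "sqrt (real N)"
    have qq: "?q * ?q = real N" by simp
    have "(\<integral>x. 1 * ep N ?g x + (?q * dev f N x) * (?q * (dev (drift_op p) N x + drift_err p N x)) \<partial>J N) = 0"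
      by (rule loop_poly[where \<phi> = "\<lambda>y. y" and \<phi>' = "\<lambda>_. 1", OF _ _ N]) (auto intro: derivative_eq_intros)
    also have "(\<lambda>x. 1 * ep N ?g x + (?q * dev f N x) * (?q * (dev (drift_op p) N x + drift_err p N x))) =
       (\<lambda>x. (dev ?g N x + mfun ?g) + real N * (dev f N x * dev (drift_op p) N x) + real N * (dev f N x * drift_err p N x))"
    proof (intro ext)
      fix x
      have "(?q * dev f N x) * (?q * (dev (drift_op p) N x + drift_err p N x)) =
        (?q * ?q) * (dev f N x * dev (drift_op p) N x) + (?q * ?q) * (dev f N x * drift_err p N x)"
        by (simp only: algebra_simps)
      then show "1 * ep N ?g x + (?q * dev f N x) * (?q * (dev (drift_op p) N x + drift_err p N x)) =
        (dev ?g N x + mfun ?g) + real N * (dev f N x * dev (drift_op p) N x) + real N * (dev f N x * drift_err p N x)"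
        by (simp only: qq dev_def[of ?g])
    qed
    finally have eq: "(\<integral>x. dev ?g N x \<partial>J N) + mfun ?g + (\<integral>x. real N * (dev f N x * dev (drift_op p) N x) \<partial>J N) +
       real N * (\<integral>x. dev f N x * drift_err p N x \<partial>J N) = 0"
      using ubd_integrable[OF ud N, of ?g] ubd_integrable[OF ubd_mult[OF ud ud] N, of f "drift_op p"]
        ubd_integrable[OF ubd_mult[OF ud ubd_drift_err] N, of f p]
      by (simp add: J.prob_space)
    have "\<bar>\<integral>x. dev ?g N x \<partial>J N\<bar> \<le> (\<integral>x. \<bar>dev ?g N x\<bar> \<partial>J N)"
      using integral_norm_bound[of "J N" "dev ?g N"] by simp
    also have "\<dots> \<le> C / ?q" using C N by simp
    finally have "\<bar>\<integral>x. dev ?g N x \<partial>J N\<bar> \<le> C / ?q" .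
    moreover have "\<bar>real N * (\<integral>x. dev f N x * drift_err p N x \<partial>J N)\<bar> \<le> D / ?q"
    proof -
      have "\<bar>\<integral>x. dev f N x * drift_err p N x \<partial>J N\<bar> \<le> (\<integral>x. \<bar>dev f N x * drift_err p N x\<bar> \<partial>J N)"
        using integral_norm_bound[of "J N" "\<lambda>x. dev f N x * drift_err p N x"] by simp
      also have "\<dots> \<le> D * (1 / (real N * ?q))" using D N by blast
      finally have "\<bar>\<integral>x. dev f N x * drift_err p N x \<partial>J N\<bar> \<le> D * (1 / (real N * ?q))" .
      then have "real N * \<bar>\<integral>x. dev f N x * drift_err p N x \<partial>J N\<bar> \<le> real N * (D * (1 / (real N * ?q)))"
        by (intro mult_left_mono) auto
      then show ?thesis using N by (simp add: abs_mult)
    qed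
    ultimately show ?thesis using eq by (simp add: add_divide_distrib)
  qed
  have "(\<lambda>N. (\<integral>x. real N * (dev f N x * dev (drift_op p) N x) \<partial>J N) + mfun ?g) \<longlonglongrightarrow> 0"
    by (rule Lim_null_comparison[OF _ const_over_sqrt_tendsto[of "C + D"]])
       (use bound in \<open>auto simp: eventually_sequentially\<close>)
  from tendsto_diff[OF this tendsto_const[of "mfun ?g"]] show ?thesis by simp
qed

text \<open>The covariance of the deviations of \<open>T p\<close> and \<open>T q\<close> is
  symmetric, and its limit can be evaluated with either of the two in the role of the test
  statistic.\<close>

lemma drift_op_symmetric:
  "mfun (pderiv (drift_op q) * (wt * p)) = mfun (pderiv (drift_op p) * (wt * q))"
proof -
  have "(\<lambda>N. \<integral>x. real N * (dev (drift_op q) N x * dev (drift_op p) N x) \<partial>J N) \<longlonglongrightarrow> - mfun (pderiv (drift_op q) * (wt * p))"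
    by (rule cov_limit)
  moreover have "(\<lambda>N. \<integral>x. real N * (dev (drift_op q) N x * dev (drift_op p) N x) \<partial>J N) \<longlonglongrightarrow> - mfun (pderiv (drift_op p) * (wt * q))"
    using cov_limit[of "drift_op p" q] by (simp add: mult.commute)
  ultimately show ?thesis using LIMSEQ_unique by fastforce
qed

end

section \<open>Eigenpolynomials of the drift operator\<close>

text \<open>The compatibility of the closed forms \<open>e\<close> and \<open>f\<close> of the
  second and third coefficients with a three-term recurrence, in the variable
  \<open>t = 2n + S\<close>, where one step is a shift by 2.\<close>

lemma second_coeff_recurrence:
  fixes t s g w :: real
  assumes "t \<noteq> 0" "t + 2 \<noteq> 0" "t - 1 \<noteq> 0" "t + 1 \<noteq> 0" "s + 1 \<noteq> 0"
  defines "e \<equiv> \<lambda>t. - (t - s) * (t - g) / (4 * t)"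
  defines "f \<equiv> \<lambda>t. - (t - s - 2) / (4 * (t - 1)) * ((s\<^sup>2 - w + g\<^sup>2) / (8 * (s + 1)) - (t - 2 - g) * (t - s) * (t - g) / (8 * t))"
  shows "f (t + 2) = f t - (e t - e (t + 2)) * e t - (t ^ 4 - w * t\<^sup>2 + s\<^sup>2 * g\<^sup>2) / (16 * (t - 1) * t\<^sup>2 * (t + 1))"
proof -
  \<comment> \<open>In terms of \<open>K\<close> the numerator on the right is
    \<open>(t^2 - s^2) * (t^2 - g^2) + 8 * (s + 1) * K * t^2\<close>, so that both sides are
    polynomials of degree one in \<open>K\<close>.\<close>
  define K where "K = (s\<^sup>2 - w + g\<^sup>2) / (8 * (s + 1))"
  have w: "w = s\<^sup>2 + g\<^sup>2 - 8 * (s + 1) * K" using assms(5) by (simp add: K_def field_simps)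
  have ft: "f t = - (t - s - 2) / (4 * (t - 1)) * (K - (t - 2 - g) * (t - s) * (t - g) / (8 * t))"
    by (simp add: f_def K_def)
  have f2: "f (t + 2) = - (t - s) / (4 * (t + 1)) * (K - (t - g) * (t + 2 - s) * (t + 2 - g) / (8 * (t + 2)))"
    by (simp add: f_def K_def add.commute)
  show ?thesis unfolding ft f2 w e_def using assms(1-4)
    by (simp add: divide_simps) algebra
qed

section \<open>Monic polynomials and their leading coefficients\<close>

context jacobi_hot begin

definition S :: real where "S = 2 * c + a + b + 2"

lemma S_pos: "S > 0" using a b c by (simp add: S_def)

lemma rate_S: "rate k = real k + S" by (simp add: rate_def S_def)

text \<open>Equal to \<open>(n + 1) * rate n\<close>: the operator \<open>T\<close> multiplies the
  leading coefficient by \<open>- rate n\<close> while raising the degree to \<open>n + 1\<close>,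
  and the derivative contributes the factor \<open>n + 1\<close>.\<close>

definition eig :: "nat \<Rightarrow> real" where "eig n = (real n + 1) * (real n + S)"

definition al :: "nat \<Rightarrow> real" where "al n = a_star a b c (Suc n)"

definition be :: "nat \<Rightarrow> real" where "be n = mu_star a b c (n - 1) * lambda_star a b c n"

text \<open>The monic multiples of \<open>p_tilde\<close>, whose recurrence contains no square
  roots. The indices are offset: \<open>al n\<close> is \<open>a_star\<close> at
  \<open>n + 1\<close>, whereas \<open>be n\<close> is the square of \<open>b_star\<close> at
  \<open>n\<close>.\<close>

fun mp :: "nat \<Rightarrow> real poly" where
  "mp 0 = 1"
| "mp (Suc 0) = [:- al 0, 1:]"
| "mp (Suc (Suc n)) = [:- al (Suc n), 1:] * mp (Suc n) - smult (be (Suc n)) (mp n)"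

text \<open>The recursion coefficients are rational functions of \<open>Tn n\<close>, and besides
  \<open>S\<close> they depend on \<open>S - 2 * c\<close> and \<open>b - a\<close> only through the
  product \<open>S * G\<close> and the sum of squares \<open>W\<close>.\<close>

definition Tn :: "nat \<Rightarrow> real" where "Tn n = 2 * real n + S"
definition G :: real where "G = (S - 2 * c) * (b - a) / S"
definition W :: real where "W = (S - 2 * c)\<^sup>2 + (b - a)\<^sup>2"

lemma al_eq: "al n = 1 / 2 - S * G / (2 * Tn n * (Tn n + 2))"
proof -
  have T: "Tn n > 0" using S_pos by (simp add: Tn_def)
  have SG: "S * G = (S - 2 * c) * (b - a)" using S_pos by (simp add: G_def)
  have 1: "lambda_star a b c n = ((Tn n - (b - a)) / 2 * ((Tn n + (S - 2 * c)) / 2)) / (Tn n * (Tn n + 1))"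
  proof -
    have r: "real n + c + a + 1 = (Tn n - (b - a)) / 2" "real n + c + a + b + 2 = (Tn n + (S - 2 * c)) / 2"
      "2 * real n + 2 * c + a + b + 2 = Tn n" "2 * real n + 2 * c + a + b + 3 = Tn n + 1"
      by (simp_all add: Tn_def S_def)
    show ?thesis unfolding lambda_star_def r by (rule times_divide_times_eq)
  qed
  have 2: "mu_star a b c n = (((Tn n + 2) - (S - 2 * c)) / 2 * (((Tn n + 2) + (b - a)) / 2)) / ((Tn n + 1) * (Tn n + 2))"
  proof -
    have r: "real n + c + 1 = ((Tn n + 2) - (S - 2 * c)) / 2" "real n + c + b + 2 = ((Tn n + 2) + (b - a)) / 2"
      "2 * real n + 2 * c + a + b + 3 = Tn n + 1" "2 * real n + 2 * c + a + b + 4 = Tn n + 2"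
      by (simp_all add: Tn_def S_def)
    show ?thesis unfolding mu_star_def r by (rule times_divide_times_eq)
  qed
  have id: "((t - d) / 2 * ((t + x) / 2)) / (t * (t + 1)) + (((t + 2) - x) / 2 * (((t + 2) + d) / 2)) / ((t + 1) * (t + 2)) =
      1 / 2 - x * d / (2 * t * (t + 2))" if "t > 0" for t d x :: real
  proof -
    have "t \<noteq> 0" "t + 1 \<noteq> 0" "t + 2 \<noteq> 0" using that by auto
    then show ?thesis by (simp add: divide_simps) algebra
  qed
  show ?thesis unfolding al_def a_star_def diff_Suc_1 1 2 SG by (rule id[OF T])
qed

lemma be_eq:
  assumes "n \<ge> 1"
  shows "be n = (Tn n ^ 4 - W * (Tn n)\<^sup>2 + S\<^sup>2 * G\<^sup>2) / (16 * (Tn n - 1) * (Tn n)\<^sup>2 * (Tn n + 1))"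
proof -
  have T: "Tn n > 1" using S_pos assms by (simp add: Tn_def)
  have SG: "S\<^sup>2 * G\<^sup>2 = ((S - 2 * c) * (b - a))\<^sup>2" using S_pos by (simp add: G_def power_divide)
  have rn: "real (n - 1) = real n - 1" using assms by simp
  have 1: "lambda_star a b c n = ((Tn n - (b - a)) / 2 * ((Tn n + (S - 2 * c)) / 2)) / (Tn n * (Tn n + 1))"
  proof -
    have r: "real n + c + a + 1 = (Tn n - (b - a)) / 2" "real n + c + a + b + 2 = (Tn n + (S - 2 * c)) / 2"
      "2 * real n + 2 * c + a + b + 2 = Tn n" "2 * real n + 2 * c + a + b + 3 = Tn n + 1"
      by (simp_all add: Tn_def S_def)
    show ?thesis unfolding lambda_star_def r by (rule times_divide_times_eq)
  qed
  have 2: "mu_star a b c (n - 1) = ((Tn n - (S - 2 * c)) / 2 * ((Tn n + (b - a)) / 2)) / ((Tn n - 1) * Tn n)"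
  proof -
    have r: "real n - 1 + c + 1 = (Tn n - (S - 2 * c)) / 2" "real n - 1 + c + b + 2 = (Tn n + (b - a)) / 2"
      "2 * (real n - 1) + 2 * c + a + b + 3 = Tn n - 1" "2 * (real n - 1) + 2 * c + a + b + 4 = Tn n"
      by (simp_all add: Tn_def S_def)
    show ?thesis unfolding mu_star_def rn r by (rule times_divide_times_eq)
  qed
  have id: "((t - x) / 2 * ((t + d) / 2)) / ((t - 1) * t) * (((t - d) / 2 * ((t + x) / 2)) / (t * (t + 1))) =
     (t ^ 4 - (x\<^sup>2 + d\<^sup>2) * t\<^sup>2 + (x * d)\<^sup>2) / (16 * (t - 1) * t\<^sup>2 * (t + 1))" if "t > 1" for t d x :: real
  proof -
    have "t \<noteq> 0" "t + 1 \<noteq> 0" "t - 1 \<noteq> 0" using that by auto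
    then show ?thesis by (simp add: divide_simps) algebra
  qed
  show ?thesis unfolding be_def 1 2 SG W_def by (rule id[OF T])
qed

lemma be_pos:
  assumes "n \<ge> 1" shows "be n > 0"
proof -
  have n: "real n \<ge> 1" using assms by simp
  have "lambda_star a b c n > 0" unfolding lambda_star_def using a b c n
    by (intro mult_pos_pos divide_pos_pos) auto
  moreover have "mu_star a b c (n - 1) > 0" unfolding mu_star_def using a b c
    by (intro mult_pos_pos divide_pos_pos) auto
  ultimately show ?thesis by (simp add: be_def)
qed

text \<open>Closed forms of the second and third coefficient of \<open>mp n\<close>.\<close>

definition ec :: "nat \<Rightarrow> real" where "ec n = - (Tn n - S) * (Tn n - G) / (4 * Tn n)"

definition fc :: "nat \<Rightarrow> real" where
  "fc n = - (Tn n - S - 2) / (4 * (Tn n - 1)) * ((S\<^sup>2 - W + G\<^sup>2) / (8 * (S + 1)) - (Tn n - 2 - G) * (Tn n - S) * (Tn n - G) / (8 * Tn n))"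

lemma Tn_Suc: "Tn (Suc n) = Tn n + 2" by (simp add: Tn_def)

lemma Tn_pos: "Tn n > 0" using S_pos by (simp add: Tn_def)

text \<open>The closed forms are what the eigenvalue equation prescribes for the second and third
  coefficients. That they obey the recurrence of \<open>mp\<close> is the point where the given
  recursion coefficients meet the loop equation.\<close>

lemma ec_Suc: "ec (Suc n) = ec n - al n"
proof -
  have "t > 0 \<Longrightarrow> - (t + 2 - s) * (t + 2 - g) / (4 * (t + 2)) = - (t - s) * (t - g) / (4 * t) - (1 / 2 - s * g / (2 * t * (t + 2)))" for t s g :: real
    by (simp add: divide_simps) algebra
  from this[OF Tn_pos] show ?thesis unfolding ec_def al_eq Tn_Suc .
qed

lemma fc_Suc:
  assumes "n \<ge> 1"
  shows "fc (Suc n) = fc n - al n * ec n - be n"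
proof -
  have T: "Tn n > 1" using S_pos assms by (simp add: Tn_def)
  have al: "al n = ec n - ec (Suc n)" by (simp add: ec_Suc)
  show ?thesis unfolding al unfolding fc_def ec_def be_eq[OF assms] Tn_Suc
    by (rule second_coeff_recurrence) (use T S_pos in auto)
qed

lemma coeff_linear_mult: "coeff ([:k, 1:] * q) i = k * coeff q i + (if i = 0 then 0 else coeff q (i - 1))" for q :: "real poly"
  by (cases i) simp_all

lemma mp_lead: "(\<forall>i>n. coeff (mp n) i = 0) \<and> coeff (mp n) n = 1"
proof (induction n rule: mp.induct)
  case 2
  show ?case by (auto simp: coeff_eq_0)
next
  case (3 n)
  then show ?case by (simp del: mult_pCons_left add: coeff_linear_mult)
qed (auto simp: coeff_eq_0)

lemma coeff_mp_ec: "coeff (mp (Suc n)) n = ec (Suc n)"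
proof (induction n)
  case 0
  have "ec 0 = 0" by (simp add: ec_def Tn_def)
  then show ?case by (simp add: ec_Suc)
next
  case (Suc n)
  then show ?case using mp_lead[of "Suc n"] mp_lead[of n] by (simp del: mult_pCons_left add: coeff_linear_mult ec_Suc[of "Suc n"])
qed

lemma coeff_mp_fc: "coeff (mp (Suc (Suc n))) n = fc (Suc (Suc n))"
proof (induction n)
  case 0
  \<comment> \<open>The polynomial of degree 1 has no third coefficient, and the closed form agrees:
    its factor \<open>Tn n - S - 2\<close> vanishes at \<open>n = 1\<close>.\<close>
  have "fc (Suc 0) = 0" by (simp add: fc_def Tn_def)
  then show ?case using mp_lead[of 0] coeff_mp_ec[of 0] fc_Suc[of "Suc 0"] by (simp del: mult_pCons_left mp.simps(2) add: coeff_linear_mult)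
next
  case (Suc n)
  then show ?case using mp_lead[of "Suc n"] coeff_mp_ec[of "Suc n"] fc_Suc[of "Suc (Suc n)"]
    by (simp del: mult_pCons_left mp.simps(3) add: coeff_linear_mult mp.simps(3)[of "Suc n"])
qed

section \<open>The first two limiting moments in terms of the parameters\<close>

lemma mom_1: "mom 1 = (c + a + 1) / S"
  unfolding One_nat_def by (simp add: jmom.simps(2) S_def algebra_simps)

definition Z :: real where "Z = mom 1 - mom 2"

lemma Z_eq: "Z = (c + a + 1) * (c + b + 1) * (c + a + b + 2) / (S\<^sup>2 * (S + 1))"
proof -
  define p where "p = c + a + 1"
  have m1: "mom 1 = p / S" by (simp add: mom_1 p_def)
  have "mom 2 = ((2 + a) * mom 1 + c * (2 * mom 1 - mom 1 * mom 1)) / (S + 1)"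
    using jmom.simps(2)[of a b c 1] by (simp add: One_nat_def numeral_2_eq_2 S_def algebra_simps)
  then have m2: "mom 2 = ((2 + (p - c - 1)) * (p / S) + c * (2 * (p / S) - p / S * (p / S))) / (S + 1)"
    unfolding m1 by (simp add: p_def)
  have q: "c + b + 1 = S - p" "c + a + b + 2 = S - c" by (simp_all add: p_def S_def)
  show ?thesis unfolding Z_def m1 m2 q p_def[symmetric] using S_pos
    by (simp add: divide_simps power2_eq_square) algebra
qed

lemma Z_pos: "Z > 0"
  unfolding Z_eq using a b c S_pos by (intro divide_pos_pos mult_pos_pos) auto

text \<open>The coefficient of \<open>x ^ k\<close> in \<open>lin_drift k\<close>, one place below
  the leading one.\<close>

definition diag1 :: "nat \<Rightarrow> real" where "diag1 k = real k + 1 + a + 2 * c * (1 - mom 1)"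

lemma diag1_eq: "diag1 k = (2 * real k + S - G) / 2"
proof -
  have SG: "S * G = (S - 2 * c) * (b - a)" using S_pos by (simp add: G_def)
  have "S * (2 * real k + S - G) = S * (2 * real k + S) - S * G" by (simp add: algebra_simps)
  also have "\<dots> = 2 * (S * (real k + 1 + a + 2 * c) - 2 * c * (c + a + 1))"
    unfolding SG unfolding S_def by algebra
  finally show ?thesis unfolding diag1_def mom_1 using S_pos by (simp add: field_simps)
qed

text \<open>\<open>2 * c * Z\<close> is the coefficient of \<open>lin_drift\<close> two places below
  the leading one. In the variables \<open>S\<close>, \<open>W\<close>, \<open>G\<close> it is the
  constant \<open>K\<close> of the rational identity, so the moments fit the closed form
  \<open>fc\<close>.\<close>

lemma cZ_eq: "2 * c * Z = (S\<^sup>2 - W + G\<^sup>2) / (8 * (S + 1))"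
proof -
  define E where "E = S - 2 * c"
  define D where "D = b - a"
  have r: "c + a + 1 = (S - D) / 2" "c + b + 1 = (S + D) / 2" "c + a + b + 2 = (S + E) / 2" "c = (S - E) / 2"
    by (simp_all add: E_def D_def S_def)
  have "2 * c * Z = 2 * ((S - E) / 2) * (((S - D) / 2) * ((S + D) / 2) * ((S + E) / 2) / (S\<^sup>2 * (S + 1)))"
  proof -
    have "2 * c * Z = 2 * c * (((S - D) / 2) * ((S + D) / 2) * ((S + E) / 2) / (S\<^sup>2 * (S + 1)))"
      unfolding Z_eq r(1-3) ..
    moreover have "2 * c = 2 * ((S - E) / 2)" by (simp add: E_def)
    ultimately show ?thesis by (simp only:)
  qed
  also have "\<dots> = (S\<^sup>2 - (E\<^sup>2 + D\<^sup>2) + (E * D / S)\<^sup>2) / (8 * (S + 1))"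
    using S_pos by (simp add: divide_simps power2_eq_square) algebra
  finally show ?thesis by (simp add: W_def G_def E_def D_def)
qed

section \<open>The top three coefficients of the eigenvalue equation\<close>

lemma coeff_lin_drift_Suc: "coeff (lin_drift k) (Suc k) = - rate k"
proof -
  have "(\<Sum>p<Suc k. coeff (monom (mom p) (k - p)) (Suc k)) = 0"
    by (intro sum.neutral) auto
  moreover have "(\<Sum>p<Suc (Suc k). coeff (monom (mom p) (Suc k - p)) (Suc k)) = (\<Sum>p\<in>{0::nat}. mom 0)"
    by (intro sum.mono_neutral_cong_right) auto
  ultimately show ?thesis
    by (simp add: lin_drift_def coeff_sum rate_def del: sum.lessThan_Suc)
qed

lemma coeff_lin_drift_above: "i > Suc k \<Longrightarrow> coeff (lin_drift k) i = 0"
proof -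
  assume i: "i > Suc k"
  have "(\<Sum>p<Suc k. coeff (monom (mom p) (k - p)) i) = 0" "(\<Sum>p<Suc (Suc k). coeff (monom (mom p) (Suc k - p)) i) = 0"
    using i by (intro sum.neutral; auto)+
  then show ?thesis using i
    by (simp add: lin_drift_def coeff_sum del: sum.lessThan_Suc)
qed

lemma coeff_lin_drift_diag: "coeff (lin_drift k) k = diag1 k"
proof -
  have "(\<Sum>p<Suc k. coeff (monom (mom p) (k - p)) k) = (\<Sum>p\<in>{0::nat}. mom 0)"
    by (intro sum.mono_neutral_cong_right) auto
  moreover have "(\<Sum>p<Suc (Suc k). coeff (monom (mom p) (Suc k - p)) k) = (\<Sum>p\<in>{1::nat}. mom 1)"
    by (intro sum.mono_neutral_cong_right) (auto simp: One_nat_def)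
  ultimately show ?thesis
    by (simp add: lin_drift_def coeff_sum diag1_def del: sum.lessThan_Suc)
qed

lemma coeff_lin_drift_sub: "coeff (lin_drift (Suc k)) k = 2 * c * Z"
proof -
  have "(\<Sum>p<Suc (Suc k). coeff (monom (mom p) (Suc k - p)) k) = (\<Sum>p\<in>{1::nat}. mom 1)"
    by (intro sum.mono_neutral_cong_right) (auto simp: One_nat_def)
  moreover have "(\<Sum>p<Suc (Suc (Suc k)). coeff (monom (mom p) (Suc (Suc k) - p)) k) = (\<Sum>p\<in>{2::nat}. mom 2)"
    by (intro sum.mono_neutral_cong_right) auto
  ultimately show ?thesis
    by (simp add: lin_drift_def coeff_sum Z_def del: sum.lessThan_Suc)
qed

lemma drift_op_eq: "degree p \<le> n \<Longrightarrow> drift_op p = (\<Sum>k\<le>n. smult (coeff p k) (lin_drift k))"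
  unfolding drift_op_def by (intro sum.mono_neutral_left) (auto simp: coeff_eq_0)

lemma drift_op_add: "drift_op (p + q) = drift_op p + drift_op q"
proof -
  let ?n = "max (degree p) (degree q)"
  have "degree (p + q) \<le> ?n" by (rule degree_add_le_max)
  then show ?thesis
    by (simp add: drift_op_eq[of "p + q" ?n] drift_op_eq[of p ?n] drift_op_eq[of q ?n] smult_add_left sum.distrib)
qed

lemma drift_op_smult: "drift_op (smult k p) = smult k (drift_op p)"
  by (simp add: drift_op_eq[of "smult k p" "degree p"] drift_op_def degree_smult_le poly_eq_iff coeff_sum sum_distrib_left mult.assoc)

lemma drift_op_0 [simp]: "drift_op 0 = 0" by (simp add: drift_op_def)

lemma drift_op_sum: "drift_op (\<Sum>i\<in>I. p i) = (\<Sum>i\<in>I. drift_op (p i))"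
  by (induction I rule: infinite_finite_induct) (auto simp: drift_op_add)

lemma degree_mp: "degree (mp n) = n"
proof -
  have "degree (mp n) \<le> n" using mp_lead[of n] by (intro degree_le) auto
  moreover have "n \<le> degree (mp n)" using mp_lead[of n] by (intro le_degree) auto
  ultimately show ?thesis by simp
qed

lemma coeff_drift_op: "degree p \<le> n \<Longrightarrow> coeff (drift_op p) i = (\<Sum>k\<le>n. coeff p k * coeff (lin_drift k) i)"
  by (simp add: drift_op_eq coeff_sum)

text \<open>The defect in the eigenvalue equation for \<open>mp n\<close>.\<close>

definition res :: "nat \<Rightarrow> real poly" where "res n = pderiv (drift_op (mp n)) + smult (eig n) (mp n)"

lemma coeff_res: "coeff (res n) i = real (Suc i) * (\<Sum>k\<le>n. coeff (mp n) k * coeff (lin_drift k) (Suc i)) + eig n * coeff (mp n) i"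
  by (simp add: res_def coeff_pderiv coeff_drift_op[of _ n] degree_mp)

lemma coeff_res_above: "i > n \<Longrightarrow> coeff (res n) i = 0"
  using mp_lead[of n] by (simp add: coeff_res coeff_lin_drift_above)

lemma coeff_res_top: "coeff (res n) n = 0"
proof -
  have "(\<Sum>k\<le>n. coeff (mp n) k * coeff (lin_drift k) (Suc n)) = (\<Sum>k\<in>{n}. coeff (mp n) k * coeff (lin_drift k) (Suc n))"
    by (intro sum.mono_neutral_right) (auto simp: coeff_lin_drift_above)
  then have 1: "(\<Sum>k\<le>n. coeff (mp n) k * coeff (lin_drift k) (Suc n)) = - rate n"
    using mp_lead[of n] by (simp add: coeff_lin_drift_Suc)
  show ?thesis unfolding coeff_res 1 using mp_lead[of n]
    by (simp add: eig_def rate_S algebra_simps)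
qed

lemma coeff_res_1: "coeff (res (Suc n)) n = 0"
proof -
  have "(\<Sum>k\<le>Suc n. coeff (mp (Suc n)) k * coeff (lin_drift k) (Suc n)) = (\<Sum>k\<in>{n, Suc n}. coeff (mp (Suc n)) k * coeff (lin_drift k) (Suc n))"
    by (intro sum.mono_neutral_right) (auto simp: coeff_lin_drift_above)
  then have 1: "coeff (res (Suc n)) n = real (Suc n) * (ec (Suc n) * - rate n + diag1 (Suc n)) + eig (Suc n) * ec (Suc n)"
    using mp_lead[of "Suc n"] by (simp add: coeff_res coeff_lin_drift_Suc coeff_lin_drift_diag coeff_mp_ec del: of_nat_Suc)
  have t: "Tn (Suc n) = 2 * real n + 2 + S" by (simp add: Tn_def)
  have "Tn (Suc n) * ec (Suc n) = - (Tn (Suc n) - S) * (Tn (Suc n) - G) / 4"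
    using Tn_pos[of "Suc n"] by (simp add: ec_def)
  then have "Tn (Suc n) * ec (Suc n) = - real (Suc n) * diag1 (Suc n)"
    by (simp add: diag1_eq t field_simps)
  then show ?thesis unfolding 1 t by (simp add: eig_def rate_S algebra_simps)
qed

lemma coeff_res_2: "coeff (res (Suc (Suc n))) n = 0"
proof -
  let ?m = "Suc (Suc n)"
  \<comment> \<open>\<open>lin_drift k\<close> has degree \<open>k + 1\<close>, so nothing below
    \<open>k = n\<close> reaches the coefficient of \<open>x ^ (n + 1)\<close>, which becomes that
    of \<open>x ^ n\<close> after differentiation.\<close>
  have "(\<Sum>k\<le>?m. coeff (mp ?m) k * coeff (lin_drift k) (Suc n)) = (\<Sum>k\<in>{n, Suc n, ?m}. coeff (mp ?m) k * coeff (lin_drift k) (Suc n))"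
    by (intro sum.mono_neutral_right) (auto simp: coeff_lin_drift_above)
  then have 1: "coeff (res ?m) n = real (Suc n) * (fc ?m * - rate n + ec ?m * diag1 (Suc n) + 2 * c * Z) + eig ?m * fc ?m"
    using mp_lead[of ?m] coeff_mp_ec[of "Suc n"] coeff_mp_fc[of n]
    by (simp add: coeff_res coeff_lin_drift_Suc coeff_lin_drift_diag coeff_lin_drift_sub del: of_nat_Suc mp.simps)
  have t: "Tn ?m = 2 * real n + 4 + S" by (simp add: Tn_def)
  have "4 * (Tn ?m - 1) * fc ?m = - (Tn ?m - S - 2) * (2 * c * Z - (Tn ?m - 2 - G) * (Tn ?m - S) * (Tn ?m - G) / (8 * Tn ?m))"
    using S_pos t unfolding fc_def cZ_eq by simp
  moreover have "(Tn ?m - 2 - G) * (Tn ?m - S) * (Tn ?m - G) / (8 * Tn ?m) = - diag1 (Suc n) * ec ?m"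
  proof -
    have d: "diag1 (Suc n) = (Tn ?m - 2 - G) / 2" by (simp add: diag1_eq t)
    have "u * v * w / (8 * t) = - (u / 2) * (- v * w / (4 * t))" for u v w t :: real by simp
    then show ?thesis unfolding d ec_def by blast
  qed
  ultimately have "4 * (Tn ?m - 1) * fc ?m = - (2 * real (Suc n)) * (2 * c * Z + diag1 (Suc n) * ec ?m)"
    by (simp add: t)
  then have 2: "2 * (2 * real n + 3 + S) * fc ?m = - (real (Suc n)) * (2 * c * Z + diag1 (Suc n) * ec ?m)"
    by (simp add: t algebra_simps)
  have "coeff (res ?m) n = real (Suc n) * (2 * c * Z + diag1 (Suc n) * ec ?m) + (eig ?m - real (Suc n) * rate n) * fc ?m"
    unfolding 1 by (simp add: algebra_simps)
  also have "eig ?m - real (Suc n) * rate n = 2 * (2 * real n + 3 + S)"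
    by (simp add: eig_def rate_S algebra_simps)
  finally show ?thesis unfolding 2 by algebra
qed

section \<open>The bilinear form of the weighted moments and orthogonality\<close>

text \<open>Up to the factor \<open>Z\<close> the inner product of the weighted limiting measure. It
  is defined through the moments alone, so its positivity is not automatic and has to be
  earned.\<close>

definition ip :: "real poly \<Rightarrow> real poly \<Rightarrow> real" where "ip p q = mfun (p * (wt * q))"

lemma ip_commute: "ip p q = ip q p" by (simp only: ip_def mult_ac)

lemma ip_add: "ip (p + q) r = ip p r + ip q r" by (simp only: ip_def distrib_right mfun_add)

lemma ip_smult: "ip (smult k p) r = k * ip p r" by (simp only: ip_def mult_smult_left mfun_smult)

lemma ip_diff: "ip (p - q) r = ip p r - ip q r" by (simp only: ip_def left_diff_distrib mfun_diff)

lemma ip_0 [simp]: "ip 0 r = 0" by (simp add: ip_def)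

lemma ip_sum: "ip (\<Sum>i\<in>I. p i) r = (\<Sum>i\<in>I. ip (p i) r)"
  by (induction I rule: infinite_finite_induct) (auto simp: ip_add)

lemma ip_mult: "ip (x * p) q = ip p (x * q)" by (simp only: ip_def mult_ac)

text \<open>Self-adjointness of \<open>p \<mapsto> (T p)'\<close>, a restatement of the symmetry of
  the limiting covariances.\<close>

lemma ip_drift: "ip (pderiv (drift_op p)) q = ip p (pderiv (drift_op q))"
proof -
  have "ip (pderiv (drift_op p)) q = ip (pderiv (drift_op q)) p"
    unfolding ip_def by (rule drift_op_symmetric)
  then show ?thesis by (simp only: ip_commute)
qed

lemma eig_strict: "i < j \<Longrightarrow> eig i < eig j"
  unfolding eig_def using S_pos by (intro mult_strict_mono) auto

lemma eig_inj: "i \<noteq> j \<Longrightarrow> eig i \<noteq> eig j"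
  by (metis eig_strict linorder_neqE_nat less_irrefl)

lemma orth_of_eigen:
  assumes "res i = 0" "res j = 0" "i \<noteq> j"
  shows "ip (mp i) (mp j) = 0"
proof -
  have "pderiv (drift_op (mp i)) = smult (- eig i) (mp i)" "pderiv (drift_op (mp j)) = smult (- eig j) (mp j)"
    using assms(1,2) by (simp_all add: res_def eq_neg_iff_add_eq_0)
  with ip_drift[of "mp i" "mp j"] have "- eig i * ip (mp i) (mp j) = - eig j * ip (mp i) (mp j)"
    by (simp only: ip_smult ip_commute[of "mp i" "smult _ _"]) (simp add: ip_commute)
  then show ?thesis using eig_inj[OF assms(3)] by simp
qed

lemma x_mp: "[:0, 1:] * mp (Suc n) = mp (Suc (Suc n)) + smult (al (Suc n)) (mp (Suc n)) + smult (be (Suc n)) (mp n)"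
proof -
  have "[:- al (Suc n), 1:] * mp (Suc n) = [:0, 1:] * mp (Suc n) - smult (al (Suc n)) (mp (Suc n))"
    by simp
  then show ?thesis by (simp del: mult_pCons_left)
qed

lemma x_mp_0: "[:0, 1:] * mp 0 = mp (Suc 0) + smult (al 0) (mp 0)"
  by simp

text \<open>Multiplication by \<open>x\<close> can be moved to the other argument, where the
  recurrence raises the index by one at most.\<close>

lemma ip_x_mp:
  assumes "\<And>i. i \<le> Suc j \<Longrightarrow> ip p (mp i) = 0"
  shows "ip ([:0, 1:] * p) (mp j) = 0"
proof -
  have "ip ([:0, 1:] * p) (mp j) = ip p ([:0, 1:] * mp j)" by (rule ip_mult)
  also have "\<dots> = ip ([:0, 1:] * mp j) p" by (rule ip_commute)
  also have "\<dots> = 0"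
  proof (cases j)
    case 0
    then show ?thesis unfolding 0 x_mp_0 ip_add ip_smult using assms[of 0] assms[of "Suc 0"] by (simp add: ip_commute)
  next
    case (Suc i)
    show ?thesis unfolding Suc x_mp ip_add ip_smult using assms[of i] assms[of "Suc i"] assms[of "Suc (Suc i)"] Suc
      by (simp only: ip_commute[of _ p])
  qed
  finally show ?thesis .
qed

text \<open>The form of \<open>x * mp n\<close> and \<open>mp (n + 1)\<close> is computed by
  expanding \<open>x * mp n\<close> and by expanding \<open>x * mp (n + 1)\<close>. The second
  expansion contains \<open>mp (n + 2)\<close>, hence the range of the assumption.\<close>

lemma norm_step:
  assumes "\<And>i. i \<le> Suc (Suc n) \<Longrightarrow> res i = 0"
  shows "ip (mp (Suc n)) (mp (Suc n)) = be (Suc n) * ip (mp n) (mp n)"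
proof -
  have o1: "ip (mp (Suc n)) (mp n) = 0" and o2: "ip (mp (Suc (Suc n))) (mp n) = 0"
    by (intro orth_of_eigen assms; simp)+
  have "ip (mp (Suc n)) ([:0, 1:] * mp n) = ip (mp (Suc n)) (mp (Suc n))"
  proof (cases n)
    case 0
    have "ip (mp (Suc n)) ([:0, 1:] * mp n) = ip (mp (Suc 0) + smult (al 0) (mp 0)) (mp (Suc 0))"
      unfolding 0 x_mp_0 by (rule ip_commute)
    then show ?thesis using o1 by (simp only: 0 ip_add ip_smult ip_commute[of "mp 0" "mp (Suc 0)"] mult_zero_right add_0_right)
  next
    case (Suc m)
    have "ip (mp (Suc n)) ([:0, 1:] * mp n) = ip (mp (Suc n) + smult (al n) (mp n) + smult (be n) (mp m)) (mp (Suc n))"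
      unfolding Suc x_mp by (rule ip_commute)
    also have "\<dots> = ip (mp (Suc n)) (mp (Suc n)) + be n * ip (mp m) (mp (Suc n))"
      using o1 by (simp only: ip_add ip_smult ip_commute[of "mp n" "mp (Suc n)"] mult_zero_right add_0_right)
    finally have 1: "ip (mp (Suc n)) ([:0, 1:] * mp n) = ip (mp (Suc n)) (mp (Suc n)) + be n * ip (mp m) (mp (Suc n))" .
    have "ip (mp m) (mp (Suc n)) = 0" using Suc by (intro orth_of_eigen assms) auto
    then show ?thesis using 1 by simp
  qed
  moreover have "ip (mp (Suc n)) ([:0, 1:] * mp n) = ip ([:0, 1:] * mp (Suc n)) (mp n)" by (rule ip_mult[symmetric])
  moreover have "ip ([:0, 1:] * mp (Suc n)) (mp n) = be (Suc n) * ip (mp n) (mp n)"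
    unfolding x_mp ip_add ip_smult o1 o2 by simp
  ultimately show ?thesis by simp
qed

text \<open>Positivity is propagated from \<open>Z > 0\<close> by the positive factors
  \<open>be\<close>. It holds only as far as the eigenvalue equation is known, which is what an
  induction proving that equation can use.\<close>

lemma norm_pos:
  assumes "\<And>i. i \<le> Suc n \<Longrightarrow> res i = 0"
  shows "ip (mp n) (mp n) > 0"
  using assms
proof (induction n)
  case 0
  have "ip (mp 0) (mp 0) = mfun (monom 1 1 - monom 1 2)"
    by (simp add: ip_def numeral_2_eq_2 One_nat_def monom_Suc monom_0)
  then show ?case using Z_pos by (simp add: mfun_diff mfun_monom Z_def)
next
  case (Suc n)
  have "ip (mp n) (mp n) > 0" by (rule Suc.IH) (use Suc.prems in simp)
  then show ?case using norm_step[of n] Suc.prems be_pos[of "Suc n"] by simp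
qed

lemma mp_span:
  assumes "\<And>i. i \<ge> m \<Longrightarrow> coeff r i = 0"
  shows "\<exists>d. r = (\<Sum>j<m. smult (d j) (mp j))"
  using assms
proof (induction m arbitrary: r)
  case 0
  then show ?case by (auto simp: poly_eq_iff)
next
  case (Suc m)
  define q where "q = r - smult (coeff r m) (mp m)"
  have "coeff q i = 0" if "i \<ge> m" for i
    using that mp_lead[of m] Suc.prems[of i] by (cases "i = m") (auto simp: q_def)
  from Suc.IH[OF this] obtain d where d: "q = (\<Sum>j<m. smult (d j) (mp j))" by blast
  have "r = (\<Sum>j<m. smult (d j) (mp j)) + smult (coeff r m) (mp m)" using d by (simp add: q_def algebra_simps)
  also have "\<dots> = (\<Sum>j<Suc m. smult ((d(m := coeff r m)) j) (mp j))" by simp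
  finally show ?case by blast
qed

text \<open>The residue of the eigenvalue equation has vanishing top three coefficients, and by the
  symmetry of the operator it is orthogonal to all polynomials of the remaining degrees.\<close>

lemma res_zero: "res n = 0"
proof (induction n rule: less_induct)
  case (less n)
  \<comment> \<open>Subtraction on naturals truncates: for \<open>n \<le> 2\<close> all indices are
    covered, and the span below is empty.\<close>
  have top: "coeff (res n) i = 0" if "i \<ge> n - 2" for i
  proof -
    have "i > n \<or> i = n \<or> n = Suc i \<or> n = Suc (Suc i)" using that by presburger
    then show ?thesis by (auto simp: coeff_res_above coeff_res_top coeff_res_1 coeff_res_2 simp del: mp.simps)
  qed
  obtain d where d: "res n = (\<Sum>j<n - 2. smult (d j) (mp j))" using mp_span[OF top] by blast
  have "d j = 0" if j: "j < n - 2" for j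
  proof -
    obtain m where n: "n = Suc (Suc m)" and jm: "j < m" using j by (metis Suc_diff_Suc diff_diff_left less_imp_Suc_add add_2_eq_Suc' zero_less_diff le_add_diff_inverse2 add_Suc_right add_diff_inverse_nat not_less_zero diff_is_0_eq' nat_le_linear less_or_eq_imp_le One_nat_def)
    have orth: "ip (mp i) (mp i') = 0" if "i \<noteq> i'" "i < n" "i' < n" for i i'
      by (rule orth_of_eigen) (use less.IH that in auto)
    \<comment> \<open>This requires the eigenvalue equation up to index \<open>j + 1\<close>, which
      is below \<open>n\<close> because \<open>j < m\<close>.\<close>
    have pos: "ip (mp j) (mp j) > 0" by (rule norm_pos) (use less.IH n jm in auto)
    \<comment> \<open>The eigenvalue equation for \<open>n\<close> is not yet known, so
      orthogonality to \<open>mp j\<close> is obtained from the recurrence and the orthogonality of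
      the earlier polynomials.\<close>
    have "ip (mp n) (mp j) = ip ([:- al (Suc m), 1:] * mp (Suc m) - smult (be (Suc m)) (mp m)) (mp j)"
      unfolding n mp.simps ..
    also have "\<dots> = ip ([:0, 1:] * mp (Suc m)) (mp j) - al (Suc m) * ip (mp (Suc m)) (mp j) - be (Suc m) * ip (mp m) (mp j)"
    proof -
      have "[:- al (Suc m), 1:] * mp (Suc m) = [:0, 1:] * mp (Suc m) - smult (al (Suc m)) (mp (Suc m))" by simp
      then show ?thesis by (simp only: ip_diff ip_smult)
    qed
    also have "\<dots> = 0"
    proof -
      have "ip ([:0, 1:] * mp (Suc m)) (mp j) = 0" by (rule ip_x_mp, rule orth) (use n jm in auto)
      moreover have "ip (mp (Suc m)) (mp j) = 0" "ip (mp m) (mp j) = 0" by (rule orth; use n jm in auto)+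
      ultimately show ?thesis by simp
    qed
    finally have nj: "ip (mp n) (mp j) = 0" .
    have "pderiv (drift_op (mp j)) = smult (- eig j) (mp j)"
      using less.IH[of j] j by (simp add: res_def eq_neg_iff_add_eq_0)
    then have "ip (res n) (mp j) = ip (mp n) (smult (- eig j) (mp j)) + eig n * ip (mp n) (mp j)"
      by (simp only: res_def ip_add ip_smult ip_drift)
    also have "\<dots> = 0" using nj by (simp only: ip_commute[of "mp n" "smult _ _"] ip_smult ip_commute[of "mp j" "mp n"] mult_zero_right add_0_right)
    finally have "0 = ip (res n) (mp j)" ..
    also have "\<dots> = (\<Sum>i<n - 2. d i * ip (mp i) (mp j))" unfolding d ip_sum ip_smult ..
    also have "\<dots> = (\<Sum>i\<in>{j}. d i * ip (mp i) (mp j))"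
      using j orth by (intro sum.mono_neutral_right) auto
    finally show ?thesis using pos by simp
  qed
  then show ?case unfolding d by simp
qed

lemma mp_orth: "i \<noteq> j \<Longrightarrow> ip (mp i) (mp j) = 0"
  by (intro orth_of_eigen res_zero)

lemma mp_norm: "ip (mp n) (mp n) = (\<Prod>j\<in>{1..n}. be j) * Z"
proof (induction n)
  case 0
  have "ip (mp 0) (mp 0) = mfun (monom 1 1 - monom 1 2)"
    by (simp add: ip_def numeral_2_eq_2 One_nat_def monom_Suc monom_0)
  then show ?case by (simp add: mfun_diff mfun_monom Z_def)
next
  case (Suc n)
  then show ?case using norm_step[of n] res_zero by simp
qed

section \<open>Return to the orthonormal polynomials and their primitives\<close>

lemma b_star_be: "b_star a b c n = sqrt (be n)" by (simp add: b_star_def be_def)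

lemma p_tilde_mp: "p_tilde a b c n = smult (1 / sqrt (\<Prod>j\<in>{1..n}. be j)) (mp n)"
proof (induction n rule: mp.induct)
  case 2
  then show ?case by (simp add: b_star_be al_def One_nat_def)
next
  case (3 n)
  define Q where "Q = (\<Prod>j\<in>{1..n}. be j)"
  have Q: "Q > 0" unfolding Q_def by (intro prod_pos ballI be_pos) auto
  have b1: "be (Suc n) > 0" "be (Suc (Suc n)) > 0" using be_pos by simp_all
  have s1: "(\<Prod>j\<in>{1..Suc n}. be j) = Q * be (Suc n)" "(\<Prod>j\<in>{1..Suc (Suc n)}. be j) = Q * be (Suc n) * be (Suc (Suc n))"
    by (simp_all add: Q_def)
  have idx: "n + 2 = Suc (Suc n)" "n + 1 = Suc n" by simp_all
  have e: "sqrt (be (Suc n)) * (1 / sqrt Q) = 1 / sqrt (Q * be (Suc n)) * be (Suc n)"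
  proof -
    have "be (Suc n) = sqrt (be (Suc n)) * sqrt (be (Suc n))" using b1 by simp
    then show ?thesis using Q b1 by (simp add: real_sqrt_mult field_simps)
  qed
  have "p_tilde a b c (Suc (Suc n)) = smult (1 / sqrt (be (Suc (Suc n))))
     ([:- al (Suc n), 1:] * smult (1 / sqrt (Q * be (Suc n))) (mp (Suc n)) - smult (sqrt (be (Suc n))) (smult (1 / sqrt Q) (mp n)))"
    using 3 unfolding p_tilde.simps(3) idx s1 Q_def[symmetric] b_star_be al_def by (simp only:)
  also have "smult (sqrt (be (Suc n))) (smult (1 / sqrt Q) (mp n)) = smult (1 / sqrt (Q * be (Suc n))) (smult (be (Suc n)) (mp n))"
    by (simp only: smult_smult e)
  also have "smult (1 / sqrt (be (Suc (Suc n)))) ([:- al (Suc n), 1:] * smult (1 / sqrt (Q * be (Suc n))) (mp (Suc n)) - smult (1 / sqrt (Q * be (Suc n))) (smult (be (Suc n)) (mp n)))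
     = smult (1 / sqrt (be (Suc (Suc n))) * (1 / sqrt (Q * be (Suc n)))) (mp (Suc (Suc n)))"
    unfolding mp.simps by (simp only: mult_smult_right smult_diff_right smult_smult mult.assoc)
  also have "1 / sqrt (be (Suc (Suc n))) * (1 / sqrt (Q * be (Suc n))) = 1 / sqrt (\<Prod>j\<in>{1..Suc (Suc n)}. be j)"
    unfolding s1 by (simp add: real_sqrt_mult)
  finally show ?case .
qed simp

lemma p_tilde_eigen: "pderiv (drift_op (p_tilde a b c n)) = smult (- eig n) (p_tilde a b c n)"
proof -
  have "pderiv (drift_op (mp n)) = smult (- eig n) (mp n)"
    using res_zero[of n] by (simp add: res_def eq_neg_iff_add_eq_0)
  then show ?thesis by (simp add: p_tilde_mp drift_op_smult pderiv_smult mult.commute)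
qed

lemma p_tilde_ip: "ip (p_tilde a b c n) (p_tilde a b c m) = (if n = m then Z else 0)"
proof -
  define k where "k = (\<lambda>n. 1 / sqrt (\<Prod>j\<in>{1..n}. be j))"
  have "ip (p_tilde a b c n) (p_tilde a b c m) = k n * (k m * ip (mp m) (mp n))"
    unfolding p_tilde_mp ip_smult ip_commute[of "mp n" "smult _ _"] k_def ..
  also have "\<dots> = (if n = m then Z else 0)"
  proof (cases "n = m")
    case True
    define P where "P = (\<Prod>j\<in>{1..n}. be j)"
    have "P > 0" unfolding P_def by (intro prod_pos ballI be_pos) auto
    moreover have "k n = 1 / sqrt P" by (simp add: k_def P_def)
    ultimately have "k n * k n * (\<Prod>j\<in>{1..n}. be j) = 1" by (simp add: P_def[symmetric])
    then show ?thesis using True by (simp add: mp_norm flip: mult.assoc)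
  next
    case False
    then show ?thesis using mp_orth[of m n] by simp
  qed
  finally show ?thesis .
qed

text \<open>The eigenvalue equation holds after differentiation, which leaves an unknown constant.
  It is harmless, since constants have no deviation.\<close>

lemma drift_op_primitive:
  assumes "pderiv P = p_tilde a b c n"
  shows "\<exists>k. drift_op (p_tilde a b c n) = smult (- eig n) P + [:k:]"
proof -
  have "pderiv (drift_op (p_tilde a b c n) - smult (- eig n) P) = 0"
    by (simp only: pderiv_diff pderiv_smult p_tilde_eigen assms diff_self)
  then obtain k where "drift_op (p_tilde a b c n) - smult (- eig n) P = [:k:]"
    by (auto simp: pderiv_eq_0_iff elim: degree_eq_zeroE)
  then show ?thesis by (intro exI[of _ k]) (simp add: algebra_simps)
qed

end

section \<open>The moments and hypergeometric series\<close>

lemma jmom_unique: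
  assumes "x 0 = 1"
    and "\<And>k. (real k + 2 + a + b + 2 * c) * x (Suc k) = (real k + 1 + a) * x k +
      c * (conv_sum k x x - (\<Sum>p\<in>{1..k}. x p * x (Suc k - p)))"
    and "a > -1" "b > -1" "c > 0"
  shows "x n = jmom a b c n"
proof (induction n rule: less_induct)
  case (less n)
  show ?case
  proof (cases n)
    case 0
    then show ?thesis by (simp add: assms)
  next
    case (Suc k)
    have eq: "x j = jmom a b c j" if "j \<le> k" for j using less.IH[of j] that Suc by simp
    have 1: "conv_sum k x x = (\<Sum>p\<in>{..<Suc k}. jmom a b c p * jmom a b c (k - p))"
      unfolding conv_sum_def by (intro sum.cong) (auto simp: eq)
    have 2: "(\<Sum>p\<in>{1..k}. x p * x (Suc k - p)) = (\<Sum>p\<in>{1..k}. jmom a b c p * jmom a b c (Suc k - p))"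
      by (intro sum.cong) (auto simp: eq)
    have pos: "real k + 2 + a + b + 2 * c > 0" using assms by simp
    have "(real k + 2 + a + b + 2 * c) * x (Suc k) = (real k + 2 + a + b + 2 * c) * jmom a b c (Suc k)"
      unfolding assms(2) 1 2 jmom.simps(2) eq[OF order_refl] using pos by simp
    then show ?thesis using pos Suc by simp
  qed
qed

text \<open>Markov--Krein: the generating function of the moments is \<open>1 + (z/c) (d/dz) log I(z)\<close> for the
  hypergeometric series \<open>I\<close> below, whose differential equation turns into the Riccati equation
  encoded by the moment recursion.\<close>

lemma jmom_of_hypergeometric:
  fixes I M :: "real fps"
  assumes ab: "a > -1" "b > -1" "c > 0"
    and I0: "fps_nth I 0 = 1"
    and rec: "\<And>n. real (Suc n) * (real n + 2 * c + a + b + 2) * fps_nth I (Suc n) = (real n + c) * (real n + c + a + 1) * fps_nth I n"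
    and H: "\<And>n. c * fps_nth (M * I) n = (real n + c) * fps_nth I n"
  shows "fps_nth M n = jmom a b c n"
proof (rule jmom_unique)
  define S where "S = 2 * c + a + b + 2"
  \<comment> \<open>The Euler operator \<open>z d/dz\<close>: it multiplies the coefficient of
    \<open>z ^ n\<close> by \<open>n\<close> and so turns recursions for coefficients into
    differential equations.\<close>
  define T where "T = (\<lambda>f :: real fps. fps_X * fps_deriv f)"
  have Tn: "fps_nth (T f) n = real n * fps_nth f n" for f n by (cases n) (simp_all add: T_def Suc_eq_plus1 add.commute)
  have Tmult: "T (f * g) = T f * g + f * T g" for f g by (simp add: T_def algebra_simps)
  have Tc: "T (fps_const k * f) = fps_const k * T f" for k f by (simp add: T_def)
  have Tdiff: "T (f - g) = T f - T g" for f g by (simp add: T_def algebra_simps)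
  have T1: "T 1 = 0" "T (fps_const k) = 0" for k by (simp_all add: T_def)
  let ?c = "fps_const c"
  have TI: "T I = ?c * (M - 1) * I"
  proof (rule fps_ext)
    fix n
    have "fps_nth (?c * (M - 1) * I) n = c * (fps_nth (M * I) n - fps_nth I n)"
      by (simp only: mult.assoc fps_mult_left_const_nth left_diff_distrib fps_sub_nth mult_1_left)
    also have "\<dots> = real n * fps_nth I n" using H[of n] by (simp add: algebra_simps)
    finally show "fps_nth (T I) n = fps_nth (?c * (M - 1) * I) n" by (simp add: Tn)
  qed
  \<comment> \<open>The hypergeometric equation with parameters \<open>c\<close>,
    \<open>c + a + 1\<close> and \<open>S\<close>. On the right, \<open>(T + c) I\<close> is written
    as \<open>c * M * I\<close>, which brings in the unknown \<open>M\<close>.\<close>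
  have ode: "T (T I) + fps_const (S - 1) * T I = fps_X * (T (?c * M * I) + fps_const (c + a + 1) * (?c * M * I))"
  proof (rule fps_ext)
    fix n
    show "fps_nth (T (T I) + fps_const (S - 1) * T I) n = fps_nth (fps_X * (T (?c * M * I) + fps_const (c + a + 1) * (?c * M * I))) n"
    proof (cases n)
      case (Suc k)
      have "fps_nth (?c * M * I) k = (real k + c) * fps_nth I k" using H[of k] by (simp add: mult.assoc)
      then have "fps_nth (fps_X * (T (?c * M * I) + fps_const (c + a + 1) * (?c * M * I))) n =
        (real k + c) * (real k + c + a + 1) * fps_nth I k"
        unfolding Suc by (simp add: Tn) (simp add: algebra_simps)
      moreover have "fps_nth (T (T I) + fps_const (S - 1) * T I) n = real (Suc k) * (real k + 2 * c + a + b + 2) * fps_nth I (Suc k)"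
        unfolding Suc by (simp add: Tn S_def) (simp add: algebra_simps)
      ultimately show ?thesis using rec[of k] by simp
    qed (simp add: Tn)
  qed
  have "?c * (T M + ?c * (M - 1) * (M - 1) + fps_const (S - 1) * (M - 1)) * I =
        ?c * (fps_X * (T M + ?c * M * (M - 1) + fps_const (c + a + 1) * M)) * I"
  proof -
    have "T (T I) = ?c * T M * I + ?c * (M - 1) * (?c * (M - 1) * I)"
      unfolding TI by (simp add: mult.assoc Tc Tmult Tdiff T1 TI) (simp add: algebra_simps)
    moreover have "T (?c * M * I) = ?c * T M * I + ?c * M * (?c * (M - 1) * I)"
      by (simp add: mult.assoc Tc Tmult T1 TI) (simp add: algebra_simps)
    ultimately have "?c * T M * I + ?c * (M - 1) * (?c * (M - 1) * I) + fps_const (S - 1) * (?c * (M - 1) * I) =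
       fps_X * (?c * T M * I + ?c * M * (?c * (M - 1) * I) + fps_const (c + a + 1) * (?c * M * I))"
      using ode unfolding TI by simp
    then show ?thesis by (simp only: algebra_simps)
  qed
  moreover have "I \<noteq> 0" using I0 by auto
  moreover have "?c \<noteq> 0" using ab by simp
  \<comment> \<open>Formal power series have no zero divisors, so \<open>I\<close> cancels and an
    equation for \<open>M\<close> alone remains; its coefficients give the recursion.\<close>
  ultimately have ric: "T M + ?c * (M - 1) * (M - 1) + fps_const (S - 1) * (M - 1) =
     fps_X * (T M + ?c * M * (M - 1) + fps_const (c + a + 1) * M)" by simp
  show M0: "fps_nth M 0 = 1" using H[of 0] I0 ab by simp
  fix k
  have conv: "fps_nth (M * M) n = conv_sum n (fps_nth M) (fps_nth M)" for n
    by (simp add: fps_mult_nth conv_sum_def atLeast0AtMost lessThan_Suc_atMost)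
  have ric': "T M + (?c * (M * M) - fps_const (2 * c) * M + ?c) + (fps_const (S - 1) * M - fps_const (S - 1)) =
     fps_X * (T M + (?c * (M * M) - ?c * M) + fps_const (c + a + 1) * M)"
  proof -
    have "fps_const (2 * c) = 2 * ?c" by (simp add: fps_const_mult[symmetric] numeral_fps_const del: fps_const_mult)
    then show ?thesis using ric by (simp add: algebra_simps)
  qed
  have "fps_nth (T M + (?c * (M * M) - fps_const (2 * c) * M + ?c) + (fps_const (S - 1) * M - fps_const (S - 1))) (Suc k) =
     fps_nth (fps_X * (T M + (?c * (M * M) - ?c * M) + fps_const (c + a + 1) * M)) (Suc k)" using ric' by simp
  then have "real (Suc k) * fps_nth M (Suc k) + c * conv_sum (Suc k) (fps_nth M) (fps_nth M) - 2 * c * fps_nth M (Suc k) + (S - 1) * fps_nth M (Suc k)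
     = real k * fps_nth M k + c * conv_sum k (fps_nth M) (fps_nth M) - c * fps_nth M k + (c + a + 1) * fps_nth M k"
    by (simp add: Tn conv del: of_nat_Suc)
  then show "(real k + 2 + a + b + 2 * c) * fps_nth M (Suc k) = (real k + 1 + a) * fps_nth M k +
      c * (conv_sum k (fps_nth M) (fps_nth M) - (\<Sum>p\<in>{1..k}. fps_nth M p * fps_nth M (Suc k - p)))"
    unfolding conv_sum_Suc M0 by (simp add: S_def algebra_simps)
qed (use ab in auto)

section \<open>Hypergeometric series and Euler's integral\<close>

text \<open>The coefficients of the Gauss series with upper parameters \<open>u\<close>,
  \<open>v\<close> and lower parameter \<open>w\<close>.\<close>

definition hyp_coeff :: "real \<Rightarrow> real \<Rightarrow> real \<Rightarrow> nat \<Rightarrow> real" where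
  "hyp_coeff u v w n = pochhammer u n * pochhammer v n / (pochhammer w n * fact n)"

lemma hyp_coeff_Suc:
  assumes "w > 0"
  shows "real (Suc n) * (real n + w) * hyp_coeff u v w (Suc n) = (real n + u) * (real n + v) * hyp_coeff u v w n"
proof -
  have "pochhammer w n > 0" using assms by (rule pochhammer_pos)
  moreover have "w + real n > 0" using assms by simp
  moreover have "k * x * ((p * A) * (q * B) / ((W * x) * (k * f))) = A * B * (p * q / (W * f))"
    if "W > 0" "x > 0" "f > 0" "k > 0" for k x p q A B W f :: real
    using that by (simp add: field_simps)
  ultimately show ?thesis unfolding hyp_coeff_def pochhammer_Suc fact_Suc add.commute[of "real n"]
    by (auto simp del: of_nat_Suc)
qed

text \<open>Raising the first upper parameter by 1 amounts to applying
  \<open>(z d/dz + u) / u\<close>. An additional factor \<open>1 / (1 - z y)\<close> in Euler's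
  integral has the same effect, and this links the resolvent to \<open>(T + c) I\<close>.\<close>

lemma hyp_coeff_shift:
  "u * hyp_coeff (u + 1) v w n = (real n + u) * hyp_coeff u v w n"
proof -
  have "u * pochhammer (u + 1) n = (real n + u) * pochhammer u n"
    using pochhammer_rec[of u n] pochhammer_Suc[of u n] by (simp add: add.commute mult.commute)
  then show ?thesis by (simp add: hyp_coeff_def mult.assoc[symmetric])
qed

lemma Beta_add_nat:
  fixes u v :: real assumes "u > 0" "v > 0"
  shows "Beta (u + real n) v = Beta u v * pochhammer u n / pochhammer (u + v) n"
proof (induction n)
  case (Suc n)
  have "pochhammer (u + v) n > 0" using assms by (intro pochhammer_pos) simp
  moreover have n: "u + v + real n > 0" using assms by simp
  moreover have "(u + real n + v) * Beta (u + real n + 1) v = (u + real n) * Beta (u + real n) v"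
    using assms by (intro Beta_plus1_left) auto
  then have "(u + v + real n) * Beta (u + real (Suc n)) v = (u + real n) * Beta (u + real n) v"
    by (simp add: add_ac)
  then have "Beta (u + real (Suc n)) v = (u + real n) * Beta (u + real n) v / (u + v + real n)"
    using n by (simp add: field_simps)
  ultimately show ?case using Suc.IH by (simp add: pochhammer_Suc mult_ac)
qed simp

lemma Beta_pos: "u > 0 \<Longrightarrow> v > 0 \<Longrightarrow> Beta u v > (0::real)"
  by (simp add: Beta_def Gamma_real_pos)

lemma nn_integral_Beta:
  fixes u v :: real assumes "u > 0" "v > 0"
  shows "(\<integral>\<^sup>+y. ennreal (indicator {0..1} y * y powr (u - 1) * (1 - y) powr (v - 1)) \<partial>lborel) = ennreal (Beta u v)"
proof -
  have "((\<lambda>t. t powr (u - 1) * (1 - t) powr (v - 1)) has_integral Beta u v) {0..1}"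
    by (rule has_integral_Beta_real[OF assms])
  then have "(\<integral>\<^sup>+y. ennreal (indicator {0..1} y * (y powr (u - 1) * (1 - y) powr (v - 1))) \<partial>lborel) = ennreal (Beta u v)"
    by (subst nn_integral_has_integral_lebesgue) auto
  then show ?thesis by (simp add: mult.assoc)
qed

lemma powr_minus_sums:
  fixes x s :: real assumes "0 \<le> x" "x < 1"
  shows "(\<lambda>n. pochhammer s n / fact n * x ^ n) sums ((1 - x) powr (- s))"
proof -
  have "(\<lambda>n. (- s gchoose n) * (- x) ^ n) sums ((1 + (- x)) powr (- s))"
    using assms by (intro gen_binomial_real) auto
  moreover have "(- s gchoose n) * (- x) ^ n = pochhammer s n / fact n * x ^ n" for n
  proof -
    have "(- s gchoose n) = (- 1) ^ n * pochhammer s n / fact n"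
      by (simp add: gbinomial_pochhammer)
    moreover have "(- x) ^ n = (-1) ^ n * x ^ n" by (rule power_minus)
    ultimately have "(- s gchoose n) * (- x) ^ n = ((- 1) ^ n * pochhammer s n / fact n) * ((-1) ^ n * x ^ n)"
      by (simp only:)
    also have "\<dots> = ((- 1) ^ n * (- 1) ^ n) * (pochhammer s n / fact n * x ^ n)" by simp
    also have "(- 1) ^ n * (- 1) ^ n = (1 :: real)" by (simp flip: power_mult_distrib)
    finally show ?thesis by simp
  qed
  ultimately show ?thesis by simp
qed

text \<open>Euler's integral, by expanding the power of \<open>1 - z y\<close> in a binomial series.
  All its terms are nonnegative, so sum and integral may be exchanged before convergence is
  known.\<close>

lemma nn_integral_hypergeometric:
  fixes u v s z :: real
  assumes uv: "u > 0" "v > 0" and s: "s > 0" and z: "0 \<le> z" "z < 1"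
  shows "(\<integral>\<^sup>+y. ennreal (indicator {0..1} y * y powr (u - 1) * (1 - y) powr (v - 1) * (1 - z * y) powr (- s)) \<partial>lborel) =
     (\<Sum>n. ennreal (Beta u v * hyp_coeff s u (u + v) n * z ^ n))"
proof -
  let ?w = "\<lambda>y. indicator {0..1} y * y powr (u - 1) * (1 - y) powr (v - 1) :: real"
  let ?k = "\<lambda>n. pochhammer s n / fact n :: real"
  have k: "?k n \<ge> 0" for n using s by (intro divide_nonneg_nonneg pochhammer_nonneg) auto
  have "(\<integral>\<^sup>+y. ennreal (?w y * (1 - z * y) powr (- s)) \<partial>lborel) = (\<integral>\<^sup>+y. (\<Sum>n. ennreal (?w y * (?k n * (z * y) ^ n))) \<partial>lborel)"
  proof (intro nn_integral_cong)
    fix y :: real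
    show "ennreal (?w y * (1 - z * y) powr (- s)) = (\<Sum>n. ennreal (?w y * (?k n * (z * y) ^ n)))"
    proof (cases "y \<in> {0..1}")
      case True
      have zy: "0 \<le> z * y" "z * y < 1" using True z by (auto intro: le_less_trans[OF mult_left_le])
      have "(\<lambda>n. ?w y * (?k n * (z * y) ^ n)) sums (?w y * (1 - z * y) powr (- s))"
        by (intro sums_mult powr_minus_sums zy)
      then have "(\<lambda>n. ennreal (?w y * (?k n * (z * y) ^ n))) sums ennreal (?w y * (1 - z * y) powr (- s))"
        using True by (subst sums_ennreal) (auto intro!: mult_nonneg_nonneg k zero_le_power zy(1) simp del: times_divide_eq_left)
      then show ?thesis by (simp add: sums_iff)
    qed simp
  qed
  also have "\<dots> = (\<Sum>n. \<integral>\<^sup>+y. ennreal (?w y * (?k n * (z * y) ^ n)) \<partial>lborel)"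
    by (intro nn_integral_suminf) auto
  also have "\<dots> = (\<Sum>n. ennreal (Beta u v * hyp_coeff s u (u + v) n * z ^ n))"
  proof (intro suminf_cong)
    fix n
    have "(\<integral>\<^sup>+y. ennreal (?w y * (?k n * (z * y) ^ n)) \<partial>lborel) =
       (\<integral>\<^sup>+y. ennreal (?k n * z ^ n) * ennreal (indicator {0..1} y * y powr (u + real n - 1) * (1 - y) powr (v - 1)) \<partial>lborel)"
    proof (intro nn_integral_cong)
      fix y :: real
      have "y powr (u - 1) * y ^ n = y powr (u + real n - 1)" if "0 \<le> y"
      proof (cases "y = 0")
        case True
        then show ?thesis using uv by simp
      next
        case False
        then have "y ^ n = y powr real n" using that by (simp add: powr_realpow)
        then show ?thesis by (simp add: powr_add[symmetric] algebra_simps)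
      qed
      then have "?w y * (?k n * (z * y) ^ n) = (?k n * z ^ n) * (indicator {0..1} y * y powr (u + real n - 1) * (1 - y) powr (v - 1))"
        by (cases "y \<in> {0..1}") (auto simp: power_mult_distrib)
      then show "ennreal (?w y * (?k n * (z * y) ^ n)) = ennreal (?k n * z ^ n) * ennreal (indicator {0..1} y * y powr (u + real n - 1) * (1 - y) powr (v - 1))"
        by (simp only:) (rule ennreal_mult', intro mult_nonneg_nonneg k zero_le_power z(1))
    qed
    also have "\<dots> = ennreal (?k n * z ^ n) * ennreal (Beta (u + real n) v)"
      using uv by (subst nn_integral_cmult) (auto simp: nn_integral_Beta)
    also have "\<dots> = ennreal (?k n * z ^ n * Beta (u + real n) v)"
      by (rule ennreal_mult'[symmetric], intro mult_nonneg_nonneg k zero_le_power z(1))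
    also have "?k n * z ^ n * Beta (u + real n) v = Beta u v * hyp_coeff s u (u + v) n * z ^ n"
      unfolding Beta_add_nat[OF uv] hyp_coeff_def by (simp add: mult_ac)
    finally show "(\<integral>\<^sup>+y. ennreal (?w y * (?k n * (z * y) ^ n)) \<partial>lborel) = ennreal (Beta u v * hyp_coeff s u (u + v) n * z ^ n)" .
  qed
  finally show ?thesis .
qed

section \<open>Powers of the Jacobi matrix and a continued fraction\<close>

text \<open>The first column of the matrix power after a diagonal conjugation that removes the square roots.\<close>

primrec walk :: "(nat \<Rightarrow> real) \<Rightarrow> (nat \<Rightarrow> real) \<Rightarrow> nat \<Rightarrow> nat \<Rightarrow> real" where
  "walk p q 0 i = (if i = 1 then 1 else 0)"
| "walk p q (Suc k) i = (if i \<ge> 2 then walk p q k (i - 1) + coeff_t p q (i - 1) * walk p q k i else 0)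
     + coeff_s p q i * walk p q k i + coeff_s p q i * coeff_t p q i * walk p q k (Suc i)"

lemma suminf_eq_sum: "finite A \<Longrightarrow> (\<And>l. l \<notin> A \<Longrightarrow> f l = 0) \<Longrightarrow> (\<Sum>l. f l) = sum f A" for f :: "nat \<Rightarrow> real"
  by (rule suminf_finite)

lemma jacobi_matrix_entry:
  assumes "i \<ge> 1"
  shows "jacobi_matrix p q i j = sqrt (coeff_s p q i) * bidiag p q j i +
    (if i \<ge> 2 then sqrt (coeff_t p q (i - 1)) * bidiag p q j (i - 1) else 0)"
proof -
  have "jacobi_matrix p q i j = (\<Sum>l\<in>{i - 1, i}. bidiag p q i l * bidiag p q j l)"
    unfolding jacobi_matrix_def imat_mult_def imat_transpose_def using assms
    by (intro suminf_eq_sum) (auto simp: bidiag_def)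
  also have "\<dots> = bidiag p q i (i - 1) * bidiag p q j (i - 1) + bidiag p q i i * bidiag p q j i"
    using assms by simp
  finally show ?thesis using assms by (auto simp: bidiag_def)
qed

lemma imat_mult_jacobi:
  assumes "i \<ge> 1"
  shows "imat_mult (jacobi_matrix p q) X i m =
    sqrt (coeff_s p q i) * (sqrt (coeff_s p q i) * X i m + sqrt (coeff_t p q i) * X (Suc i) m) +
    (if i \<ge> 2 then sqrt (coeff_t p q (i - 1)) * (sqrt (coeff_s p q (i - 1)) * X (i - 1) m + sqrt (coeff_t p q (i - 1)) * X i m) else 0)"
proof -
  have "imat_mult (jacobi_matrix p q) X i m = (\<Sum>l\<in>{i - 1, i, Suc i}. jacobi_matrix p q i l * X l m)"
    unfolding imat_mult_def using assms
    by (intro suminf_eq_sum) (auto simp: jacobi_matrix_entry bidiag_def)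
  also have "\<dots> = jacobi_matrix p q i (i - 1) * X (i - 1) m + jacobi_matrix p q i i * X i m + jacobi_matrix p q i (Suc i) * X (Suc i) m"
  proof -
    have "i - 1 \<noteq> i" "i - 1 \<noteq> Suc i" "i \<noteq> Suc i" using assms by auto
    then show ?thesis by (simp add: add.assoc)
  qed
  finally show ?thesis using assms
    by (cases "i \<ge> 2") (auto simp: jacobi_matrix_entry bidiag_def algebra_simps)
qed

text \<open>The product of the square roots is the diagonal conjugation of the matrix. It is empty
  for \<open>i = 1\<close>, so the corner entry is the walk sum itself.\<close>

lemma imat_power_walk:
  assumes st: "\<And>i. i \<ge> 1 \<Longrightarrow> coeff_s p q i \<ge> 0 \<and> coeff_t p q i \<ge> 0" and "i \<ge> 1"
  shows "imat_power (jacobi_matrix p q) k i 1 = (\<Prod>j\<in>{1..<i}. sqrt (coeff_s p q j) * sqrt (coeff_t p q j)) * walk p q k i"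
  using assms(2)
proof (induction k arbitrary: i)
  case (Suc k)
  define D where "D = (\<lambda>i. \<Prod>j\<in>{1..<i}. sqrt (coeff_s p q j) * sqrt (coeff_t p q j))"
  have D_Suc: "D (Suc i) = D i * (sqrt (coeff_s p q i) * sqrt (coeff_t p q i))" if "i \<ge> 1" for i
    using that by (simp add: D_def prod.atLeastLessThan_Suc)
  have sq: "sqrt (coeff_s p q i) * sqrt (coeff_s p q i) = coeff_s p q i" "sqrt (coeff_t p q i) * sqrt (coeff_t p q i) = coeff_t p q i"
    if "i \<ge> 1" for i using st[OF that] by simp_all
  have IH: "imat_power (jacobi_matrix p q) k i 1 = D i * walk p q k i" if "i \<ge> 1" for i
    using Suc.IH[OF that] by (simp add: D_def)
  have 1: "sqrt (coeff_s p q i) * (sqrt (coeff_s p q i) * (D i * walk p q k i) + sqrt (coeff_t p q i) * (D (Suc i) * walk p q k (Suc i)))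
     = D i * (coeff_s p q i * walk p q k i + coeff_s p q i * coeff_t p q i * walk p q k (Suc i))"
  proof -
    have "sqrt (coeff_s p q i) * (sqrt (coeff_s p q i) * (D i * walk p q k i) + sqrt (coeff_t p q i) * (D (Suc i) * walk p q k (Suc i))) =
      D i * ((sqrt (coeff_s p q i) * sqrt (coeff_s p q i)) * walk p q k i + (sqrt (coeff_s p q i) * sqrt (coeff_s p q i)) * (sqrt (coeff_t p q i) * sqrt (coeff_t p q i)) * walk p q k (Suc i))"
      unfolding D_Suc[OF Suc.prems] by (simp only: distrib_left mult_ac)
    then show ?thesis unfolding sq[OF Suc.prems] .
  qed
  show ?case
  proof (cases "i \<ge> 2")
    case True
    then have i1: "i - 1 \<ge> 1" "Suc (i - 1) = i" by auto
    have 2: "sqrt (coeff_t p q (i - 1)) * (sqrt (coeff_s p q (i - 1)) * (D (i - 1) * walk p q k (i - 1)) + sqrt (coeff_t p q (i - 1)) * (D i * walk p q k i))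
      = D i * (walk p q k (i - 1) + coeff_t p q (i - 1) * walk p q k i)"
    proof -
      have Di: "D i = D (i - 1) * (sqrt (coeff_s p q (i - 1)) * sqrt (coeff_t p q (i - 1)))" using D_Suc[OF i1(1)] i1(2) by simp
      have "sqrt (coeff_t p q (i - 1)) * (sqrt (coeff_s p q (i - 1)) * (D (i - 1) * walk p q k (i - 1)) + sqrt (coeff_t p q (i - 1)) * (D i * walk p q k i))
        = D (i - 1) * (sqrt (coeff_s p q (i - 1)) * sqrt (coeff_t p q (i - 1))) * walk p q k (i - 1) + D i * (sqrt (coeff_t p q (i - 1)) * sqrt (coeff_t p q (i - 1)) * walk p q k i)"
        by (simp only: distrib_left mult_ac)
      then show ?thesis unfolding Di[symmetric] sq[OF i1(1)] by (simp only: distrib_left)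
    qed
    have "imat_power (jacobi_matrix p q) (Suc k) i 1 = sqrt (coeff_s p q i) * (sqrt (coeff_s p q i) * (D i * walk p q k i) + sqrt (coeff_t p q i) * (D (Suc i) * walk p q k (Suc i))) +
       sqrt (coeff_t p q (i - 1)) * (sqrt (coeff_s p q (i - 1)) * (D (i - 1) * walk p q k (i - 1)) + sqrt (coeff_t p q (i - 1)) * (D i * walk p q k i))"
      using True Suc.prems by (simp add: imat_mult_jacobi IH)
    then show ?thesis unfolding 1 2 using True by (simp add: D_def distrib_left)
  next
    case False
    have "imat_power (jacobi_matrix p q) (Suc k) i 1 = sqrt (coeff_s p q i) * (sqrt (coeff_s p q i) * (D i * walk p q k i) + sqrt (coeff_t p q i) * (D (Suc i) * walk p q k (Suc i)))"
      using False Suc.prems by (simp add: imat_mult_jacobi IH)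
    then show ?thesis unfolding 1 using False by (simp add: D_def)
  qed
qed auto

definition unit_seq :: "(nat \<Rightarrow> real) \<Rightarrow> bool" where
  "unit_seq p \<longleftrightarrow> (\<forall>i\<ge>1. 0 \<le> p i \<and> p i \<le> 1)"

lemma unit_seqD: "unit_seq p \<Longrightarrow> i \<ge> 1 \<Longrightarrow> 0 \<le> p i" "unit_seq p \<Longrightarrow> i \<ge> 1 \<Longrightarrow> p i \<le> 1"
  by (simp_all add: unit_seq_def)

lemma coeff_st_bounds:
  assumes "unit_seq p" "unit_seq q" "i \<ge> 1"
  shows "0 \<le> coeff_s p q i" "coeff_s p q i \<le> 1" "0 \<le> coeff_t p q i" "coeff_t p q i \<le> 1"
proof -
  note pi = unit_seqD[OF assms(1,3)] and qi = unit_seqD[OF assms(2,3)]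
  have r: "0 \<le> (if i = 1 then 0 else q (i - 1))" "(if i = 1 then 0 else q (i - 1)) \<le> 1"
    using unit_seqD[OF assms(2), of "i - 1"] assms(3) by auto
  show "0 \<le> coeff_s p q i" "coeff_s p q i \<le> 1"
    unfolding coeff_s_def using r pi by (auto intro!: mult_nonneg_nonneg mult_le_one)
  show "0 \<le> coeff_t p q i" "coeff_t p q i \<le> 1"
    unfolding coeff_t_def using pi qi by (auto intro!: mult_nonneg_nonneg mult_le_one)
qed

text \<open>One step of the recursion has at most four terms, each with a coefficient between 0 and
  1. This growth is why \<open>z \<le> 1/8\<close> is imposed later: the generating series is then
  dominated by powers of 1/2.\<close>

lemma walk_bounds:
  assumes pq: "unit_seq p" "unit_seq q" and "i \<ge> 1"
  shows "0 \<le> walk p q k i \<and> walk p q k i \<le> 4 ^ k"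
  using assms(3)
proof (induction k arbitrary: i)
  case (Suc k)
  note st = coeff_st_bounds[OF pq]
  have W: "0 \<le> walk p q k j" "walk p q k j \<le> 4 ^ k" if "j \<ge> 1" for j using Suc.IH[OF that] by auto
  have m: "0 \<le> u * walk p q k j" "u * walk p q k j \<le> 4 ^ k" if "j \<ge> 1" "0 \<le> u" "u \<le> 1" for j u
    using W[OF that(1)] that(2,3) by (auto intro: order_trans[OF mult_left_le_one_le])
  have st1: "0 \<le> coeff_s p q i * coeff_t p q i" "coeff_s p q i * coeff_t p q i \<le> 1"
    using st[OF Suc.prems] by (auto intro: mult_le_one)
  have a: "0 \<le> coeff_s p q i * walk p q k i" "coeff_s p q i * walk p q k i \<le> 4 ^ k"
    using m[OF Suc.prems st(1,2)[OF Suc.prems]] .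
  have b: "0 \<le> coeff_s p q i * coeff_t p q i * walk p q k (Suc i)" "coeff_s p q i * coeff_t p q i * walk p q k (Suc i) \<le> 4 ^ k"
    using m[OF _ st1, of "Suc i"] by auto
  show ?case
  proof (cases "i \<ge> 2")
    case True
    then have i1: "i - 1 \<ge> 1" by auto
    have "0 \<le> coeff_t p q (i - 1) * walk p q k i" "coeff_t p q (i - 1) * walk p q k i \<le> 4 ^ k"
      using m[OF Suc.prems st(3,4)[OF i1]] .
    then show ?thesis using a b W[OF i1] True by simp
  next
    case False
    have "(4::real) ^ k \<ge> 0" by simp
    then show ?thesis using a b False by simp
  qed
qed auto

section \<open>Generating functions of the walks and their continued fraction\<close>

text \<open>The first column of the resolvent, up to the diagonal conjugation; at
  \<open>i = 1\<close> the two agree.\<close>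

definition wgf :: "(nat \<Rightarrow> real) \<Rightarrow> (nat \<Rightarrow> real) \<Rightarrow> real \<Rightarrow> nat \<Rightarrow> real" where
  "wgf p q z i = (\<Sum>k. walk p q k i * z ^ k)"

text \<open>The continued fraction of the resolvent has coefficients \<open>u * (1 - v)\<close>,
  where \<open>v\<close> is the variable of the preceding level. Attaching \<open>1 - v\<close> to
  the level of \<open>v\<close> makes each level depend on one variable only, so that independent
  variables give independent random maps.\<close>

definition cstep :: "real \<Rightarrow> real \<Rightarrow> real \<Rightarrow> real" where
  "cstep z u y = u / (1 - (1 - u) * z * y)"

primrec cchain :: "real \<Rightarrow> (nat \<Rightarrow> real) \<Rightarrow> (nat \<Rightarrow> real) \<Rightarrow> nat \<Rightarrow> nat \<Rightarrow> real \<Rightarrow> real" where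
  "cchain z p q i 0 y = y"
| "cchain z p q i (Suc n) y = cstep z (p i) (cstep z (q i) (cchain z p q (Suc i) n y))"

text \<open>By definition a chain grows at its outer end; the stationarity argument needs the new
  level next to the innermost argument \<open>y\<close>.\<close>

lemma cchain_Suc_end: "cchain z p q i (Suc n) y = cchain z p q i n (cstep z (p (i + n)) (cstep z (q (i + n)) y))"
  by (induction n arbitrary: i) simp_all

lemma cchain_cong:
  assumes "\<And>j. i \<le> j \<Longrightarrow> j < i + n \<Longrightarrow> p j = p' j \<and> q j = q' j"
  shows "cchain z p q i n y = cchain z p' q' i n y"
  using assms by (induction n arbitrary: i) auto

lemma cstep_denom:
  fixes z u y :: real
  assumes "0 \<le> z" "z \<le> 1/8" "0 \<le> u" "u \<le> 1" "0 \<le> y" "y \<le> 1"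
  shows "7/8 \<le> 1 - (1 - u) * z * y" "1 - (1 - u) * z * y \<le> 1"
proof -
  have "(1 - u) * z \<le> 1 * (1/8)" using assms by (intro mult_mono) auto
  moreover have "0 \<le> (1 - u) * z" using assms by simp
  ultimately have "(1 - u) * z * y \<le> (1 * (1/8)) * 1" using assms by (intro mult_mono) auto
  then show "7/8 \<le> 1 - (1 - u) * z * y" by simp
  show "1 - (1 - u) * z * y \<le> 1" using assms by simp
qed

lemma cstep_bounds:
  assumes "0 \<le> z" "z \<le> 1/8" "0 \<le> u" "u \<le> 1" "0 \<le> y" "y \<le> 1"
  shows "0 \<le> cstep z u y" "cstep z u y \<le> 1"
proof -
  note d = cstep_denom[OF assms]
  show "0 \<le> cstep z u y" unfolding cstep_def using d assms by (intro divide_nonneg_nonneg) auto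
  have "z * y \<le> 1/8 * 1" using assms by (intro mult_mono) auto
  then have "(1 - u) * (z * y) \<le> (1 - u) * 1" using assms by (intro mult_left_mono) auto
  then have "u \<le> 1 - (1 - u) * z * y" by (simp add: mult.assoc)
  then show "cstep z u y \<le> 1" unfolding cstep_def using d by (simp add: divide_le_eq)
qed

lemma cchain_bounds:
  assumes z: "0 \<le> z" "z \<le> 1/8" and y: "0 \<le> y" "y \<le> 1" and "i \<ge> 1"
    and pq: "unit_seq p" "unit_seq q"
  shows "0 \<le> cchain z p q i n y \<and> cchain z p q i n y \<le> 1"
  using assms(5)
proof (induction n arbitrary: i)
  case (Suc n)
  have 1: "0 \<le> cchain z p q (Suc i) n y" "cchain z p q (Suc i) n y \<le> 1" using Suc.IH[of "Suc i"] by auto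
  have 2: "0 \<le> cstep z (q i) (cchain z p q (Suc i) n y)" "cstep z (q i) (cchain z p q (Suc i) n y) \<le> 1"
    using cstep_bounds[OF z unit_seqD[OF pq(2) Suc.prems] 1] .
  show ?case using cstep_bounds[OF z unit_seqD[OF pq(1) Suc.prems] 2] by auto
qed (use y in simp)

lemma cfrac_inverse:
  fixes x y t T z :: real
  assumes "x * y = t * T" "7/8 \<le> 1 - x * z * y"
  shows "1 / (1 - x * z * y) * (1 - t * z * T) = 1"
proof -
  have "t * z * T = z * (t * T)" "x * z * y = z * (x * y)" by simp_all
  then have e: "t * z * T = x * z * y" by (simp only: assms(1))
  have "1 - x * z * y \<noteq> 0" using assms(2) by linarith
  from divide_self[OF this] show ?thesis unfolding e by (simp only: times_divide_eq_left mult_1)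
qed

context
  fixes p q :: "nat \<Rightarrow> real" and z :: real
  assumes pq: "unit_seq p" "unit_seq q"
    and z: "0 \<le> z" "z \<le> 1/8"
begin

lemma wgf_summable: "i \<ge> 1 \<Longrightarrow> summable (\<lambda>k. walk p q k i * z ^ k)"
proof (rule summable_comparison_test'[where N = 0])
  show "summable (\<lambda>k. (1/2::real) ^ k)" by (rule summable_geometric) simp
  fix k assume i: "i \<ge> 1"
  have "walk p q k i * z ^ k \<le> 4 ^ k * (1/8) ^ k"
    using walk_bounds[OF pq i, of k] z by (intro mult_mono power_mono) auto
  also have "\<dots> = (1/2) ^ k" by (simp flip: power_mult_distrib)
  finally show "norm (walk p q k i * z ^ k) \<le> (1/2) ^ k" using walk_bounds[OF pq i, of k] z by simp
qed

lemma wgf_bounds: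
  assumes "i \<ge> 1" shows "0 \<le> wgf p q z i" "wgf p q z i \<le> 2"
proof -
  show "0 \<le> wgf p q z i" unfolding wgf_def using walk_bounds[OF pq assms] z
    by (intro suminf_nonneg wgf_summable assms) auto
  have "wgf p q z i \<le> (\<Sum>k. (1/2) ^ k)"
    unfolding wgf_def
  proof (intro suminf_le wgf_summable assms)
    fix k
    have "walk p q k i * z ^ k \<le> 4 ^ k * (1/8) ^ k"
      using walk_bounds[OF pq assms, of k] z by (intro mult_mono power_mono) auto
    also have "\<dots> = (1/2) ^ k" by (simp flip: power_mult_distrib)
    finally show "walk p q k i * z ^ k \<le> (1/2) ^ k" .
  qed (rule summable_geometric, simp)
  also have "\<dots> = 2" by (subst suminf_geometric) auto
  finally show "wgf p q z i \<le> 2" .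
qed

lemma wgf_rec:
  assumes i: "i \<ge> 1"
  shows "wgf p q z i = (if i = 1 then 1 else 0) + z * ((if i \<ge> 2 then wgf p q z (i - 1) + coeff_t p q (i - 1) * wgf p q z i else 0)
     + coeff_s p q i * wgf p q z i + coeff_s p q i * coeff_t p q i * wgf p q z (Suc i))"
proof -
  have s: "(\<lambda>k. walk p q k j * z ^ k) sums wgf p q z j" if "j \<ge> 1" for j
    unfolding wgf_def using wgf_summable[OF that] by (rule summable_sums)
  have "(\<lambda>k. (if i \<ge> 2 then walk p q k (i - 1) * z ^ k + coeff_t p q (i - 1) * (walk p q k i * z ^ k) else 0)
     + coeff_s p q i * (walk p q k i * z ^ k) + coeff_s p q i * coeff_t p q i * (walk p q k (Suc i) * z ^ k)) sums
     ((if i \<ge> 2 then wgf p q z (i - 1) + coeff_t p q (i - 1) * wgf p q z i else 0)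
     + coeff_s p q i * wgf p q z i + coeff_s p q i * coeff_t p q i * wgf p q z (Suc i))"
    using i by (cases "i \<ge> 2") (auto intro!: sums_add sums_mult s)
  then have "(\<lambda>k. z * ((if i \<ge> 2 then walk p q k (i - 1) * z ^ k + coeff_t p q (i - 1) * (walk p q k i * z ^ k) else 0)
     + coeff_s p q i * (walk p q k i * z ^ k) + coeff_s p q i * coeff_t p q i * (walk p q k (Suc i) * z ^ k))) sums
     (z * ((if i \<ge> 2 then wgf p q z (i - 1) + coeff_t p q (i - 1) * wgf p q z i else 0)
     + coeff_s p q i * wgf p q z i + coeff_s p q i * coeff_t p q i * wgf p q z (Suc i)))"
    by (rule sums_mult)
  moreover have "z * ((if i \<ge> 2 then walk p q k (i - 1) * z ^ k + coeff_t p q (i - 1) * (walk p q k i * z ^ k) else 0)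
     + coeff_s p q i * (walk p q k i * z ^ k) + coeff_s p q i * coeff_t p q i * (walk p q k (Suc i) * z ^ k)) = walk p q (Suc k) i * z ^ Suc k" for k
    by (cases "i \<ge> 2") (simp_all add: algebra_simps)
  ultimately have "(\<lambda>k. walk p q (Suc k) i * z ^ Suc k) sums
     (z * ((if i \<ge> 2 then wgf p q z (i - 1) + coeff_t p q (i - 1) * wgf p q z i else 0)
     + coeff_s p q i * wgf p q z i + coeff_s p q i * coeff_t p q i * wgf p q z (Suc i)))" by (simp only:)
  then have "(\<lambda>k. walk p q k i * z ^ k) sums
     (z * ((if i \<ge> 2 then wgf p q z (i - 1) + coeff_t p q (i - 1) * wgf p q z i else 0)
     + coeff_s p q i * wgf p q z i + coeff_s p q i * coeff_t p q i * wgf p q z (Suc i)) + walk p q 0 i * z ^ 0)"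
    by (rule sums_Suc)
  from sums_unique2[OF this s[OF i]] show ?thesis by (simp del: walk.simps(2))
qed

text \<open>The intermediate level belonging to the factorisation into two bidiagonal matrices: with
  it the three-term recursion splits into two relations, one with the coefficients \<open>t\<close>
  and one with the coefficients \<open>s\<close>.\<close>

definition wgf' :: "nat \<Rightarrow> real" where "wgf' i = wgf p q z i + coeff_t p q i * wgf p q z (Suc i)"

lemma wgf_Suc: "i \<ge> 1 \<Longrightarrow> wgf p q z (Suc i) = z * (wgf' i + coeff_s p q (Suc i) * wgf' (Suc i))"
  unfolding wgf'_def by (subst wgf_rec) (auto simp: algebra_simps)

lemma wgf_1: "wgf p q z 1 = 1 + z * coeff_s p q 1 * wgf' 1"
  unfolding wgf'_def by (subst wgf_rec) (auto simp: algebra_simps)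

lemma wgf'_bounds: "i \<ge> 1 \<Longrightarrow> 0 \<le> wgf' i \<and> wgf' i \<le> 4"
proof -
  assume i: "i \<ge> 1"
  note t = coeff_st_bounds(3,4)[OF pq i] and w = wgf_bounds[OF i] and w1 = wgf_bounds[of "Suc i"]
  have "coeff_t p q i * wgf p q z (Suc i) \<le> 1 * 2" using t w1 by (intro mult_mono) auto
  moreover have "0 \<le> coeff_t p q i * wgf p q z (Suc i)" using t w1 by simp
  ultimately show ?thesis unfolding wgf'_def using w by auto
qed

text \<open>The Schur-type continued fraction with the canonical moments \<open>p\<^sub>1, q\<^sub>1, p\<^sub>2, q\<^sub>2, \<dots>\<close> is
  truncated; each level contracts the error by a factor of order \<open>z\<close>.\<close>

lemma wgf_tail_error:
  assumes y: "0 \<le> y" "y \<le> 1" and i: "i \<ge> 1"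
  shows "\<bar>wgf p q z (Suc i) - z / (1 - (1 - q i) * z * cchain z p q (Suc i) n y) * wgf' i\<bar> \<le> 10 * (1/4) ^ n"
  using i
proof (induction n arbitrary: i)
  case 0
  have d: "7/8 \<le> 1 - (1 - q i) * z * y" using cstep_denom[OF z unit_seqD[OF pq(2) 0] y] by auto
  have "z / (1 - (1 - q i) * z * y) \<le> (1/8) / (7/8)" using d z by (intro frac_le) auto
  moreover have "0 \<le> z / (1 - (1 - q i) * z * y)" using d z by (intro divide_nonneg_nonneg) auto
  ultimately have "0 \<le> z / (1 - (1 - q i) * z * y) * wgf' i" "z / (1 - (1 - q i) * z * y) * wgf' i \<le> 1/7 * 4"
    using wgf'_bounds[OF 0] by (intro mult_nonneg_nonneg mult_mono; simp)+
  then have "\<bar>wgf p q z (Suc i) - z / (1 - (1 - q i) * z * y) * wgf' i\<bar> \<le> 10"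
    using wgf_bounds[of "Suc i"] by linarith
  then show ?case by simp
next
  case (Suc n)
  define y1 where "y1 = cchain z p q (Suc (Suc i)) n y"
  define y2 where "y2 = cstep z (q (Suc i)) y1"
  define T1 where "T1 = 1 / (1 - (1 - q (Suc i)) * z * y1)"
  define T2 where "T2 = 1 / (1 - (1 - p (Suc i)) * z * y2)"
  define T3 where "T3 = 1 / (1 - (1 - q i) * z * cstep z (p (Suc i)) y2)"
  have pi: "0 \<le> p (Suc i)" "p (Suc i) \<le> 1" and qi: "0 \<le> q (Suc i)" "q (Suc i) \<le> 1" and qi': "0 \<le> q i" "q i \<le> 1"
    using unit_seqD[OF pq(1), of "Suc i"] unit_seqD[OF pq(2), of "Suc i"] unit_seqD[OF pq(2) Suc.prems] by auto
  have y1: "0 \<le> y1" "y1 \<le> 1" unfolding y1_def using cchain_bounds[OF z y _ pq, of "Suc (Suc i)" n] by auto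
  have y2: "0 \<le> y2" "y2 \<le> 1" unfolding y2_def using cstep_bounds[OF z qi y1] by auto
  have y3: "0 \<le> cstep z (p (Suc i)) y2" "cstep z (p (Suc i)) y2 \<le> 1" using cstep_bounds[OF z pi y2] by auto
  note d2 = cstep_denom[OF z pi y2] and d3 = cstep_denom[OF z qi' y3]
  have T2: "0 \<le> T2" "T2 \<le> 8/7" unfolding T2_def using d2 by (auto simp: divide_le_eq)
  have T3: "0 \<le> T3" "T3 \<le> 8/7" unfolding T3_def using d3 by (auto simp: divide_le_eq)
  have IH: "\<bar>wgf p q z (Suc (Suc i)) - z * T1 * wgf' (Suc i)\<bar> \<le> 10 * (1/4) ^ n"
    using Suc.IH[of "Suc i"] by (simp add: T1_def y1_def)
  \<comment> \<open>\<open>d\<close> is the error one full level deeper, and \<open>e\<close> below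
    is the error at the intermediate level; each of the two relations passes the error on with one
    more bounded factor.\<close>
  define d where "d = wgf p q z (Suc (Suc i)) - z * T1 * wgf' (Suc i)"
  define t where "t = coeff_t p q (Suc i)"
  define s where "s = coeff_s p q (Suc i)"
  have st: "0 \<le> s" "s \<le> 1" "0 \<le> t" "t \<le> 1" unfolding s_def t_def using coeff_st_bounds[OF pq, of "Suc i"] by auto
  have y2T: "(1 - p (Suc i)) * y2 = t * T1" by (simp add: y2_def cstep_def t_def coeff_t_def T1_def)
  have sT: "(1 - q i) * cstep z (p (Suc i)) y2 = s * T2"
    using Suc.prems by (simp add: cstep_def s_def coeff_s_def T2_def)
  have T2e: "T2 * (1 - t * z * T1) = 1" unfolding T2_def by (rule cfrac_inverse[OF y2T d2(1)])
  have T3e: "T3 * (1 - s * z * T2) = 1" unfolding T3_def by (rule cfrac_inverse[OF sT d3(1)])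
  define e where "e = wgf' (Suc i) - T2 * wgf p q z (Suc i)"
  have "wgf' (Suc i) = wgf p q z (Suc i) + t * (z * T1 * wgf' (Suc i) + d)" by (simp add: wgf'_def t_def d_def)
  then have "wgf' (Suc i) * (1 - t * z * T1) = wgf p q z (Suc i) + t * d" by (simp add: algebra_simps)
  then have "T2 * (wgf' (Suc i) * (1 - t * z * T1)) = T2 * (wgf p q z (Suc i) + t * d)" by simp
  moreover have "T2 * (wgf' (Suc i) * (1 - t * z * T1)) = wgf' (Suc i)" using T2e by (simp add: mult.left_commute)
  ultimately have e: "e = T2 * t * d" by (simp add: e_def algebra_simps)
  have "wgf p q z (Suc i) = z * (wgf' i + s * (T2 * wgf p q z (Suc i) + e))"
    using wgf_Suc[OF Suc.prems] by (simp add: e_def s_def)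
  then have "wgf p q z (Suc i) * (1 - s * z * T2) = z * wgf' i + z * s * e" by (simp add: algebra_simps)
  then have "T3 * (wgf p q z (Suc i) * (1 - s * z * T2)) = T3 * (z * wgf' i + z * s * e)" by simp
  moreover have "T3 * (wgf p q z (Suc i) * (1 - s * z * T2)) = wgf p q z (Suc i)" using T3e by (simp add: mult.left_commute)
  ultimately have "wgf p q z (Suc i) - z * T3 * wgf' i = (T3 * z * s * T2 * t) * d" unfolding e by (simp add: algebra_simps)
  then have "\<bar>wgf p q z (Suc i) - z * T3 * wgf' i\<bar> = (T3 * z * s * T2 * t) * \<bar>d\<bar>"
    using T2 T3 st z by (simp add: abs_mult)
  \<comment> \<open>From \<open>z \<le> 1/8\<close> and the bound 8/7 for \<open>T2\<close> and
    \<open>T3\<close> the error shrinks by 8/49, which is less than 1/4.\<close>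
  also have "\<dots> \<le> (8/7 * (1/8) * 1 * (8/7) * 1) * (10 * (1/4) ^ n)"
    using T2 T3 st z IH unfolding d_def by (intro mult_mono mult_nonneg_nonneg) auto
  also have "\<dots> \<le> 10 * (1/4) ^ Suc n" by simp
  finally show ?case by (simp add: T3_def y2_def y1_def)
qed

text \<open>The outermost level is separate: the first coefficient is \<open>p 1\<close> without a
  preceding factor, as if \<open>q 0\<close> were 0, and only at index 1 does the recursion have the
  inhomogeneous term 1.\<close>

lemma wgf_error:
  assumes y: "0 \<le> y" "y \<le> 1"
  shows "\<bar>wgf p q z 1 - 1 / (1 - z * cchain z p q 1 (Suc n) y)\<bar> \<le> 10 * (1/4) ^ n"
proof -
  define y1 where "y1 = cchain z p q (Suc 1) n y"
  define y2 where "y2 = cstep z (q 1) y1"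
  define T1 where "T1 = 1 / (1 - (1 - q 1) * z * y1)"
  define T2 where "T2 = 1 / (1 - (1 - p 1) * z * y2)"
  define T3 where "T3 = 1 / (1 - z * cstep z (p 1) y2)"
  have pi: "0 \<le> p 1" "p 1 \<le> 1" and qi: "0 \<le> q 1" "q 1 \<le> 1" using unit_seqD[OF pq(1), of 1] unit_seqD[OF pq(2), of 1] by auto
  have y1: "0 \<le> y1" "y1 \<le> 1" unfolding y1_def using cchain_bounds[OF z y _ pq, of "Suc 1" n] by auto
  have y2: "0 \<le> y2" "y2 \<le> 1" unfolding y2_def using cstep_bounds[OF z qi y1] by auto
  have y3: "0 \<le> cstep z (p 1) y2" "cstep z (p 1) y2 \<le> 1" using cstep_bounds[OF z pi y2] by auto
  note d2 = cstep_denom[OF z pi y2] and d3 = cstep_denom[OF z _ _ y3, of 0]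
  have T2: "0 \<le> T2" "T2 \<le> 8/7" unfolding T2_def using d2 by (auto simp: divide_le_eq)
  have T3: "0 \<le> T3" "T3 \<le> 8/7" unfolding T3_def using d3 by (auto simp: divide_le_eq)
  define d where "d = wgf p q z (Suc 1) - z * T1 * wgf' 1"
  have IH: "\<bar>d\<bar> \<le> 10 * (1/4) ^ n"
    using wgf_tail_error[OF y, of 1 n] by (simp add: T1_def y1_def d_def)
  define t where "t = coeff_t p q 1"
  define s where "s = coeff_s p q 1"
  have st: "0 \<le> s" "s \<le> 1" "0 \<le> t" "t \<le> 1" unfolding s_def t_def using coeff_st_bounds[OF pq, of 1] by auto
  have y2T: "(1 - p 1) * y2 = t * T1" by (simp add: y2_def cstep_def t_def coeff_t_def T1_def)
  have sT: "cstep z (p 1) y2 = s * T2" by (simp add: cstep_def s_def coeff_s_def T2_def)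
  have T2e: "T2 * (1 - t * z * T1) = 1" unfolding T2_def by (rule cfrac_inverse[OF y2T d2(1)])
  have T3e: "T3 * (1 - s * z * T2) = 1" using cfrac_inverse[of 1 "cstep z (p 1) y2" s T2 z] sT d3(1) by (simp add: T3_def)
  define e where "e = wgf' 1 - T2 * wgf p q z 1"
  have "wgf' 1 = wgf p q z 1 + t * (z * T1 * wgf' 1 + d)" by (simp add: wgf'_def t_def d_def)
  then have "wgf' 1 * (1 - t * z * T1) = wgf p q z 1 + t * d" by (simp add: algebra_simps)
  then have "T2 * (wgf' 1 * (1 - t * z * T1)) = T2 * (wgf p q z 1 + t * d)" by simp
  moreover have "T2 * (wgf' 1 * (1 - t * z * T1)) = wgf' 1" using T2e by (simp add: mult.left_commute)
  ultimately have e: "e = T2 * t * d" by (simp add: e_def algebra_simps)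
  have "wgf p q z 1 = 1 + z * s * (T2 * wgf p q z 1 + e)"
    using wgf_1 by (simp add: e_def s_def)
  then have "wgf p q z 1 * (1 - s * z * T2) = 1 + z * s * e" by (simp add: algebra_simps)
  then have "T3 * (wgf p q z 1 * (1 - s * z * T2)) = T3 * (1 + z * s * e)" by simp
  moreover have "T3 * (wgf p q z 1 * (1 - s * z * T2)) = wgf p q z 1" using T3e by (simp add: mult.left_commute)
  ultimately have "wgf p q z 1 - T3 = (T3 * z * s * T2 * t) * d" unfolding e by (simp add: algebra_simps)
  then have "\<bar>wgf p q z 1 - T3\<bar> = (T3 * z * s * T2 * t) * \<bar>d\<bar>"
    using T2 T3 st z by (simp add: abs_mult)
  also have "\<dots> \<le> (8/7 * (1/8) * 1 * (8/7) * 1) * (10 * (1/4) ^ n)"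
    using T2 T3 st z IH by (intro mult_mono mult_nonneg_nonneg) auto
  also have "\<dots> \<le> 10 * (1/4) ^ n" by simp
  finally show ?thesis by (simp add: T3_def y2_def y1_def)
qed

end

section \<open>Stationarity of the random continued fraction\<close>

lemma measurable_cstep [measurable]:
  assumes [measurable]: "f \<in> borel_measurable M" "g \<in> borel_measurable M"
  shows "(\<lambda>x. cstep z (f x) (g x)) \<in> borel_measurable M"
  unfolding cstep_def by measurable

lemma DERIV_cstep:
  assumes "1 - (1 - u) * w > (0::real)"
  shows "((\<lambda>u. u / (1 - (1 - u) * w)) has_real_derivative (1 - w) / (1 - (1 - u) * w)\<^sup>2) (at u)"
proof -
  have 1: "((\<lambda>u. 1 - (1 - u) * w) has_real_derivative w) (at u)"
    by (auto intro!: derivative_eq_intros)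
  have e: "1 * (1 - (1 - u) * w) - u * w = 1 - w" by (simp add: algebra_simps)
  have "((\<lambda>u. u / (1 - (1 - u) * w)) has_real_derivative (1 * (1 - (1 - u) * w) - u * w) / ((1 - (1 - u) * w) * (1 - (1 - u) * w))) (at u)"
    using assms by (intro DERIV_divide DERIV_ident 1) auto
  then show ?thesis unfolding e power2_eq_square .
qed

text \<open>For fixed \<open>w\<close> the map is a Moebius bijection of the unit interval fixing
  both ends. It multiplies a beta density by a power of \<open>1 - w * y\<close>, because all other
  powers of the denominator cancel.\<close>

lemma nn_integral_cstep:
  fixes w \<alpha> \<beta> :: real
  assumes w: "0 \<le> w" "w < 1" and ab: "\<alpha> > 0" "\<beta> > 0" and [measurable]: "f \<in> borel_measurable borel"
  shows "(\<integral>\<^sup>+u. f (u / (1 - (1 - u) * w)) * ennreal (indicator {0..1} u * u powr (\<alpha> - 1) * (1 - u) powr (\<beta> - 1)) \<partial>lborel) =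
    (\<integral>\<^sup>+y. f y * ennreal (indicator {0..1} y * y powr (\<alpha> - 1) * (1 - y) powr (\<beta> - 1) * (1 - w) powr \<alpha> * (1 - w * y) powr (- (\<alpha> + \<beta>))) \<partial>lborel)"
proof -
  define T where "T = (\<lambda>u. u / (1 - (1 - u) * w))"
  define F where "F = (\<lambda>y. f y * ennreal (y powr (\<alpha> - 1) * (1 - y) powr (\<beta> - 1) * (1 - w) powr \<alpha> * (1 - w * y) powr (- (\<alpha> + \<beta>))))"
  have D: "1 - (1 - u) * w > 0" if "u \<in> {0..1}" for u
  proof -
    have "(1 - u) * w \<le> 1 * w" using that w by (intro mult_right_mono) auto
    then show ?thesis using w by linarith
  qed
  have T01: "T 0 = 0" "T 1 = 1" by (simp_all add: T_def)
  have [measurable]: "F \<in> borel_measurable borel" unfolding F_def by measurable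
  have "(\<integral>\<^sup>+y. F y * indicator {T 0..T 1} y \<partial>lborel) = (\<integral>\<^sup>+u. F (T u) * ennreal ((1 - w) / (1 - (1 - u) * w)\<^sup>2) * indicator {0..1} u \<partial>lborel)"
  proof (rule nn_integral_substitution_aux)
    show "(T has_real_derivative (1 - w) / (1 - (1 - u) * w)\<^sup>2) (at u)" if "u \<in> {0..1}" for u
      unfolding T_def by (rule DERIV_cstep[OF D[OF that]])
    show "continuous_on {0..1} (\<lambda>u. (1 - w) / (1 - (1 - u) * w)\<^sup>2)"
      using D by (intro continuous_intros) (auto simp: less_imp_neq[symmetric] dest!: D)
    show "0 \<le> (1 - w) / (1 - (1 - u) * w)\<^sup>2" if "u \<in> {0..1}" for u using w by simp
  qed auto
  also have "(\<integral>\<^sup>+y. F y * indicator {T 0..T 1} y \<partial>lborel) =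
    (\<integral>\<^sup>+y. f y * ennreal (indicator {0..1} y * y powr (\<alpha> - 1) * (1 - y) powr (\<beta> - 1) * (1 - w) powr \<alpha> * (1 - w * y) powr (- (\<alpha> + \<beta>))) \<partial>lborel)"
    unfolding T01 F_def by (intro nn_integral_cong) (auto simp: indicator_def)
  also have "(\<integral>\<^sup>+u. F (T u) * ennreal ((1 - w) / (1 - (1 - u) * w)\<^sup>2) * indicator {0..1} u \<partial>lborel) =
    (\<integral>\<^sup>+u. f (u / (1 - (1 - u) * w)) * ennreal (indicator {0..1} u * u powr (\<alpha> - 1) * (1 - u) powr (\<beta> - 1)) \<partial>lborel)"
  proof (intro nn_integral_cong)
    fix u :: real
    show "F (T u) * ennreal ((1 - w) / (1 - (1 - u) * w)\<^sup>2) * indicator {0..1} u =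
      f (u / (1 - (1 - u) * w)) * ennreal (indicator {0..1} u * u powr (\<alpha> - 1) * (1 - u) powr (\<beta> - 1))"
    proof (cases "u \<in> {0..1}")
      case True
      define d where "d = 1 - (1 - u) * w"
      have d: "d > 0" using D[OF True] by (simp add: d_def)
      have v: "1 - w > 0" using w by simp
      have Tu: "T u = u / d" by (simp add: T_def d_def)
      have 1: "1 - T u = (1 - w) * (1 - u) / d" unfolding Tu using d by (simp add: field_simps) (simp add: d_def algebra_simps)
      have 2: "1 - w * T u = (1 - w) / d" unfolding Tu using d by (simp add: field_simps) (simp add: d_def algebra_simps)
      have e: "(T u) powr (\<alpha> - 1) * (1 - T u) powr (\<beta> - 1) * (1 - w) powr \<alpha> * (1 - w * T u) powr (- (\<alpha> + \<beta>)) * ((1 - w) / d\<^sup>2) =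
        u powr (\<alpha> - 1) * (1 - u) powr (\<beta> - 1)"
      proof -
        have "(T u) powr (\<alpha> - 1) = u powr (\<alpha> - 1) * d powr (1 - \<alpha>)"
          unfolding Tu using True d by (simp add: powr_divide powr_minus_divide[symmetric] divide_powr_uminus)
        moreover have "(1 - T u) powr (\<beta> - 1) = (1 - w) powr (\<beta> - 1) * (1 - u) powr (\<beta> - 1) * d powr (1 - \<beta>)"
          unfolding 1 using True d v by (simp add: powr_divide powr_mult divide_powr_uminus)
        moreover have "(1 - w * T u) powr (- (\<alpha> + \<beta>)) = (1 - w) powr (- (\<alpha> + \<beta>)) * d powr (\<alpha> + \<beta>)"
          unfolding 2 using d v by (simp add: powr_divide divide_powr_uminus add.commute)
        moreover have "(1 - w) / d\<^sup>2 = (1 - w) powr 1 * d powr (- 2)"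
          using d v by (simp add: powr_minus_divide powr_numeral)
        ultimately have "(T u) powr (\<alpha> - 1) * (1 - T u) powr (\<beta> - 1) * (1 - w) powr \<alpha> * (1 - w * T u) powr (- (\<alpha> + \<beta>)) * ((1 - w) / d\<^sup>2) =
          u powr (\<alpha> - 1) * (1 - u) powr (\<beta> - 1) *
            (d powr (1 - \<alpha>) * d powr (1 - \<beta>) * d powr (\<alpha> + \<beta>) * d powr (- 2)) *
            ((1 - w) powr (\<beta> - 1) * (1 - w) powr \<alpha> * (1 - w) powr (- (\<alpha> + \<beta>)) * (1 - w) powr 1)"
          by (simp only: mult_ac)
        also have "d powr (1 - \<alpha>) * d powr (1 - \<beta>) * d powr (\<alpha> + \<beta>) * d powr (- 2) = d powr 0"
          unfolding powr_add[symmetric] by (rule arg_cong) simp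
        also have "(1 - w) powr (\<beta> - 1) * (1 - w) powr \<alpha> * (1 - w) powr (- (\<alpha> + \<beta>)) * (1 - w) powr 1 = (1 - w) powr 0"
          unfolding powr_add[symmetric] by (rule arg_cong) simp
        finally show ?thesis using d v by simp
      qed
      have "F (T u) * ennreal ((1 - w) / (1 - (1 - u) * w)\<^sup>2) = f (T u) * (ennreal ((T u) powr (\<alpha> - 1) * (1 - T u) powr (\<beta> - 1) * (1 - w) powr \<alpha> * (1 - w * T u) powr (- (\<alpha> + \<beta>))) * ennreal ((1 - w) / d\<^sup>2))"
        by (simp only: F_def d_def[symmetric] mult.assoc)
      also have "\<dots> = f (T u) * ennreal (u powr (\<alpha> - 1) * (1 - u) powr (\<beta> - 1))"
        by (subst ennreal_mult'[symmetric]) (simp_all only: e, simp)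
      finally show ?thesis using True by (simp add: T_def)
    qed simp
  qed
  finally show ?thesis by simp
qed

text \<open>Kept without normalisation, since its total mass is, up to a beta constant, the
  hypergeometric series that enters the final identity.\<close>

definition bdens :: "real \<Rightarrow> real \<Rightarrow> real \<Rightarrow> real \<Rightarrow> real \<Rightarrow> real" where
  "bdens z \<alpha> \<beta> \<gamma> y = indicator {0..1} y * y powr (\<alpha> - 1) * (1 - y) powr (\<beta> - 1) * (1 - z * y) powr (- \<gamma>)"

lemma measurable_bdens [measurable]: "bdens z \<alpha> \<beta> \<gamma> \<in> borel_measurable borel"
  unfolding bdens_def[abs_def] by measurable

lemma bdens_nonneg: "0 \<le> bdens z \<alpha> \<beta> \<gamma> y"
  by (simp add: bdens_def)

lemma sets_beta_distr [measurable_cong]: "sets (beta_distr p q) = sets borel"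
  by (simp add: beta_distr_def)

lemma nn_integral_beta_distr:
  assumes "p > 0" "q > 0" and [measurable]: "f \<in> borel_measurable borel"
  shows "(\<integral>\<^sup>+u. f u \<partial>beta_distr p q) =
    (\<integral>\<^sup>+u. f u * ennreal (indicator {0..1} u * u powr (p - 1) * (1 - u) powr (q - 1)) \<partial>lborel) / ennreal (Beta p q)"
proof -
  have B: "Beta p q > 0" using assms by (rule_tac Beta_pos)
  have "(\<integral>\<^sup>+u. f u \<partial>beta_distr p q) = (\<integral>\<^sup>+u. ennreal (indicator {0..1} u * u powr (p - 1) * (1 - u) powr (q - 1) / Beta p q) * f u \<partial>lborel)"
    unfolding beta_distr_def by (rule nn_integral_density) auto
  also have "\<dots> = (\<integral>\<^sup>+u. f u * ennreal (indicator {0..1} u * u powr (p - 1) * (1 - u) powr (q - 1)) / ennreal (Beta p q) \<partial>lborel)"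
    by (intro nn_integral_cong, subst divide_ennreal[symmetric])
       (use B in \<open>auto simp: ennreal_times_divide mult.commute\<close>)
  also have "\<dots> = (\<integral>\<^sup>+u. f u * ennreal (indicator {0..1} u * u powr (p - 1) * (1 - u) powr (q - 1)) \<partial>lborel) / ennreal (Beta p q)"
    by (intro nn_integral_divide) auto
  finally show ?thesis .
qed

lemma prob_space_beta_distr:
  assumes "p > 0" "q > 0" shows "prob_space (beta_distr p q)"
proof
  have "emeasure (beta_distr p q) (space (beta_distr p q)) = (\<integral>\<^sup>+u. 1 \<partial>beta_distr p q)" by simp
  also have "\<dots> = ennreal (Beta p q) / ennreal (Beta p q)"
    using assms by (subst nn_integral_beta_distr) (auto simp: nn_integral_Beta)
  also have "\<dots> = 1" using Beta_pos[OF assms] by (simp add: divide_ennreal)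
  finally show "emeasure (beta_distr p q) (space (beta_distr p q)) = 1" .
qed

text \<open>Half a step exchanges the roles of the two beta laws. After substitution the joint
  weight of the old value \<open>y\<close> and the new value \<open>x\<close> is the product of two
  beta weights and a power of \<open>1 - z * x * y\<close>; equality of the parameter sums makes
  that power symmetric in the two roles, and integrating out \<open>y\<close> leaves the other
  density.\<close>

lemma nn_integral_bdens_beta:
  assumes z: "0 \<le> z" "z < 1" and pos: "\<alpha> > 0" "\<beta> > 0" "\<alpha>' > 0" "\<beta>' > 0" and sum: "\<alpha> + \<beta> = \<alpha>' + \<beta>'"
    and [measurable]: "f \<in> borel_measurable borel"
  shows "(\<integral>\<^sup>+y. ennreal (bdens z \<alpha>' \<beta>' \<alpha> y) * (\<integral>\<^sup>+u. f (cstep z u y) \<partial>beta_distr \<alpha> \<beta>) \<partial>lborel) =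
    ennreal (Beta \<alpha>' \<beta>') / ennreal (Beta \<alpha> \<beta>) * (\<integral>\<^sup>+y. ennreal (bdens z \<alpha> \<beta> \<alpha>' y) * f y \<partial>lborel)"
proof -
  let ?B = "ennreal (Beta \<alpha> \<beta>)"
  have zy: "0 \<le> z * y" "z * y < 1" if "y \<in> {0..1}" for y
    using z that by (auto intro: le_less_trans[OF mult_left_le])
  let ?k = "\<lambda>y x. ennreal (indicator {0..1} y * y powr (\<alpha>' - 1) * (1 - y) powr (\<beta>' - 1) * (1 - z * x * y) powr (- (\<alpha>' + \<beta>')))"
  let ?g = "\<lambda>x. ennreal (indicator {0..1} x * x powr (\<alpha> - 1) * (1 - x) powr (\<beta> - 1)) * f x"
  \<comment> \<open>The substitution formula for the constant function 1: the beta mass is unchanged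
    by the map, which evaluates this integral.\<close>
  have mass: "(\<integral>\<^sup>+y. ?k y x \<partial>lborel) = ennreal (Beta \<alpha>' \<beta>' * (1 - z * x) powr (- \<alpha>'))" if x: "x \<in> {0..1}" for x
  proof -
    have p: "(1 - z * x) powr \<alpha>' > 0" using zy[OF x] by simp
    have "ennreal (Beta \<alpha>' \<beta>') = (\<integral>\<^sup>+y. ennreal (indicator {0..1} y * y powr (\<alpha>' - 1) * (1 - y) powr (\<beta>' - 1) * (1 - z * x) powr \<alpha>' * (1 - z * x * y) powr (- (\<alpha>' + \<beta>'))) \<partial>lborel)"
      using nn_integral_cstep[OF zy[OF x] pos(3,4), of "\<lambda>_. 1"] nn_integral_Beta[OF pos(3,4)] by simp
    also have "\<dots> = (\<integral>\<^sup>+y. ennreal ((1 - z * x) powr \<alpha>') * ?k y x \<partial>lborel)"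
      by (intro nn_integral_cong, subst ennreal_mult'[symmetric]) (auto simp: mult_ac)
    also have "\<dots> = ennreal ((1 - z * x) powr \<alpha>') * (\<integral>\<^sup>+y. ?k y x \<partial>lborel)"
      by (intro nn_integral_cmult) auto
    finally have e: "ennreal (Beta \<alpha>' \<beta>') = ennreal ((1 - z * x) powr \<alpha>') * (\<integral>\<^sup>+y. ?k y x \<partial>lborel)" .
    have "ennreal ((1 - z * x) powr (- \<alpha>')) * ennreal (Beta \<alpha>' \<beta>') =
       (ennreal ((1 - z * x) powr (- \<alpha>')) * ennreal ((1 - z * x) powr \<alpha>')) * (\<integral>\<^sup>+y. ?k y x \<partial>lborel)"
      unfolding e by (simp only: mult.assoc)
    also have "ennreal ((1 - z * x) powr (- \<alpha>')) * ennreal ((1 - z * x) powr \<alpha>') = 1"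
    proof -
      have "(1 - z * x) powr (- \<alpha>') * (1 - z * x) powr \<alpha>' = 1" using zy[OF x] by (simp flip: powr_add)
      then show ?thesis by (simp flip: ennreal_mult')
    qed
    finally show ?thesis using Beta_pos[OF pos(3,4)] by (simp add: mult.commute flip: ennreal_mult')
  qed
  have "(\<integral>\<^sup>+y. ennreal (bdens z \<alpha>' \<beta>' \<alpha> y) * (\<integral>\<^sup>+u. f (cstep z u y) \<partial>beta_distr \<alpha> \<beta>) \<partial>lborel) =
    (\<integral>\<^sup>+y. (\<integral>\<^sup>+x. ?k y x * ?g x \<partial>lborel) / ?B \<partial>lborel)"
  proof (intro nn_integral_cong)
    fix y :: real
    show "ennreal (bdens z \<alpha>' \<beta>' \<alpha> y) * (\<integral>\<^sup>+u. f (cstep z u y) \<partial>beta_distr \<alpha> \<beta>) = (\<integral>\<^sup>+x. ?k y x * ?g x \<partial>lborel) / ?B"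
    proof (cases "y \<in> {0..1}")
      case True
      have c: "cstep z u y = u / (1 - (1 - u) * (z * y))" for u by (simp add: cstep_def mult.assoc)
      have "(\<integral>\<^sup>+u. f (cstep z u y) \<partial>beta_distr \<alpha> \<beta>) =
        (\<integral>\<^sup>+x. f x * ennreal (indicator {0..1} x * x powr (\<alpha> - 1) * (1 - x) powr (\<beta> - 1) * (1 - z * y) powr \<alpha> * (1 - z * y * x) powr (- (\<alpha> + \<beta>))) \<partial>lborel) / ?B"
        using nn_integral_cstep[OF zy[OF True] pos(1,2), of f]
        by (subst nn_integral_beta_distr[OF pos(1,2)]) (simp_all add: c)
      then have "ennreal (bdens z \<alpha>' \<beta>' \<alpha> y) * (\<integral>\<^sup>+u. f (cstep z u y) \<partial>beta_distr \<alpha> \<beta>) =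
         ennreal (bdens z \<alpha>' \<beta>' \<alpha> y) * (\<integral>\<^sup>+x. f x * ennreal (indicator {0..1} x * x powr (\<alpha> - 1) * (1 - x) powr (\<beta> - 1) * (1 - z * y) powr \<alpha> * (1 - z * y * x) powr (- (\<alpha> + \<beta>))) \<partial>lborel) / ?B"
        by (simp add: ennreal_times_divide)
      also have "ennreal (bdens z \<alpha>' \<beta>' \<alpha> y) * (\<integral>\<^sup>+x. f x * ennreal (indicator {0..1} x * x powr (\<alpha> - 1) * (1 - x) powr (\<beta> - 1) * (1 - z * y) powr \<alpha> * (1 - z * y * x) powr (- (\<alpha> + \<beta>))) \<partial>lborel) =
         (\<integral>\<^sup>+x. ennreal (bdens z \<alpha>' \<beta>' \<alpha> y) * (f x * ennreal (indicator {0..1} x * x powr (\<alpha> - 1) * (1 - x) powr (\<beta> - 1) * (1 - z * y) powr \<alpha> * (1 - z * y * x) powr (- (\<alpha> + \<beta>)))) \<partial>lborel)"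
        by (intro nn_integral_cmult[symmetric]) auto
      also have "\<dots> = (\<integral>\<^sup>+x. ?k y x * ?g x \<partial>lborel)"
      proof (intro nn_integral_cong)
        fix x :: real
        have cancel: "(1 - z * y) powr (- \<alpha>) * (1 - z * y) powr \<alpha> = 1" using zy[OF True] by (simp flip: powr_add)
        have "bdens z \<alpha>' \<beta>' \<alpha> y * (indicator {0..1} x * x powr (\<alpha> - 1) * (1 - x) powr (\<beta> - 1) * (1 - z * y) powr \<alpha> * (1 - z * y * x) powr (- (\<alpha> + \<beta>))) =
          ((1 - z * y) powr (- \<alpha>) * (1 - z * y) powr \<alpha>) * ((indicator {0..1} y * y powr (\<alpha>' - 1) * (1 - y) powr (\<beta>' - 1) * (1 - z * x * y) powr (- (\<alpha>' + \<beta>'))) *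
          (indicator {0..1} x * x powr (\<alpha> - 1) * (1 - x) powr (\<beta> - 1)))"
          unfolding sum bdens_def mult.assoc[of z x y] mult.commute[of x y] mult.assoc[of z y x] by (simp only: mult_ac)
        then have e: "bdens z \<alpha>' \<beta>' \<alpha> y * (indicator {0..1} x * x powr (\<alpha> - 1) * (1 - x) powr (\<beta> - 1) * (1 - z * y) powr \<alpha> * (1 - z * y * x) powr (- (\<alpha> + \<beta>))) =
          (indicator {0..1} y * y powr (\<alpha>' - 1) * (1 - y) powr (\<beta>' - 1) * (1 - z * x * y) powr (- (\<alpha>' + \<beta>'))) *
          (indicator {0..1} x * x powr (\<alpha> - 1) * (1 - x) powr (\<beta> - 1))"
          unfolding cancel by (simp only: mult_1)
        have "ennreal (bdens z \<alpha>' \<beta>' \<alpha> y) * (f x * ennreal (indicator {0..1} x * x powr (\<alpha> - 1) * (1 - x) powr (\<beta> - 1) * (1 - z * y) powr \<alpha> * (1 - z * y * x) powr (- (\<alpha> + \<beta>)))) =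
          f x * (ennreal (bdens z \<alpha>' \<beta>' \<alpha> y) * ennreal (indicator {0..1} x * x powr (\<alpha> - 1) * (1 - x) powr (\<beta> - 1) * (1 - z * y) powr \<alpha> * (1 - z * y * x) powr (- (\<alpha> + \<beta>))))"
          by (simp only: mult_ac)
        also have "\<dots> = f x * (?k y x * ennreal (indicator {0..1} x * x powr (\<alpha> - 1) * (1 - x) powr (\<beta> - 1)))"
          by (subst ennreal_mult'[symmetric], simp add: bdens_nonneg, subst e, subst ennreal_mult', simp, rule refl)
        finally show "ennreal (bdens z \<alpha>' \<beta>' \<alpha> y) * (f x * ennreal (indicator {0..1} x * x powr (\<alpha> - 1) * (1 - x) powr (\<beta> - 1) * (1 - z * y) powr \<alpha> * (1 - z * y * x) powr (- (\<alpha> + \<beta>)))) = ?k y x * ?g x"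
          by (simp only: mult_ac)
      qed
      finally show ?thesis .
    qed (simp add: bdens_def)
  qed
  also have "\<dots> = (\<integral>\<^sup>+y. (\<integral>\<^sup>+x. ?k y x * ?g x \<partial>lborel) \<partial>lborel) / ?B"
    by (intro nn_integral_divide) measurable
  also have "(\<integral>\<^sup>+y. (\<integral>\<^sup>+x. ?k y x * ?g x \<partial>lborel) \<partial>lborel) = (\<integral>\<^sup>+x. (\<integral>\<^sup>+y. ?k y x * ?g x \<partial>lborel) \<partial>lborel)"
    by (rule lborel_pair.Fubini') measurable
  also have "\<dots> = (\<integral>\<^sup>+x. ennreal (Beta \<alpha>' \<beta>') * (ennreal (bdens z \<alpha> \<beta> \<alpha>' x) * f x) \<partial>lborel)"
  proof (intro nn_integral_cong)
    fix x :: real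
    have "(\<integral>\<^sup>+y. ?k y x * ?g x \<partial>lborel) = (\<integral>\<^sup>+y. ?k y x \<partial>lborel) * ?g x"
      by (intro nn_integral_multc) auto
    also have "\<dots> = ennreal (Beta \<alpha>' \<beta>') * (ennreal (bdens z \<alpha> \<beta> \<alpha>' x) * f x)"
    proof (cases "x \<in> {0..1}")
      case True
      have e: "Beta \<alpha>' \<beta>' * (1 - z * x) powr (- \<alpha>') * (indicator {0..1} x * x powr (\<alpha> - 1) * (1 - x) powr (\<beta> - 1)) = Beta \<alpha>' \<beta>' * bdens z \<alpha> \<beta> \<alpha>' x"
        by (simp add: bdens_def mult_ac)
      have "ennreal (Beta \<alpha>' \<beta>' * (1 - z * x) powr (- \<alpha>')) * ennreal (indicator {0..1} x * x powr (\<alpha> - 1) * (1 - x) powr (\<beta> - 1)) =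
         ennreal (Beta \<alpha>' \<beta>') * ennreal (bdens z \<alpha> \<beta> \<alpha>' x)"
      proof -
        have "ennreal (Beta \<alpha>' \<beta>' * (1 - z * x) powr (- \<alpha>')) * ennreal (indicator {0..1} x * x powr (\<alpha> - 1) * (1 - x) powr (\<beta> - 1)) =
          ennreal (Beta \<alpha>' \<beta>' * (1 - z * x) powr (- \<alpha>') * (indicator {0..1} x * x powr (\<alpha> - 1) * (1 - x) powr (\<beta> - 1)))"
          by (rule ennreal_mult'[symmetric]) (use Beta_pos[OF pos(3,4)] in simp)
        also have "\<dots> = ennreal (Beta \<alpha>' \<beta>') * ennreal (bdens z \<alpha> \<beta> \<alpha>' x)"
          unfolding e by (rule ennreal_mult') (use Beta_pos[OF pos(3,4)] in simp)
        finally show ?thesis .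
      qed
      then show ?thesis unfolding mass[OF True] by (simp only: mult.assoc[symmetric])
    qed (simp add: bdens_def)
    finally show "(\<integral>\<^sup>+y. ?k y x * ?g x \<partial>lborel) = ennreal (Beta \<alpha>' \<beta>') * (ennreal (bdens z \<alpha> \<beta> \<alpha>' x) * f x)" .
  qed
  also have "\<dots> = ennreal (Beta \<alpha>' \<beta>') * (\<integral>\<^sup>+x. ennreal (bdens z \<alpha> \<beta> \<alpha>' x) * f x \<partial>lborel)"
    by (intro nn_integral_cmult) auto
  finally show ?thesis by (simp add: ennreal_times_divide divide_ennreal_def mult_ac)
qed

lemma Beta_ennreal_cancel:
  assumes "(A::real) > 0" "B > 0"
  shows "ennreal A / ennreal B * (ennreal B / ennreal A * X) = X"
proof -
  have "ennreal A / ennreal B * (ennreal B / ennreal A) = 1"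
    using assms by (simp add: divide_ennreal ennreal_mult'[symmetric])
  then show ?thesis by (simp add: mult.assoc[symmetric])
qed

text \<open>The law with density proportional to \<open>bdens\<close> is stationary for the random continued fraction.\<close>

lemma nn_integral_bdens_two_steps:
  assumes z: "0 \<le> z" "z < 1" and pos: "\<alpha> > 0" "\<beta> > 0" "\<alpha>' > 0" "\<beta>' > 0" and sum: "\<alpha> + \<beta> = \<alpha>' + \<beta>'"
    and [measurable]: "f \<in> borel_measurable borel"
  shows "(\<integral>\<^sup>+y. ennreal (bdens z \<alpha> \<beta> \<alpha>' y) * (\<integral>\<^sup>+v. (\<integral>\<^sup>+u. f (cstep z u (cstep z v y)) \<partial>beta_distr \<alpha> \<beta>) \<partial>beta_distr \<alpha>' \<beta>') \<partial>lborel) =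
    (\<integral>\<^sup>+y. ennreal (bdens z \<alpha> \<beta> \<alpha>' y) * f y \<partial>lborel)"
proof -
  interpret A: prob_space "beta_distr \<alpha> \<beta>" by (rule prob_space_beta_distr[OF pos(1,2)])
  define g where "g = (\<lambda>y. \<integral>\<^sup>+u. f (cstep z u y) \<partial>beta_distr \<alpha> \<beta>)"
  have [measurable]: "g \<in> borel_measurable borel" unfolding g_def by measurable
  have "(\<integral>\<^sup>+y. ennreal (bdens z \<alpha> \<beta> \<alpha>' y) * (\<integral>\<^sup>+v. g (cstep z v y) \<partial>beta_distr \<alpha>' \<beta>') \<partial>lborel) =
    ennreal (Beta \<alpha> \<beta>) / ennreal (Beta \<alpha>' \<beta>') * (\<integral>\<^sup>+y. ennreal (bdens z \<alpha>' \<beta>' \<alpha> y) * g y \<partial>lborel)"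
    by (rule nn_integral_bdens_beta[OF z pos(3,4,1,2) sum[symmetric]]) measurable
  also have "(\<integral>\<^sup>+y. ennreal (bdens z \<alpha>' \<beta>' \<alpha> y) * g y \<partial>lborel) =
    ennreal (Beta \<alpha>' \<beta>') / ennreal (Beta \<alpha> \<beta>) * (\<integral>\<^sup>+y. ennreal (bdens z \<alpha> \<beta> \<alpha>' y) * f y \<partial>lborel)"
    unfolding g_def by (rule nn_integral_bdens_beta[OF z pos sum]) measurable
  finally show ?thesis unfolding Beta_ennreal_cancel[OF Beta_pos[OF pos(1,2)] Beta_pos[OF pos(3,4)]] by (simp add: g_def)
qed

lemma (in prob_space) nn_integral_cmult_iterated:
  assumes h: "h \<in> borel_measurable (N \<Otimes>\<^sub>M M)"
  shows "(\<integral>\<^sup>+u. \<integral>\<^sup>+x. k * h (u, x) \<partial>M \<partial>N) = k * (\<integral>\<^sup>+u. \<integral>\<^sup>+x. h (u, x) \<partial>M \<partial>N)"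
proof -
  have "(\<integral>\<^sup>+u. \<integral>\<^sup>+x. k * h (u, x) \<partial>M \<partial>N) = (\<integral>\<^sup>+u. k * (\<integral>\<^sup>+x. h (u, x) \<partial>M) \<partial>N)"
  proof (rule nn_integral_cong)
    fix u assume "u \<in> space N"
    then have "(\<lambda>x. h (u, x)) \<in> borel_measurable M"
      using measurable_compose[OF measurable_Pair1' h] by blast
    then show "(\<integral>\<^sup>+x. k * h (u, x) \<partial>M) = k * (\<integral>\<^sup>+x. h (u, x) \<partial>M)"
      by (rule nn_integral_cmult)
  qed
  also have "\<dots> = k * (\<integral>\<^sup>+u. \<integral>\<^sup>+x. h (u, x) \<partial>M \<partial>N)"
    using h by (intro nn_integral_cmult borel_measurable_nn_integral) simp
  finally show ?thesis .
qed

lemma measurable_cchain: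
  assumes "1 \<le> i" "i + n \<le> Suc m"
    and sets: "sets A = sets (borel :: real measure)" "sets B = sets (borel :: real measure)"
  shows "(\<lambda>((p, q), y). cchain z p q i n y) \<in> borel_measurable ((PiM {1..m} (\<lambda>_. A) \<Otimes>\<^sub>M PiM {1..m} (\<lambda>_. B)) \<Otimes>\<^sub>M borel)"
  using assms(1,2)
proof (induction n arbitrary: i)
  case (Suc n)
  have i: "i \<in> {1..m}" using Suc.prems by auto
  note [measurable_cong] = sets
  have pm: "(\<lambda>x. fst (fst x) i) \<in> measurable ((PiM {1..m} (\<lambda>_. A) \<Otimes>\<^sub>M PiM {1..m} (\<lambda>_. B)) \<Otimes>\<^sub>M (borel :: real measure)) A"
    by (rule measurable_compose[OF _ measurable_component_singleton[OF i]]) measurable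
  have qm: "(\<lambda>x. snd (fst x) i) \<in> measurable ((PiM {1..m} (\<lambda>_. A) \<Otimes>\<^sub>M PiM {1..m} (\<lambda>_. B)) \<Otimes>\<^sub>M (borel :: real measure)) B"
    by (rule measurable_compose[OF _ measurable_component_singleton[OF i]]) measurable
  have IH: "(\<lambda>x. cchain z (fst (fst x)) (snd (fst x)) (Suc i) n (snd x)) \<in> borel_measurable ((PiM {1..m} (\<lambda>_. A) \<Otimes>\<^sub>M PiM {1..m} (\<lambda>_. B)) \<Otimes>\<^sub>M borel)"
    using Suc.IH[of "Suc i"] Suc.prems by (simp add: case_prod_beta')
  show ?case
    unfolding case_prod_beta' cchain.simps
    using pm qm by (intro measurable_cstep IH) (simp_all add: measurable_cong_sets[OF refl sets(1)] measurable_cong_sets[OF refl sets(2)])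
qed (simp add: case_prod_beta')

text \<open>A further level is added at the inner end of the chain. Fubini brings the integrations
  over its two variables next to that over \<open>y\<close>, where stationarity absorbs
  them.\<close>

lemma nn_integral_cchain:
  assumes z: "0 \<le> z" "z < 1" and pos: "\<alpha> > 0" "\<beta> > 0" "\<alpha>' > 0" "\<beta>' > 0" and sum: "\<alpha> + \<beta> = \<alpha>' + \<beta>'"
    and [measurable]: "f \<in> borel_measurable borel"
  shows "(\<integral>\<^sup>+p. \<integral>\<^sup>+q. \<integral>\<^sup>+y. ennreal (bdens z \<alpha> \<beta> \<alpha>' y) * f (cchain z p q 1 n y) \<partial>lborel
      \<partial>PiM {1..n} (\<lambda>_. beta_distr \<alpha>' \<beta>') \<partial>PiM {1..n} (\<lambda>_. beta_distr \<alpha> \<beta>)) =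
    (\<integral>\<^sup>+y. ennreal (bdens z \<alpha> \<beta> \<alpha>' y) * f y \<partial>lborel)"
proof (induction n)
  case 0
  interpret A: prob_space "PiM ({} :: nat set) (\<lambda>_. beta_distr \<alpha> \<beta>)" by (intro prob_space_PiM prob_space_beta_distr pos)
  interpret B: prob_space "PiM ({} :: nat set) (\<lambda>_. beta_distr \<alpha>' \<beta>')" by (intro prob_space_PiM prob_space_beta_distr pos)
  show ?case using A.emeasure_space_1 B.emeasure_space_1 by simp
next
  case (Suc n)
  let ?A = "beta_distr \<alpha> \<beta>" and ?B = "beta_distr \<alpha>' \<beta>'"
  interpret A1: prob_space ?A by (rule prob_space_beta_distr[OF pos(1,2)])
  interpret B1: prob_space ?B by (rule prob_space_beta_distr[OF pos(3,4)])
  interpret A: product_sigma_finite "\<lambda>_::nat. ?A" by standard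
  interpret B: product_sigma_finite "\<lambda>_::nat. ?B" by standard
  interpret An: prob_space "PiM {1..n} (\<lambda>_. ?A)" by (intro prob_space_PiM prob_space_beta_distr pos)
  interpret Bn: prob_space "PiM {1..n} (\<lambda>_. ?B)" by (intro prob_space_PiM prob_space_beta_distr pos)
  interpret Bm: prob_space "PiM {1..Suc n} (\<lambda>_. ?B)" by (intro prob_space_PiM prob_space_beta_distr pos)
  have ins: "{1..Suc n} = insert (Suc n) {1..n}" by auto
  have sA: "sets ?A = sets borel" and sB: "sets ?B = sets borel" by (rule sets_beta_distr)+
  define K where "K = (\<lambda>p q. \<integral>\<^sup>+y. ennreal (bdens z \<alpha> \<beta> \<alpha>' y) * f (cchain z p q 1 (Suc n) y) \<partial>lborel)"
  have mc: "(\<lambda>((p, q), y). cchain z p q 1 (Suc n) y) \<in> borel_measurable ((PiM {1..Suc n} (\<lambda>_. ?A) \<Otimes>\<^sub>M PiM {1..Suc n} (\<lambda>_. ?B)) \<Otimes>\<^sub>M borel)"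
    by (rule measurable_cchain[OF _ _ sA sB]) auto
  have mK: "(\<lambda>(p, q). K p q) \<in> borel_measurable (PiM {1..Suc n} (\<lambda>_. ?A) \<Otimes>\<^sub>M PiM {1..Suc n} (\<lambda>_. ?B))"
    unfolding K_def case_prod_beta' using mc[unfolded case_prod_beta']
    by (intro lborel.borel_measurable_nn_integral) (simp add: case_prod_beta')
  have mc': "(\<lambda>((p, q), y). cchain z p q 1 n y) \<in> borel_measurable ((PiM {1..n} (\<lambda>_. ?A) \<Otimes>\<^sub>M PiM {1..n} (\<lambda>_. ?B)) \<Otimes>\<^sub>M borel)"
    by (rule measurable_cchain[OF _ _ sA sB]) auto
  have K_upd: "K (p(Suc n := x)) (q(Suc n := u)) = (\<integral>\<^sup>+y. ennreal (bdens z \<alpha> \<beta> \<alpha>' y) * f (cchain z p q 1 n (cstep z x (cstep z u y))) \<partial>lborel)" for p q x u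
  proof -
    have "cchain z (p(Suc n := x)) (q(Suc n := u)) 1 n y = cchain z p q 1 n y" for y by (rule cchain_cong) auto
    then show ?thesis unfolding K_def cchain_Suc_end by simp
  qed
  have mKx: "(\<lambda>q. K p q) \<in> borel_measurable (PiM {1..Suc n} (\<lambda>_. ?B))" if "p \<in> space (PiM {1..Suc n} (\<lambda>_. ?A))" for p
    using measurable_compose[OF measurable_Pair1'[OF that] mK] by simp
  have "(\<integral>\<^sup>+p. \<integral>\<^sup>+q. K p q \<partial>PiM {1..Suc n} (\<lambda>_. ?B) \<partial>PiM {1..Suc n} (\<lambda>_. ?A)) =
    (\<integral>\<^sup>+p. \<integral>\<^sup>+x. \<integral>\<^sup>+q. K (p(Suc n := x)) q \<partial>PiM {1..Suc n} (\<lambda>_. ?B) \<partial>?A \<partial>PiM {1..n} (\<lambda>_. ?A))"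
  proof -
    have "(\<lambda>p. \<integral>\<^sup>+q. K p q \<partial>PiM {1..Suc n} (\<lambda>_. ?B)) \<in> borel_measurable (PiM {1..Suc n} (\<lambda>_. ?A))"
      using mK by (intro Bm.borel_measurable_nn_integral) simp
    then show ?thesis unfolding ins by (intro A.product_nn_integral_insert) auto
  qed
  also have "\<dots> = (\<integral>\<^sup>+p. \<integral>\<^sup>+q. \<integral>\<^sup>+y. ennreal (bdens z \<alpha> \<beta> \<alpha>' y) * f (cchain z p q 1 n y) \<partial>lborel
      \<partial>PiM {1..n} (\<lambda>_. ?B) \<partial>PiM {1..n} (\<lambda>_. ?A))"
  proof (intro nn_integral_cong)
    fix p :: "nat \<Rightarrow> real" assume p: "p \<in> space (PiM {1..n} (\<lambda>_. ?A))"
    define G where "G = (\<lambda>q x u. \<integral>\<^sup>+y. ennreal (bdens z \<alpha> \<beta> \<alpha>' y) * f (cchain z p q 1 n (cstep z x (cstep z u y))) \<partial>lborel)"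
    have mch: "(\<lambda>(q, y). cchain z p q 1 n y) \<in> borel_measurable (PiM {1..n} (\<lambda>_. ?B) \<Otimes>\<^sub>M borel)"
    proof -
      have "(\<lambda>qy. ((p, fst qy), snd qy)) \<in> measurable (PiM {1..n} (\<lambda>_. ?B) \<Otimes>\<^sub>M borel) ((PiM {1..n} (\<lambda>_. ?A) \<Otimes>\<^sub>M PiM {1..n} (\<lambda>_. ?B)) \<Otimes>\<^sub>M (borel :: real measure))"
        using p by measurable
      from measurable_compose[OF this mc'] show ?thesis by (simp add: case_prod_beta')
    qed
    have [measurable]: "(\<lambda>x. cchain z p (f1 x) 1 n (f2 x)) \<in> borel_measurable M"
      if "f1 \<in> measurable M (PiM {1..n} (\<lambda>_. ?B))" "f2 \<in> borel_measurable M" for f1 f2 and M :: "'z measure"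
      using measurable_compose[OF measurable_Pair[OF that] mch] by simp
    note [measurable_cong] = sA sB
    have [measurable]: "(\<lambda>(w, y). cchain z p (fst w) 1 n (cstep z (fst (snd w)) (cstep z (snd (snd w)) y))) \<in> borel_measurable ((PiM {1..n} (\<lambda>_. ?B) \<Otimes>\<^sub>M (?A \<Otimes>\<^sub>M ?B)) \<Otimes>\<^sub>M borel)"
    proof -
      have "(\<lambda>x. (fst (fst x), cstep z (fst (snd (fst x))) (cstep z (snd (snd (fst x))) (snd x)))) \<in>
        measurable ((PiM {1..n} (\<lambda>_. ?B) \<Otimes>\<^sub>M (?A \<Otimes>\<^sub>M ?B)) \<Otimes>\<^sub>M borel) (PiM {1..n} (\<lambda>_. ?B) \<Otimes>\<^sub>M borel)"
        by measurable
      from measurable_compose[OF this mch] show ?thesis by (simp add: case_prod_beta')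
    qed
    have mG: "(\<lambda>w. G (fst w) (fst (snd w)) (snd (snd w))) \<in> borel_measurable (PiM {1..n} (\<lambda>_. ?B) \<Otimes>\<^sub>M (?A \<Otimes>\<^sub>M ?B))"
      unfolding G_def by (intro lborel.borel_measurable_nn_integral) measurable
    have mG2: "(\<lambda>(x, q). \<integral>\<^sup>+u. G q x u \<partial>?B) \<in> borel_measurable (?A \<Otimes>\<^sub>M PiM {1..n} (\<lambda>_. ?B))"
    proof -
      have "(\<lambda>w. (snd (fst w), fst (fst w), snd w)) \<in> measurable ((?A \<Otimes>\<^sub>M PiM {1..n} (\<lambda>_. ?B)) \<Otimes>\<^sub>M ?B) (PiM {1..n} (\<lambda>_. ?B) \<Otimes>\<^sub>M (?A \<Otimes>\<^sub>M ?B))"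
        by measurable
      from measurable_compose[OF this mG] have "(\<lambda>((x, q), u). G q x u) \<in> borel_measurable ((?A \<Otimes>\<^sub>M PiM {1..n} (\<lambda>_. ?B)) \<Otimes>\<^sub>M ?B)"
        by (simp add: case_prod_beta')
      then show ?thesis unfolding case_prod_beta' by (intro B1.borel_measurable_nn_integral) (simp add: case_prod_beta')
    qed
    have "(\<integral>\<^sup>+x. \<integral>\<^sup>+q. K (p(Suc n := x)) q \<partial>PiM {1..Suc n} (\<lambda>_. ?B) \<partial>?A) =
       (\<integral>\<^sup>+x. \<integral>\<^sup>+q. \<integral>\<^sup>+u. G q x u \<partial>?B \<partial>PiM {1..n} (\<lambda>_. ?B) \<partial>?A)"
    proof (intro nn_integral_cong)
      fix x assume x: "x \<in> space ?A"
      have px: "p(Suc n := x) \<in> space (PiM {1..Suc n} (\<lambda>_. ?A))"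
        using p x unfolding ins by (auto simp: space_PiM PiE_def extensional_def)
      show "(\<integral>\<^sup>+q. K (p(Suc n := x)) q \<partial>PiM {1..Suc n} (\<lambda>_. ?B)) = (\<integral>\<^sup>+q. \<integral>\<^sup>+u. G q x u \<partial>?B \<partial>PiM {1..n} (\<lambda>_. ?B))"
        unfolding ins G_def K_upd[symmetric] using mKx[OF px, unfolded ins]
        by (intro B.product_nn_integral_insert) auto
    qed
    also have "\<dots> = (\<integral>\<^sup>+q. \<integral>\<^sup>+x. \<integral>\<^sup>+u. G q x u \<partial>?B \<partial>?A \<partial>PiM {1..n} (\<lambda>_. ?B))"
    proof -
      interpret P: pair_sigma_finite ?A "PiM {1..n} (\<lambda>_. ?B)" ..
      show ?thesis by (rule P.Fubini'[symmetric]) (use mG2 in simp)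
    qed
    also have "\<dots> = (\<integral>\<^sup>+q. \<integral>\<^sup>+y. ennreal (bdens z \<alpha> \<beta> \<alpha>' y) * f (cchain z p q 1 n y) \<partial>lborel \<partial>PiM {1..n} (\<lambda>_. ?B))"
    proof (intro nn_integral_cong)
      fix q :: "nat \<Rightarrow> real" assume q: "q \<in> space (PiM {1..n} (\<lambda>_. ?B))"
      define F where "F = (\<lambda>y. f (cchain z p q 1 n y))"
      have [measurable]: "F \<in> borel_measurable borel"
        unfolding F_def using measurable_compose[OF measurable_Pair1'[OF q] mch] by simp
      have "(\<integral>\<^sup>+x. \<integral>\<^sup>+u. G q x u \<partial>?B \<partial>?A) =
        (\<integral>\<^sup>+x. \<integral>\<^sup>+y. \<integral>\<^sup>+u. ennreal (bdens z \<alpha> \<beta> \<alpha>' y) * F (cstep z x (cstep z u y)) \<partial>?B \<partial>lborel \<partial>?A)"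
      proof (intro nn_integral_cong)
        fix x :: real
        interpret P: pair_sigma_finite ?B lborel ..
        show "(\<integral>\<^sup>+u. G q x u \<partial>?B) = (\<integral>\<^sup>+y. \<integral>\<^sup>+u. ennreal (bdens z \<alpha> \<beta> \<alpha>' y) * F (cstep z x (cstep z u y)) \<partial>?B \<partial>lborel)"
          unfolding G_def fun_cong[OF F_def[symmetric]] by (intro P.Fubini'[symmetric]) measurable
      qed
      also have "\<dots> = (\<integral>\<^sup>+y. \<integral>\<^sup>+x. \<integral>\<^sup>+u. ennreal (bdens z \<alpha> \<beta> \<alpha>' y) * F (cstep z x (cstep z u y)) \<partial>?B \<partial>?A \<partial>lborel)"
      proof -
        interpret P: pair_sigma_finite ?A lborel ..
        show ?thesis by (intro P.Fubini'[symmetric] ) measurable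
      qed
      also have "\<dots> = (\<integral>\<^sup>+y. \<integral>\<^sup>+u. \<integral>\<^sup>+x. ennreal (bdens z \<alpha> \<beta> \<alpha>' y) * F (cstep z x (cstep z u y)) \<partial>?A \<partial>?B \<partial>lborel)"
      proof (intro nn_integral_cong)
        fix y :: real
        interpret P: pair_sigma_finite ?A ?B ..
        show "(\<integral>\<^sup>+x. \<integral>\<^sup>+u. ennreal (bdens z \<alpha> \<beta> \<alpha>' y) * F (cstep z x (cstep z u y)) \<partial>?B \<partial>?A) =
          (\<integral>\<^sup>+u. \<integral>\<^sup>+x. ennreal (bdens z \<alpha> \<beta> \<alpha>' y) * F (cstep z x (cstep z u y)) \<partial>?A \<partial>?B)"
          by (intro P.Fubini'[symmetric]) measurable
      qed
      also have "\<dots> = (\<integral>\<^sup>+y. ennreal (bdens z \<alpha> \<beta> \<alpha>' y) * (\<integral>\<^sup>+u. \<integral>\<^sup>+x. F (cstep z x (cstep z u y)) \<partial>?A \<partial>?B) \<partial>lborel)"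
      proof (rule nn_integral_cong)
        fix y :: real
        have "(\<lambda>w. F (cstep z (snd w) (cstep z (fst w) y))) \<in> borel_measurable (?B \<Otimes>\<^sub>M ?A)"
          by measurable
        from A1.nn_integral_cmult_iterated[OF this]
        show "(\<integral>\<^sup>+u. \<integral>\<^sup>+x. ennreal (bdens z \<alpha> \<beta> \<alpha>' y) * F (cstep z x (cstep z u y)) \<partial>?A \<partial>?B) =
          ennreal (bdens z \<alpha> \<beta> \<alpha>' y) * (\<integral>\<^sup>+u. \<integral>\<^sup>+x. F (cstep z x (cstep z u y)) \<partial>?A \<partial>?B)"
          by (simp only: fst_conv snd_conv)
      qed
      also have "\<dots> = (\<integral>\<^sup>+y. ennreal (bdens z \<alpha> \<beta> \<alpha>' y) * f (cchain z p q 1 n y) \<partial>lborel)"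
        unfolding fun_cong[OF F_def[symmetric]] by (rule nn_integral_bdens_two_steps[OF z pos sum]) measurable
      finally show "(\<integral>\<^sup>+x. \<integral>\<^sup>+u. G q x u \<partial>?B \<partial>?A) = (\<integral>\<^sup>+y. ennreal (bdens z \<alpha> \<beta> \<alpha>' y) * f (cchain z p q 1 n y) \<partial>lborel)" .
    qed
    finally show "(\<integral>\<^sup>+x. \<integral>\<^sup>+q. K (p(Suc n := x)) q \<partial>PiM {1..Suc n} (\<lambda>_. ?B) \<partial>?A) =
      (\<integral>\<^sup>+q. \<integral>\<^sup>+y. ennreal (bdens z \<alpha> \<beta> \<alpha>' y) * f (cchain z p q 1 n y) \<partial>lborel \<partial>PiM {1..n} (\<lambda>_. ?B))" .
  qed
  also note Suc.IH
  finally show ?case unfolding K_def .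
qed

declare measurable_jacobi_component [measurable del]

text \<open>Only arguments \<open>z \<ge> 0\<close> are available. The lower coefficients being
  zero, the series is divided by \<open>z ^ n\<close>, and continuity of the quotient series gives
  the value at 0 as a limit from the right.\<close>

lemma power_series_eq_zero:
  fixes d :: "nat \<Rightarrow> real"
  assumes r: "r > 0" and s: "\<And>z. 0 \<le> z \<Longrightarrow> z < r \<Longrightarrow> (\<lambda>n. d n * z ^ n) sums 0"
  shows "d n = 0"
proof (induction n rule: less_induct)
  case (less n)
  define g where "g = (\<lambda>z. \<Sum>k. d (k + n) * z ^ k)"
  have sm: "(\<lambda>k. d (k + n) * z ^ k) sums 0" if z: "0 < z" "z < r" for z
  proof -
    have "(\<lambda>k. d (k + n) * z ^ (k + n)) sums (0 - (\<Sum>i<n. d i * z ^ i))"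
      using s[of z] z by (intro sums_split_initial_segment) auto
    moreover have "(\<Sum>i<n. d i * z ^ i) = 0" using less.IH by (intro sum.neutral) auto
    ultimately have "(\<lambda>k. d (k + n) * z ^ (k + n) / z ^ n) sums (0 / z ^ n)"
      by (intro sums_divide) simp
    then show ?thesis using z by (simp add: power_add)
  qed
  have "isCont g 0" unfolding g_def
    using sm[of "r / 2"] r by (intro isCont_powser[where K = "r / 2"]) (auto simp: sums_iff)
  then have lim: "(g \<longlongrightarrow> g 0) (at_right 0)" by (simp add: isCont_def filterlim_at_split)
  have g0: "g 0 = d n"
  proof -
    have "g 0 = (\<Sum>k\<in>{0}. d (k + n) * 0 ^ k)" unfolding g_def by (rule suminf_finite) auto
    then show ?thesis by simp
  qed
  have "eventually (\<lambda>z. g z = 0) (at_right 0)"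
    using sm by (intro eventually_at_rightI[of 0 r]) (auto simp: g_def sums_iff r)
  from Lim_transform_eventually[OF lim this] have "((\<lambda>z::real. 0) \<longlongrightarrow> d n) (at_right 0)"
    unfolding g0 .
  from tendsto_unique[OF trivial_limit_at_right_real this tendsto_const] show ?case .
qed

context jacobi_hot begin

section \<open>The beta sequences and the expected resolvent\<close>

definition PA :: "real measure" where "PA = beta_distr (c + a + 1) (c + b + 1)"
definition PB :: "real measure" where "PB = beta_distr c (c + a + b + 2)"

lemma ppos: "c + a + 1 > 0" "c + b + 1 > 0" "c > 0" "c + a + b + 2 > 0" using a b c by auto

lemma psum: "(c + a + 1) + (c + b + 1) = c + (c + a + b + 2)" by simp

lemma prob_PA: "prob_space PA" and prob_PB: "prob_space PB"
  unfolding PA_def PB_def using ppos by (auto intro!: prob_space_beta_distr)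

lemma sets_PA [measurable_cong]: "sets PA = sets borel" and sets_PB [measurable_cong]: "sets PB = sets borel"
  by (simp_all add: PA_def PB_def sets_beta_distr)

abbreviation PAI :: "(nat \<Rightarrow> real) measure" where "PAI \<equiv> PiM {1..} (\<lambda>_. PA)"
abbreviation PBI :: "(nat \<Rightarrow> real) measure" where "PBI \<equiv> PiM {1..} (\<lambda>_. PB)"

lemma pq_law_eq: "pq_law a b c = PAI \<Otimes>\<^sub>M PBI"
  by (simp add: pq_law_def PA_def PB_def)

lemma prob_PAI: "prob_space PAI" and prob_PBI: "prob_space PBI"
  by (auto intro!: prob_space_PiM prob_PA prob_PB)

lemma AE_beta_distr:
  assumes "p > 0" "q > 0" shows "AE u in beta_distr p q. 0 \<le> u \<and> u \<le> 1"
  unfolding beta_distr_def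
  by (subst AE_density) (auto simp: indicator_def intro!: AE_I2)

lemma measurable_p: "i \<ge> 1 \<Longrightarrow> (\<lambda>x. x i) \<in> borel_measurable PAI"
proof -
  assume "i \<ge> 1"
  then have "(\<lambda>x. x i) \<in> measurable PAI PA" by (intro measurable_component_singleton) auto
  then show ?thesis by (simp add: measurable_cong_sets[OF refl sets_PA])
qed

lemma measurable_q: "i \<ge> 1 \<Longrightarrow> (\<lambda>x. x i) \<in> borel_measurable PBI"
proof -
  assume "i \<ge> 1"
  then have "(\<lambda>x. x i) \<in> measurable PBI PB" by (intro measurable_component_singleton) auto
  then show ?thesis by (simp add: measurable_cong_sets[OF refl sets_PB])
qed

lemma measurable_fst_p: "i \<ge> 1 \<Longrightarrow> (\<lambda>w. fst w i) \<in> borel_measurable (PAI \<Otimes>\<^sub>M PBI)"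
  by (rule measurable_compose[OF measurable_fst measurable_p])

lemma measurable_snd_q: "i \<ge> 1 \<Longrightarrow> (\<lambda>w. snd w i) \<in> borel_measurable (PAI \<Otimes>\<^sub>M PBI)"
  by (rule measurable_compose[OF measurable_snd measurable_q])

lemma AE_unit_seq_A: "AE p in PAI. unit_seq p"
proof -
  have "AE p in PAI. i \<ge> 1 \<longrightarrow> 0 \<le> p i \<and> p i \<le> 1" for i
  proof (cases "i \<ge> 1")
    case True
    have "AE p in PAI. 0 \<le> p i \<and> p i \<le> 1"
      using AE_beta_distr[OF ppos(1,2)] True unfolding PA_def[symmetric]
      by (intro AE_PiM_component[where P = "\<lambda>u. 0 \<le> u \<and> u \<le> 1"] prob_PA) (simp_all only: atLeast_iff)
    then show ?thesis by (auto elim: eventually_mono)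
  qed auto
  then show ?thesis unfolding unit_seq_def by (simp add: AE_all_countable)
qed

lemma AE_unit_seq_B: "AE q in PBI. unit_seq q"
proof -
  have "AE q in PBI. i \<ge> 1 \<longrightarrow> 0 \<le> q i \<and> q i \<le> 1" for i
  proof (cases "i \<ge> 1")
    case True
    have "AE q in PBI. 0 \<le> q i \<and> q i \<le> 1"
      using AE_beta_distr[OF ppos(3,4)] True unfolding PB_def[symmetric]
      by (intro AE_PiM_component[where P = "\<lambda>u. 0 \<le> u \<and> u \<le> 1"] prob_PB) (simp_all only: atLeast_iff)
    then show ?thesis by (auto elim: eventually_mono)
  qed auto
  then show ?thesis unfolding unit_seq_def by (simp add: AE_all_countable)
qed

lemma measurable_coeffs:
  assumes "i \<ge> 1"
  shows "(\<lambda>w. coeff_s (fst w) (snd w) i) \<in> borel_measurable (PAI \<Otimes>\<^sub>M PBI)"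
    "(\<lambda>w. coeff_t (fst w) (snd w) i) \<in> borel_measurable (PAI \<Otimes>\<^sub>M PBI)"
proof -
  have [measurable]: "(\<lambda>w. fst w i) \<in> borel_measurable (PAI \<Otimes>\<^sub>M PBI)" "(\<lambda>w. snd w i) \<in> borel_measurable (PAI \<Otimes>\<^sub>M PBI)"
    using assms by (auto intro: measurable_fst_p measurable_snd_q)
  show "(\<lambda>w. coeff_t (fst w) (snd w) i) \<in> borel_measurable (PAI \<Otimes>\<^sub>M PBI)"
    unfolding coeff_t_def by measurable
  show "(\<lambda>w. coeff_s (fst w) (snd w) i) \<in> borel_measurable (PAI \<Otimes>\<^sub>M PBI)"
  proof (cases "i = 1")
    case True
    then show ?thesis unfolding coeff_s_def by simp
  next
    case False
    then have [measurable]: "(\<lambda>w. snd w (i - 1)) \<in> borel_measurable (PAI \<Otimes>\<^sub>M PBI)"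
      using assms by (intro measurable_snd_q) auto
    show ?thesis unfolding coeff_s_def using False by simp
  qed
qed

lemma measurable_walk:
  "i \<ge> 1 \<Longrightarrow> (\<lambda>w. walk (fst w) (snd w) k i) \<in> borel_measurable (PAI \<Otimes>\<^sub>M PBI)"
proof (induction k arbitrary: i)
  case (Suc k)
  have [measurable]: "(\<lambda>w. walk (fst w) (snd w) k i) \<in> borel_measurable (PAI \<Otimes>\<^sub>M PBI)"
    "(\<lambda>w. walk (fst w) (snd w) k (Suc i)) \<in> borel_measurable (PAI \<Otimes>\<^sub>M PBI)"
    "(\<lambda>w. coeff_s (fst w) (snd w) i) \<in> borel_measurable (PAI \<Otimes>\<^sub>M PBI)"
    "(\<lambda>w. coeff_t (fst w) (snd w) i) \<in> borel_measurable (PAI \<Otimes>\<^sub>M PBI)"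
    using Suc.IH[of i] Suc.IH[of "Suc i"] Suc.prems measurable_coeffs[of i] by auto
  show ?case
  proof (cases "i \<ge> 2")
    case True
    then have [measurable]: "(\<lambda>w. walk (fst w) (snd w) k (i - 1)) \<in> borel_measurable (PAI \<Otimes>\<^sub>M PBI)"
      "(\<lambda>w. coeff_t (fst w) (snd w) (i - 1)) \<in> borel_measurable (PAI \<Otimes>\<^sub>M PBI)"
      using Suc.IH[of "i - 1"] measurable_coeffs[of "i - 1"] by auto
    show ?thesis using True by simp
  qed simp
qed simp

lemma measurable_imat_power:
  "i \<ge> 1 \<Longrightarrow> (\<lambda>w. imat_power (jacobi_matrix (fst w) (snd w)) k i 1) \<in> borel_measurable (PAI \<Otimes>\<^sub>M PBI)"
proof (induction k arbitrary: i)
  case (Suc k)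
  have [measurable]: "(\<lambda>w. imat_power (jacobi_matrix (fst w) (snd w)) k i 1) \<in> borel_measurable (PAI \<Otimes>\<^sub>M PBI)"
    "(\<lambda>w. imat_power (jacobi_matrix (fst w) (snd w)) k (Suc i) 1) \<in> borel_measurable (PAI \<Otimes>\<^sub>M PBI)"
    "(\<lambda>w. coeff_s (fst w) (snd w) i) \<in> borel_measurable (PAI \<Otimes>\<^sub>M PBI)"
    "(\<lambda>w. coeff_t (fst w) (snd w) i) \<in> borel_measurable (PAI \<Otimes>\<^sub>M PBI)"
    using Suc.IH[of i] Suc.IH[of "Suc i"] Suc.prems measurable_coeffs[of i] by auto
  show ?case
  proof (cases "i \<ge> 2")
    case True
    then have [measurable]: "(\<lambda>w. imat_power (jacobi_matrix (fst w) (snd w)) k (i - 1) 1) \<in> borel_measurable (PAI \<Otimes>\<^sub>M PBI)"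
      "(\<lambda>w. coeff_t (fst w) (snd w) (i - 1)) \<in> borel_measurable (PAI \<Otimes>\<^sub>M PBI)"
      "(\<lambda>w. coeff_s (fst w) (snd w) (i - 1)) \<in> borel_measurable (PAI \<Otimes>\<^sub>M PBI)"
      using Suc.IH[of "i - 1"] measurable_coeffs[of "i - 1"] by auto
    show ?thesis unfolding imat_power.simps imat_mult_jacobi[OF Suc.prems] using True by simp
  next
    case False
    then show ?thesis unfolding imat_power.simps imat_mult_jacobi[OF Suc.prems] by simp
  qed
qed simp

sublocale PQ: pair_prob_space PAI PBI
  using prob_PAI prob_PBI by (simp add: pair_prob_space_def pair_sigma_finite_def prob_space_imp_sigma_finite)

lemma AE_unit_seq: "AE w in PAI \<Otimes>\<^sub>M PBI. unit_seq (fst w) \<and> unit_seq (snd w)"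
proof (rule PQ.AE_pair_measure)
  have "Measurable.pred (PAI \<Otimes>\<^sub>M PBI) (\<lambda>w. \<forall>i. i \<ge> 1 \<longrightarrow> (0 \<le> fst w i \<and> fst w i \<le> 1) \<and> (0 \<le> snd w i \<and> snd w i \<le> 1))"
  proof (intro pred_intros_countable)
    fix i :: nat
    show "Measurable.pred (PAI \<Otimes>\<^sub>M PBI) (\<lambda>w. i \<ge> 1 \<longrightarrow> (0 \<le> fst w i \<and> fst w i \<le> 1) \<and> (0 \<le> snd w i \<and> snd w i \<le> 1))"
    proof (cases "i \<ge> 1")
      case True
      then have [measurable]: "(\<lambda>w. fst w i) \<in> borel_measurable (PAI \<Otimes>\<^sub>M PBI)" "(\<lambda>w. snd w i) \<in> borel_measurable (PAI \<Otimes>\<^sub>M PBI)"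
        by (auto intro: measurable_fst_p measurable_snd_q)
      show ?thesis by measurable
    qed simp
  qed
  moreover have "(\<lambda>w. \<forall>i. i \<ge> 1 \<longrightarrow> (0 \<le> fst w i \<and> fst w i \<le> (1::real)) \<and> (0 \<le> snd w i \<and> snd w i \<le> (1::real))) = (\<lambda>w. unit_seq (fst w) \<and> unit_seq (snd w))"
    by (auto simp: unit_seq_def fun_eq_iff)
  ultimately have "Measurable.pred (PAI \<Otimes>\<^sub>M PBI) (\<lambda>w. unit_seq (fst w) \<and> unit_seq (snd w))"
    by (simp only:)
  then show "{x \<in> space (PAI \<Otimes>\<^sub>M PBI). unit_seq (fst x) \<and> unit_seq (snd x)} \<in> sets (PAI \<Otimes>\<^sub>M PBI)"
    unfolding pred_def .
  show "AE p in PAI. AE q in PBI. unit_seq (fst (p, q)) \<and> unit_seq (snd (p, q))"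
    using AE_unit_seq_A AE_unit_seq_B by (auto elim!: eventually_mono)
qed

definition wm :: "nat \<Rightarrow> real" where "wm k = (\<integral>w. walk (fst w) (snd w) k 1 \<partial>(PAI \<Otimes>\<^sub>M PBI))"

lemma AE_walk_bounds: "AE w in PAI \<Otimes>\<^sub>M PBI. 0 \<le> walk (fst w) (snd w) k 1 \<and> walk (fst w) (snd w) k 1 \<le> 4 ^ k"
  using AE_unit_seq by eventually_elim (auto intro!: walk_bounds[THEN conjunct1] walk_bounds[THEN conjunct2])

lemma integrable_walk: "integrable (PAI \<Otimes>\<^sub>M PBI) (\<lambda>w. walk (fst w) (snd w) k 1)"
proof (rule PQ.P.integrable_const_bound[where B = "4 ^ k"])
  show "AE w in PAI \<Otimes>\<^sub>M PBI. norm (walk (fst w) (snd w) k 1) \<le> 4 ^ k"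
    using AE_walk_bounds[of k] by eventually_elim auto
  show "(\<lambda>w. walk (fst w) (snd w) k 1) \<in> borel_measurable (PAI \<Otimes>\<^sub>M PBI)" by (rule measurable_walk) simp
qed

lemma imat_power_expectation:
  "(\<integral>(p, q). imat_power (jacobi_matrix p q) k 1 1 \<partial>pq_law a b c) = wm k"
  unfolding pq_law_eq wm_def case_prod_beta'
proof (rule integral_cong_AE)
  show "AE w in PAI \<Otimes>\<^sub>M PBI. imat_power (jacobi_matrix (fst w) (snd w)) k 1 1 = walk (fst w) (snd w) k 1"
    using AE_unit_seq
  proof eventually_elim
    case (elim w)
    then have "imat_power (jacobi_matrix (fst w) (snd w)) k 1 1 = (\<Prod>j\<in>{1..<1}. sqrt (coeff_s (fst w) (snd w) j) * sqrt (coeff_t (fst w) (snd w) j)) * walk (fst w) (snd w) k 1"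
      by (intro imat_power_walk) (auto intro!: coeff_st_bounds)
    then show ?case by simp
  qed
qed (auto intro!: measurable_imat_power measurable_walk)

lemma wm_nonneg: "0 \<le> wm k"
  unfolding wm_def using AE_walk_bounds[of k] by (intro integral_nonneg_AE) (auto elim!: eventually_mono)

lemma nn_integral_wgf:
  assumes z: "0 \<le> z" "z \<le> 1/8"
  shows "(\<integral>\<^sup>+w. ennreal (wgf (fst w) (snd w) z 1) \<partial>(PAI \<Otimes>\<^sub>M PBI)) = (\<Sum>k. ennreal (wm k * z ^ k))"
proof -
  have [measurable]: "(\<lambda>w. walk (fst w) (snd w) k 1) \<in> borel_measurable (PAI \<Otimes>\<^sub>M PBI)" for k
    by (rule measurable_walk) simp
  have "(\<integral>\<^sup>+w. ennreal (wgf (fst w) (snd w) z 1) \<partial>(PAI \<Otimes>\<^sub>M PBI)) = (\<integral>\<^sup>+w. (\<Sum>k. ennreal (walk (fst w) (snd w) k 1 * z ^ k)) \<partial>(PAI \<Otimes>\<^sub>M PBI))"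
  proof (rule nn_integral_cong_AE)
    show "AE w in PAI \<Otimes>\<^sub>M PBI. ennreal (wgf (fst w) (snd w) z 1) = (\<Sum>k. ennreal (walk (fst w) (snd w) k 1 * z ^ k))"
      using AE_unit_seq
    proof eventually_elim
      case (elim w)
      then have u: "unit_seq (fst w)" "unit_seq (snd w)" by auto
      have "0 \<le> walk (fst w) (snd w) k 1 * z ^ k" for k using walk_bounds[OF u, of 1 k] z by simp
      moreover have "(\<lambda>k. walk (fst w) (snd w) k 1 * z ^ k) sums wgf (fst w) (snd w) z 1"
        unfolding wgf_def using wgf_summable[OF u z, of 1] by (simp add: summable_sums)
      ultimately show ?case by (rule suminf_ennreal_eq[symmetric])
    qed
  qed
  also have "\<dots> = (\<Sum>k. \<integral>\<^sup>+w. ennreal (walk (fst w) (snd w) k 1 * z ^ k) \<partial>(PAI \<Otimes>\<^sub>M PBI))"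
    by (rule nn_integral_suminf) measurable
  also have "\<dots> = (\<Sum>k. ennreal (wm k * z ^ k))"
  proof (rule suminf_cong)
    fix k
    have "(\<integral>\<^sup>+w. ennreal (walk (fst w) (snd w) k 1 * z ^ k) \<partial>(PAI \<Otimes>\<^sub>M PBI)) = ennreal (\<integral>w. walk (fst w) (snd w) k 1 * z ^ k \<partial>(PAI \<Otimes>\<^sub>M PBI))"
      using integrable_walk[of k] AE_walk_bounds[of k] z
      by (intro nn_integral_eq_integral) (auto elim!: eventually_mono)
    then show "(\<integral>\<^sup>+w. ennreal (walk (fst w) (snd w) k 1 * z ^ k) \<partial>(PAI \<Otimes>\<^sub>M PBI)) = ennreal (wm k * z ^ k)"
      by (simp add: wm_def)
  qed
  finally show ?thesis .
qed

lemma measurable_cchain_arg: "cchain z p q i m \<in> borel_measurable borel"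
proof (induction m arbitrary: i)
  case 0
  have "cchain z p q i 0 = (\<lambda>y. y)" by (simp add: fun_eq_iff)
  then show ?case by simp
next
  case (Suc m)
  have "cchain z p q i (Suc m) = (\<lambda>y. cstep z (p i) (cstep z (q i) (cchain z p q (Suc i) m y)))"
    by (simp add: fun_eq_iff)
  then show ?case by (simp only:) (intro measurable_cstep measurable_const Suc.IH, auto)
qed

lemma measurable_pq_cchain:
  assumes f: "f \<in> borel_measurable borel"
  shows "(\<lambda>w. \<integral>\<^sup>+y. ennreal (bdens z (c + a + 1) (c + b + 1) c y) * f (cchain z (fst w) (snd w) 1 n y) \<partial>lborel) \<in> borel_measurable (PAI \<Otimes>\<^sub>M PBI)"
proof -
  note [measurable] = f
  let ?An = "PiM {1..n} (\<lambda>_. PA)" and ?Bn = "PiM {1..n} (\<lambda>_. PB)"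
  have mc: "(\<lambda>((p, q), y). cchain z p q 1 n y) \<in> borel_measurable ((?An \<Otimes>\<^sub>M ?Bn) \<Otimes>\<^sub>M borel)"
    by (rule measurable_cchain[OF _ _ sets_PA sets_PB]) auto
  have mK: "(\<lambda>w. \<integral>\<^sup>+y. ennreal (bdens z (c + a + 1) (c + b + 1) c y) * f (cchain z (fst w) (snd w) 1 n y) \<partial>lborel) \<in> borel_measurable (?An \<Otimes>\<^sub>M ?Bn)"
    using mc[unfolded case_prod_beta']
    by (intro lborel.borel_measurable_nn_integral) (simp add: case_prod_beta')
  have rA: "(\<lambda>p. restrict p {1..n}) \<in> measurable PAI ?An" and rB: "(\<lambda>q. restrict q {1..n}) \<in> measurable PBI ?Bn"
    by (intro measurable_restrict_subset; auto)+
  have "(\<lambda>w. (restrict (fst w) {1..n}, restrict (snd w) {1..n})) \<in> measurable (PAI \<Otimes>\<^sub>M PBI) (?An \<Otimes>\<^sub>M ?Bn)"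
    by (intro measurable_Pair measurable_compose[OF measurable_fst rA] measurable_compose[OF measurable_snd rB])
  from measurable_compose[OF this mK]
  have "(\<lambda>w. \<integral>\<^sup>+y. ennreal (bdens z (c + a + 1) (c + b + 1) c y) * f (cchain z (restrict (fst w) {1..n}) (restrict (snd w) {1..n}) 1 n y) \<partial>lborel) \<in> borel_measurable (PAI \<Otimes>\<^sub>M PBI)"
    by simp
  moreover have "cchain z (restrict p {1..n}) (restrict q {1..n}) 1 n y = cchain z p q 1 n y" for p q y
    by (rule cchain_cong) auto
  ultimately show ?thesis by simp
qed

text \<open>A chain of length \<open>n\<close> sees only the first \<open>n\<close> variables of
  each sequence, so the infinite products may be replaced by their finite marginals.\<close>

lemma nn_integral_pq_cchain:
  assumes z: "0 \<le> z" "z < 1" and f: "f \<in> borel_measurable borel"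
  shows "(\<integral>\<^sup>+w. \<integral>\<^sup>+y. ennreal (bdens z (c + a + 1) (c + b + 1) c y) * f (cchain z (fst w) (snd w) 1 n y) \<partial>lborel \<partial>(PAI \<Otimes>\<^sub>M PBI)) =
    (\<integral>\<^sup>+y. ennreal (bdens z (c + a + 1) (c + b + 1) c y) * f y \<partial>lborel)"
proof -
  note [measurable] = f
  interpret A: product_prob_space "\<lambda>_::nat. PA" "{1..}" by (rule product_prob_spaceI, rule prob_PA)
  interpret B: product_prob_space "\<lambda>_::nat. PB" "{1..}" by (rule product_prob_spaceI, rule prob_PB)
  let ?An = "PiM {1..n} (\<lambda>_. PA)" and ?Bn = "PiM {1..n} (\<lambda>_. PB)"
  define K where "K = (\<lambda>p q. \<integral>\<^sup>+y. ennreal (bdens z (c + a + 1) (c + b + 1) c y) * f (cchain z p q 1 n y) \<partial>lborel)"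
  have K_restrict: "K p q = K (restrict p {1..n}) (restrict q {1..n})" for p q
  proof -
    have "cchain z p q 1 n y = cchain z (restrict p {1..n}) (restrict q {1..n}) 1 n y" for y
      by (rule cchain_cong) auto
    then show ?thesis by (simp add: K_def)
  qed
  have mc: "(\<lambda>((p, q), y). cchain z p q 1 n y) \<in> borel_measurable ((?An \<Otimes>\<^sub>M ?Bn) \<Otimes>\<^sub>M borel)"
    by (rule measurable_cchain[OF _ _ sets_PA sets_PB]) auto
  have mK: "(\<lambda>(p, q). K p q) \<in> borel_measurable (?An \<Otimes>\<^sub>M ?Bn)"
    unfolding K_def case_prod_beta' using mc[unfolded case_prod_beta']
    by (intro lborel.borel_measurable_nn_integral) (simp add: case_prod_beta')
  have rA: "(\<lambda>p. restrict p {1..n}) \<in> measurable PAI ?An" and rB: "(\<lambda>q. restrict q {1..n}) \<in> measurable PBI ?Bn"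
    by (intro measurable_restrict_subset; auto)+
  have dA: "distr PAI ?An (\<lambda>p. restrict p {1..n}) = ?An" by (rule A.distr_PiM_restrict_finite) auto
  have dB: "distr PBI ?Bn (\<lambda>q. restrict q {1..n}) = ?Bn" by (rule B.distr_PiM_restrict_finite) auto
  interpret Bn: prob_space ?Bn by (intro prob_space_PiM prob_PB)
  have mKI: "(\<lambda>w. K (fst w) (snd w)) \<in> borel_measurable (PAI \<Otimes>\<^sub>M PBI)"
    unfolding K_def by (rule measurable_pq_cchain[OF f])
  have "(\<integral>\<^sup>+w. K (fst w) (snd w) \<partial>(PAI \<Otimes>\<^sub>M PBI)) = (\<integral>\<^sup>+p. \<integral>\<^sup>+q. K p q \<partial>PBI \<partial>PAI)"
    using PQ.M2.nn_integral_fst[OF mKI] by simp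
  also have "\<dots> = (\<integral>\<^sup>+p. \<integral>\<^sup>+q. K (restrict p {1..n}) q \<partial>?Bn \<partial>PAI)"
  proof (rule nn_integral_cong)
    fix p assume p: "p \<in> space PAI"
    have "(\<lambda>q. K (restrict p {1..n}) q) \<in> borel_measurable ?Bn"
      using measurable_compose[OF measurable_Pair1' mK, of "restrict p {1..n}"] measurable_space[OF rA p] by simp
    then have "(\<integral>\<^sup>+q. K (restrict p {1..n}) q \<partial>distr PBI ?Bn (\<lambda>q. restrict q {1..n})) = (\<integral>\<^sup>+q. K (restrict p {1..n}) (restrict q {1..n}) \<partial>PBI)"
      by (intro nn_integral_distr rB) simp
    then show "(\<integral>\<^sup>+q. K p q \<partial>PBI) = (\<integral>\<^sup>+q. K (restrict p {1..n}) q \<partial>?Bn)"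
      unfolding dB K_restrict[symmetric] by simp
  qed
  also have "\<dots> = (\<integral>\<^sup>+p. \<integral>\<^sup>+q. K p q \<partial>?Bn \<partial>distr PAI ?An (\<lambda>p. restrict p {1..n}))"
    using mK by (intro nn_integral_distr[symmetric] rA) (simp add: Bn.borel_measurable_nn_integral)
  also have "\<dots> = (\<integral>\<^sup>+p. \<integral>\<^sup>+q. K p q \<partial>?Bn \<partial>?An)" unfolding dA ..
  also have "\<dots> = (\<integral>\<^sup>+y. ennreal (bdens z (c + a + 1) (c + b + 1) c y) * f y \<partial>lborel)"
    unfolding K_def PA_def PB_def by (rule nn_integral_cchain[OF z ppos psum f])
  finally show ?thesis unfolding K_def .
qed

text \<open>At depth \<open>n\<close> the continued fraction is within \<open>10 * (1/4) ^ n\<close>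
  of the resolvent, uniformly in its innermost argument \<open>y\<close>; in the limit the integral
  over \<open>y\<close> therefore factors out as the mass \<open>I\<close>. Extended nonnegative
  numbers do not subtract well, so two inequalities are proved; finiteness of \<open>I\<close> makes
  the error vanish.\<close>

lemma nn_integral_wgf_bdens:
  assumes z: "0 \<le> z" "z \<le> 1/8"
  defines "I \<equiv> (\<integral>\<^sup>+y. ennreal (bdens z (c + a + 1) (c + b + 1) c y) \<partial>lborel)"
  assumes I: "I \<noteq> \<infinity>"
  shows "I * (\<integral>\<^sup>+w. ennreal (wgf (fst w) (snd w) z 1) \<partial>(PAI \<Otimes>\<^sub>M PBI)) =
    (\<integral>\<^sup>+y. ennreal (bdens z (c + a + 1) (c + b + 1) c y) * ennreal (1 / (1 - z * y)) \<partial>lborel)" (is "I * ?E = ?H")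
proof -
  let ?b = "\<lambda>y. ennreal (bdens z (c + a + 1) (c + b + 1) c y)"
  let ?P = "PAI \<Otimes>\<^sub>M PBI"
  let ?\<Phi> = "\<lambda>w. wgf (fst w) (snd w) z 1"
  have z1: "z < 1" using z by simp
  have [measurable]: "?\<Phi> \<in> borel_measurable ?P"
  proof -
    have [measurable]: "(\<lambda>w. walk (fst w) (snd w) k 1) \<in> borel_measurable ?P" for k
      by (rule measurable_walk) simp
    show ?thesis unfolding wgf_def by measurable
  qed
  \<comment> \<open>By stationarity the integral on the right has the same value at every depth, so
    the depth can be sent to infinity on one side only.\<close>
  have H: "?H = (\<integral>\<^sup>+w. \<integral>\<^sup>+y. ?b y * ennreal (1 / (1 - z * cchain z (fst w) (snd w) 1 n y)) \<partial>lborel \<partial>?P)" for n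
    by (rule nn_integral_pq_cchain[OF z(1) z1, symmetric]) measurable
  have mass: "(\<integral>\<^sup>+w. \<integral>\<^sup>+y. ?b y * ennreal (r w) \<partial>lborel \<partial>?P) = I * (\<integral>\<^sup>+w. ennreal (r w) \<partial>?P)"
    if [measurable]: "r \<in> borel_measurable ?P" for r
  proof -
    have "(\<integral>\<^sup>+w. \<integral>\<^sup>+y. ?b y * ennreal (r w) \<partial>lborel \<partial>?P) = (\<integral>\<^sup>+w. I * ennreal (r w) \<partial>?P)"
    proof (rule nn_integral_cong)
      fix w
      show "(\<integral>\<^sup>+y. ?b y * ennreal (r w) \<partial>lborel) = I * ennreal (r w)"
        unfolding I_def by (rule nn_integral_multc) simp
    qed
    also have "\<dots> = I * (\<integral>\<^sup>+w. ennreal (r w) \<partial>?P)" by (rule nn_integral_cmult) measurable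
    finally show ?thesis .
  qed
  have ptw: "AE w in ?P. \<forall>n y. y \<in> {0..1} \<longrightarrow> 0 \<le> ?\<Phi> w \<and> 0 \<le> 1 / (1 - z * cchain z (fst w) (snd w) 1 (Suc n) y) \<and>
     \<bar>?\<Phi> w - 1 / (1 - z * cchain z (fst w) (snd w) 1 (Suc n) y)\<bar> \<le> 10 * (1/4) ^ n"
    using AE_unit_seq
  proof eventually_elim
    case (elim w)
    then have u: "unit_seq (fst w)" "unit_seq (snd w)" by auto
    show ?case
    proof (intro allI impI conjI)
      fix n and y :: real assume y: "y \<in> {0..1}"
      then have y01: "0 \<le> y" "y \<le> 1" by auto
      show "0 \<le> ?\<Phi> w" using wgf_bounds[OF u z, of 1] by simp
      have cb: "0 \<le> cchain z (fst w) (snd w) 1 (Suc n) y \<and> cchain z (fst w) (snd w) 1 (Suc n) y \<le> 1"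
        by (rule cchain_bounds[OF z y01 _ u]) simp
      then have "z * cchain z (fst w) (snd w) 1 (Suc n) y \<le> 1/8 * 1" using z by (intro mult_mono) auto
      then show "0 \<le> 1 / (1 - z * cchain z (fst w) (snd w) 1 (Suc n) y)" by simp
      show "\<bar>?\<Phi> w - 1 / (1 - z * cchain z (fst w) (snd w) 1 (Suc n) y)\<bar> \<le> 10 * (1/4) ^ n"
        by (rule wgf_error[OF u z y01])
    qed
  qed
  have E1: "?H \<le> I * ?E + I * ennreal (10 * (1/4) ^ n)" for n
  proof -
    have "?H \<le> (\<integral>\<^sup>+w. \<integral>\<^sup>+y. ?b y * ennreal (?\<Phi> w + 10 * (1/4) ^ n) \<partial>lborel \<partial>?P)"
      unfolding H[of "Suc n"]
    proof (rule nn_integral_mono_AE)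
      show "AE w in ?P. (\<integral>\<^sup>+y. ?b y * ennreal (1 / (1 - z * cchain z (fst w) (snd w) 1 (Suc n) y)) \<partial>lborel) \<le>
        (\<integral>\<^sup>+y. ?b y * ennreal (?\<Phi> w + 10 * (1/4) ^ n) \<partial>lborel)"
        using ptw
      proof eventually_elim
        case (elim w)
        show ?case
        proof (rule nn_integral_mono)
          fix y :: real
          show "?b y * ennreal (1 / (1 - z * cchain z (fst w) (snd w) 1 (Suc n) y)) \<le> ?b y * ennreal (?\<Phi> w + 10 * (1/4) ^ n)"
          proof (cases "y \<in> {0..1}")
            case True
            then have "\<bar>?\<Phi> w - 1 / (1 - z * cchain z (fst w) (snd w) 1 (Suc n) y)\<bar> \<le> 10 * (1/4) ^ n"
              using elim by blast
            then have "1 / (1 - z * cchain z (fst w) (snd w) 1 (Suc n) y) \<le> ?\<Phi> w + 10 * (1/4) ^ n" by linarith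
            then show ?thesis by (intro mult_left_mono ennreal_leI) auto
          qed (simp add: bdens_def)
        qed
      qed
    qed
    also have "\<dots> = I * (\<integral>\<^sup>+w. ennreal (?\<Phi> w + 10 * (1/4) ^ n) \<partial>?P)" by (rule mass) measurable
    also have "(\<integral>\<^sup>+w. ennreal (?\<Phi> w + 10 * (1/4) ^ n) \<partial>?P) = (\<integral>\<^sup>+w. ennreal (?\<Phi> w) + ennreal (10 * (1/4) ^ n) \<partial>?P)"
    proof (rule nn_integral_cong_AE)
      show "AE w in ?P. ennreal (?\<Phi> w + 10 * (1/4) ^ n) = ennreal (?\<Phi> w) + ennreal (10 * (1/4) ^ n)"
        using AE_unit_seq
      proof eventually_elim
        case (elim w)
        then have "0 \<le> ?\<Phi> w" using wgf_bounds(1)[OF _ _ z, of "fst w" "snd w" 1] by simp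
        then show ?case by (rule ennreal_plus) simp
      qed
    qed
    also have "\<dots> = ?E + (\<integral>\<^sup>+w. ennreal (10 * (1/4) ^ n) \<partial>?P)"
      by (rule nn_integral_add) measurable
    also have "\<dots> = ?E + ennreal (10 * (1/4) ^ n)"
      by (simp only: nn_integral_const PQ.P.emeasure_space_1 mult_1_right)
    finally show ?thesis by (simp add: distrib_left)
  qed
  have E2: "I * ?E \<le> ?H + I * ennreal (10 * (1/4) ^ n)" for n
  proof -
    have "I * ?E = (\<integral>\<^sup>+w. \<integral>\<^sup>+y. ?b y * ennreal (?\<Phi> w) \<partial>lborel \<partial>?P)" by (rule mass[symmetric]) measurable
    also have "\<dots> \<le> (\<integral>\<^sup>+w. (\<integral>\<^sup>+y. ?b y * ennreal (1 / (1 - z * cchain z (fst w) (snd w) 1 (Suc n) y)) \<partial>lborel) + I * ennreal (10 * (1/4) ^ n) \<partial>?P)"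
    proof (rule nn_integral_mono_AE)
      show "AE w in ?P. (\<integral>\<^sup>+y. ?b y * ennreal (?\<Phi> w) \<partial>lborel) \<le>
        (\<integral>\<^sup>+y. ?b y * ennreal (1 / (1 - z * cchain z (fst w) (snd w) 1 (Suc n) y)) \<partial>lborel) + I * ennreal (10 * (1/4) ^ n)"
        using ptw AE_space
      proof eventually_elim
        case (elim w)
        have "(\<lambda>x. ennreal (1 / (1 - z * x))) \<in> borel_measurable borel" by simp
        then have "(\<lambda>y. ennreal (1 / (1 - z * cchain z (fst w) (snd w) 1 (Suc n) y))) \<in> borel_measurable borel"
          by (rule measurable_compose[OF measurable_cchain_arg])
        then have m1: "(\<lambda>y. ?b y * ennreal (1 / (1 - z * cchain z (fst w) (snd w) 1 (Suc n) y))) \<in> borel_measurable lborel"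
          by simp
        have "(\<integral>\<^sup>+y. ?b y * ennreal (?\<Phi> w) \<partial>lborel) \<le>
          (\<integral>\<^sup>+y. ?b y * ennreal (1 / (1 - z * cchain z (fst w) (snd w) 1 (Suc n) y)) + ?b y * ennreal (10 * (1/4) ^ n) \<partial>lborel)"
        proof (rule nn_integral_mono)
          fix y :: real
          show "?b y * ennreal (?\<Phi> w) \<le> ?b y * ennreal (1 / (1 - z * cchain z (fst w) (snd w) 1 (Suc n) y)) + ?b y * ennreal (10 * (1/4) ^ n)"
          proof (cases "y \<in> {0..1}")
            case True
            then have "\<bar>?\<Phi> w - 1 / (1 - z * cchain z (fst w) (snd w) 1 (Suc n) y)\<bar> \<le> 10 * (1/4) ^ n"
              and nn: "0 \<le> 1 / (1 - z * cchain z (fst w) (snd w) 1 (Suc n) y)"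
              using elim(1) by blast+
            then have le: "?\<Phi> w \<le> 1 / (1 - z * cchain z (fst w) (snd w) 1 (Suc n) y) + 10 * (1/4) ^ n" by linarith
            have "ennreal (?\<Phi> w) \<le> ennreal (1 / (1 - z * cchain z (fst w) (snd w) 1 (Suc n) y)) + ennreal (10 * (1/4) ^ n)"
            proof -
              from le have "ennreal (?\<Phi> w) \<le> ennreal (1 / (1 - z * cchain z (fst w) (snd w) 1 (Suc n) y) + 10 * (1/4) ^ n)"
                by (rule ennreal_leI)
              also have "\<dots> = ennreal (1 / (1 - z * cchain z (fst w) (snd w) 1 (Suc n) y)) + ennreal (10 * (1/4) ^ n)"
                by (rule ennreal_plus[OF nn]) simp
              finally show ?thesis .
            qed
            then show ?thesis unfolding distrib_left[symmetric] by (intro mult_left_mono) auto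
          qed (simp add: bdens_def)
        qed
        also have "\<dots> = (\<integral>\<^sup>+y. ?b y * ennreal (1 / (1 - z * cchain z (fst w) (snd w) 1 (Suc n) y)) \<partial>lborel) + (\<integral>\<^sup>+y. ?b y * ennreal (10 * (1/4) ^ n) \<partial>lborel)"
          by (rule nn_integral_add[OF m1]) simp
        also have "(\<integral>\<^sup>+y. ?b y * ennreal (10 * (1/4) ^ n) \<partial>lborel) = I * ennreal (10 * (1/4) ^ n)"
          unfolding I_def by (rule nn_integral_multc) simp
        finally show ?case .
      qed
    qed
    also have "\<dots> = ?H + I * ennreal (10 * (1/4) ^ n)"
    proof -
      have "(\<lambda>w. \<integral>\<^sup>+y. ?b y * ennreal (1 / (1 - z * cchain z (fst w) (snd w) 1 (Suc n) y)) \<partial>lborel) \<in> borel_measurable ?P"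
        by (rule measurable_pq_cchain) measurable
      then have "(\<integral>\<^sup>+w. (\<integral>\<^sup>+y. ?b y * ennreal (1 / (1 - z * cchain z (fst w) (snd w) 1 (Suc n) y)) \<partial>lborel) + I * ennreal (10 * (1/4) ^ n) \<partial>?P)
        = (\<integral>\<^sup>+w. \<integral>\<^sup>+y. ?b y * ennreal (1 / (1 - z * cchain z (fst w) (snd w) 1 (Suc n) y)) \<partial>lborel \<partial>?P)
          + (\<integral>\<^sup>+w. I * ennreal (10 * (1/4) ^ n) \<partial>?P)"
        by (rule nn_integral_add) (rule borel_measurable_const)
      then show ?thesis
        by (simp only: nn_integral_const PQ.P.emeasure_space_1 mult_1_right H[of "Suc n", symmetric])
    qed
    finally show ?thesis .
  qed
  have lim: "(\<lambda>n. X + I * ennreal (10 * (1/4) ^ n)) \<longlonglongrightarrow> X" for X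
  proof -
    have "(\<lambda>n. ennreal (10 * (1/4) ^ n)) \<longlonglongrightarrow> ennreal (10 * 0)"
      by (intro tendsto_ennrealI tendsto_mult tendsto_const LIMSEQ_realpow_zero) auto
    then have "(\<lambda>n. I * ennreal (10 * (1/4) ^ n)) \<longlonglongrightarrow> I * ennreal (10 * 0)"
      using I by (intro ennreal_tendsto_cmult) (auto simp: less_top)
    then have "(\<lambda>n. X + I * ennreal (10 * (1/4) ^ n)) \<longlonglongrightarrow> X + I * ennreal (10 * 0)"
      by (intro tendsto_add tendsto_const)
    then show ?thesis by simp
  qed
  show ?thesis
  proof (rule antisym)
    show "I * ?E \<le> ?H" by (rule LIMSEQ_le_const[OF lim]) (use E2 in auto)
    show "?H \<le> I * ?E" by (rule LIMSEQ_le_const[OF lim]) (use E1 in auto)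
  qed
qed

lemma sums_of_nn_suminf:
  assumes "\<And>n. 0 \<le> f n" "(\<Sum>n. ennreal (f n)) \<noteq> \<infinity>"
  shows "summable f" "(\<Sum>n. ennreal (f n)) = ennreal (\<Sum>n. f n)"
proof -
  show s: "summable f" using assms by (intro summable_suminf_not_top) auto
  show "(\<Sum>n. ennreal (f n)) = ennreal (\<Sum>n. f n)" by (rule suminf_ennreal_eq[OF assms(1) summable_sums[OF s]])
qed

text \<open>The identity \<open>I * E = H\<close> between three series in \<open>z\<close>, read as
  a Cauchy product. All three have to be finite before the equation can be moved to real series,
  where the difference makes sense.\<close>

lemma wm_hypergeometric:
  assumes z: "0 \<le> z" "z < 1/8"
  defines "w \<equiv> (c + a + 1) + (c + b + 1)"
  shows "(\<lambda>n. ((\<Sum>i\<le>n. wm i * hyp_coeff c (c + a + 1) w (n - i)) - hyp_coeff (c + 1) (c + a + 1) w n) * z ^ n) sums 0"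
proof -
  let ?B = "Beta (c + a + 1) (c + b + 1)"
  let ?i = "hyp_coeff c (c + a + 1) w" and ?h = "hyp_coeff (c + 1) (c + a + 1) w"
  have B: "?B > 0" by (rule Beta_pos[OF ppos(1,2)])
  have w: "w > 0" using ppos unfolding w_def by linarith
  have in0: "0 \<le> ?i n" "0 \<le> ?h n" for n
    unfolding hyp_coeff_def using ppos w by (auto intro!: divide_nonneg_nonneg mult_nonneg_nonneg pochhammer_nonneg)
  have z': "z \<le> 1/8" "z < 1" using z by auto
  have I: "(\<integral>\<^sup>+y. ennreal (bdens z (c + a + 1) (c + b + 1) c y) \<partial>lborel) = (\<Sum>n. ennreal (?B * ?i n * z ^ n))"
    unfolding bdens_def w_def by (rule nn_integral_hypergeometric[OF ppos(1,2,3) z(1) z'(2)])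
  have H: "(\<integral>\<^sup>+y. ennreal (bdens z (c + a + 1) (c + b + 1) c y) * ennreal (1 / (1 - z * y)) \<partial>lborel) = (\<Sum>n. ennreal (?B * ?h n * z ^ n))"
  proof -
    have "(\<integral>\<^sup>+y. ennreal (bdens z (c + a + 1) (c + b + 1) c y) * ennreal (1 / (1 - z * y)) \<partial>lborel) =
      (\<integral>\<^sup>+y. ennreal (indicator {0..1} y * y powr (c + a + 1 - 1) * (1 - y) powr (c + b + 1 - 1) * (1 - z * y) powr (- (c + 1))) \<partial>lborel)"
    proof (rule nn_integral_cong)
      fix y :: real
      show "ennreal (bdens z (c + a + 1) (c + b + 1) c y) * ennreal (1 / (1 - z * y)) =
        ennreal (indicator {0..1} y * y powr (c + a + 1 - 1) * (1 - y) powr (c + b + 1 - 1) * (1 - z * y) powr (- (c + 1)))"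
      proof (cases "y \<in> {0..1}")
        case True
        have p: "1 - z * y > 0" using z True z'(2) by (auto intro: le_less_trans[OF mult_left_le])
        have "(1 - z * y) powr (- (c + 1)) = (1 - z * y) powr (- c) * (1 / (1 - z * y))"
        proof -
          have "(1 - z * y) powr (- (c + 1)) = (1 - z * y) powr (- c) * (1 - z * y) powr (- 1)"
            by (subst powr_add[symmetric]) simp
          moreover have "(1 - z * y) powr (- 1) = 1 / (1 - z * y)" using p by (simp add: powr_minus_divide)
          ultimately show ?thesis by (simp only:)
        qed
        then show ?thesis by (subst ennreal_mult'[symmetric]) (simp_all add: bdens_def bdens_nonneg)
      qed (simp add: bdens_def)
    qed
    also have "\<dots> = (\<Sum>n. ennreal (?B * ?h n * z ^ n))"
      unfolding w_def by (rule nn_integral_hypergeometric[OF ppos(1,2) _ z(1) z'(2)]) (use c in simp)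
    finally show ?thesis .
  qed
  let ?E = "\<integral>\<^sup>+w. ennreal (wgf (fst w) (snd w) z 1) \<partial>(PAI \<Otimes>\<^sub>M PBI)"
  have E: "?E = (\<Sum>k. ennreal (wm k * z ^ k))" by (rule nn_integral_wgf[OF z(1) z'(1)])
  have finE: "?E \<noteq> \<infinity>"
  proof -
    have "?E \<le> (\<integral>\<^sup>+w. 2 \<partial>(PAI \<Otimes>\<^sub>M PBI))"
    proof (rule nn_integral_mono_AE)
      show "AE w in PAI \<Otimes>\<^sub>M PBI. ennreal (wgf (fst w) (snd w) z 1) \<le> 2"
        using AE_unit_seq
      proof eventually_elim
        case (elim w)
        then have "wgf (fst w) (snd w) z 1 \<le> 2" using wgf_bounds(2)[OF _ _ z(1) z'(1), of "fst w" "snd w" 1] by simp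
        then have "ennreal (wgf (fst w) (snd w) z 1) \<le> ennreal 2" by (rule ennreal_leI)
        then show ?case by simp
      qed
    qed
    also have "\<dots> = 2" by (simp add: PQ.P.emeasure_space_1)
    finally show ?thesis by (auto simp: top_unique)
  qed
  have finI: "(\<integral>\<^sup>+y. ennreal (bdens z (c + a + 1) (c + b + 1) c y) \<partial>lborel) \<noteq> \<infinity>"
  proof -
    have "(\<integral>\<^sup>+y. ennreal (bdens z (c + a + 1) (c + b + 1) c y) \<partial>lborel) \<le>
      (\<integral>\<^sup>+y. ennreal (2 powr c) * ennreal (indicator {0..1} y * y powr (c + a + 1 - 1) * (1 - y) powr (c + b + 1 - 1)) \<partial>lborel)"
    proof (rule nn_integral_mono)
      fix y :: real
      show "ennreal (bdens z (c + a + 1) (c + b + 1) c y) \<le> ennreal (2 powr c) * ennreal (indicator {0..1} y * y powr (c + a + 1 - 1) * (1 - y) powr (c + b + 1 - 1))"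
      proof (cases "y \<in> {0..1}")
        case True
        have "z * y \<le> 1/8 * 1" using z True by (intro mult_mono) auto
        then have p: "1/2 \<le> 1 - z * y" by simp
        have "(1 - z * y) powr (- c) \<le> (1/2) powr (- c)" using p c by (intro powr_mono2') auto
        also have "(1/2) powr (- c) = 2 powr c" by (simp add: powr_minus powr_divide)
        finally have "(indicator {0..1} y * y powr (c + a + 1 - 1) * (1 - y) powr (c + b + 1 - 1)) * (1 - z * y) powr (- c) \<le>
          (indicator {0..1} y * y powr (c + a + 1 - 1) * (1 - y) powr (c + b + 1 - 1)) * 2 powr c"
          by (intro mult_left_mono) auto
        then have "bdens z (c + a + 1) (c + b + 1) c y \<le> 2 powr c * (indicator {0..1} y * y powr (c + a + 1 - 1) * (1 - y) powr (c + b + 1 - 1))"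
          unfolding bdens_def by (simp only: mult.commute[of "2 powr c"])
        then have "ennreal (bdens z (c + a + 1) (c + b + 1) c y) \<le> ennreal (2 powr c * (indicator {0..1} y * y powr (c + a + 1 - 1) * (1 - y) powr (c + b + 1 - 1)))"
          by (rule ennreal_leI)
        also have "\<dots> = ennreal (2 powr c) * ennreal (indicator {0..1} y * y powr (c + a + 1 - 1) * (1 - y) powr (c + b + 1 - 1))"
          by (rule ennreal_mult') simp
        finally show ?thesis .
      qed (simp add: bdens_def)
    qed
    also have "\<dots> = ennreal (2 powr c) * ennreal ?B"
      unfolding nn_integral_Beta[OF ppos(1,2), symmetric] by (rule nn_integral_cmult) simp
    finally show ?thesis by (auto simp: top_unique ennreal_mult_eq_top_iff)
  qed
  have eq: "(\<Sum>n. ennreal (?B * ?i n * z ^ n)) * (\<Sum>k. ennreal (wm k * z ^ k)) = (\<Sum>n. ennreal (?B * ?h n * z ^ n))"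
    using nn_integral_wgf_bdens[OF z(1) z'(1) finI] unfolding I H E .
  have nn: "0 \<le> ?B * ?i n * z ^ n" "0 \<le> wm n * z ^ n" "0 \<le> ?B * ?h n * z ^ n" for n
    using B in0 wm_nonneg z by auto
  have fI: "(\<Sum>n. ennreal (?B * ?i n * z ^ n)) \<noteq> \<infinity>" using finI unfolding I .
  have fE: "(\<Sum>k. ennreal (wm k * z ^ k)) \<noteq> \<infinity>" using finE unfolding E .
  have fH: "(\<Sum>n. ennreal (?B * ?h n * z ^ n)) \<noteq> \<infinity>"
    unfolding eq[symmetric] using fI fE by (simp add: ennreal_mult_eq_top_iff)
  note sI = sums_of_nn_suminf[OF nn(1) fI] and sE = sums_of_nn_suminf[OF nn(2) fE] and sH = sums_of_nn_suminf[OF nn(3) fH]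
  have "ennreal ((\<Sum>n. ?B * ?i n * z ^ n) * (\<Sum>k. wm k * z ^ k)) = ennreal (\<Sum>n. ?B * ?h n * z ^ n)"
    using eq unfolding sI(2) sE(2) sH(2) by (subst ennreal_mult') (auto intro!: suminf_nonneg sI(1) nn)
  then have r: "(\<Sum>n. ?B * ?i n * z ^ n) * (\<Sum>k. wm k * z ^ k) = (\<Sum>n. ?B * ?h n * z ^ n)"
    by (subst (asm) ennreal_inj) (auto intro!: mult_nonneg_nonneg suminf_nonneg sI(1) sE(1) sH(1) nn)
  have "(\<lambda>n. \<Sum>i\<le>n. (wm i * z ^ i) * (?B * ?i (n - i) * z ^ (n - i))) sums ((\<Sum>k. wm k * z ^ k) * (\<Sum>n. ?B * ?i n * z ^ n))"
    using nn sI(1) sE(1) by (intro Cauchy_product_sums) auto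
  then have "(\<lambda>n. (\<Sum>i\<le>n. (wm i * z ^ i) * (?B * ?i (n - i) * z ^ (n - i))) - ?B * ?h n * z ^ n) sums
     ((\<Sum>k. wm k * z ^ k) * (\<Sum>n. ?B * ?i n * z ^ n) - (\<Sum>n. ?B * ?h n * z ^ n))"
    by (intro sums_diff summable_sums sH(1))
  then have "(\<lambda>n. 1 / ?B * ((\<Sum>i\<le>n. (wm i * z ^ i) * (?B * ?i (n - i) * z ^ (n - i))) - ?B * ?h n * z ^ n)) sums (1 / ?B * 0)"
    using r by (intro sums_mult) (simp add: mult.commute)
  moreover have "1 / ?B * ((\<Sum>i\<le>n. (wm i * z ^ i) * (?B * ?i (n - i) * z ^ (n - i))) - ?B * ?h n * z ^ n) =
     ((\<Sum>i\<le>n. wm i * ?i (n - i)) - ?h n) * z ^ n" for n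
  proof -
    have "(wm i * z ^ i) * (?B * ?i (n - i) * z ^ (n - i)) = ?B * z ^ n * (wm i * ?i (n - i))" if "i \<le> n" for i
    proof -
      have "z ^ n = z ^ i * z ^ (n - i)" using that by (simp flip: power_add)
      then show ?thesis by (simp only: mult_ac)
    qed
    then have "(\<Sum>i\<le>n. (wm i * z ^ i) * (?B * ?i (n - i) * z ^ (n - i))) = ?B * z ^ n * (\<Sum>i\<le>n. wm i * ?i (n - i))"
      unfolding sum_distrib_left by (intro sum.cong) auto
    then show ?thesis using B by (simp add: field_simps)
  qed
  ultimately show ?thesis by simp
qed

text \<open>Comparing coefficients gives the product of the series of \<open>wm\<close> with
  \<open>I\<close>, and the shift of the first parameter rewrites it as
  \<open>(T + c) I / c\<close>; this is the relation that determines the limiting moments.\<close>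

theorem wm_eq_mom: "wm n = mom n"
proof -
  define w where "w = (c + a + 1) + (c + b + 1)"
  let ?i = "hyp_coeff c (c + a + 1) w" and ?h = "hyp_coeff (c + 1) (c + a + 1) w"
  have w: "w > 0" using ppos unfolding w_def by linarith
  have d: "(\<Sum>i\<le>n. wm i * ?i (n - i)) - ?h n = 0" for n
    by (rule power_series_eq_zero[where r = "1/8"]) (use wm_hypergeometric in \<open>auto simp: w_def\<close>)
  have "fps_nth (Abs_fps wm) n = mom n"
  proof (rule jmom_of_hypergeometric[OF a b c])
    show "fps_nth (Abs_fps ?i) 0 = 1" by (simp add: hyp_coeff_def)
    fix n
    have "w = 2 * c + a + b + 2" by (simp add: w_def)
    then show "real (Suc n) * (real n + 2 * c + a + b + 2) * fps_nth (Abs_fps ?i) (Suc n) = (real n + c) * (real n + c + a + 1) * fps_nth (Abs_fps ?i) n"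
      using hyp_coeff_Suc[OF w, of n c "c + a + 1"] by (simp add: add.assoc del: of_nat_Suc)
    have "fps_nth (Abs_fps wm * Abs_fps ?i) n = ?h n"
      using d[of n] by (simp add: fps_mult_nth atLeast0AtMost)
    then show "c * fps_nth (Abs_fps wm * Abs_fps ?i) n = (real n + c) * fps_nth (Abs_fps ?i) n"
      by (simp add: hyp_coeff_shift)
  qed
  then show ?thesis by simp
qed

end

section \<open>The limiting measure\<close>

text \<open>Makes a coordinate bounded everywhere rather than almost everywhere, without changing it
  on the unit cube.\<close>

definition cutoff :: "real \<Rightarrow> real \<Rightarrow> real" where "cutoff R u = max (- R) (min R u)"

lemma cutoff_bound: "R \<ge> 0 \<Longrightarrow> \<bar>cutoff R u\<bar> \<le> R"
  by (auto simp: cutoff_def)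

lemma cutoff_id: "\<bar>u\<bar> \<le> R \<Longrightarrow> cutoff R u = u"
  by (auto simp: cutoff_def)

lemma measurable_cutoff [measurable]: "cutoff R \<in> borel_measurable borel"
  unfolding cutoff_def[abs_def] by measurable

lemma real_distributionI_sets:
  "prob_space M \<Longrightarrow> sets M = sets borel \<Longrightarrow> real_distribution M"
  by (simp add: real_distribution_def real_distribution_axioms_def sets_eq_imp_space_eq)

text \<open>By Weierstrass approximation on the compact interval equal moments give equal integrals
  of continuous functions, in particular equal characteristic functions.\<close>

lemma moments_determine_unit_interval_measure:
  fixes \<mu> \<nu> :: "real measure"
  assumes \<mu>: "sets \<mu> = sets borel" "prob_space \<mu>" "measure \<mu> {0..1} = 1"
    and \<nu>: "sets \<nu> = sets borel" "prob_space \<nu>" "measure \<nu> {0..1} = 1"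
    and mom: "\<And>k. (\<integral>x. x ^ k \<partial>\<mu>) = (\<integral>x. x ^ k \<partial>\<nu>)"
  shows "\<mu> = \<nu>"
proof -
  have rd: "real_distribution \<mu>" "real_distribution \<nu>"
    using \<mu> \<nu> by (auto intro: real_distributionI_sets)
  interpret M: real_distribution \<mu> by (rule rd)
  interpret N: real_distribution \<nu> by (rule rd)
  have AE: "AE x in \<mu>. x \<in> {0..1}" "AE x in \<nu>. x \<in> {0..1}"
    using M.prob_eq_1[of "{0..1}"] N.prob_eq_1[of "{0..1}"] \<mu>(3) \<nu>(3) by auto
  have bi: "integrable L f" if L: "L = \<mu> \<or> L = \<nu>" and f: "f \<in> borel_measurable borel" and B: "\<And>x. x \<in> {0..1} \<Longrightarrow> \<bar>f x\<bar> \<le> B" for L B and f :: "real \<Rightarrow> real"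
  proof -
    have "AE x in L. x \<in> {0..1}" using L AE by auto
    then have "AE x in L. norm (f x) \<le> B" by (rule eventually_mono) (use B in auto)
    moreover have "prob_space L" "f \<in> borel_measurable L" using L f \<mu> \<nu> by auto
    ultimately show ?thesis by (intro finite_measure.integrable_const_bound[where B = B] prob_space.finite_measure)
  qed
  have pow: "integrable L (\<lambda>x. x ^ k)" if "L = \<mu> \<or> L = \<nu>" for L k
    by (rule bi[OF that, of _ 1]) (auto simp: power_abs power_le_one)
  have cont: "(\<integral>x. f x \<partial>\<mu>) = (\<integral>x. f x \<partial>\<nu>)" if f: "continuous_on UNIV f" for f :: "real \<Rightarrow> real"
  proof (rule ccontr)
    assume ne: "(\<integral>x. f x \<partial>\<mu>) \<noteq> (\<integral>x. f x \<partial>\<nu>)"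
    define e where "e = \<bar>(\<integral>x. f x \<partial>\<mu>) - (\<integral>x. f x \<partial>\<nu>)\<bar> / 2"
    have e: "e > 0" using ne by (simp add: e_def)
    have c01: "continuous_on {0..1} f" using f by (rule continuous_on_subset) simp
    obtain g where g: "real_polynomial_function g" "\<And>x. x \<in> {0..1} \<Longrightarrow> \<bar>f x - g x\<bar> < e"
      using Stone_Weierstrass_real_polynomial_function[OF compact_Icc c01 e] by blast
    from g(1) obtain a n where gs: "g = (\<lambda>x. \<Sum>i\<le>n. a i * x ^ i)"
      unfolding real_polynomial_function_iff_sum by blast
    have gc: "continuous_on UNIV g" unfolding gs by (intro continuous_intros)
    have ibd: "integrable L h" if L: "L = \<mu> \<or> L = \<nu>" and h: "continuous_on UNIV h" for L and h :: "real \<Rightarrow> real"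
    proof -
      have "compact (h ` {0..1})" using h by (intro compact_continuous_image) (auto intro: continuous_on_subset)
      then obtain B where "\<And>x. x \<in> {0..1} \<Longrightarrow> \<bar>h x\<bar> \<le> B"
        using compact_imp_bounded[of "h ` {0..1}"] unfolding bounded_iff by (metis imageI real_norm_def)
      then show ?thesis by (intro bi[OF L] borel_measurable_continuous_onI h) auto
    qed
    have fg: "\<bar>(\<integral>x. f x \<partial>L) - (\<integral>x. g x \<partial>L)\<bar> < e" if L: "L = \<mu> \<or> L = \<nu>" for L
    proof -
      have pL: "prob_space L" and AL: "AE x in L. x \<in> {0..1}" using L AE \<mu> \<nu> by auto
      interpret L: prob_space L by (rule pL)
      have i: "integrable L (\<lambda>x. \<bar>f x - g x\<bar>)"
        by (intro integrable_abs Bochner_Integration.integrable_diff ibd L f gc)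
      have "\<bar>(\<integral>x. f x \<partial>L) - (\<integral>x. g x \<partial>L)\<bar> = \<bar>\<integral>x. f x - g x \<partial>L\<bar>"
        by (simp add: Bochner_Integration.integral_diff ibd L f gc)
      also have "\<dots> \<le> (\<integral>x. \<bar>f x - g x\<bar> \<partial>L)" by (rule integral_abs_bound)
      also have "\<dots> < e"
        by (rule L.expectation_less[OF i]) (rule eventually_mono[OF AL], rule g(2))
      finally show ?thesis .
    qed
    have "(\<integral>x. g x \<partial>\<mu>) = (\<integral>x. g x \<partial>\<nu>)"
      unfolding gs by (simp add: Bochner_Integration.integral_sum pow mom)
    then have "\<bar>(\<integral>x. f x \<partial>\<mu>) - (\<integral>x. f x \<partial>\<nu>)\<bar> < 2 * e"
      using fg[OF disjI1[OF refl]] fg[OF disjI2[OF refl]] by linarith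
    then show False by (simp add: e_def)
  qed
  have "char \<mu> t = char \<nu> t" for t
  proof (rule complex_eqI)
    have int: "complex_integrable \<mu> (\<lambda>x. iexp (t * x))" "complex_integrable \<nu> (\<lambda>x. iexp (t * x))"
      by (auto intro!: M.integrable_iexp N.integrable_iexp)
    have "(\<integral>x. cos (t * x) \<partial>\<mu>) = (\<integral>x. cos (t * x) \<partial>\<nu>)" "(\<integral>x. sin (t * x) \<partial>\<mu>) = (\<integral>x. sin (t * x) \<partial>\<nu>)"
      by (intro cont continuous_intros)+
    then show "Re (char \<mu> t) = Re (char \<nu> t)" "Im (char \<mu> t) = Im (char \<nu> t)"
      unfolding char_def using int by (simp_all add: integral_Re[symmetric] integral_Im[symmetric] Re_exp Im_exp del: integral_Re integral_Im)
  qed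
  then show ?thesis by (intro Levy_uniqueness rd ext)
qed

section \<open>The mean empirical law and the existence of the limiting measure\<close>

context jacobi_hot begin

text \<open>A configuration together with a uniformly drawn index. The particle so selected is
  distributed according to the mean of the empirical measure.\<close>

definition index_law :: "nat \<Rightarrow> (nat \<times> (nat \<Rightarrow> real)) measure" where
  "index_law N = uniform_count_measure {1..N} \<Otimes>\<^sub>M J N"

lemma measurable_index_component:
  "(\<lambda>w. cutoff 1 (snd w (fst w))) \<in> borel_measurable (index_law N)"
proof -
  have "(\<lambda>w. cutoff 1 (snd w (fst w))) \<in> borel_measurable (count_space {1..N} \<Otimes>\<^sub>M J N)"
  proof (rule measurable_pair_measure_countable1)
    fix i assume "i \<in> {1..N}"
    then have [measurable]: "(\<lambda>x. x i) \<in> borel_measurable (J N)" by (rule measurable_jacobi_component)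
    show "(\<lambda>y. cutoff 1 (snd (i, y) (fst (i, y)))) \<in> borel_measurable (J N)" by simp
  qed simp
  moreover have e: "sets (index_law N) = sets (count_space {1..N} \<Otimes>\<^sub>M J N)"
    unfolding index_law_def by (intro sets_pair_measure_cong) (auto simp: sets_uniform_count_measure)
  ultimately show ?thesis unfolding measurable_cong_sets[OF e refl] by simp
qed

lemma prob_index_law: "N \<ge> 1 \<Longrightarrow> prob_space (index_law N)"
proof -
  assume N: "N \<ge> 1"
  interpret U: prob_space "uniform_count_measure {1..N}" by (rule prob_space_uniform_count_measure) (use N in auto)
  interpret P: pair_prob_space "uniform_count_measure {1..N}" "J N" ..
  show ?thesis unfolding index_law_def by (rule P.prob_space_axioms)
qed

lemma integral_index_law:
  assumes N: "N \<ge> 1"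
  shows "(\<integral>w. cutoff 1 (snd w (fst w)) ^ k \<partial>index_law N) = (\<integral>x. emom N k x \<partial>J N)"
proof -
  interpret U: prob_space "uniform_count_measure {1..N}" by (rule prob_space_uniform_count_measure) (use N in auto)
  interpret P: pair_prob_space "uniform_count_measure {1..N}" "J N" ..
  have I: "integrable (index_law N) (\<lambda>w. cutoff 1 (snd w (fst w)) ^ k)"
    using measurable_index_component[of N] cutoff_bound[of 1]
    by (intro finite_measure.integrable_const_bound[OF prob_space.finite_measure[OF prob_index_law[OF N]], where B = 1])
       (auto simp: power_abs power_le_one)
  have "(\<integral>w. cutoff 1 (snd w (fst w)) ^ k \<partial>index_law N) = (\<integral>i. \<integral>x. cutoff 1 (x i) ^ k \<partial>J N \<partial>uniform_count_measure {1..N})"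
    using P.integral_fst'[OF I[unfolded index_law_def]] by (simp add: index_law_def)
  also have "\<dots> = (\<Sum>i\<in>{1..N}. \<integral>x. cutoff 1 (x i) ^ k \<partial>J N) / real N"
    by (simp add: integral_uniform_count_measure)
  also have "(\<Sum>i\<in>{1..N}. \<integral>x. cutoff 1 (x i) ^ k \<partial>J N) = (\<Sum>i\<in>{1..N}. \<integral>x. x i ^ k \<partial>J N)"
  proof (intro sum.cong refl integral_cong_AE)
    fix i assume i: "i \<in> {1..N}"
    then have [measurable]: "(\<lambda>x. x i) \<in> borel_measurable (J N)" by (rule measurable_jacobi_component)
    show "(\<lambda>x. cutoff 1 (x i) ^ k) \<in> borel_measurable (J N)" "(\<lambda>x. x i ^ k) \<in> borel_measurable (J N)" by measurable
    show "AE x in J N. cutoff 1 (x i) ^ k = x i ^ k"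
      by (rule eventually_mono[OF AE_jacobi_ensemble_cube]) (use i in \<open>auto simp: unit_cube_def cutoff_id\<close>)
  qed
  also have "\<dots> / real N = (\<integral>x. emom N k x \<partial>J N)"
  proof -
    have "integrable (J N) (\<lambda>x. x i ^ k)" if i: "i \<in> {1..N}" for i
    proof (rule J.integrable_const_bound[where B = 1])
      have [measurable]: "(\<lambda>x. x i) \<in> borel_measurable (J N)" using i by (rule measurable_jacobi_component)
      show "(\<lambda>x. x i ^ k) \<in> borel_measurable (J N)" by measurable
      show "AE x in J N. norm (x i ^ k) \<le> 1"
        by (rule eventually_mono[OF AE_jacobi_ensemble_cube]) (use i in \<open>auto simp: unit_cube_def power_abs power_le_one\<close>)
    qed
    then show ?thesis unfolding emom_def by (simp add: Bochner_Integration.integral_sum)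
  qed
  finally show ?thesis .
qed

lemma expectation_emom_tendsto: "(\<lambda>N. \<integral>x. emom (Suc N) k x \<partial>J (Suc N)) \<longlonglongrightarrow> mom k"
proof -
  obtain C where C: "\<forall>N\<ge>1. (\<integral>x. \<bar>dmom k N x\<bar> \<partial>J N) \<le> C / sqrt (real N)"
    using small_prod1[OF small_dmom] by blast
  have "(\<lambda>N. (\<integral>x. emom (Suc N) k x \<partial>J (Suc N)) - mom k) \<longlonglongrightarrow> 0"
  proof (rule Lim_null_comparison)
    show "(\<lambda>N. C / sqrt (real (Suc N))) \<longlonglongrightarrow> 0" by (rule LIMSEQ_Suc[OF const_over_sqrt_tendsto])
    have "norm ((\<integral>x. emom (Suc N) k x \<partial>J (Suc N)) - mom k) \<le> C / sqrt (real (Suc N))" for N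
    proof -
      have "(\<integral>x. emom (Suc N) k x \<partial>J (Suc N)) - mom k = (\<integral>x. dmom k (Suc N) x \<partial>J (Suc N))"
        unfolding dmom_def using ubd_integrable[OF ubd_emom, of "Suc N" k] by (simp add: J.prob_space del: of_nat_Suc)
      moreover have "\<bar>\<integral>x. dmom k (Suc N) x \<partial>J (Suc N)\<bar> \<le> (\<integral>x. \<bar>dmom k (Suc N) x\<bar> \<partial>J (Suc N))" by (rule integral_abs_bound)
      moreover have "(\<integral>x. \<bar>dmom k (Suc N) x\<bar> \<partial>J (Suc N)) \<le> C / sqrt (real (Suc N))" using C by (simp del: of_nat_Suc)
      ultimately show ?thesis unfolding real_norm_def by (simp only:)
    qed
    then show "\<forall>\<^sub>F N in sequentially. norm ((\<integral>x. emom (Suc N) k x \<partial>J (Suc N)) - mom k) \<le> C / sqrt (real (Suc N))"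
      by simp
  qed
  then show ?thesis by (simp add: LIM_zero_iff)
qed

definition is_nu :: "real measure \<Rightarrow> bool" where
  "is_nu \<mu> \<longleftrightarrow> sets \<mu> = sets borel \<and> prob_space \<mu> \<and> measure \<mu> {0..1} = 1 \<and> (\<forall>k. (\<integral>x. x ^ k \<partial>\<mu>) = mom k)"

text \<open>A weak limit along a subsequence of the laws of a random particle. Their moments
  converge along the whole sequence, so the limit has the moments \<open>mom\<close>.\<close>

lemma ex_is_nu: "\<exists>\<mu>. is_nu \<mu>"
proof -
  define X where "X = (\<lambda>w :: nat \<times> (nat \<Rightarrow> real). cutoff 1 (snd w (fst w)))"
  \<comment> \<open>\<open>Suc N\<close>, because a particle can only be drawn from a nonempty
    set.\<close>
  define \<mu> where "\<mu> = (\<lambda>N. distr (index_law (Suc N)) borel X)"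
  have X [measurable]: "X \<in> borel_measurable (index_law N)" for N
    unfolding X_def by (rule measurable_index_component)
  have rd: "real_distribution (\<mu> N)" for N
    unfolding \<mu>_def by (intro real_distributionI_sets prob_space.prob_space_distr prob_index_law) auto
  \<comment> \<open>The cutoff takes values in the closed interval from -1 to 1; tightness is stated
    with intervals open on the left, hence the margin.\<close>
  have mass: "measure (\<mu> N) {-2<..1} = 1" for N
  proof -
    interpret P: prob_space "index_law (Suc N)" by (rule prob_index_law) simp
    have "X -` {-2<..1} \<inter> space (index_law (Suc N)) = space (index_law (Suc N))"
      by (auto simp: X_def cutoff_def)
    then show ?thesis by (simp add: \<mu>_def measure_distr P.prob_space)
  qed
  have "tight \<mu>" unfolding tight_def
  proof (intro conjI allI impI)
    fix e :: real assume "e > 0"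
    then show "\<exists>a b. a < b \<and> (\<forall>n. 1 - e < measure (\<mu> n) {a<..b})"
      using mass by (intro exI[of _ "-2"] exI[of _ 1]) auto
  qed (rule rd)
  from tight_imp_convergent_subsubsequence[OF this strict_mono_id] obtain r M
    where r: "strict_mono (r :: nat \<Rightarrow> nat)" and M: "real_distribution M" and wc: "weak_conv_m (\<mu> \<circ> id \<circ> r) M" by blast
  \<comment> \<open>A continuous clamp onto the unit interval. It changes nothing almost surely
    before the limit, it makes the powers bounded test functions, and pushing the limit through it
    places all the mass on the unit interval.\<close>
  define cl where "cl = (\<lambda>u::real. max 0 (min 1 u))"
  have cl_cont: "isCont cl u" for u unfolding cl_def by (intro continuous_intros)
  have cl_meas [measurable]: "cl \<in> borel_measurable borel" unfolding cl_def by measurable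
  have cl_bd: "0 \<le> cl u" "cl u \<le> 1" for u by (auto simp: cl_def)
  interpret M: real_distribution M by (rule M)
  have lim1: "(\<lambda>n. \<integral>u. cl u ^ k \<partial>\<mu> (r n)) \<longlonglongrightarrow> (\<integral>u. cl u ^ k \<partial>M)" for k
  proof -
    have "(\<lambda>n. \<integral>u. cl u ^ k \<partial>(\<mu> \<circ> id \<circ> r) n) \<longlonglongrightarrow> (\<integral>u. cl u ^ k \<partial>M)"
    proof (rule weak_conv_imp_integral_bdd_continuous_conv[OF _ M wc])
      show "real_distribution ((\<mu> \<circ> id \<circ> r) n)" for n using rd by simp
      show "isCont (\<lambda>u. cl u ^ k) u" for u by (intro continuous_intros cl_cont)
      show "norm (cl u ^ k) \<le> 1" for u using cl_bd[of u] by (simp add: power_abs power_le_one)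
    qed
    then show ?thesis by simp
  qed
  have eq: "(\<integral>u. cl u ^ k \<partial>\<mu> N) = (\<integral>x. emom (Suc N) k x \<partial>J (Suc N))" for k N
  proof -
    have "(\<integral>u. cl u ^ k \<partial>\<mu> N) = (\<integral>w. cl (X w) ^ k \<partial>index_law (Suc N))"
      unfolding \<mu>_def by (rule integral_distr) auto
    also have "\<dots> = (\<integral>w. cutoff 1 (snd w (fst w)) ^ k \<partial>index_law (Suc N))"
    proof (rule integral_cong_AE)
      interpret U: prob_space "uniform_count_measure {1..Suc N}" by (rule prob_space_uniform_count_measure) auto
      interpret P: pair_prob_space "uniform_count_measure {1..Suc N}" "J (Suc N)" ..
      have "AE w in index_law (Suc N). 0 \<le> X w"
        unfolding index_law_def
      proof (rule P.AE_pair_measure)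
        show "{w \<in> space (uniform_count_measure {1..Suc N} \<Otimes>\<^sub>M J (Suc N)). 0 \<le> X w} \<in> sets (uniform_count_measure {1..Suc N} \<Otimes>\<^sub>M J (Suc N))"
          using X[of "Suc N"] unfolding index_law_def by measurable
        show "AE i in uniform_count_measure {1..Suc N}. AE x in J (Suc N). 0 \<le> X (i, x)"
        proof (rule AE_I2)
          fix i assume "i \<in> space (uniform_count_measure {1..Suc N})"
          then have "i \<in> {1..Suc N}" by (simp add: space_uniform_count_measure)
          then show "AE x in J (Suc N). 0 \<le> X (i, x)"
            by (intro eventually_mono[OF AE_jacobi_ensemble_cube]) (auto simp: X_def unit_cube_def cutoff_def le_max_iff_disj)
        qed
      qed
      then show "AE w in index_law (Suc N). cl (X w) ^ k = cutoff 1 (snd w (fst w)) ^ k"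
        by eventually_elim (auto simp: X_def cl_def cutoff_def)
    qed (use X in \<open>auto simp: X_def\<close>)
    also have "\<dots> = (\<integral>x. emom (Suc N) k x \<partial>J (Suc N))" by (rule integral_index_law) simp
    finally show ?thesis .
  qed
  have "(\<lambda>n. \<integral>u. cl u ^ k \<partial>\<mu> (r n)) \<longlonglongrightarrow> mom k" for k
    unfolding eq using LIMSEQ_subseq_LIMSEQ[OF expectation_emom_tendsto r] by (simp add: o_def)
  then have mk: "(\<integral>u. cl u ^ k \<partial>M) = mom k" for k by (rule LIMSEQ_unique[OF lim1])
  have "is_nu (distr M borel cl)"
    unfolding is_nu_def
  proof (intro conjI allI)
    show "prob_space (distr M borel cl)" by (rule M.prob_space_distr) simp
    have "cl -` {0..1} \<inter> space M = space M" using cl_bd by auto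
    then show "measure (distr M borel cl) {0..1} = 1" by (simp add: measure_distr M.prob_space del: M.space_eq_univ)
    show "(\<integral>x. x ^ k \<partial>distr M borel cl) = mom k" for k
      by (subst integral_distr) (auto simp: mk)
  qed simp
  then show ?thesis by blast
qed

text \<open>With the expected matrix powers rewritten as \<open>mom\<close>, existence and
  uniqueness justify the definite description.\<close>

lemma nu_is_nu: "is_nu (nu a b c)"
proof -
  have nu: "nu a b c = (THE \<mu>. is_nu \<mu>)"
    by (simp only: nu_def is_nu_def imat_power_expectation wm_eq_mom)
  from ex_is_nu obtain \<mu> where \<mu>: "is_nu \<mu>" by blast
  have "\<mu>' = \<mu>" if "is_nu \<mu>'" for \<mu>'
    using that \<mu> unfolding is_nu_def by (intro moments_determine_unit_interval_measure) auto
  with \<mu> show ?thesis unfolding nu by (rule theI)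
qed

lemma integral_poly_nu: "(\<integral>x. poly f x \<partial>nu a b c) = mfun f"
proof -
  have nu: "sets (nu a b c) = sets borel" "prob_space (nu a b c)" "measure (nu a b c) {0..1} = 1"
    "\<And>k. (\<integral>x. x ^ k \<partial>nu a b c) = mom k" using nu_is_nu by (auto simp: is_nu_def)
  interpret V: prob_space "nu a b c" by (rule nu)
  note [measurable_cong] = nu(1)
  have AE: "AE x in nu a b c. x \<in> {0..1}" using V.prob_eq_1[of "{0..1}"] nu by auto
  have "integrable (nu a b c) (\<lambda>x. x ^ k)" for k

  proof (rule V.integrable_const_bound[where B = 1])
    show "AE x in nu a b c. norm (x ^ k) \<le> 1"
      by (rule eventually_mono[OF AE]) (auto simp: power_abs power_le_one)
    show "(\<lambda>x. x ^ k) \<in> borel_measurable (nu a b c)" by measurable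
  qed
  then show ?thesis unfolding poly_altdef mfun_def by (simp add: Bochner_Integration.integral_sum nu(4))
qed

lemma Z_star_eq_Z: "Z_star a b c = Z"
proof -
  have "(\<lambda>x::real. x * (1 - x)) = poly wt" by (simp add: fun_eq_iff algebra_simps)
  then have "Z_star a b c = mfun wt" unfolding Z_star_def by (simp add: integral_poly_nu)
  also have "wt = monom 1 1 - monom 1 2" by (simp add: monom_altdef power2_eq_square)
  also have "mfun (monom 1 1 - monom 1 2) = Z" by (simp add: mfun_diff mfun_monom Z_def)
  finally show ?thesis .
qed

lemma fluctuation_eq_dev:
  assumes N: "N \<ge> 1"
  shows "fluctuation a b c N (poly f) x = sqrt (real N) * dev f N x"
proof -
  have "(\<integral>u. poly f u \<partial>empirical_distr N x) = (\<integral>i. poly f (x i) \<partial>uniform_count_measure {1..N})"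
    unfolding empirical_distr_def
  proof (rule integral_distr)
    show "x \<in> uniform_count_measure {1..N} \<rightarrow>\<^sub>M borel"
      by (auto simp: measurable_def sets_uniform_count_measure space_uniform_count_measure)
  qed (rule borel_measurable_poly)
  also have "\<dots> = ep N f x"
    by (simp add: integral_uniform_count_measure ep_def linstat_def)
  finally show ?thesis by (simp add: fluctuation_def dev_def integral_poly_nu)
qed

end

section \<open>Gaussian limits of linear statistics\<close>

text \<open>The integrating factor \<open>exp (V * s^2 / 2)\<close> and the mean value theorem. It
  is at most \<open>exp (V / 2)\<close> on the interval, a loss undone when the factor is divided
  out at \<open>s = 1\<close>.\<close>

lemma ode_bound:
  fixes h h' :: "real \<Rightarrow> real"
  assumes V: "V \<ge> 0" and d: "\<And>s. (h has_real_derivative h' s) (at s)"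
    and b: "\<And>s. 0 \<le> s \<Longrightarrow> s \<le> 1 \<Longrightarrow> \<bar>h' s + V * s * h s\<bar> \<le> e"
  shows "\<bar>h 1 - h 0 * exp (- V / 2)\<bar> \<le> e"
proof -
  let ?g = "\<lambda>s. exp (V * s\<^sup>2 / 2) * h s"
  have "(?g has_real_derivative exp (V * s\<^sup>2 / 2) * (h' s + V * s * h s)) (at s)" for s
    by (rule derivative_eq_intros d refl | simp)+ (simp add: algebra_simps)
  from MVT2[of 0 1 ?g, OF _ this] obtain \<xi> where \<xi>: "0 < \<xi>" "\<xi> < 1"
    and eq: "?g 1 - ?g 0 = exp (V * \<xi>\<^sup>2 / 2) * (h' \<xi> + V * \<xi> * h \<xi>)" by auto
  have e0: "0 \<le> e" using b[of 0] by simp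
  have "V * \<xi>\<^sup>2 \<le> V * 1" using \<xi> V by (intro mult_left_mono) (auto simp: power_le_one)
  then have "exp (V * \<xi>\<^sup>2 / 2) \<le> exp (V / 2)" by simp
  moreover have "\<bar>h' \<xi> + V * \<xi> * h \<xi>\<bar> \<le> e" using b[of \<xi>] \<xi> by simp
  ultimately have "\<bar>exp (V * \<xi>\<^sup>2 / 2)\<bar> * \<bar>h' \<xi> + V * \<xi> * h \<xi>\<bar> \<le> exp (V / 2) * e"
    by (intro mult_mono) auto
  then have "\<bar>exp (V * \<xi>\<^sup>2 / 2) * (h' \<xi> + V * \<xi> * h \<xi>)\<bar> \<le> exp (V / 2) * e"
    by (simp only: abs_mult)
  then have "exp (- V / 2) * \<bar>exp (V / 2) * h 1 - h 0\<bar> \<le> exp (- V / 2) * (exp (V / 2) * e)"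
    using eq by (intro mult_left_mono) auto
  moreover have "exp (- V / 2) * exp (V / 2) = 1" by (simp flip: exp_add)
  then have "exp (- V / 2) * \<bar>exp (V / 2) * h 1 - h 0\<bar> = \<bar>h 1 - h 0 * exp (- V / 2)\<bar>"
    "exp (- V / 2) * (exp (V / 2) * e) = e"
    by (simp_all add: abs_mult_pos' right_diff_distrib flip: mult.assoc) (simp add: mult.commute)
  ultimately show ?thesis by (simp only:)
qed

text \<open>The derivative is 1-Lipschitz, and the mean value inequality is applied once more to the
  remainder; the sharp constant 1/2 is not aimed at.\<close>

lemma first_order_taylor_bound:
  fixes \<phi> \<phi>' \<phi>'' :: "real \<Rightarrow> real"
  assumes d: "\<And>y. (\<phi> has_real_derivative \<phi>' y) (at y)" "\<And>y. (\<phi>' has_real_derivative \<phi>'' y) (at y)"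
    and b: "\<And>y. \<bar>\<phi>'' y\<bar> \<le> 1"
  shows "\<bar>\<phi> (u + v) - \<phi> u - v * \<phi>' u\<bar> \<le> v\<^sup>2"
proof -
  have l: "\<bar>\<phi>' x - \<phi>' y\<bar> \<le> \<bar>x - y\<bar>" for x y
    using field_differentiable_bound[of UNIV \<phi>' \<phi>'' 1 x y] d(2) b by simp
  let ?g = "\<lambda>w. \<phi> (u + w) - w * \<phi>' u"
  have "norm (?g v - ?g 0) \<le> \<bar>v\<bar> * norm (v - 0)"
  proof (rule field_differentiable_bound[of "cball 0 \<bar>v\<bar>" ?g "\<lambda>w. \<phi>' (u + w) - \<phi>' u"])
    show "(?g has_field_derivative \<phi>' (u + w) - \<phi>' u) (at w within cball 0 \<bar>v\<bar>)" for w
    proof -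
      have "(\<phi> has_real_derivative \<phi>' (u + w)) (at (w + u))" using d(1)[of "w + u"] by (simp add: add.commute)
      then have "((\<lambda>w. \<phi> (w + u)) has_real_derivative \<phi>' (u + w)) (at w)" by (simp only: DERIV_shift)
      then have "(?g has_real_derivative \<phi>' (u + w) - 1 * \<phi>' u) (at w)"
        unfolding add.commute[of u] by (intro DERIV_diff DERIV_cmult_right DERIV_ident)
      then show ?thesis by (simp add: has_field_derivative_at_within)
    qed
    show "norm (\<phi>' (u + w) - \<phi>' u) \<le> \<bar>v\<bar>" if "w \<in> cball 0 \<bar>v\<bar>" for w
      using l[of "u + w" u] that by simp
  qed auto
  then show ?thesis by (simp add: power2_eq_square algebra_simps flip: abs_mult)
qed

text \<open>Taylor's bound holds under the expectation with error \<open>h^2 * K^2\<close>, so the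
  difference quotient converges with an explicit rate.\<close>

lemma (in prob_space) expectation_scale_derivative:
  fixes \<phi> \<phi>' \<phi>'' :: "real \<Rightarrow> real"
  assumes [measurable]: "X \<in> borel_measurable M" and X: "AE x in M. \<bar>X x\<bar> \<le> K"
    and d: "\<And>y. (\<phi> has_real_derivative \<phi>' y) (at y)" "\<And>y. (\<phi>' has_real_derivative \<phi>'' y) (at y)"
    and b: "\<And>y. \<bar>\<phi> y\<bar> \<le> 1" "\<And>y. \<bar>\<phi>' y\<bar> \<le> 1" "\<And>y. \<bar>\<phi>'' y\<bar> \<le> 1"
  shows "((\<lambda>s. \<integral>x. \<phi> (s * X x) \<partial>M) has_real_derivative (\<integral>x. X x * \<phi>' (s * X x) \<partial>M)) (at s)"
proof -
  have "continuous_on UNIV \<phi>" "continuous_on UNIV \<phi>'"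
    using d by (auto intro!: continuous_at_imp_continuous_on DERIV_isCont)
  then have [measurable]: "\<phi> \<in> borel_measurable borel" "\<phi>' \<in> borel_measurable borel"
    by (auto intro: borel_measurable_continuous_onI)
  have i1: "integrable M (\<lambda>x. \<phi> (s * X x))" for s
    by (rule integrable_const_bound[where B = 1]) (use b in auto)
  have i2: "integrable M (\<lambda>x. X x * \<phi>' (s * X x))"
  proof (rule integrable_const_bound[where B = K])
    show "AE x in M. norm (X x * \<phi>' (s * X x)) \<le> K"
      using X
    proof eventually_elim
      case (elim x)
      have "\<bar>X x\<bar> * \<bar>\<phi>' (s * X x)\<bar> \<le> \<bar>X x\<bar> * 1" using b(2) by (intro mult_left_mono) auto
      with elim show ?case by (simp add: abs_mult)
    qed
  qed measurable
  have bd: "\<bar>(\<integral>x. \<phi> ((s + h) * X x) \<partial>M) - (\<integral>x. \<phi> (s * X x) \<partial>M) - h * (\<integral>x. X x * \<phi>' (s * X x) \<partial>M)\<bar> \<le> h\<^sup>2 * K\<^sup>2" for h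
  proof -
    have eq: "(\<integral>x. \<phi> ((s + h) * X x) \<partial>M) - (\<integral>x. \<phi> (s * X x) \<partial>M) - h * (\<integral>x. X x * \<phi>' (s * X x) \<partial>M) =
      (\<integral>x. \<phi> ((s + h) * X x) - \<phi> (s * X x) - h * (X x * \<phi>' (s * X x)) \<partial>M)"
      using i1 i2 by simp
    have "\<bar>\<integral>x. \<phi> ((s + h) * X x) - \<phi> (s * X x) - h * (X x * \<phi>' (s * X x)) \<partial>M\<bar> \<le> (\<integral>x. \<bar>\<phi> ((s + h) * X x) - \<phi> (s * X x) - h * (X x * \<phi>' (s * X x))\<bar> \<partial>M)"
      by (rule integral_abs_bound)
    also have "\<dots> \<le> (\<integral>x. h\<^sup>2 * K\<^sup>2 \<partial>M)"
    proof (rule integral_mono_AE)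
      show "AE x in M. \<bar>\<phi> ((s + h) * X x) - \<phi> (s * X x) - h * (X x * \<phi>' (s * X x))\<bar> \<le> h\<^sup>2 * K\<^sup>2"
        using X
      proof eventually_elim
        case (elim x)
        have "(X x)\<^sup>2 \<le> K\<^sup>2" using power_mono[OF elim abs_ge_zero, of 2] by (simp only: power2_abs)
        then have "(h * X x)\<^sup>2 \<le> h\<^sup>2 * K\<^sup>2" unfolding power_mult_distrib by (rule mult_left_mono) simp
        moreover have "\<bar>\<phi> (s * X x + h * X x) - \<phi> (s * X x) - h * X x * \<phi>' (s * X x)\<bar> \<le> (h * X x)\<^sup>2"
          by (rule first_order_taylor_bound[OF d b(3)])
        ultimately show ?case by (simp add: distrib_right mult.assoc)
      qed
    qed (intro integrable_abs Bochner_Integration.integrable_diff i1 integrable_mult_right i2 integrable_const)+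
    finally show ?thesis unfolding eq by (simp add: prob_space)
  qed
  let ?F = "\<lambda>s. \<integral>x. \<phi> (s * X x) \<partial>M" and ?D = "\<integral>x. X x * \<phi>' (s * X x) \<partial>M"
  have "((\<lambda>h. (?F (s + h) - ?F s) / h - ?D) \<longlongrightarrow> 0) (at 0)"
  proof (rule Lim_null_comparison)
    show "\<forall>\<^sub>F h in at 0. norm ((?F (s + h) - ?F s) / h - ?D) \<le> \<bar>h\<bar> * K\<^sup>2"
        unfolding eventually_at
      proof (intro exI[of _ 1] conjI ballI impI)
        fix h :: real assume "h \<noteq> 0 \<and> dist h 0 < 1"
        then have h: "h \<noteq> 0" by simp
        then have "norm ((?F (s + h) - ?F s) / h - ?D) = \<bar>?F (s + h) - ?F s - h * ?D\<bar> / \<bar>h\<bar>"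
          by (simp add: field_simps flip: abs_divide)
        also have "\<dots> \<le> (h\<^sup>2 * K\<^sup>2) / \<bar>h\<bar>" by (intro divide_right_mono bd) simp
        also have "\<dots> = \<bar>h\<bar> * K\<^sup>2" using h by (simp add: power2_eq_square field_simps)
        finally show "norm ((?F (s + h) - ?F s) / h - ?D) \<le> \<bar>h\<bar> * K\<^sup>2" .
      qed simp
    have "((\<lambda>h::real. \<bar>h\<bar> * K\<^sup>2) \<longlongrightarrow> \<bar>0\<bar> * K\<^sup>2) (at 0)" by (intro tendsto_intros)
    then show "((\<lambda>h::real. \<bar>h\<bar> * K\<^sup>2) \<longlongrightarrow> 0) (at 0)" by simp
  qed
  then show ?thesis unfolding DERIV_def by (simp add: LIM_zero_iff)
qed

lemma char_gaussian:
  assumes "v > 0" shows "char (gaussian 0 v) t = complex_of_real (exp (- (v * t\<^sup>2) / 2))"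
proof -
  interpret N: prob_space std_normal_distribution by (rule prob_space_normal_density) simp
  have "distributed std_normal_distribution lborel (\<lambda>x. x) (normal_density 0 1)"
    by (auto simp: distributed_def intro!: distr_id2)
  from N.normal_density_affine[OF this, of "sqrt v" 0] assms
  have "distributed std_normal_distribution lborel (\<lambda>x. sqrt v * x) (normal_density 0 (sqrt v))" by simp
  then have g: "gaussian 0 v = distr std_normal_distribution lborel (\<lambda>x. sqrt v * x)"
    by (simp add: gaussian_def distributed_def)
  have "char (gaussian 0 v) t = char std_normal_distribution (t * sqrt v)"
    unfolding g char_def by (subst integral_distr) (auto simp: mult_ac)
  also have "\<dots> = complex_of_real (exp (- (v * t\<^sup>2) / 2))"
    using assms by (simp add: char_std_normal_distribution power_mult_distrib mult.commute)
  finally show ?thesis .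
qed

lemma real_distribution_gaussian: "v > 0 \<Longrightarrow> real_distribution (gaussian 0 v)"
  unfolding gaussian_def by (intro real_distributionI_sets prob_space_normal_density) auto

section \<open>Characteristic functions of linear combinations of the fluctuations\<close>

context jacobi_hot begin

lemma measurable_dev: "dev f N \<in> borel_measurable (J N)"
  by (rule ubd_measurable[OF small_ubd[OF small_dev]])

text \<open>If \<open>T p\<close> and \<open>f\<close> have the same deviations, the approximate
  loop equation for sine and cosine of \<open>s * y\<close> says that both expectations solve
  \<open>h' = - V * s * h\<close> up to order \<open>N^(-1/2)\<close>, with initial values 1 and 0.
  The range from 0 to 1 for \<open>s\<close> keeps the derivatives of the test functions bounded by
  1 and suffices, since the argument of the characteristic function can be put into
  \<open>f\<close>.\<close>

lemma clt_cos_sin: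
  assumes dr: "\<And>N x. N \<ge> 1 \<Longrightarrow> dev (drift_op p) N x = dev f N x"
    and V: "V = - ip (pderiv f) p" "V \<ge> 0"
  shows "(\<lambda>N. \<integral>x. cos (sqrt (real N) * dev f N x) \<partial>J N) \<longlonglongrightarrow> exp (- V / 2)"
    and "(\<lambda>N. \<integral>x. sin (sqrt (real N) * dev f N x) \<partial>J N) \<longlonglongrightarrow> 0"
proof -
  obtain C where C: "\<forall>N\<ge>1. \<forall>\<phi> \<phi>'. (\<forall>y. (\<phi> has_real_derivative \<phi>' y) (at y)) \<longrightarrow> continuous_on UNIV \<phi>' \<longrightarrow>
     (\<forall>y. \<bar>\<phi> y\<bar> \<le> 1) \<longrightarrow> (\<forall>y. \<bar>\<phi>' y\<bar> \<le> 1) \<longrightarrow>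
     \<bar>mfun (pderiv f * (wt * p)) * (\<integral>x. \<phi>' (sqrt (real N) * dev f N x) \<partial>J N) +
      (\<integral>x. \<phi> (sqrt (real N) * dev f N x) * (sqrt (real N) * dev (drift_op p) N x) \<partial>J N)\<bar> \<le> C / sqrt (real N)"
    using approx_loop[of f p] by blast
  obtain K where K: "\<And>N x. N \<ge> 1 \<Longrightarrow> x \<in> unit_cube N \<Longrightarrow> \<bar>dev f N x\<bar> \<le> K"
    using small_ubd[OF small_dev, of f] by (elim ubdE) blast
  have mV: "mfun (pderiv f * (wt * p)) = - V" using V(1) by (simp add: ip_def)
  have main: "\<bar>(\<integral>x. cos (sqrt (real N) * dev f N x) \<partial>J N) - exp (- V / 2)\<bar> \<le> C / sqrt (real N) \<and>
     \<bar>\<integral>x. sin (sqrt (real N) * dev f N x) \<partial>J N\<bar> \<le> C / sqrt (real N)" if N: "N \<ge> 1" for N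
  proof -
    let ?X = "\<lambda>x. sqrt (real N) * dev f N x"
    note [measurable] = measurable_dev[of f N]
    have X: "?X \<in> borel_measurable (J N)" by measurable
    have XK: "AE x in J N. \<bar>?X x\<bar> \<le> sqrt (real N) * K"
      by (rule eventually_mono[OF AE_jacobi_ensemble_cube]) (use K[OF N] in \<open>simp add: abs_mult mult_left_mono\<close>)
    define F where "F = (\<lambda>s. \<integral>x. cos (s * ?X x) \<partial>J N)"
    define G where "G = (\<lambda>s. \<integral>x. sin (s * ?X x) \<partial>J N)"
    define F' where "F' = (\<lambda>s. \<integral>x. ?X x * - sin (s * ?X x) \<partial>J N)"
    define G' where "G' = (\<lambda>s. \<integral>x. ?X x * cos (s * ?X x) \<partial>J N)"
    have dF: "(F has_real_derivative F' s) (at s)" for s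
      unfolding F_def F'_def
      by (rule J.expectation_scale_derivative[OF X XK, where \<phi>'' = "\<lambda>y. - cos y"])
         (auto intro!: derivative_eq_intros)
    have dG: "(G has_real_derivative G' s) (at s)" for s
      unfolding G_def G'_def
      by (rule J.expectation_scale_derivative[OF X XK, where \<phi>'' = "\<lambda>y. - sin y"])
         (auto intro!: derivative_eq_intros)
    have bF: "\<bar>F' s + V * s * F s\<bar> \<le> C / sqrt (real N)" if s: "0 \<le> s" "s \<le> 1" for s
    proof -
      have d: "\<forall>y. ((\<lambda>y. sin (s * y)) has_real_derivative s * cos (s * y)) (at y)"
        by (auto intro!: derivative_eq_intros)
      have c: "continuous_on UNIV (\<lambda>y. s * cos (s * y))" by (intro continuous_intros)
      have b: "\<forall>y. \<bar>sin (s * y)\<bar> \<le> 1" "\<forall>y. \<bar>s * cos (s * y)\<bar> \<le> 1"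
        using s by (auto simp: abs_mult intro!: mult_le_one)
      have "\<bar>- V * (\<integral>x. s * cos (s * ?X x) \<partial>J N) + (\<integral>x. sin (s * ?X x) * (sqrt (real N) * dev (drift_op p) N x) \<partial>J N)\<bar> \<le> C / sqrt (real N)"
        using C[rule_format, OF N, of "\<lambda>y. sin (s * y)" "\<lambda>y. s * cos (s * y)", OF d[rule_format] c b(1)[rule_format] b(2)[rule_format]]
        unfolding mV .
      moreover have "(\<integral>x. sin (s * ?X x) * (sqrt (real N) * dev (drift_op p) N x) \<partial>J N) = - F' s"
        unfolding F'_def dr[OF N] by (simp add: mult.commute)
      moreover have "(\<integral>x. s * cos (s * ?X x) \<partial>J N) = s * F s" unfolding F_def by simp
      ultimately have "\<bar>- V * (s * F s) + - F' s\<bar> \<le> C / sqrt (real N)" by (simp only:)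
      moreover have "- V * (s * F s) + - F' s = - (F' s + V * s * F s)" by simp
      ultimately show ?thesis by (simp only: abs_minus_cancel)
    qed
    have bG: "\<bar>G' s + V * s * G s\<bar> \<le> C / sqrt (real N)" if s: "0 \<le> s" "s \<le> 1" for s
    proof -
      have d: "\<forall>y. ((\<lambda>y. cos (s * y)) has_real_derivative - s * sin (s * y)) (at y)"
        by (auto intro!: derivative_eq_intros)
      have c: "continuous_on UNIV (\<lambda>y. - s * sin (s * y))" by (intro continuous_intros)
      have b: "\<forall>y. \<bar>cos (s * y)\<bar> \<le> 1" "\<forall>y. \<bar>- s * sin (s * y)\<bar> \<le> 1"
        using s by (auto simp: abs_mult intro!: mult_le_one)
      have "\<bar>- V * (\<integral>x. - s * sin (s * ?X x) \<partial>J N) + (\<integral>x. cos (s * ?X x) * (sqrt (real N) * dev (drift_op p) N x) \<partial>J N)\<bar> \<le> C / sqrt (real N)"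
        using C[rule_format, OF N, of "\<lambda>y. cos (s * y)" "\<lambda>y. - s * sin (s * y)", OF d[rule_format] c b(1)[rule_format] b(2)[rule_format]]
        unfolding mV .
      moreover have "(\<integral>x. cos (s * ?X x) * (sqrt (real N) * dev (drift_op p) N x) \<partial>J N) = G' s"
        unfolding G'_def dr[OF N] by (simp add: mult.commute)
      moreover have "(\<integral>x. - s * sin (s * ?X x) \<partial>J N) = - s * G s" unfolding G_def by simp
      ultimately have "\<bar>- V * (- s * G s) + G' s\<bar> \<le> C / sqrt (real N)" by (simp only:)
      moreover have "- V * (- s * G s) + G' s = G' s + V * s * G s" by simp
      ultimately show ?thesis by (simp only:)
    qed
    have "\<bar>F 1 - F 0 * exp (- V / 2)\<bar> \<le> C / sqrt (real N)" by (rule ode_bound[OF V(2) dF bF])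
    moreover have "\<bar>G 1 - G 0 * exp (- V / 2)\<bar> \<le> C / sqrt (real N)" by (rule ode_bound[OF V(2) dG bG])
    ultimately show ?thesis by (simp add: F_def G_def J.prob_space)
  qed
  have ev: "eventually (\<lambda>N. N \<ge> (1::nat)) sequentially" by (rule eventually_ge_at_top)
  have "(\<lambda>N. (\<integral>x. cos (sqrt (real N) * dev f N x) \<partial>J N) - exp (- V / 2)) \<longlonglongrightarrow> 0"
    by (rule Lim_null_comparison[OF eventually_mono[OF ev] const_over_sqrt_tendsto[of C]]) (use main in auto)
  then show "(\<lambda>N. \<integral>x. cos (sqrt (real N) * dev f N x) \<partial>J N) \<longlonglongrightarrow> exp (- V / 2)" by (simp add: LIM_zero_iff)
  show "(\<lambda>N. \<integral>x. sin (sqrt (real N) * dev f N x) \<partial>J N) \<longlonglongrightarrow> 0"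
    by (rule Lim_null_comparison[OF eventually_mono[OF ev] const_over_sqrt_tendsto[of C]]) (use main in auto)
qed

lemma eig_pos: "eig n > 0"
  unfolding eig_def using S_pos by (intro mult_pos_pos) auto

text \<open>On the eigenpolynomials \<open>T\<close> is inverted by dividing by the eigenvalue.
  Orthogonality then makes the variance a sum of squares without mixed terms, which is the
  independence of the limits.\<close>

lemma clt_primitives:
  fixes t :: "nat \<Rightarrow> real"
  assumes prim: "\<And>n. pderiv (P n) = p_tilde a b c n" and I: "finite I"
  defines "V \<equiv> \<Sum>n\<in>I. Z / eig n * (t n)\<^sup>2"
  shows "(\<lambda>N. \<integral>x. cos (\<Sum>n\<in>I. t n * (sqrt (real N) * dev (P n) N x)) \<partial>J N) \<longlonglongrightarrow> exp (- V / 2)"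
    and "(\<lambda>N. \<integral>x. sin (\<Sum>n\<in>I. t n * (sqrt (real N) * dev (P n) N x)) \<partial>J N) \<longlonglongrightarrow> 0"
proof -
  define f where "f = (\<Sum>n\<in>I. smult (t n) (P n))"
  \<comment> \<open>Solves \<open>T p = f\<close> up to a constant, because \<open>T\<close> sends
    each \<open>p_tilde\<close> to \<open>- eig n\<close> times its primitive, again up to a
    constant.\<close>
  define p where "p = (\<Sum>n\<in>I. smult (- t n / eig n) (p_tilde a b c n))"
  have dr: "dev (drift_op p) N x = dev f N x" if N: "N \<ge> 1" for N x
  proof -
    have "dev (drift_op (p_tilde a b c n)) N x = - eig n * dev (P n) N x" for n
    proof -
      obtain k where "drift_op (p_tilde a b c n) = smult (- eig n) (P n) + [:k:]"
        using drift_op_primitive[OF prim] by blast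
      then show ?thesis by (simp only: dev_add dev_smult dev_const[OF N] add_0_right)
    qed
    then have "dev (drift_op p) N x = (\<Sum>n\<in>I. - t n / eig n * (- eig n * dev (P n) N x))"
      unfolding p_def drift_op_sum drift_op_smult dev_sum dev_smult by (simp only:)
    also have "\<dots> = dev f N x"
      unfolding f_def dev_sum dev_smult using eig_pos by (intro sum.cong refl) (simp add: less_imp_neq[symmetric])
    finally show ?thesis .
  qed
  have df: "pderiv f = (\<Sum>n\<in>I. smult (t n) (p_tilde a b c n))"
    using higher_pderiv_sum[of "Suc 0" "\<lambda>n. smult (t n) (P n)" I] by (simp add: f_def pderiv_smult prim)
  have "ip (pderiv f) p = (\<Sum>n\<in>I. t n * ip p (p_tilde a b c n))"
    unfolding df ip_sum ip_smult by (simp only: ip_commute[of _ p])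
  also have "\<dots> = (\<Sum>n\<in>I. t n * (\<Sum>m\<in>I. - t m / eig m * ip (p_tilde a b c m) (p_tilde a b c n)))"
    unfolding p_def ip_sum ip_smult ..
  also have "\<dots> = (\<Sum>n\<in>I. - (Z / eig n * (t n)\<^sup>2))"
  proof (intro sum.cong refl)
    fix n assume "n \<in> I"
    then have "(\<Sum>m\<in>I. - t m / eig m * ip (p_tilde a b c m) (p_tilde a b c n)) = - t n / eig n * Z"
      unfolding p_tilde_ip using I by (simp add: if_distrib[of "\<lambda>x. _ * x"] sum.delta cong: if_cong)
    then show "t n * (\<Sum>m\<in>I. - t m / eig m * ip (p_tilde a b c m) (p_tilde a b c n)) = - (Z / eig n * (t n)\<^sup>2)"
      by (simp only: power2_eq_square) simp
  qed
  finally have V: "V = - ip (pderiv f) p" by (simp add: V_def sum_negf)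
  have "V \<ge> 0" unfolding V_def using eig_pos Z_pos by (intro sum_nonneg mult_nonneg_nonneg divide_nonneg_nonneg) (auto simp: less_imp_le)
  note clt = clt_cos_sin[OF dr V this]
  have e: "(\<Sum>n\<in>I. t n * (sqrt (real N) * dev (P n) N x)) = sqrt (real N) * dev f N x" for N x
    by (simp add: f_def dev_sum dev_smult sum_distrib_left mult_ac)
  show "(\<lambda>N. \<integral>x. cos (\<Sum>n\<in>I. t n * (sqrt (real N) * dev (P n) N x)) \<partial>J N) \<longlonglongrightarrow> exp (- V / 2)"
    "(\<lambda>N. \<integral>x. sin (\<Sum>n\<in>I. t n * (sqrt (real N) * dev (P n) N x)) \<partial>J N) \<longlonglongrightarrow> 0"
    unfolding e using clt by simp_all
qed

lemma fluctuation_eq: "fluctuation a b c N (poly f) = (\<lambda>x. sqrt (real N) * dev f N x)"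
proof (cases "N = 0")
  case True
  then show ?thesis by (simp add: fluctuation_def fun_eq_iff)
next
  case False
  then show ?thesis using fluctuation_eq_dev[of N f] by (simp add: fun_eq_iff)
qed

lemma measurable_fluctuation: "fluctuation a b c N (poly f) \<in> borel_measurable (J N)"
  unfolding fluctuation_eq using measurable_dev[of f N] by simp

text \<open>Levy's continuity theorem; the real and imaginary parts of the characteristic function
  are the cosine and sine expectations for a single index.\<close>

lemma fluctuation_weak_conv:
  assumes prim: "\<And>n. pderiv (P n) = p_tilde a b c n"
  shows "weak_conv_m (\<lambda>N. distr (J N) borel (fluctuation a b c N (poly (P n)))) (gaussian 0 (Z / eig n))"
proof (rule levy_continuity)
  have v: "Z / eig n > 0" using Z_pos eig_pos by simp
  show "real_distribution (gaussian 0 (Z / eig n))" by (rule real_distribution_gaussian[OF v])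
  show "real_distribution (distr (J N) borel (fluctuation a b c N (poly (P n))))" for N
    by (intro real_distributionI_sets J.prob_space_distr measurable_fluctuation) simp
  fix t
  have "char (distr (J N) borel (fluctuation a b c N (poly (P n)))) t =
    Complex (\<integral>x. cos (t * (sqrt (real N) * dev (P n) N x)) \<partial>J N) (\<integral>x. sin (t * (sqrt (real N) * dev (P n) N x)) \<partial>J N)" for N
  proof -
    note [measurable] = measurable_dev[of "P n" N]
    have "char (distr (J N) borel (fluctuation a b c N (poly (P n)))) t = (\<integral>x. iexp (t * (sqrt (real N) * dev (P n) N x)) \<partial>J N)"
      unfolding char_def fluctuation_eq by (rule integral_distr) measurable
    moreover have "complex_integrable (J N) (\<lambda>x. iexp (t * (sqrt (real N) * dev (P n) N x)))"
      by (rule J.integrable_const_bound[where B = 1]) auto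
    ultimately show ?thesis
      by (intro complex_eqI) (simp_all add: integral_Re[symmetric] integral_Im[symmetric] Re_exp Im_exp del: integral_Re integral_Im of_real_mult)
  qed
  moreover have "(\<lambda>N. Complex (\<integral>x. cos (t * (sqrt (real N) * dev (P n) N x)) \<partial>J N) (\<integral>x. sin (t * (sqrt (real N) * dev (P n) N x)) \<partial>J N))
     \<longlonglongrightarrow> Complex (exp (- (Z / eig n * t\<^sup>2) / 2)) 0"
    using clt_primitives[OF prim, of "{n}" "\<lambda>_. t"] by (intro tendsto_Complex) simp_all
  moreover have "Complex (exp (- (Z / eig n * t\<^sup>2) / 2)) 0 = char (gaussian 0 (Z / eig n)) t"
    unfolding char_gaussian[OF v] by (simp add: complex_of_real_def)
  ultimately show "(\<lambda>N. char (distr (J N) borel (fluctuation a b c N (poly (P n)))) t) \<longlonglongrightarrow> char (gaussian 0 (Z / eig n)) t"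
    by simp
qed

end

section \<open>Joint convergence\<close>

text \<open>Sums of cosines with arbitrary phase. The phase makes sines a special case, and the
  closure under products then needs the single identity for a product of two cosines.\<close>

inductive_set trig_poly :: "nat set \<Rightarrow> ((nat \<Rightarrow> real) \<Rightarrow> real) set" for I where
  wave: "(\<lambda>x. k * cos ((\<Sum>i\<in>I. t i * x i) + s)) \<in> trig_poly I"
| add: "g \<in> trig_poly I \<Longrightarrow> h \<in> trig_poly I \<Longrightarrow> (\<lambda>x. g x + h x) \<in> trig_poly I"

lemma trig_poly_const: "(\<lambda>x. k) \<in> trig_poly I"
  using trig_poly.wave[of k "\<lambda>_. 0" I 0] by simp

lemma trig_poly_sin: "finite I \<Longrightarrow> i \<in> I \<Longrightarrow> (\<lambda>x. sin (\<theta> * x i)) \<in> trig_poly I"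
proof -
  assume "finite I" "i \<in> I"
  then have "(\<Sum>j\<in>I. (if j = i then \<theta> else 0) * x j) = \<theta> * x i" for x :: "nat \<Rightarrow> real"
    by (simp add: if_distrib[of "\<lambda>y. y * _"] sum.delta cong: if_cong)
  then show ?thesis
    using trig_poly.wave[of 1 "\<lambda>j. if j = i then \<theta> else 0" I "- (pi / 2)"] by (simp add: cos_diff)
qed

lemma trig_poly_mult:
  assumes "g \<in> trig_poly I" "h \<in> trig_poly I"
  shows "(\<lambda>x. g x * h x) \<in> trig_poly I"
  using assms
proof (induction g)
  case (wave k t s)
  from wave show ?case
  proof (induction h)
    case (wave k' t' s')
    have "k * cos ((\<Sum>i\<in>I. t i * x i) + s) * (k' * cos ((\<Sum>i\<in>I. t' i * x i) + s')) =
       k * k' / 2 * cos ((\<Sum>i\<in>I. (t i - t' i) * x i) + (s - s')) + k * k' / 2 * cos ((\<Sum>i\<in>I. (t i + t' i) * x i) + (s + s'))" for x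
    proof -
      have "cos u * cos v = (cos (u - v) + cos (u + v)) / 2" for u v :: real by (rule cos_times_cos)
      moreover have "(\<Sum>i\<in>I. t i * x i) + s - ((\<Sum>i\<in>I. t' i * x i) + s') = (\<Sum>i\<in>I. (t i - t' i) * x i) + (s - s')"
        by (simp add: left_diff_distrib sum_subtractf)
      moreover have "(\<Sum>i\<in>I. t i * x i) + s + ((\<Sum>i\<in>I. t' i * x i) + s') = (\<Sum>i\<in>I. (t i + t' i) * x i) + (s + s')"
        by (simp add: distrib_right sum.distrib)
      moreover have "k * u * (k' * v) = k * k' * (u * v)" for u v by simp
      ultimately show ?thesis by (simp only: distrib_left add_divide_distrib) simp
    qed
    then show ?case by (simp only:) (intro trig_poly.intros)
  next
    case (add g h)
    then show ?case by (simp only: distrib_left) (rule trig_poly.add)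
  qed
next
  case (add g1 g2)
  from trig_poly.add[OF add.IH(1)[OF add.prems] add.IH(2)[OF add.prems]] show ?case by (simp only: distrib_right)
qed

lemma trig_poly_continuous: "g \<in> trig_poly I \<Longrightarrow> continuous_on S g"
proof (induction rule: trig_poly.induct)
  case (wave k t s)
  have "continuous_on S (\<lambda>x :: nat \<Rightarrow> real. x i)" for i
    by (rule continuous_on_subset[OF continuous_on_product_coordinates]) simp
  then show ?case by (intro continuous_intros)
qed (intro continuous_intros)

lemma trig_poly_measurable:
  assumes "g \<in> trig_poly I" shows "g \<in> borel_measurable (PiM I (\<lambda>_. borel))"
  using assms by induction measurable

lemma trig_poly_bounded: "g \<in> trig_poly I \<Longrightarrow> \<exists>B. \<forall>x. \<bar>g x\<bar> \<le> B"
proof (induction rule: trig_poly.induct)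
  case (wave k t s)
  have "\<bar>k * cos ((\<Sum>i\<in>I. t i * x i) + s)\<bar> \<le> \<bar>k\<bar> * 1" for x
    unfolding abs_mult by (intro mult_left_mono) auto
  then show ?case by (intro exI[of _ "\<bar>k\<bar>"]) simp
next
  case (add g h)
  then obtain B B' where "\<forall>x. \<bar>g x\<bar> \<le> B" "\<forall>x. \<bar>h x\<bar> \<le> B'" by blast
  then have "\<bar>g x + h x\<bar> \<le> B + B'" for x
    by (intro order_trans[OF abs_triangle_ineq] add_mono) auto
  then show ?case by blast
qed

text \<open>In each coordinate a triangle wave of period \<open>4 * R\<close>: it folds the line
  onto the interval from \<open>-R\<close> to \<open>R\<close> without changing the sine of
  \<open>pi / (2 * R) * x i\<close>. Outside \<open>I\<close> the value is \<open>undefined\<close>,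
  as for extensional functions.\<close>

definition fold_box :: "nat set \<Rightarrow> real \<Rightarrow> (nat \<Rightarrow> real) \<Rightarrow> nat \<Rightarrow> real" where
  "fold_box I R x = (\<lambda>i. if i \<in> I then arcsin (sin (pi / (2 * R) * x i)) / (pi / (2 * R)) else undefined)"

definition real_box :: "nat set \<Rightarrow> real \<Rightarrow> (nat \<Rightarrow> real) set" where
  "real_box I R = PiE UNIV (\<lambda>i. if i \<in> I then {-R..R} else {undefined})"

lemma compact_real_box: "compact (real_box I R)"
proof -
  have "compactin (product_topology (\<lambda>_. euclidean) UNIV) (real_box I R)"
    unfolding real_box_def compactin_PiE by auto
  then show ?thesis by (simp add: euclidean_product_topology)
qed

lemma real_box_iff: "x \<in> real_box I R \<longleftrightarrow> (\<forall>i. if i \<in> I then - R \<le> x i \<and> x i \<le> R else x i = undefined)"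
  by (auto simp: real_box_def PiE_iff split: if_splits)

lemma fold_box_in_real_box: "R > 0 \<Longrightarrow> fold_box I R x \<in> real_box I R"
proof -
  assume R: "R > 0"
  define \<theta> where "\<theta> = pi / (2 * R)"
  have \<theta>: "\<theta> > 0" "R * \<theta> = pi / 2" using R by (simp_all add: \<theta>_def)
  have "- R \<le> arcsin (sin u) / \<theta> \<and> arcsin (sin u) / \<theta> \<le> R" for u
    unfolding pos_le_divide_eq[OF \<theta>(1)] pos_divide_le_eq[OF \<theta>(1)] mult_minus_left \<theta>(2)
    using arcsin[of "sin u"] by auto
  then show ?thesis by (simp add: real_box_iff fold_box_def \<theta>_def)
qed

text \<open>A polynomial in the functions \<open>sin (\<pi> x\<^sub>i / 2 R)\<close> is a trigonometric polynomial all of whose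
  values are attained on the box, so an approximation on the box is bounded everywhere.\<close>

lemma trig_approximation:
  fixes f :: "(nat \<Rightarrow> real) \<Rightarrow> real"
  assumes I: "finite I" and R: "R > 0" and f: "continuous_on UNIV f" and e: "e > 0"
  shows "\<exists>g \<in> trig_poly I. (\<forall>x\<in>real_box I R. \<bar>f x - g x\<bar> < e) \<and> (\<forall>x. \<exists>y\<in>real_box I R. g x = g y)"
proof -
  let ?\<theta> = "pi / (2 * R)"
  \<comment> \<open>Invariance under folding is built into the algebra, so that the approximant
    delivered by Stone-Weierstrass inherits it.\<close>
  define A where "A = {g \<in> trig_poly I. \<forall>x. g (fold_box I R x) = g x}"
  interpret function_ring_on A "real_box I R"
  proof
    show "compact (real_box I R)" by (rule compact_real_box)
    show "\<exists>g\<in>A. g x \<noteq> g y" if xy: "x \<in> real_box I R" "y \<in> real_box I R" "x \<noteq> y" for x y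
    proof -
      from \<open>x \<noteq> y\<close> obtain i where i: "x i \<noteq> y i" by blast
      have "i \<in> I" using xy i unfolding real_box_iff by metis
      then have r: "- R \<le> x i" "x i \<le> R" "- R \<le> y i" "y i \<le> R" using xy unfolding real_box_iff by metis+
      have \<theta>: "?\<theta> > 0" "?\<theta> * R = pi / 2" using R by simp_all
      have "- (pi / 2) \<le> ?\<theta> * u \<and> ?\<theta> * u \<le> pi / 2" if "- R \<le> u" "u \<le> R" for u
        using mult_left_mono[OF that(1) less_imp_le[OF \<theta>(1)]] mult_left_mono[OF that(2) less_imp_le[OF \<theta>(1)]]
        unfolding mult_minus_right \<theta>(2) by (rule conjI)
      from this[OF r(1,2)] this[OF r(3,4)]
      have "- (pi / 2) \<le> ?\<theta> * x i" "?\<theta> * x i \<le> pi / 2" "- (pi / 2) \<le> ?\<theta> * y i" "?\<theta> * y i \<le> pi / 2" by auto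
      then have "sin (?\<theta> * x i) \<noteq> sin (?\<theta> * y i)"
        using i R sin_inj_pi[of "?\<theta> * x i" "?\<theta> * y i"] by auto
      moreover have "(\<lambda>x. sin (?\<theta> * x i)) \<in> A"
        using \<open>i \<in> I\<close> R trig_poly_sin[OF I \<open>i \<in> I\<close>, of ?\<theta>] by (simp add: A_def fold_box_def)
      ultimately show ?thesis by (intro bexI[of _ "\<lambda>x. sin (?\<theta> * x i)"])
    qed
  qed (auto simp: A_def intro: trig_poly_continuous trig_poly.add trig_poly_mult trig_poly_const)
  have "continuous_on (real_box I R) f" using f by (rule continuous_on_subset) simp
  from Stone_Weierstrass_basic[OF this e] obtain g where g: "g \<in> A" "\<forall>x\<in>real_box I R. \<bar>f x - g x\<bar> < e" by blast
  moreover have "\<exists>y\<in>real_box I R. g x = g y" for x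
    using g(1) fold_box_in_real_box[OF R, of I x] by (intro bexI[of _ "fold_box I R x"]) (auto simp: A_def)
  ultimately show ?thesis unfolding A_def by blast
qed

section \<open>A continuity theorem for laws on finite products\<close>

text \<open>Test functions live on extensional functions, while the approximation takes place on the
  full function space; restricting the argument connects the two.\<close>

lemma continuous_map_extension:
  fixes f :: "(nat \<Rightarrow> real) \<Rightarrow> real"
  assumes "continuous_map (powertop_real I) euclideanreal f"
  shows "continuous_on UNIV (\<lambda>x. f (restrict x I))"
proof -
  have "continuous_map euclidean (powertop_real I) (\<lambda>x. restrict x I)"
    unfolding continuous_map_componentwise by auto
  from continuous_map_compose[OF this assms] show ?thesis by (simp add: o_def)
qed

text \<open>Over all of the countable index type the product sigma-algebra is the Borel one, so the
  function is routed through the extension of its argument by 0.\<close>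

lemma borel_measurable_continuous_map_PiM:
  fixes f :: "(nat \<Rightarrow> real) \<Rightarrow> real"
  assumes "continuous_map (powertop_real I) euclideanreal f"
  shows "f \<in> borel_measurable (PiM I (\<lambda>_. borel))"
proof -
  have m: "(\<lambda>x i. if i \<in> I then x i else 0) \<in> PiM I (\<lambda>_. borel) \<rightarrow>\<^sub>M PiM UNIV (\<lambda>_. borel :: real measure)"
  proof (rule measurable_PiM_single')
    show "(\<lambda>x. if i \<in> I then x i else 0) \<in> borel_measurable (PiM I (\<lambda>_. borel :: real measure))" for i
      by (cases "i \<in> I") auto
  qed auto
  have "(\<lambda>x. f (restrict x I)) \<in> borel_measurable (borel :: (nat \<Rightarrow> real) measure)"
    by (rule borel_measurable_continuous_onI[OF continuous_map_extension[OF assms]])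
  then have "(\<lambda>x. f (restrict x I)) \<in> borel_measurable (PiM UNIV (\<lambda>_. borel))"
    unfolding measurable_cong_sets[OF sets_PiM_equal_borel refl] .
  from measurable_compose[OF m this] have "(\<lambda>x. f (restrict (\<lambda>i. if i \<in> I then x i else 0) I)) \<in> borel_measurable (PiM I (\<lambda>_. borel))" .
  then show ?thesis
  proof (subst measurable_cong)
    fix x :: "nat \<Rightarrow> real" assume "x \<in> space (PiM I (\<lambda>_. borel))"
    then have "x \<in> extensional I" by (auto simp: space_PiM PiE_def)
    then have "restrict x I = x" by (rule extensional_restrict)
    moreover have "restrict (\<lambda>i. if i \<in> I then x i else 0) I = restrict x I" by (rule restrict_ext) simp
    ultimately show "f x = f (restrict (\<lambda>i. if i \<in> I then x i else 0) I)" by (simp only:)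
  qed
qed

lemma measurable_outside_box:
  "finite I \<Longrightarrow> {x \<in> space (PiM I (\<lambda>_. borel)). \<exists>i\<in>I. \<bar>x i\<bar> > R} \<in> sets (PiM I (\<lambda>_. borel :: real measure))"
  by measurable

lemma integral_diff_le_outside_box:
  fixes f g :: "(nat \<Rightarrow> real) \<Rightarrow> real"
  assumes I: "finite I" and Q: "prob_space Q" "sets Q = sets (PiM I (\<lambda>_. borel))"
    and f: "f \<in> borel_measurable (PiM I (\<lambda>_. borel))" "\<And>x. x \<in> extensional I \<Longrightarrow> \<bar>f x\<bar> \<le> B"
    and g: "g \<in> borel_measurable (PiM I (\<lambda>_. borel))" "\<And>x. \<bar>g x\<bar> \<le> B'"
    and fg: "\<And>x. x \<in> extensional I \<Longrightarrow> \<forall>i\<in>I. \<bar>x i\<bar> \<le> R \<Longrightarrow> \<bar>f x - g x\<bar> \<le> e" and e: "0 \<le> e"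
    and tail: "measure Q {x \<in> space (PiM I (\<lambda>_. borel)). \<exists>i\<in>I. \<bar>x i\<bar> > R} \<le> \<delta>"
  shows "\<bar>(\<integral>x. f x \<partial>Q) - (\<integral>x. g x \<partial>Q)\<bar> \<le> e + (B + B') * \<delta>"
proof -
  interpret Q: prob_space Q by (rule Q)
  let ?T = "{x \<in> space (PiM I (\<lambda>_. borel)). \<exists>i\<in>I. \<bar>x i\<bar> > R}"
  have sp: "space Q = space (PiM I (\<lambda>_. borel))" by (rule sets_eq_imp_space_eq[OF Q(2)])
  have ext: "x \<in> extensional I" if "x \<in> space Q" for x using that unfolding sp by (auto simp: space_PiM PiE_def)
  have T: "?T \<in> sets Q" unfolding Q(2) by (rule measurable_outside_box[OF I])
  have fm: "f \<in> borel_measurable Q" "g \<in> borel_measurable Q"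
    using f g unfolding measurable_cong_sets[OF Q(2) refl] by auto
  have fi: "integrable Q f" by (rule Q.integrable_const_bound[where B = B]) (use f ext fm in auto)
  have gi: "integrable Q g" by (rule Q.integrable_const_bound[where B = B']) (use g fm in auto)
  have BB: "0 \<le> B + B'"
  proof -
    have "(\<lambda>i\<in>I. 0) \<in> extensional I" by simp
    from f(2)[OF this] g(2)[of "\<lambda>_. 0"] show ?thesis by linarith
  qed
  have di: "integrable Q (\<lambda>x. \<bar>f x - g x\<bar>)" by (intro integrable_abs Bochner_Integration.integrable_diff fi gi)
  have ii: "integrable Q (\<lambda>x. e + (B + B') * indicator ?T x)"
    using T by (intro Bochner_Integration.integrable_add Q.integrable_const integrable_mult_right integrable_real_indicator)
      (auto simp: Q.emeasure_finite less_top[symmetric])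
  have "(\<integral>x. f x \<partial>Q) - (\<integral>x. g x \<partial>Q) = (\<integral>x. f x - g x \<partial>Q)" using fi gi by simp
  then have "\<bar>(\<integral>x. f x \<partial>Q) - (\<integral>x. g x \<partial>Q)\<bar> \<le> (\<integral>x. \<bar>f x - g x\<bar> \<partial>Q)" by (simp only: integral_abs_bound)
  also have "\<dots> \<le> (\<integral>x. e + (B + B') * indicator ?T x \<partial>Q)"
  proof (rule integral_mono[OF di ii])
    fix x assume x: "x \<in> space Q"
    show "\<bar>f x - g x\<bar> \<le> e + (B + B') * indicator ?T x"
    proof (cases "x \<in> ?T")
      case True
      have "\<bar>f x - g x\<bar> \<le> B + B'" using f(2)[OF ext[OF x]] g(2)[of x] by linarith
      with True e show ?thesis by simp
    next
      case False
      then have "\<forall>i\<in>I. \<bar>x i\<bar> \<le> R" using x sp by (auto simp: not_less)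
      from fg[OF ext[OF x] this] False show ?thesis by simp
    qed
  qed
  also have "\<dots> = e + (B + B') * measure Q ?T"
  proof -
    have "?T \<inter> space Q = ?T" unfolding sp by blast
    then have "(\<integral>x. (B + B') * indicator ?T x \<partial>Q) = (B + B') * measure Q ?T"
      by (simp only: integral_mult_right_zero Bochner_Integration.integral_indicator)
    moreover have "(\<integral>x. e \<partial>Q) = e" by (simp only: lebesgue_integral_const Q.prob_space scaleR_one)
    moreover have "(\<integral>x. e + (B + B') * indicator ?T x \<partial>Q) = (\<integral>x. e \<partial>Q) + (\<integral>x. (B + B') * indicator ?T x \<partial>Q)"
      using T by (intro Bochner_Integration.integral_add Q.integrable_const integrable_mult_right integrable_real_indicator)
        (auto simp: Q.emeasure_finite less_top[symmetric])
    ultimately show ?thesis by (simp only:)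
  qed
  also have "\<dots> \<le> e + (B + B') * \<delta>" using tail BB by (intro add_left_mono mult_left_mono)
  finally show ?thesis .
qed

lemma prob_space_tail_tendsto_0:
  fixes Q :: "(nat \<Rightarrow> real) measure"
  assumes I: "finite I" and Q: "prob_space Q" "sets Q = sets (PiM I (\<lambda>_. borel))"
  shows "(\<lambda>n. measure Q {x \<in> space (PiM I (\<lambda>_. borel)). \<exists>i\<in>I. \<bar>x i\<bar> > real n}) \<longlonglongrightarrow> 0"
proof -
  interpret Q: prob_space Q by (rule Q)
  let ?T = "\<lambda>n. {x \<in> space (PiM I (\<lambda>_. borel)). \<exists>i\<in>I. \<bar>x i\<bar> > real n}"
  have "(\<lambda>n. measure Q (?T n)) \<longlonglongrightarrow> measure Q (\<Inter>n. ?T n)"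
  proof (rule Q.finite_Lim_measure_decseq)
    show "range ?T \<subseteq> sets Q" unfolding Q(2) using measurable_outside_box[OF I] by auto
    show "decseq ?T"
    proof (rule decseq_SucI)
      show "?T (Suc n) \<subseteq> ?T n" for n
      proof clarify
        fix x i assume "i \<in> I" "real (Suc n) < \<bar>x i\<bar>"
        then show "\<exists>i\<in>I. real n < \<bar>x i\<bar>" by (intro bexI[of _ i]) auto
      qed
    qed
  qed
  moreover have "(\<Inter>n. ?T n) = {}"
  proof (rule ccontr)
    assume "(\<Inter>n. ?T n) \<noteq> {}"
    then obtain x where x: "\<And>n. \<exists>i\<in>I. \<bar>x i\<bar> > real n" by auto
    obtain n where "(\<Sum>i\<in>I. \<bar>x i\<bar>) < real n" using reals_Archimedean2 by blast
    moreover from x[of n] obtain i where "i \<in> I" "\<bar>x i\<bar> > real n" by blast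
    moreover have "\<bar>x i\<bar> \<le> (\<Sum>i\<in>I. \<bar>x i\<bar>)" using I \<open>i \<in> I\<close> by (intro member_le_sum) auto
    ultimately show False by linarith
  qed
  ultimately show ?thesis by simp
qed

text \<open>On a large box the test function is replaced by a trigonometric polynomial, whose
  expectations converge by assumption. Off the box the tails are small by tightness, and the
  polynomial causes no harm there because its values are all attained on the box.\<close>

theorem weak_conv_PiM_of_characteristic_functions:
  fixes Q :: "nat \<Rightarrow> (nat \<Rightarrow> real) measure"
  assumes I: "finite I"
    and Q: "\<And>N. prob_space (Q N)" "\<And>N. sets (Q N) = sets (PiM I (\<lambda>_. borel))"
    and L: "prob_space L" "sets L = sets (PiM I (\<lambda>_. borel))"
    and char: "\<And>t. (\<lambda>N. \<integral>x. cos (\<Sum>i\<in>I. t i * x i) \<partial>Q N) \<longlonglongrightarrow> (\<integral>x. cos (\<Sum>i\<in>I. t i * x i) \<partial>L)"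
      "\<And>t. (\<lambda>N. \<integral>x. sin (\<Sum>i\<in>I. t i * x i) \<partial>Q N) \<longlonglongrightarrow> (\<integral>x. sin (\<Sum>i\<in>I. t i * x i) \<partial>L)"
    and tight: "\<And>e. e > 0 \<Longrightarrow> \<exists>R0. \<forall>R\<ge>R0. \<forall>N. measure (Q N) {x \<in> space (PiM I (\<lambda>_. borel)). \<exists>i\<in>I. \<bar>x i\<bar> > R} \<le> e"
  shows "weak_conv_PiM I Q L"
  unfolding weak_conv_PiM_def
proof (intro allI impI, elim conjE)
  fix f assume fc: "continuous_map (powertop_real I) euclideanreal f" and fb: "bounded (f ` topspace (powertop_real I))"
  interpret L: prob_space L by (rule L)
  interpret Q: prob_space "Q N" for N by (rule Q)
  from fb obtain B0 where B0: "\<And>x. x \<in> extensional I \<Longrightarrow> \<bar>f x\<bar> \<le> B0"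
    by (auto simp: bounded_iff PiE_def)
  define B where "B = max 0 B0"
  have B: "B \<ge> 0" "\<And>x. x \<in> extensional I \<Longrightarrow> \<bar>f x\<bar> \<le> B" using B0 by (auto simp: B_def le_max_iff_disj)
  have fm: "f \<in> borel_measurable (PiM I (\<lambda>_. borel))" by (rule borel_measurable_continuous_map_PiM[OF fc])
  have trig: "(\<lambda>N. \<integral>x. g x \<partial>Q N) \<longlonglongrightarrow> (\<integral>x. g x \<partial>L)" if "g \<in> trig_poly I" for g
    using that
  proof induction
    case (wave k t s)
    have e: "(\<integral>x. k * cos ((\<Sum>i\<in>I. t i * x i) + s) \<partial>D) =
       k * (cos s * (\<integral>x. cos (\<Sum>i\<in>I. t i * x i) \<partial>D) - sin s * (\<integral>x. sin (\<Sum>i\<in>I. t i * x i) \<partial>D))"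
      if D: "prob_space D" "sets D = sets (PiM I (\<lambda>_. borel :: real measure))" for D
    proof -
      interpret D: prob_space D by (rule D)
      have "(\<lambda>x. \<Sum>i\<in>I. t i * x i) \<in> borel_measurable (PiM I (\<lambda>_. borel :: real measure))" by measurable
      then have [measurable]: "(\<lambda>x. \<Sum>i\<in>I. t i * x i) \<in> borel_measurable D" unfolding measurable_cong_sets[OF D(2) refl] .
      have "integrable D (\<lambda>x. cos (\<Sum>i\<in>I. t i * x i))" by (rule D.integrable_const_bound[where B = 1]) auto
      moreover have "integrable D (\<lambda>x. sin (\<Sum>i\<in>I. t i * x i))" by (rule D.integrable_const_bound[where B = 1]) auto
      ultimately show ?thesis by (simp add: cos_add mult.commute)
    qed
    show ?case unfolding e[OF Q] e[OF L] by (intro tendsto_intros char)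
  next
    case (add g h)
    have "(\<integral>x. g x + h x \<partial>D) = (\<integral>x. g x \<partial>D) + (\<integral>x. h x \<partial>D)"
      if D: "prob_space D" "sets D = sets (PiM I (\<lambda>_. borel :: real measure))" for D
    proof -
      interpret D: prob_space D by (rule D)
      have "integrable D u" if u: "u \<in> trig_poly I" for u
      proof -
        obtain B where "\<forall>x. \<bar>u x\<bar> \<le> B" using trig_poly_bounded[OF u] by blast
        moreover have "u \<in> borel_measurable D" using trig_poly_measurable[OF u] unfolding measurable_cong_sets[OF D(2) refl] .
        ultimately show ?thesis by (intro D.integrable_const_bound[where B = B]) auto
      qed
      then show ?thesis using add.hyps by simp
    qed
    note e = this
    show ?case unfolding e[OF Q] e[OF L] by (intro tendsto_add add.IH)
  qed
  show "(\<lambda>N. \<integral>x. f x \<partial>Q N) \<longlonglongrightarrow> (\<integral>x. f x \<partial>L)"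
  proof (rule LIMSEQ_I)
    fix r :: real assume r: "r > 0"
    \<comment> \<open>Two comparisons on and off the box cost at most \<open>(2 * B + 2) * e\<close>
      each and the polynomial costs \<open>e\<close>, in total \<open>(4 * B + 5) * e < r\<close>;
      \<open>e \<le> 1\<close> is used to bound the polynomial by \<open>B + 1\<close>.\<close>
    define e where "e = min 1 (r / (4 * B + 6))"
    have e: "e > 0" "e \<le> 1" using r B by (auto simp: e_def)
    have er: "(4 * B + 5) * e < r"
    proof -
      have "(4 * B + 5) * e < (4 * B + 6) * e" using e by simp
      also have "\<dots> \<le> (4 * B + 6) * (r / (4 * B + 6))" using B(1) by (intro mult_left_mono) (auto simp: e_def)
      also have "\<dots> = r" using B(1) by simp
      finally show ?thesis .
    qed
    let ?T = "\<lambda>R. {x \<in> space (PiM I (\<lambda>_. borel)). \<exists>i\<in>I. \<bar>x i\<bar> > R}"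
    from tight[OF e(1)] obtain R0 where R0: "\<And>R N. R \<ge> R0 \<Longrightarrow> measure (Q N) (?T R) \<le> e" by blast
    have "eventually (\<lambda>n. measure L (?T (real n)) < e) sequentially"
      by (rule order_tendstoD(2)[OF prob_space_tail_tendsto_0[OF I L] e(1)])
    moreover have "eventually (\<lambda>n. R0 \<le> real n) sequentially"
      using filterlim_real_sequentially by (simp add: filterlim_at_top)
    ultimately have "eventually (\<lambda>n. measure L (?T (real n)) < e \<and> R0 \<le> real n \<and> n \<ge> 1) sequentially"
      using eventually_ge_at_top[of "1::nat"] by eventually_elim auto
    then obtain n where n: "measure L (?T (real n)) < e" "R0 \<le> real n" "n \<ge> 1"
      by (auto dest!: eventually_happens'[rotated])
    define R where "R = real n"
    have R: "R > 0" using n by (simp add: R_def)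
    obtain g where g: "g \<in> trig_poly I" "\<And>x. x \<in> real_box I R \<Longrightarrow> \<bar>f (restrict x I) - g x\<bar> < e" "\<And>x. \<exists>y\<in>real_box I R. g x = g y"
      using trig_approximation[OF I R continuous_map_extension[OF fc] e(1)] by blast
    have gB: "\<bar>g x\<bar> \<le> B + e" for x
    proof -
      obtain y where y: "y \<in> real_box I R" "g x = g y" using g(3) by blast
      have "\<bar>f (restrict y I)\<bar> \<le> B" by (rule B(2)) simp
      with g(2)[OF y(1)] y(2) show ?thesis by linarith
    qed
    have fg: "\<bar>f x - g x\<bar> \<le> e" if "x \<in> extensional I" "\<forall>i\<in>I. \<bar>x i\<bar> \<le> R" for x
    proof -
      have "x i = undefined" if "i \<notin> I" for i using \<open>x \<in> extensional I\<close> that by (rule extensional_arb)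
      then have "x \<in> real_box I R" using that(2) by (simp add: real_box_iff abs_le_iff minus_le_iff)
      from g(2)[OF this] that(1) show ?thesis by (simp add: extensional_restrict)
    qed
    have close: "\<bar>(\<integral>x. f x \<partial>D) - (\<integral>x. g x \<partial>D)\<bar> \<le> e + (B + (B + e)) * e"
      if "prob_space D" "sets D = sets (PiM I (\<lambda>_. borel))" "measure D (?T R) \<le> e" for D
      by (rule integral_diff_le_outside_box[OF I that(1,2) fm B(2) trig_poly_measurable[OF g(1)] gB fg less_imp_le[OF e(1)] that(3)])
    have cL: "\<bar>(\<integral>x. f x \<partial>L) - (\<integral>x. g x \<partial>L)\<bar> \<le> e + (B + (B + e)) * e"
      by (rule close[OF L]) (use n(1) in \<open>simp add: R_def\<close>)
    have cQ: "\<bar>(\<integral>x. f x \<partial>Q N) - (\<integral>x. g x \<partial>Q N)\<bar> \<le> e + (B + (B + e)) * e" for N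
      by (rule close[OF Q]) (use R0 n(2) in \<open>simp add: R_def\<close>)
    obtain N0 where N0: "\<And>N. N \<ge> N0 \<Longrightarrow> norm ((\<integral>x. g x \<partial>Q N) - (\<integral>x. g x \<partial>L)) < e"
      using LIMSEQ_D[OF trig[OF g(1)] e(1)] by blast
    have "norm ((\<integral>x. f x \<partial>Q N) - (\<integral>x. f x \<partial>L)) < r" if N: "N \<ge> N0" for N
    proof -
      have "e + (B + (B + e)) * e \<le> e + (B + (B + 1)) * e" using e B by (intro add_left_mono mult_right_mono) auto
      also have "\<dots> = (2 * B + 2) * e" by (simp add: algebra_simps)
      finally have b: "e + (B + (B + e)) * e \<le> (2 * B + 2) * e" .
      have "\<bar>(\<integral>x. f x \<partial>Q N) - (\<integral>x. f x \<partial>L)\<bar> < 2 * ((2 * B + 2) * e) + e"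
        using cL cQ[of N] b N0[OF N] unfolding real_norm_def by linarith
      also have "\<dots> = (4 * B + 5) * e" by (simp add: algebra_simps)
      finally show ?thesis using er by simp
    qed
    then show "\<exists>no. \<forall>N\<ge>no. norm ((\<integral>x. f x \<partial>Q N) - (\<integral>x. f x \<partial>L)) < r" by blast
  qed
qed

lemma integral_cos_sin_PiM_gaussian:
  fixes t v :: "nat \<Rightarrow> real"
  assumes I: "finite I" and v: "\<And>i. v i > 0"
  shows "(\<integral>x. cos (\<Sum>i\<in>I. t i * x i) \<partial>PiM I (\<lambda>i. gaussian 0 (v i))) = exp (- (\<Sum>i\<in>I. v i * (t i)\<^sup>2) / 2)"
    and "(\<integral>x. sin (\<Sum>i\<in>I. t i * x i) \<partial>PiM I (\<lambda>i. gaussian 0 (v i))) = 0"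
proof -
  let ?L = "PiM I (\<lambda>i. gaussian 0 (v i))"
  have rd: "real_distribution (gaussian 0 (v i))" for i by (rule real_distribution_gaussian[OF v])
  have pr: "prob_space (gaussian 0 (v i))" for i using rd[of i] by (simp add: real_distribution_def)
  interpret product_prob_space "\<lambda>i. gaussian 0 (v i)" I by (rule product_prob_spaceI) (rule pr)
  have pL: "prob_space ?L" by (rule prob_space_PiM) (rule pr)
  have ml: "(\<lambda>x. \<Sum>i\<in>I. t i * x i) \<in> borel_measurable ?L"
  proof (intro borel_measurable_sum borel_measurable_times borel_measurable_const)
    fix i assume "i \<in> I"
    then have "(\<lambda>x. x i) \<in> measurable ?L (gaussian 0 (v i))" by (rule measurable_component_singleton)
    then show "(\<lambda>x. x i) \<in> borel_measurable ?L" by (simp add: gaussian_def)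
  qed
  have int: "complex_integrable ?L (\<lambda>x. iexp (\<Sum>i\<in>I. t i * x i))"
  proof (rule finite_measure.integrable_const_bound[OF prob_space.finite_measure[OF pL], where B = 1])
    have "(\<lambda>y. iexp y) \<in> borel_measurable borel" by simp
    from measurable_compose[OF ml this] show "(\<lambda>x. iexp (\<Sum>i\<in>I. t i * x i)) \<in> borel_measurable ?L" .
  qed simp
  have "(\<integral>x. iexp (\<Sum>i\<in>I. t i * x i) \<partial>?L) = (\<integral>x. (\<Prod>i\<in>I. iexp (t i * x i)) \<partial>?L)"
    using I by (simp add: exp_sum sum_distrib_left)
  also have "\<dots> = (\<Prod>i\<in>I. char (gaussian 0 (v i)) (t i))"
    unfolding char_def
  proof (rule product_integral_prod[OF I])
    fix i assume "i \<in> I"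
    show "complex_integrable (gaussian 0 (v i)) (\<lambda>x. iexp (t i * x))"
      by (intro finite_measure.integrable_const_bound[OF prob_space.finite_measure[OF pr], where B = 1]) (auto simp: gaussian_def)
  qed
  also have "\<dots> = complex_of_real (exp (- (\<Sum>i\<in>I. v i * (t i)\<^sup>2) / 2))"
    using I by (simp add: char_gaussian[OF v] exp_sum[symmetric] sum_negf sum_divide_distrib flip: of_real_prod)
  finally have eq: "(\<integral>x. iexp (\<Sum>i\<in>I. t i * x i) \<partial>?L) = complex_of_real (exp (- (\<Sum>i\<in>I. v i * (t i)\<^sup>2) / 2))" .
  have "(\<integral>x. cos (\<Sum>i\<in>I. t i * x i) \<partial>?L) = Re (\<integral>x. iexp (\<Sum>i\<in>I. t i * x i) \<partial>?L)"
    unfolding integral_Re[OF int, symmetric] by (simp add: Re_exp del: of_real_sum of_real_mult)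
  then show "(\<integral>x. cos (\<Sum>i\<in>I. t i * x i) \<partial>?L) = exp (- (\<Sum>i\<in>I. v i * (t i)\<^sup>2) / 2)" unfolding eq by simp
  have "(\<integral>x. sin (\<Sum>i\<in>I. t i * x i) \<partial>?L) = Im (\<integral>x. iexp (\<Sum>i\<in>I. t i * x i) \<partial>?L)"
    unfolding integral_Im[OF int, symmetric] by (simp add: Im_exp del: of_real_sum of_real_mult)
  then show "(\<integral>x. sin (\<Sum>i\<in>I. t i * x i) \<partial>?L) = 0" unfolding eq by simp
qed

section \<open>Tightness and the joint limit\<close>

context jacobi_hot begin

lemma fluctuation_second_moment:
  "\<exists>K. \<forall>N. integrable (J N) (\<lambda>x. (sqrt (real N) * dev f N x)\<^sup>2) \<and> (\<integral>x. (sqrt (real N) * dev f N x)\<^sup>2 \<partial>J N) \<le> K"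
proof -
  obtain C where C: "\<forall>N\<ge>1. (\<integral>x. \<bar>dev f N x * dev f N x\<bar> \<partial>J N) \<le> C / real N"
    using small_prod2[OF small_dev small_dev] by blast
  have "integrable (J N) (\<lambda>x. (sqrt (real N) * dev f N x)\<^sup>2) \<and> (\<integral>x. (sqrt (real N) * dev f N x)\<^sup>2 \<partial>J N) \<le> \<bar>C\<bar>" for N
  proof (cases "N = 0")
    case False
    then have N: "N \<ge> 1" by simp
    have e: "(sqrt (real N) * dev f N x)\<^sup>2 = real N * \<bar>dev f N x * dev f N x\<bar>" for x
      by (simp add: power_mult_distrib power2_eq_square)
    have "ubd (\<lambda>N x. dev f N x * dev f N x)" by (intro ubd_mult small_ubd small_dev)
    then have "integrable (J N) (\<lambda>x. dev f N x * dev f N x)" using N by (rule ubd_integrable)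
    moreover have "real N * (\<integral>x. \<bar>dev f N x * dev f N x\<bar> \<partial>J N) \<le> real N * (C / real N)"
      using C N by (intro mult_left_mono) auto
    ultimately show ?thesis unfolding e using N by simp
  qed simp
  then show ?thesis by blast
qed

text \<open>Chebyshev's inequality and a union bound, the second moments being bounded uniformly in
  \<open>N\<close>. Starting \<open>R0\<close> above 1 allows \<open>R ^ 2\<close> to be replaced by
  \<open>R\<close>, whence the simple threshold.\<close>

lemma fluctuation_tight:
  assumes I: "finite I" and e: "e > 0"
  shows "\<exists>R0. \<forall>R\<ge>R0. \<forall>N. measure (J N) {x \<in> space (J N). \<exists>i\<in>I. \<bar>sqrt (real N) * dev (P i) N x\<bar> > R} \<le> e"
proof -
  have "\<forall>i. \<exists>K. \<forall>N. integrable (J N) (\<lambda>x. (sqrt (real N) * dev (P i) N x)\<^sup>2) \<and> (\<integral>x. (sqrt (real N) * dev (P i) N x)\<^sup>2 \<partial>J N) \<le> K"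
    by (rule allI) (rule fluctuation_second_moment)
  from choice[OF this] obtain K where
    K': "\<forall>i N. integrable (J N) (\<lambda>x. (sqrt (real N) * dev (P i) N x)\<^sup>2) \<and> (\<integral>x. (sqrt (real N) * dev (P i) N x)\<^sup>2 \<partial>J N) \<le> K i" ..
  have K: "integrable (J N) (\<lambda>x. (sqrt (real N) * dev (P i) N x)\<^sup>2)"
    "(\<integral>x. (sqrt (real N) * dev (P i) N x)\<^sup>2 \<partial>J N) \<le> K i" for i N
    using K'[rule_format, of N i] by (rule conjunct1, rule conjunct2)
  have K0: "0 \<le> K i" for i by (rule order_trans[OF Bochner_Integration.integral_nonneg K(2)]) simp
  define R0 where "R0 = 1 + (\<Sum>i\<in>I. K i) / e"
  have "measure (J N) {x \<in> space (J N). \<exists>i\<in>I. \<bar>sqrt (real N) * dev (P i) N x\<bar> > R} \<le> e" if R: "R \<ge> R0" for R N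
  proof -
    have K1: "0 \<le> (\<Sum>i\<in>I. K i) / e" using K0 e by (intro divide_nonneg_pos sum_nonneg) auto
    have R1: "R \<ge> 1" and Rs: "(\<Sum>i\<in>I. K i) / e \<le> R" using R K1 by (auto simp: R0_def)
    note [measurable] = measurable_dev
    let ?A = "\<lambda>i. {x \<in> space (J N). R\<^sup>2 \<le> (sqrt (real N) * dev (P i) N x)\<^sup>2}"
    have A: "?A i \<in> sets (J N)" for i by measurable
    have "measure (J N) {x \<in> space (J N). \<exists>i\<in>I. \<bar>sqrt (real N) * dev (P i) N x\<bar> > R} \<le> measure (J N) (\<Union>i\<in>I. ?A i)"
    proof (rule J.finite_measure_mono)
      show "{x \<in> space (J N). \<exists>i\<in>I. \<bar>sqrt (real N) * dev (P i) N x\<bar> > R} \<subseteq> (\<Union>i\<in>I. ?A i)"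
      proof (clarify, rule UN_I, assumption)
        fix x i assume x: "x \<in> space (J N)" "R < \<bar>sqrt (real N) * dev (P i) N x\<bar>"
        have "R\<^sup>2 \<le> \<bar>sqrt (real N) * dev (P i) N x\<bar>\<^sup>2" using x R1 by (intro power_mono) auto
        with x(1) show "x \<in> ?A i" by (simp only: power2_abs mem_Collect_eq)
      qed
      show "(\<Union>i\<in>I. ?A i) \<in> sets (J N)" using A I by (intro sets.finite_UN) auto
    qed
    also have "\<dots> \<le> (\<Sum>i\<in>I. measure (J N) (?A i))" using A I by (intro J.finite_measure_subadditive_finite) auto
    also have "\<dots> \<le> (\<Sum>i\<in>I. K i / R\<^sup>2)"
    proof (rule sum_mono)
      fix i
      have "measure (J N) (?A i) \<le> (\<integral>x. (sqrt (real N) * dev (P i) N x)\<^sup>2 \<partial>J N) / R\<^sup>2"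
        using R1 by (intro integral_Markov_inequality_measure[OF K(1), where A = "space (J N)"]) auto
      also have "\<dots> \<le> K i / R\<^sup>2" by (intro divide_right_mono K) simp
      finally show "measure (J N) (?A i) \<le> K i / R\<^sup>2" .
    qed
    also have "\<dots> = (\<Sum>i\<in>I. K i) / R\<^sup>2" by (simp add: sum_divide_distrib)
    also have "\<dots> \<le> (\<Sum>i\<in>I. K i) / R"
      using R1 K0 by (intro divide_left_mono sum_nonneg) (auto simp: power2_eq_square)
    also have "\<dots> \<le> e" using Rs e R1 by (simp add: field_simps)
    finally show ?thesis .
  qed
  then show ?thesis by blast
qed

text \<open>Independence in the limit is expressed by the product measure; its characteristic
  function is the right one because the limiting quadratic form is diagonal.\<close>

lemma fluctuations_joint_weak_conv:
  assumes prim: "\<And>n. pderiv (P n) = p_tilde a b c n"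
  shows "weak_conv_PiM {..M}
    (\<lambda>N. distr (J N) (PiM {..M} (\<lambda>_. borel)) (\<lambda>x. \<lambda>n\<in>{..M}. fluctuation a b c N (poly (P n)) x))
    (PiM {..M} (\<lambda>n. gaussian 0 (Z / eig n)))"
proof -
  let ?F = "\<lambda>N x. \<lambda>n\<in>{..M}. sqrt (real N) * dev (P n) N x"
  let ?B = "PiM {..M} (\<lambda>_. borel :: real measure)"
  have v: "Z / eig n > 0" for n using Z_pos eig_pos by simp
  have mF: "?F N \<in> J N \<rightarrow>\<^sub>M ?B" for N
    by (intro measurable_restrict borel_measurable_times borel_measurable_const measurable_dev)
  have "weak_conv_PiM {..M} (\<lambda>N. distr (J N) ?B (?F N)) (PiM {..M} (\<lambda>n. gaussian 0 (Z / eig n)))"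
  proof (rule weak_conv_PiM_of_characteristic_functions)
    show "prob_space (distr (J N) ?B (?F N))" for N by (rule J.prob_space_distr[OF mF])
    show "prob_space (PiM {..M} (\<lambda>n. gaussian 0 (Z / eig n)))"
      using real_distribution_gaussian[OF v] by (intro prob_space_PiM) (simp add: real_distribution_def)
    show "sets (PiM {..M} (\<lambda>n. gaussian 0 (Z / eig n))) = sets ?B"
      by (intro sets_PiM_cong) (auto simp: gaussian_def)
    fix t :: "nat \<Rightarrow> real"
    have s: "(\<Sum>n\<le>M. t n * ?F N x n) = (\<Sum>n\<le>M. t n * (sqrt (real N) * dev (P n) N x))" for N x
      by (intro sum.cong) auto
    have "(\<integral>y. cos (\<Sum>n\<le>M. t n * y n) \<partial>distr (J N) ?B (?F N)) = (\<integral>x. cos (\<Sum>n\<le>M. t n * (sqrt (real N) * dev (P n) N x)) \<partial>J N)" for N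
      unfolding s[symmetric] by (rule integral_distr[OF mF]) measurable
    then show "(\<lambda>N. \<integral>y. cos (\<Sum>n\<le>M. t n * y n) \<partial>distr (J N) ?B (?F N)) \<longlonglongrightarrow> (\<integral>y. cos (\<Sum>n\<le>M. t n * y n) \<partial>PiM {..M} (\<lambda>n. gaussian 0 (Z / eig n)))"
      unfolding integral_cos_sin_PiM_gaussian(1)[OF finite_atMost v]
      using clt_primitives(1)[OF prim, of "{..M}" t] by (simp only: finite_atMost)
    have "(\<integral>y. sin (\<Sum>n\<le>M. t n * y n) \<partial>distr (J N) ?B (?F N)) = (\<integral>x. sin (\<Sum>n\<le>M. t n * (sqrt (real N) * dev (P n) N x)) \<partial>J N)" for N
      unfolding s[symmetric] by (rule integral_distr[OF mF]) measurable
    then show "(\<lambda>N. \<integral>y. sin (\<Sum>n\<le>M. t n * y n) \<partial>distr (J N) ?B (?F N)) \<longlonglongrightarrow> (\<integral>y. sin (\<Sum>n\<le>M. t n * y n) \<partial>PiM {..M} (\<lambda>n. gaussian 0 (Z / eig n)))"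
      unfolding integral_cos_sin_PiM_gaussian(2)[OF finite_atMost v]
      using clt_primitives(2)[OF prim, of "{..M}" t] by (simp only: finite_atMost)
  next
    fix e :: real assume e: "e > 0"
    from fluctuation_tight[OF finite_atMost e, of M P] obtain R0 where
      R0: "\<And>R N. R \<ge> R0 \<Longrightarrow> measure (J N) {x \<in> space (J N). \<exists>i\<in>{..M}. \<bar>sqrt (real N) * dev (P i) N x\<bar> > R} \<le> e" by blast
    have "measure (distr (J N) ?B (?F N)) {x \<in> space ?B. \<exists>i\<in>{..M}. \<bar>x i\<bar> > R} =
       measure (J N) {x \<in> space (J N). \<exists>i\<in>{..M}. \<bar>sqrt (real N) * dev (P i) N x\<bar> > R}" for R N
    proof -
      have "?F N -` {x \<in> space ?B. \<exists>i\<in>{..M}. \<bar>x i\<bar> > R} \<inter> space (J N) = {x \<in> space (J N). \<exists>i\<in>{..M}. \<bar>sqrt (real N) * dev (P i) N x\<bar> > R}"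
        using measurable_space[OF mF, of _ N] by auto
      then show ?thesis using measure_distr[OF mF measurable_outside_box[OF finite_atMost]] by (simp only:)
    qed
    then show "\<exists>R0. \<forall>R\<ge>R0. \<forall>N. measure (distr (J N) ?B (?F N)) {x \<in> space ?B. \<exists>i\<in>{..M}. \<bar>x i\<bar> > R} \<le> e"
      using R0 by (intro exI[of _ R0]) simp
  qed simp_all
  then show ?thesis by (simp only: fluctuation_eq)
qed

end

theorem theorem1p1:
  fixes a b c :: real and P :: "nat \<Rightarrow> real poly" and \<sigma>2 :: "nat \<Rightarrow> real"
  assumes "a > -1/2" and "b > -1/2" and "c > 0"
    and primitive: "\<And>n. pderiv (P n) = p_tilde a b c n"
    and variance: "\<And>n. \<sigma>2 n = Z_star a b c / ((real n + 1) * (real n + 2 * c + a + b + 2))"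
  shows "(\<forall>n. weak_conv_m
            (\<lambda>N. distr (jacobi_ensemble (2 * c / real N) a b N) borel
                   (fluctuation a b c N (poly (P n))))
            (gaussian 0 (\<sigma>2 n)))
       \<and> Z_star a b c =
           (c + a + 1) * (c + b + 1) * (c + a + b + 2) /
           ((2 * c + a + b + 2)\<^sup>2 * (2 * c + a + b + 3))
       \<and> (\<forall>M. weak_conv_PiM {..M}
            (\<lambda>N. distr (jacobi_ensemble (2 * c / real N) a b N) (PiM {..M} (\<lambda>_. borel))
                   (\<lambda>x. \<lambda>n\<in>{..M}. fluctuation a b c N (poly (P n)) x))
            (PiM {..M} (\<lambda>n. gaussian 0 (\<sigma>2 n))))"
proof -
  interpret jacobi_hot a b c by unfold_locales (use assms(1-3) in auto)
  have "\<sigma>2 n = Z / eig n" for n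
    unfolding variance Z_star_eq_Z eig_def S_def by (simp add: algebra_simps)
  then have \<sigma>2: "\<sigma>2 = (\<lambda>n. Z / eig n)" by (simp add: fun_eq_iff)
  have "Z_star a b c = (c + a + 1) * (c + b + 1) * (c + a + b + 2) / ((2 * c + a + b + 2)\<^sup>2 * (2 * c + a + b + 3))"
    unfolding Z_star_eq_Z Z_eq S_def by (simp add: add.commute)
  then show ?thesis
    unfolding \<sigma>2 using fluctuation_weak_conv[OF primitive] fluctuations_joint_weak_conv[OF primitive] by blast
qed

end
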